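(* Suppose that (i) $\mathcal{E}_{\mathrm{xc}}(\rho)=\int_\Omega\mathcal{N}(\rho(r))\,dr$ where either $\mathcal{N}\in\mathscr{P}(3,(c_1,c_2))$ with $c_1\ge0$, or $\mathcal{N}\in\mathscr{P}(4/3,(c_1,c_2))$; (ii) there exists a constant $\alpha>0$ such that $(\psi,\mathcal{B}\psi)\ge\alpha\|\psi\|^2$ for all $\psi\in L^2_{\#}(\Omega)$; (iii) $f,S:\mathbb{R}\to\mathbb{R}$ are analytic with $S'(x)=xf'(x)$, $\lim_{x\to-\infty}f(x)=1$, $\lim_{x\to+\infty}f(x)=0$, the limits $\lim_{x\to\pm\infty}S(x)$ exist, and $f$ is strictly decreasing. Then there exists $(\Phi_*,F_* )\in\mathcal{M}^N_{\mathcal{B}}\times\overline{\mathscr{F}}_{\mathrm{occ}}$ such that $$\widetilde{\mathcal{F}}(\Phi_*,F_* )=\inf_{(\Psi,F)\in\mathcal{M}^N_{\mathcal{B}}\times\overline{\mathscr{F}}_{\mathrm{occ}}}\widetilde{\mathcal{F}}(\Psi,F).$$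
   Context: All functions are real valued (only the $\Gamma$ k-point is used). $\Omega\subset\mathbb{R}^3$ is the unit cell of a Bravais lattice; $L^2_{\#}(\Omega)$, $H^1_{\#}(\Omega)$ are the spaces of real periodic locally $L^2$, resp. $H^1$, functions; $(\cdot,\cdot)$, $\|\cdot\|$ are the $L^2(\Omega)$ inner product and norm. For tuples $\Psi=(\psi_1,\dots,\psi_p)$, $\Phi=(\phi_1,\dots,\phi_q)$, $\langle\Psi^T\Phi\rangle=((\psi_i,\phi_j))_{i,j}$ and $\Psi^T\Phi=(\psi_i\phi_j)_{i,j}$. Data: $\sigma>0$; $N_e$ is the number of electrons, $0<N_e<2N$; $M=(\varphi_1,\dots,\varphi_m)\in(L^2_{\#}(\Omega))^m$; $\mathcal{Q}$ is a symmetric $m\times m$ matrix of functions in $L^2_{\#}(\Omega)$, $Q=\int_\Omega\mathcal{Q}$; $D$ is a symmetric $m\times m$ matrix; $V_{\mathrm{nl}}\Psi=MD\langle M^T\Psi\rangle$; $V_{\mathrm{loc}}\in L^2_{\#}(\Omega)$; $\mathcal{B}\Psi=\Psi+MQ\langle M^T\Psi\rangle$; $\mathcal{M}^N_{\mathcal{B}}=\{\Psi\in(H^1_{\#}(\Omega))^N:\langle\Psi^T\mathcal{B}\Psi\rangle=I_N\}$. The exchange-correlation functional $\mathcal{E}_{\mathrm{xc}}$ is assumed differentiable. For $p,c_2\in[0,\infty)$, $c_1\in\mathbb{R}$, $$\mathscr{P}(p,(c_1,c_2))=\{g:\exists a_1,a_2\in\mathbb{R}\text{ such that }c_1t^p+a_1\le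 g(t)\le c_2t^p+a_2\ \ \forall t\ge0\}.$$ Occupations: $$\overline{\mathscr{F}}_{\mathrm{occ}}=\Big\{F=\operatorname{Diag}(f_1,\dots,f_N):\ 2\sum_{i=1}^Nf_i=N_e,\ f_i\in[0,1]\Big\}.$$ Put $f(-\infty)=1$, $f(+\infty)=0$, $S(\pm\infty)=\lim_{x\to\pm\infty}S(x)$, so that $S\circ f^{-1}$ is a continuous function on $[0,1]$, applied to diagonal matrices entrywise on the diagonal. Energy: with $\tilde\rho_{\Psi,F}=2\operatorname{tr}\big((\Psi^T\Psi+\langle\Psi^TM\rangle\mathcal{Q}\langle M^T\Psi\rangle)F\big)$, $$\widetilde{\mathcal{F}}(\Psi,F)=2\operatorname{tr}\Big(\big\langle\Psi^T\big(-\tfrac12\Delta+V_{\mathrm{nl}}\big)\Psi\big\rangle F\Big)+\int_\Omega V_{\mathrm{loc}}\,\tilde\rho_{\Psi,F}+\frac12\int_\Omega\int_\Omega\frac{\tilde\rho_{\Psi,F}(r)\tilde\rho_{\Psi,F}(r')}{|r-r'|}\,dr\,dr'+\mathcal{E}_{\mathrm{xc}}(\tilde\rho_{\Psi,F})-2\sigma\operatorname{tr}(S\circ f^{-1})(F),$$ where $(\psi,-\tfrac12\Delta\phi)$ means $\tfrac12\int_\Omega\nabla\psi\cdot\nabla\phi$.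
   Formalization: The density ρ̃ can be negative on a set of positive measure, where 𝒩 (a function on [0,∞)) is undefined, and ∫𝒩(ρ̃) may diverge; E_xc is therefore taken extended-real valued, with value +∞ if ρ̃ is not ≥ 0 a.e. *)

theory Defs
  imports "HOL-Analysis.Analysis"
begin

section \<open>Periodic function spaces\<close>

text \<open>The Bravais lattice is generated by the columns of an invertible matrix \<open>A\<close>; the unit cell
  is the half-open parallelepiped spanned by them.\<close>

definition cell :: "real^3^3 \<Rightarrow> (real^3) set" where
  "cell A = {A *v t | t. \<forall>i. 0 \<le> t $ i \<and> t $ i < 1}"

definition periodic :: "real^3^3 \<Rightarrow> (real^3 \<Rightarrow> 'a) \<Rightarrow> bool" where
  "periodic A u \<longleftrightarrow> (\<forall>x i. u (x + column i A) = u x)"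

text \<open>Elements of \<open>L\<^sup>2\<close> and \<open>H\<^sup>1\<close> are represented by functions that are Borel measurable and
  periodic everywhere; every almost-everywhere class of periodic functions has such a
  representative.\<close>

definition L2per :: "real^3^3 \<Rightarrow> (real^3 \<Rightarrow> real) set" where
  "L2per A = {u. u \<in> borel_measurable borel \<and> periodic A u \<and>
                 set_integrable lborel (cell A) (\<lambda>x. (u x)\<^sup>2)}"

text \<open>Weak gradient on the whole space, tested against compactly supported \<open>C\<^sup>1\<close> functions.\<close>

definition test_fun :: "(real^3 \<Rightarrow> real) \<Rightarrow> (real^3 \<Rightarrow> real^3) \<Rightarrow> bool" where
  "test_fun \<eta> G \<longleftrightarrow> (\<forall>x. GDERIV \<eta> x :> G x) \<and> continuous_on UNIV G \<and>
                    compact (closure {x. \<eta> x \<noteq> 0})"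

definition weak_grad :: "(real^3 \<Rightarrow> real) \<Rightarrow> (real^3 \<Rightarrow> real^3) \<Rightarrow> bool" where
  "weak_grad u g \<longleftrightarrow> (\<forall>\<eta> G. test_fun \<eta> G \<longrightarrow>
      (LINT x|lborel. u x *\<^sub>R G x) = - (LINT x|lborel. \<eta> x *\<^sub>R g x))"

definition has_grad :: "real^3^3 \<Rightarrow> (real^3 \<Rightarrow> real) \<Rightarrow> (real^3 \<Rightarrow> real^3) \<Rightarrow> bool" where
  "has_grad A u g \<longleftrightarrow> (\<forall>i. (\<lambda>x. g x $ i) \<in> L2per A) \<and> weak_grad u g"

definition H1per :: "real^3^3 \<Rightarrow> (real^3 \<Rightarrow> real) set" where
  "H1per A = {u \<in> L2per A. \<exists>g. has_grad A u g}"

text \<open>Unique up to a null set for \<open>u \<in> H1per A\<close>.\<close>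

definition grad :: "real^3^3 \<Rightarrow> (real^3 \<Rightarrow> real) \<Rightarrow> real^3 \<Rightarrow> real^3" where
  "grad A u = (SOME g. has_grad A u g)"

definition ip :: "real^3^3 \<Rightarrow> (real^3 \<Rightarrow> real) \<Rightarrow> (real^3 \<Rightarrow> real) \<Rightarrow> real" where
  "ip A u v = (LINT x:cell A|lborel. u x * v x)"


section \<open>Tuples of functions and the operators\<close>

text \<open>A tuple \<open>(\<psi>\<^sub>1, \<dots>, \<psi>\<^sub>p)\<close> is a map \<open>\<Psi>\<close> into \<open>real^'p\<close>, read as a row vector; hence
  multiplication by a matrix on the right is \<open>v*\<close>.\<close>

definition gram :: "real^3^3 \<Rightarrow> (real^3 \<Rightarrow> real^'p) \<Rightarrow> (real^3 \<Rightarrow> real^'q) \<Rightarrow> real^'q^'p" where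
  "gram A \<Psi> \<Phi> = (\<chi> i j. ip A (\<lambda>x. \<Psi> x $ i) (\<lambda>x. \<Phi> x $ j))"

definition outer :: "real^'p \<Rightarrow> real^'q \<Rightarrow> real^'q^'p" where
  "outer v w = (\<chi> i j. v $ i * w $ j)"

definition int_mat :: "real^3^3 \<Rightarrow> (real^3 \<Rightarrow> real^'q^'p) \<Rightarrow> real^'q^'p" where
  "int_mat A Q = (\<chi> i j. LINT x:cell A|lborel. Q x $ i $ j)"

definition Bop ::
  "real^3^3 \<Rightarrow> (real^3 \<Rightarrow> real^'m) \<Rightarrow> (real^3 \<Rightarrow> real^'m^'m) \<Rightarrow> (real^3 \<Rightarrow> real^'p) \<Rightarrow> real^3 \<Rightarrow> real^'p" where
  "Bop A M Q \<Psi> = (\<lambda>x. \<Psi> x + M x v* (int_mat A Q ** gram A M \<Psi>))"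

definition Vnl ::
  "real^3^3 \<Rightarrow> (real^3 \<Rightarrow> real^'m) \<Rightarrow> real^'m^'m \<Rightarrow> (real^3 \<Rightarrow> real^'p) \<Rightarrow> real^3 \<Rightarrow> real^'p" where
  "Vnl A M D \<Psi> = (\<lambda>x. M x v* (D ** gram A M \<Psi>))"

text \<open>Action on a single function, viewed as a tuple of length one.\<close>

definition Bop1 ::
  "real^3^3 \<Rightarrow> (real^3 \<Rightarrow> real^'m) \<Rightarrow> (real^3 \<Rightarrow> real^'m^'m) \<Rightarrow> (real^3 \<Rightarrow> real) \<Rightarrow> real^3 \<Rightarrow> real" where
  "Bop1 A M Q \<psi> = (\<lambda>x. Bop A M Q (\<lambda>y. vec (\<psi> y) :: real^1) x $ 1)"

definition MB ::
  "real^3^3 \<Rightarrow> (real^3 \<Rightarrow> real^'m) \<Rightarrow> (real^3 \<Rightarrow> real^'m^'m) \<Rightarrow> (real^3 \<Rightarrow> real^'n) set" where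
  "MB A M Q = {\<Psi>. (\<forall>i. (\<lambda>x. \<Psi> x $ i) \<in> H1per A) \<and> gram A \<Psi> (Bop A M Q \<Psi>) = mat 1}"


section \<open>Occupations\<close>

definition Diag :: "real^'n \<Rightarrow> real^'n^'n" where
  "Diag v = (\<chi> i j. if i = j then v $ i else 0)"

definition Focc :: "nat \<Rightarrow> (real^'n^'n) set" where
  "Focc Ne = {Diag v | v. 2 * (\<Sum>i\<in>UNIV. v $ i) = real Ne \<and> (\<forall>i. v $ i \<in> {0..1})}"

text \<open>\<open>S \<circ> f\<^sup>-\<^sup>1\<close> on \<open>[0,1]\<close> for decreasing \<open>f\<close>, with \<open>f(-\<infinity>) = 1\<close> and \<open>f(+\<infinity>) = 0\<close>.\<close>

definition S_finv :: "(real \<Rightarrow> real) \<Rightarrow> (real \<Rightarrow> real) \<Rightarrow> real \<Rightarrow> real" where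
  "S_finv S f t = (if t = 0 then Lim at_top S
                   else if t = 1 then Lim at_bot S
                   else S (inv f t))"

definition apply_diag :: "(real \<Rightarrow> real) \<Rightarrow> real^'n^'n \<Rightarrow> real^'n^'n" where
  "apply_diag g F = Diag (\<chi> i. g (F $ i $ i))"

definition real_analytic :: "(real \<Rightarrow> real) \<Rightarrow> bool" where
  "real_analytic f \<longleftrightarrow> (\<forall>x. \<exists>P. (\<lambda>h. f (x + h)) has_fps_expansion P)"


section \<open>Exchange-correlation functionals\<close>

text \<open>Used for \<open>p > 0\<close>. (For \<open>p = 0\<close>, \<open>powr\<close> gives \<open>0\<close> instead of \<open>1\<close> at \<open>t = 0\<close>, which the
  constants \<open>a1\<close>, \<open>a2\<close> absorb.)\<close>

definition growth_class :: "real \<Rightarrow> real \<Rightarrow> real \<Rightarrow> (real \<Rightarrow> real) set" where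
  "growth_class p c1 c2 = {g. \<exists>a1 a2. \<forall>t\<ge>0. c1 * t powr p + a1 \<le> g t \<and> g t \<le> c2 * t powr p + a2}"

text \<open>\<open>\<rho> \<mapsto> \<integral> \<N>(\<rho>)\<close>, where \<open>\<N>\<close> is a function on \<open>[0,\<infinity>)\<close>: its values at negative arguments are
  never used, and densities that are not nonnegative almost everywhere get the value \<open>\<infinity>\<close>. For
  nonnegative densities the integral is the extended-real one, since a density that is only
  square integrable can have \<open>\<integral> \<N>(\<rho>) = \<infinity>\<close> when \<open>\<N>\<close> grows like \<open>t\<^sup>3\<close>.\<close>

definition local_xc :: "real^3^3 \<Rightarrow> (real \<Rightarrow> real) \<Rightarrow> (real^3 \<Rightarrow> real) \<Rightarrow> ereal" where
  "local_xc A \<N> \<rho> =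
     (if AE x\<in>cell A in lborel. 0 \<le> \<rho> x
      then enn2ereal (\<integral>\<^sup>+x\<in>cell A. ennreal (\<N> (\<rho> x)) \<partial>lborel)
           - enn2ereal (\<integral>\<^sup>+x\<in>cell A. ennreal (- \<N> (\<rho> x)) \<partial>lborel)
      else \<infinity>)"

definition Linf_per :: "real^3^3 \<Rightarrow> (real^3 \<Rightarrow> real) set" where
  "Linf_per A = {u. u \<in> borel_measurable borel \<and> periodic A u \<and> bounded (range u)}"

text \<open>Gateaux differentiability on the convex set of bounded nonnegative periodic densities, along
  segments inside that set. This is implied by Frechet differentiability with respect to any of
  the usual \<open>L\<^sup>p\<close> norms. As the derivative is a real number, the limit also forces finite values
  of \<open>E\<close> on bounded densities.\<close>

definition xc_differentiable :: "real^3^3 \<Rightarrow> ((real^3 \<Rightarrow> real) \<Rightarrow> ereal) \<Rightarrow> bool" where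
  "xc_differentiable A E \<longleftrightarrow>
     (\<forall>\<rho>\<in>Linf_per A. (\<forall>x. 0 \<le> \<rho> x) \<longrightarrow>
       (\<exists>L :: (real^3 \<Rightarrow> real) \<Rightarrow> real.
          (\<forall>h\<in>Linf_per A. \<forall>k\<in>Linf_per A. L (\<lambda>x. h x + k x) = L h + L k) \<and>
          (\<forall>h\<in>Linf_per A. \<forall>c. L (\<lambda>x. c * h x) = c * L h) \<and>
          (\<forall>\<eta>\<in>Linf_per A. (\<forall>x. 0 \<le> \<eta> x) \<longrightarrow>
             ((\<lambda>t. (E (\<lambda>x. \<rho> x + t * (\<eta> x - \<rho> x)) - E \<rho>) / ereal t)
                \<longlongrightarrow> ereal (L (\<lambda>x. \<eta> x - \<rho> x))) (at_right 0))))"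


section \<open>The energy\<close>

definition density ::
  "real^3^3 \<Rightarrow> (real^3 \<Rightarrow> real^'m) \<Rightarrow> (real^3 \<Rightarrow> real^'m^'m) \<Rightarrow> (real^3 \<Rightarrow> real^'n) \<Rightarrow> real^'n^'n
   \<Rightarrow> real^3 \<Rightarrow> real" where
  "density A M Q \<Psi> F x =
     2 * trace ((outer (\<Psi> x) (\<Psi> x) + gram A \<Psi> M ** Q x ** gram A M \<Psi>) ** F)"

definition kin :: "real^3^3 \<Rightarrow> (real^3 \<Rightarrow> real^'n) \<Rightarrow> real^'n^'n" where
  "kin A \<Psi> = (\<chi> i j. (1/2) * (LINT x:cell A|lborel.
                 grad A (\<lambda>y. \<Psi> y $ i) x \<bullet> grad A (\<lambda>y. \<Psi> y $ j) x))"

definition hartree :: "real^3^3 \<Rightarrow> (real^3 \<Rightarrow> real) \<Rightarrow> real" where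
  "hartree A \<rho> = (1/2) * (LINT r:cell A|lborel. LINT r':cell A|lborel. \<rho> r * \<rho> r' / norm (r - r'))"

definition energy ::
  "real^3^3 \<Rightarrow> (real^3 \<Rightarrow> real^'m) \<Rightarrow> (real^3 \<Rightarrow> real^'m^'m) \<Rightarrow> real^'m^'m \<Rightarrow> (real^3 \<Rightarrow> real)
   \<Rightarrow> ((real^3 \<Rightarrow> real) \<Rightarrow> ereal) \<Rightarrow> real \<Rightarrow> (real \<Rightarrow> real) \<Rightarrow> (real \<Rightarrow> real)
   \<Rightarrow> (real^3 \<Rightarrow> real^'n) \<Rightarrow> real^'n^'n \<Rightarrow> ereal" where
  "energy A M Q D Vloc Exc \<sigma> f S \<Psi> F =
     ereal (2 * trace ((kin A \<Psi> + gram A \<Psi> (Vnl A M D \<Psi>)) ** F)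
            + ip A Vloc (density A M Q \<Psi> F)
            + hartree A (density A M Q \<Psi> F))
     + Exc (density A M Q \<Psi> F)
     - ereal (2 * \<sigma> * trace (apply_diag (S_finv S f) F))"

end

theory Submission
  imports Defs "HOL-Complex_Analysis.Great_Picard"
begin

text \<open>The direct method, applied after the substitution \<open>u\<^sub>i = \<surd>f\<^sub>i \<psi>\<^sub>i\<close>. The energy depends on the \<open>u\<^sub>i\<close> only through
  their Dirichlet integrals, finite-rank quadratic forms and the density, and the constraint becomes
  \<open>(u\<^sub>i, B u\<^sub>j) = f\<^sub>i \<delta>\<^sub>i\<^sub>j\<close>, which is closed under \<open>L\<^sup>2\<close> convergence. All lower-order terms are absorbed by the
  Dirichlet integral, so minimizing sequences are bounded in \<open>H\<^sup>1\<close>, hence compact in \<open>L\<^sup>4\<close>, and the densities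
  converge in \<open>L\<^sup>2\<close>; the Dirichlet, Hartree and exchange-correlation terms are lower semicontinuous. If \<open>f\<^sub>i\<close>
  vanishes in the limit, then so does \<open>u\<^sub>i\<close> by coercivity, and \<open>\<psi>\<^sub>i\<close>, which may have been lost, does not
  contribute to the energy: it is replaced by an arbitrary \<open>B\<close>-orthonormal completion.

  The embedding of \<open>H\<^sup>1\<close> into \<open>L\<^sup>4\<close> comes from averages over dyadic subcells of the unit cell: the translation
  estimate \<open>\<parallel>u(\<sqdot> + z) - u\<parallel> \<le> |z| \<parallel>\<nabla>u\<parallel>\<close> bounds their error, and for fixed \<open>n\<close> they have finite rank.\<close>

section \<open>The norms of \<open>L\<^sup>p\<close>\<close>

text \<open>The substitution answers an obstacle: the energy controls only the occupation times the
  Dirichlet integral of an orbital, so an orbital whose occupation tends to 0 may have unbounded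
  gradients. The exponent 4 comes from the data: \<open>Vloc\<close> is merely square integrable, so
  its term asks for densities in L2, that is, for orbitals in L4. Absorption rests on the free
  parameter in \<open>H1_L4\<close>: the coefficient of the gradient tends to 0 like \<theta>^n
  while the coefficient of the L2 norm grows. Hence, for every e > 0, the L2 norm of the density is
  at most e times the Dirichlet integral plus a constant (\<open>rhoT_eps\<close>), and it suffices
  to bound the terms of indefinite sign below linearly in that norm. For the exchange-correlation
  term this works because the mass of the density is bounded by the L2 norms of the orbitals.
  \<open>Q\<close> is only symmetric, so the density may be negative somewhere; its sign is inferred
  from finite energy. Since \<open>local_xc\<close> may be infinite, it is handled by Fatou's lemma
  alone, for which continuity of \<N> is extracted from differentiability.\<close>

definition Lp :: "nat \<Rightarrow> 'a measure \<Rightarrow> ('a \<Rightarrow> real) set" where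
  "Lp p M = {u \<in> borel_measurable M. integrable M (\<lambda>x. \<bar>u x\<bar> ^ p)}"

text \<open>A Bochner integral that does not exist is 0, so \<open>nrm\<close> is informative only
  on \<open>Lp\<close>. Natural exponents suffice, as only 2 and 4 occur.\<close>

definition nrm :: "nat \<Rightarrow> 'a measure \<Rightarrow> ('a \<Rightarrow> real) \<Rightarrow> real" where
  "nrm p M u = root p (LINT x|M. \<bar>u x\<bar> ^ p)"

lemma Lp_measurable [measurable_dest]: "u \<in> Lp p M \<Longrightarrow> u \<in> borel_measurable M"
  by (simp add: Lp_def)

lemma Lp_integrable: "u \<in> Lp p M \<Longrightarrow> integrable M (\<lambda>x. \<bar>u x\<bar> ^ p)"
  by (simp add: Lp_def)

lemma nrm_nonneg [simp]: "0 \<le> nrm p M u"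
  by (cases "p = 0") (auto simp: nrm_def intro!: real_root_ge_zero integral_nonneg)

lemma nrm_power: "0 < p \<Longrightarrow> nrm p M u ^ p = (LINT x|M. \<bar>u x\<bar> ^ p)"
  by (simp add: nrm_def integral_nonneg)

lemma nrm_power2: "(nrm 2 M u)\<^sup>2 = (LINT x|M. (u x)\<^sup>2)"
  by (simp add: nrm_power)

lemma nrm_le:
  assumes "0 < p" "(LINT x|M. \<bar>u x\<bar> ^ p) \<le> c ^ p" "0 \<le> c"
  shows "nrm p M u \<le> c"
  using assms nrm_power[of p M u] by (metis power_mono_iff nrm_nonneg)

lemma nrm_cong_AE:
  assumes "AE x in M. u x = v x" "u \<in> borel_measurable M" "v \<in> borel_measurable M"
  shows "nrm p M u = nrm p M v"
  unfolding nrm_def using assms by (intro arg_cong[where f="root p"] integral_cong_AE) auto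

lemma nrm_mult: "0 < p \<Longrightarrow> nrm p M (\<lambda>x. c * u x) = \<bar>c\<bar> * nrm p M u"
  by (simp add: nrm_def abs_mult power_mult_distrib real_root_mult real_root_power_cancel)

lemma nrm_minus_commute: "nrm p M (\<lambda>x. u x - v x) = nrm p M (\<lambda>x. v x - u x)"
  by (simp add: nrm_def abs_minus_commute)

lemma nrm_zero [simp]: "0 < p \<Longrightarrow> nrm p M (\<lambda>x. 0) = 0"
  by (simp add: nrm_def)

lemma Lp_mult: "u \<in> Lp p M \<Longrightarrow> (\<lambda>x. c * u x) \<in> Lp p M"
  by (auto simp: Lp_def abs_mult power_mult_distrib)

lemma Lp_uminus: "u \<in> Lp p M \<Longrightarrow> (\<lambda>x. - u x) \<in> Lp p M"
  by (auto simp: Lp_def)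

lemma Lp_zero [simp]: "0 < p \<Longrightarrow> (\<lambda>x. 0) \<in> Lp p M"
  by (simp add: Lp_def zero_power)

lemma convex_power_nonneg: "convex_on {0::real..} (\<lambda>x. x ^ p)"
  using convex_power_even[of p] convex_power_odd[of p]
  by (cases "even p") (auto intro: convex_on_subset)

text \<open>The pointwise form of Minkowski's inequality: (a + b) / (\<alpha> + \<beta>) is a convex
  combination of a / \<alpha> and b / \<beta>, and t ^ p is convex for t \<ge> 0. Integrated with
  \<alpha> and \<beta> just above the two norms, it gives the triangle inequality.\<close>

lemma power_add_convex_bound:
  fixes a b \<alpha> \<beta> :: real
  assumes "0 \<le> a" "0 \<le> b" "0 < \<alpha>" "0 < \<beta>"
  shows "(a + b) ^ p \<le> (\<alpha> + \<beta>) ^ p * (\<alpha> / (\<alpha> + \<beta>) * (a / \<alpha>) ^ p + \<beta> / (\<alpha> + \<beta>) * (b / \<beta>) ^ p)"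
proof -
  have s: "\<alpha> + \<beta> > 0" using assms by simp
  have w: "\<alpha> / (\<alpha> + \<beta>) + \<beta> / (\<alpha> + \<beta>) = 1"
    using s by (metis add_divide_distrib divide_self less_irrefl)
  have "(\<alpha> / (\<alpha> + \<beta>) * (a / \<alpha>) + \<beta> / (\<alpha> + \<beta>) * (b / \<beta>)) ^ p
      \<le> \<alpha> / (\<alpha> + \<beta>) * (a / \<alpha>) ^ p + \<beta> / (\<alpha> + \<beta>) * (b / \<beta>) ^ p"
    using convex_onD[OF convex_power_nonneg[of p], of "\<beta> / (\<alpha> + \<beta>)" "a / \<alpha>" "b / \<beta>"] assms s w
    by (simp add: eq_diff_eq[symmetric])
  moreover have "\<alpha> / (\<alpha> + \<beta>) * (a / \<alpha>) + \<beta> / (\<alpha> + \<beta>) * (b / \<beta>) = (a + b) / (\<alpha> + \<beta>)"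
    using assms by (simp add: add_divide_distrib)
  ultimately have "((a + b) / (\<alpha> + \<beta>)) ^ p \<le> \<alpha> / (\<alpha> + \<beta>) * (a / \<alpha>) ^ p + \<beta> / (\<alpha> + \<beta>) * (b / \<beta>) ^ p"
    by simp
  then have "(\<alpha> + \<beta>) ^ p * ((a + b) / (\<alpha> + \<beta>)) ^ p \<le> (\<alpha> + \<beta>) ^ p * (\<alpha> / (\<alpha> + \<beta>) * (a / \<alpha>) ^ p + \<beta> / (\<alpha> + \<beta>) * (b / \<beta>) ^ p)"
    using s by (intro mult_left_mono) auto
  moreover have "(\<alpha> + \<beta>) ^ p * ((a + b) / (\<alpha> + \<beta>)) ^ p = (a + b) ^ p"
    using s by (simp add: power_divide)
  ultimately show ?thesis by simp
qed

lemma Lp_add: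
  assumes "u \<in> Lp p M" "v \<in> Lp p M"
  shows "(\<lambda>x. u x + v x) \<in> Lp p M"
proof -
  have [measurable]: "u \<in> borel_measurable M" "v \<in> borel_measurable M"
    using assms by (auto dest: Lp_measurable)
  have "integrable M (\<lambda>x. \<bar>u x + v x\<bar> ^ p)"
  proof (rule Bochner_Integration.integrable_bound)
    show "integrable M (\<lambda>x. 2 ^ p * (1/2 * \<bar>u x\<bar> ^ p + 1/2 * \<bar>v x\<bar> ^ p))"
      using assms by (auto simp: Lp_def)
    show "AE x in M. norm (\<bar>u x + v x\<bar> ^ p) \<le> norm (2 ^ p * (1/2 * \<bar>u x\<bar> ^ p + 1/2 * \<bar>v x\<bar> ^ p))"
    proof (rule AE_I2)
      fix x
      have "\<bar>u x + v x\<bar> ^ p \<le> (\<bar>u x\<bar> + \<bar>v x\<bar>) ^ p" by (intro power_mono) auto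
      also have "\<dots> \<le> 2 ^ p * (1/2 * \<bar>u x\<bar> ^ p + 1/2 * \<bar>v x\<bar> ^ p)"
        using power_add_convex_bound[of "\<bar>u x\<bar>" "\<bar>v x\<bar>" 1 1 p] by simp
      finally show "norm (\<bar>u x + v x\<bar> ^ p) \<le> norm (2 ^ p * (1/2 * \<bar>u x\<bar> ^ p + 1/2 * \<bar>v x\<bar> ^ p))"
        by simp
    qed
  qed measurable
  then show ?thesis by (simp add: Lp_def)
qed

lemma Lp_diff: "u \<in> Lp p M \<Longrightarrow> v \<in> Lp p M \<Longrightarrow> (\<lambda>x. u x - v x) \<in> Lp p M"
  using Lp_add[OF _ Lp_uminus, of u p M v] by simp

lemma Lp_sum: "0 < p \<Longrightarrow> (\<And>i. i \<in> I \<Longrightarrow> u i \<in> Lp p M) \<Longrightarrow> (\<lambda>x. \<Sum>i\<in>I. u i x) \<in> Lp p M"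
  by (induction I rule: infinite_finite_induct) (auto intro: Lp_add)

lemma nrm_triangle:
  assumes "0 < p" "u \<in> Lp p M" "v \<in> Lp p M"
  shows "nrm p M (\<lambda>x. u x + v x) \<le> nrm p M u + nrm p M v"
proof (rule field_le_epsilon)
  fix e :: real assume e: "0 < e"
  \<comment> \<open>The shift by e / 2 keeps the divisors positive when a norm vanishes; the two
    normalized integrals are then at most 1.\<close>
  define \<alpha> where "\<alpha> = nrm p M u + e / 2"
  define \<beta> where "\<beta> = nrm p M v + e / 2"
  have pos: "0 < \<alpha>" "0 < \<beta>" using e by (auto simp: \<alpha>_def \<beta>_def intro: add_nonneg_pos)
  note [simp] = Lp_integrable[OF assms(2)] Lp_integrable[OF assms(3)]
  have *: "(LINT x|M. \<bar>u x\<bar> ^ p) \<le> \<alpha> ^ p" "(LINT x|M. \<bar>v x\<bar> ^ p) \<le> \<beta> ^ p"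
    using e assms(1) by (auto simp: \<alpha>_def \<beta>_def nrm_power[symmetric] intro!: power_mono)
  have "(LINT x|M. \<bar>u x + v x\<bar> ^ p) \<le>
     (LINT x|M. (\<alpha> + \<beta>) ^ p * (\<alpha> / (\<alpha> + \<beta>) * (\<bar>u x\<bar> / \<alpha>) ^ p + \<beta> / (\<alpha> + \<beta>) * (\<bar>v x\<bar> / \<beta>) ^ p))"
  proof (rule integral_mono)
    show "integrable M (\<lambda>x. \<bar>u x + v x\<bar> ^ p)"
      using Lp_add[OF assms(2,3)] by (simp add: Lp_def)
    show "integrable M (\<lambda>x. (\<alpha> + \<beta>) ^ p * (\<alpha> / (\<alpha> + \<beta>) * (\<bar>u x\<bar> / \<alpha>) ^ p + \<beta> / (\<alpha> + \<beta>) * (\<bar>v x\<bar> / \<beta>) ^ p))"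
      by (simp add: power_divide)
    fix x
    have "\<bar>u x + v x\<bar> ^ p \<le> (\<bar>u x\<bar> + \<bar>v x\<bar>) ^ p" by (intro power_mono) auto
    also note power_add_convex_bound[OF abs_ge_zero abs_ge_zero pos, of "u x" "v x" p]
    finally show "\<bar>u x + v x\<bar> ^ p \<le> (\<alpha> + \<beta>) ^ p * (\<alpha> / (\<alpha> + \<beta>) * (\<bar>u x\<bar> / \<alpha>) ^ p + \<beta> / (\<alpha> + \<beta>) * (\<bar>v x\<bar> / \<beta>) ^ p)" .
  qed
  also have "\<dots> = (\<alpha> + \<beta>) ^ p * (\<alpha> / (\<alpha> + \<beta>) * ((LINT x|M. \<bar>u x\<bar> ^ p) / \<alpha> ^ p) + \<beta> / (\<alpha> + \<beta>) * ((LINT x|M. \<bar>v x\<bar> ^ p) / \<beta> ^ p))"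
    by (simp add: power_divide)
  also have "\<dots> \<le> (\<alpha> + \<beta>) ^ p * (\<alpha> / (\<alpha> + \<beta>) * 1 + \<beta> / (\<alpha> + \<beta>) * 1)"
    using * pos by (intro mult_left_mono add_mono) auto
  also have "\<dots> = (\<alpha> + \<beta>) ^ p"
    using pos by (simp add: add_divide_distrib[symmetric])
  finally have "nrm p M (\<lambda>x. u x + v x) \<le> \<alpha> + \<beta>"
    using pos assms(1) by (intro nrm_le) auto
  then show "nrm p M (\<lambda>x. u x + v x) \<le> nrm p M u + nrm p M v + e"
    by (simp add: \<alpha>_def \<beta>_def)
qed

lemma nrm_triangle_mid:
  assumes "0 < p" "u \<in> Lp p M" "v \<in> Lp p M" "w \<in> Lp p M"
  shows "nrm p M (\<lambda>x. u x - w x) \<le> nrm p M (\<lambda>x. u x - v x) + nrm p M (\<lambda>x. v x - w x)"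
  using nrm_triangle[OF assms(1) Lp_diff[OF assms(2,3)] Lp_diff[OF assms(3,4)]] by simp

lemma nrm_reverse_triangle:
  assumes "0 < p" "u \<in> Lp p M" "v \<in> Lp p M"
  shows "\<bar>nrm p M u - nrm p M v\<bar> \<le> nrm p M (\<lambda>x. u x - v x)"
  using nrm_triangle[OF assms(1) Lp_diff[OF assms(2,3)] assms(3)]
    nrm_triangle[OF assms(1) Lp_diff[OF assms(3,2)] assms(2)]
  by (simp add: nrm_minus_commute[of p M u v])

section \<open>Cauchy-Schwarz, inner products, and products of L4 functions\<close>

lemma L2_mult_integrable:
  assumes "u \<in> Lp 2 M" "v \<in> Lp 2 M"
  shows "integrable M (\<lambda>x. u x * v x)"
proof (rule Bochner_Integration.integrable_bound)
  show "integrable M (\<lambda>x. (u x)\<^sup>2 + (v x)\<^sup>2)"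
    using assms by (auto simp: Lp_def)
  show "(\<lambda>x. u x * v x) \<in> borel_measurable M"
    using assms[THEN Lp_measurable] by measurable
  show "AE x in M. norm (u x * v x) \<le> norm ((u x)\<^sup>2 + (v x)\<^sup>2)"
  proof (rule AE_I2)
    fix x
    have "2 * (\<bar>u x\<bar> * \<bar>v x\<bar>) \<le> (u x)\<^sup>2 + (v x)\<^sup>2"
      using sum_squares_bound[of "\<bar>u x\<bar>" "\<bar>v x\<bar>"] by simp
    moreover have "0 \<le> \<bar>u x\<bar> * \<bar>v x\<bar>" by simp
    ultimately have "\<bar>u x\<bar> * \<bar>v x\<bar> \<le> (u x)\<^sup>2 + (v x)\<^sup>2" by linarith
    then show "norm (u x * v x) \<le> norm ((u x)\<^sup>2 + (v x)\<^sup>2)"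
      by (simp add: abs_mult)
  qed
qed

lemma L2_Cauchy_Schwarz:
  assumes "u \<in> Lp 2 M" "v \<in> Lp 2 M"
  shows "(LINT x|M. \<bar>u x * v x\<bar>) \<le> nrm 2 M u * nrm 2 M v"
proof (rule field_le_epsilon)
  fix e :: real assume e: "0 < e"
  define a where "a = nrm 2 M u"
  define b where "b = nrm 2 M v"
  have ab: "0 \<le> a" "0 \<le> b" by (auto simp: a_def b_def)
  \<comment> \<open>Shifting both norms by \<open>d\<close> avoids division by 0. The shift costs
    \<open>d * (a + b) / 2\<close>, which this choice keeps below \<open>e\<close>.\<close>
  define d where "d = e / (a + b + 1)"
  have d: "0 < d" using e ab by (simp add: d_def)
  have sq: "(LINT x|M. (u x)\<^sup>2) = a\<^sup>2" "(LINT x|M. (v x)\<^sup>2) = b\<^sup>2"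
    by (simp_all add: a_def b_def nrm_power2)
  have I: "integrable M (\<lambda>x. (u x)\<^sup>2)" "integrable M (\<lambda>x. (v x)\<^sup>2)"
    using assms by (auto simp: Lp_def)
  \<comment> \<open>The nearly optimal weight in 2 |u v| \<le> s u^2 + v^2 / s: the quotient of the
    shifted norms.\<close>
  define s where "s = (b + d) / (a + d)"
  have s: "0 < s" using ab d by (simp add: s_def add_nonneg_pos)
  have "(LINT x|M. \<bar>u x * v x\<bar>) \<le> (LINT x|M. (s * (u x)\<^sup>2 + (v x)\<^sup>2 / s) / 2)"
  proof (rule integral_mono)
    show "integrable M (\<lambda>x. \<bar>u x * v x\<bar>)" using L2_mult_integrable[OF assms] by simp
    show "integrable M (\<lambda>x. (s * (u x)\<^sup>2 + (v x)\<^sup>2 / s) / 2)" using I by simp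
    fix x
    have "0 \<le> (s * \<bar>u x\<bar> - \<bar>v x\<bar>)\<^sup>2 / s" using s by simp
    also have "\<dots> = s * (u x)\<^sup>2 + (v x)\<^sup>2 / s - 2 * \<bar>u x * v x\<bar>"
    proof -
      have "(s * \<bar>u x\<bar> - \<bar>v x\<bar>)\<^sup>2 = s * (s * (u x)\<^sup>2) + (v x)\<^sup>2 - s * (2 * \<bar>u x * v x\<bar>)"
        by (simp add: power2_diff power_mult_distrib abs_mult) (simp add: power2_eq_square)
      then show ?thesis using s by (simp add: add_divide_distrib diff_divide_distrib)
    qed
    finally show "\<bar>u x * v x\<bar> \<le> (s * (u x)\<^sup>2 + (v x)\<^sup>2 / s) / 2" by simp
  qed
  also have "\<dots> = (s * a\<^sup>2 + b\<^sup>2 / s) / 2" using I sq by simp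
  also have "\<dots> \<le> (s * (a * (a + d)) + (b * (b + d)) / s) / 2"
    using ab d s by (intro divide_right_mono add_mono mult_left_mono) (auto simp: power2_eq_square mult_left_mono)
  also have "\<dots> = ((b + d) * a + b * (a + d)) / 2"
  proof -
    have "a + d \<noteq> 0" "b + d \<noteq> 0" using ab d by auto
    then show ?thesis by (simp add: s_def)
  qed
  also have "\<dots> = a * b + d * (a + b) / 2" by (simp add: field_simps)
  also have "\<dots> \<le> a * b + e"
  proof -
    have "d * (a + b) / 2 \<le> d * (a + b + 1)" using ab d by (simp add: algebra_simps)
    also have "\<dots> = e" using ab by (simp add: d_def)
    finally show ?thesis by simp
  qed
  finally show "(LINT x|M. \<bar>u x * v x\<bar>) \<le> nrm 2 M u * nrm 2 M v + e" by (simp add: a_def b_def)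
qed

lemma L2_inner_le:
  assumes "u \<in> Lp 2 M" "v \<in> Lp 2 M"
  shows "\<bar>LINT x|M. u x * v x\<bar> \<le> nrm 2 M u * nrm 2 M v"
  using L2_Cauchy_Schwarz[OF assms] integral_abs_bound[of M "\<lambda>x. u x * v x"] by linarith

lemma L2_inner_tendsto:
  assumes "\<And>n. u n \<in> Lp 2 M" "u' \<in> Lp 2 M" "\<And>n. v n \<in> Lp 2 M" "v' \<in> Lp 2 M"
    and "(\<lambda>n. nrm 2 M (\<lambda>x. u n x - u' x)) \<longlonglongrightarrow> 0" "(\<lambda>n. nrm 2 M (\<lambda>x. v n x - v' x)) \<longlonglongrightarrow> 0"
  shows "(\<lambda>n. LINT x|M. u n x * v n x) \<longlonglongrightarrow> (LINT x|M. u' x * v' x)"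
proof -
  define a where "a n = nrm 2 M (\<lambda>x. u n x - u' x)" for n
  define b where "b n = nrm 2 M (\<lambda>x. v n x - v' x)" for n
  have d: "(\<lambda>x. u n x - u' x) \<in> Lp 2 M" "(\<lambda>x. v n x - v' x) \<in> Lp 2 M" for n
    using assms by (auto intro: Lp_diff)
  have "norm ((LINT x|M. u n x * v n x) - (LINT x|M. u' x * v' x)) \<le> a n * b n + a n * nrm 2 M v' + nrm 2 M u' * b n" for n
  proof -
    \<comment> \<open>Expansion around the limits, in which every term has a factor tending to
      0.\<close>
    have e: "u n x * v n x - u' x * v' x = ((u n x - u' x) * (v n x - v' x) + (u n x - u' x) * v' x) + u' x * (v n x - v' x)" for x
      by (simp add: algebra_simps)
    have i: "integrable M (\<lambda>x. (u n x - u' x) * (v n x - v' x))" "integrable M (\<lambda>x. (u n x - u' x) * v' x)" "integrable M (\<lambda>x. u' x * (v n x - v' x))"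
      using L2_mult_integrable[OF d(1) d(2)] L2_mult_integrable[OF d(1) assms(4)] L2_mult_integrable[OF assms(2) d(2)] by auto
    have "(LINT x|M. u n x * v n x) - (LINT x|M. u' x * v' x) = (LINT x|M. u n x * v n x - u' x * v' x)"
      using L2_mult_integrable[OF assms(1,3)] L2_mult_integrable[OF assms(2,4)] by simp
    also have "\<dots> = (LINT x|M. (u n x - u' x) * (v n x - v' x)) + (LINT x|M. (u n x - u' x) * v' x) + (LINT x|M. u' x * (v n x - v' x))"
      unfolding e using i by (simp only: Bochner_Integration.integral_add Bochner_Integration.integrable_add)
    finally show ?thesis
      using L2_inner_le[OF d(1) d(2), of n n] L2_inner_le[OF d(1) assms(4), of n] L2_inner_le[OF assms(2) d(2), of n]
      unfolding a_def b_def real_norm_def by linarith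
  qed
  note bd = this
  have "(\<lambda>n. a n * b n + a n * nrm 2 M v' + nrm 2 M u' * b n) \<longlonglongrightarrow> 0 * 0 + 0 * nrm 2 M v' + nrm 2 M u' * 0"
    using assms(5,6) unfolding a_def b_def by (intro tendsto_intros)
  then have lim: "(\<lambda>n. a n * b n + a n * nrm 2 M v' + nrm 2 M u' * b n) \<longlonglongrightarrow> 0" by simp
  have "(\<lambda>n. (LINT x|M. u n x * v n x) - (LINT x|M. u' x * v' x)) \<longlonglongrightarrow> 0"
    by (rule Lim_null_comparison[OF always_eventually lim]) (rule allI, rule bd)
  then show ?thesis by (simp add: LIM_zero_iff)
qed

lemma Lp_const: "finite_measure M \<Longrightarrow> (\<lambda>x. c) \<in> Lp p M"
  by (auto simp: Lp_def finite_measure.integrable_const)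

text \<open>Cauchy-Schwarz against the constant 1, which is square integrable on a finite measure
  space.\<close>

lemma (in finite_measure) L2_imp_integrable:
  assumes "u \<in> Lp 2 M"
  shows "integrable M u" "(LINT x|M. \<bar>u x\<bar>) \<le> sqrt (measure M (space M)) * nrm 2 M u"
proof -
  have c: "(\<lambda>x. 1) \<in> Lp 2 M" by (rule Lp_const) unfold_locales
  have "nrm 2 M (\<lambda>x. 1) = sqrt (measure M (space M))"
    by (simp add: nrm_def sqrt_def)
  then show "integrable M u" "(LINT x|M. \<bar>u x\<bar>) \<le> sqrt (measure M (space M)) * nrm 2 M u"
    using L2_mult_integrable[OF assms c] L2_Cauchy_Schwarz[OF assms c] by (auto simp: mult.commute)
qed

lemma L4_iff_square: "u \<in> borel_measurable M \<Longrightarrow> u \<in> Lp 4 M \<longleftrightarrow> (\<lambda>x. (u x)\<^sup>2) \<in> Lp 2 M"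
proof -
  have "(x\<^sup>2)\<^sup>2 = x ^ 4" for x :: real by simp
  then show "u \<in> borel_measurable M \<Longrightarrow> ?thesis" by (auto simp: Lp_def simp del: power_abs)
qed

lemma nrm_square: "nrm 2 M (\<lambda>x. (u x)\<^sup>2) = (nrm 4 M u)\<^sup>2"
proof -
  have "(nrm 2 M (\<lambda>x. (u x)\<^sup>2))\<^sup>2 = ((nrm 4 M u)\<^sup>2)\<^sup>2"
    by (simp add: nrm_power2) (simp add: nrm_power)
  then show ?thesis by (metis nrm_nonneg power2_eq_iff_nonneg zero_le_power2)
qed

lemma L4_mult:
  assumes "u \<in> Lp 4 M" "v \<in> Lp 4 M"
  shows "(\<lambda>x. u x * v x) \<in> Lp 2 M" "nrm 2 M (\<lambda>x. u x * v x) \<le> nrm 4 M u * nrm 4 M v"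
proof -
  have m: "u \<in> borel_measurable M" "v \<in> borel_measurable M" using assms by (auto dest: Lp_measurable)
  have s: "(\<lambda>x. (u x)\<^sup>2) \<in> Lp 2 M" "(\<lambda>x. (v x)\<^sup>2) \<in> Lp 2 M"
    using assms m by (auto simp: L4_iff_square)
  have e: "\<bar>u x * v x\<bar>\<^sup>2 = (u x)\<^sup>2 * (v x)\<^sup>2" for x by (simp add: power_mult_distrib)
  show "(\<lambda>x. u x * v x) \<in> Lp 2 M"
    using L2_mult_integrable[OF s] m unfolding Lp_def by (simp add: power_mult_distrib)
  show "nrm 2 M (\<lambda>x. u x * v x) \<le> nrm 4 M u * nrm 4 M v"
    using L2_inner_le[OF s] by (intro nrm_le) (auto simp: power_mult_distrib nrm_square)
qed

lemma (in finite_measure) L4_imp_L2: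
  assumes "u \<in> Lp 4 M"
  shows "u \<in> Lp 2 M" "nrm 2 M u \<le> root 4 (measure M (space M)) * nrm 4 M u"
proof -
  have c: "(\<lambda>x. 1) \<in> Lp 4 M" by (rule Lp_const) unfold_locales
  show "u \<in> Lp 2 M" "nrm 2 M u \<le> root 4 (measure M (space M)) * nrm 4 M u"
    using L4_mult[OF assms c] by (auto simp: mult.commute nrm_def)
qed

text \<open>Fatou's lemma for the powers |w n| ^ p. The bound on the norms is asked for only
  eventually, which fits tails of Cauchy sequences.\<close>

lemma Lp_Fatou:
  assumes p: "0 < p" and w: "\<And>n. w n \<in> Lp p M" and v[measurable]: "v \<in> borel_measurable M"
    and lim: "AE x in M. (\<lambda>n. w n x) \<longlonglongrightarrow> v x" and b: "\<forall>\<^sub>F n in sequentially. nrm p M (w n) \<le> c"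
  shows "v \<in> Lp p M" "nrm p M v \<le> c"
proof -
  have [measurable]: "w n \<in> borel_measurable M" for n using w by (auto dest: Lp_measurable)
  from b have c: "0 \<le> c" using order_trans[OF nrm_nonneg] by (metis eventually_happens trivial_limit_sequentially)
  have "AE x in M. (\<lambda>n. ennreal (\<bar>w n x\<bar> ^ p)) \<longlonglongrightarrow> ennreal (\<bar>v x\<bar> ^ p)"
    using lim by eventually_elim (intro tendsto_intros)
  then have "AE x in M. ennreal (\<bar>v x\<bar> ^ p) = liminf (\<lambda>n. ennreal (\<bar>w n x\<bar> ^ p))"
    by eventually_elim (rule lim_imp_Liminf[symmetric], simp)
  then have "(\<integral>\<^sup>+x. ennreal (\<bar>v x\<bar> ^ p) \<partial>M) = (\<integral>\<^sup>+x. liminf (\<lambda>n. ennreal (\<bar>w n x\<bar> ^ p)) \<partial>M)"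
    by (intro nn_integral_cong_AE)
  also have "\<dots> \<le> liminf (\<lambda>n. \<integral>\<^sup>+x. ennreal (\<bar>w n x\<bar> ^ p) \<partial>M)"
    by (intro nn_integral_liminf) auto
  also have "\<dots> = liminf (\<lambda>n. ennreal (nrm p M (w n) ^ p))"
    using Lp_integrable[OF w] p by (simp add: nn_integral_eq_integral nrm_power)
  also have "\<dots> \<le> liminf (\<lambda>n. ennreal (c ^ p))"
    using b by (intro Liminf_mono) (auto elim!: eventually_mono intro!: ennreal_leI power_mono)
  also have "\<dots> = ennreal (c ^ p)" by (simp add: Liminf_const)
  finally have *: "(\<integral>\<^sup>+x. ennreal (\<bar>v x\<bar> ^ p) \<partial>M) \<le> ennreal (c ^ p)" .
  then have i: "integrable M (\<lambda>x. \<bar>v x\<bar> ^ p)"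
    by (intro integrableI_bounded) (auto intro: le_less_trans[OF _ ennreal_less_top])
  then show "v \<in> Lp p M" by (simp add: Lp_def)
  show "nrm p M v \<le> c"
    using * i c p by (intro nrm_le) (auto simp: nn_integral_eq_integral)
qed

section \<open>Almost everywhere convergent subsequences and completeness\<close>

lemma (in finite_measure) L2_tendsto_AE_subseq:
  assumes "\<And>n. u n \<in> Lp 2 M" "v \<in> Lp 2 M" "(\<lambda>n. nrm 2 M (\<lambda>x. u n x - v x)) \<longlonglongrightarrow> 0"
  obtains r where "strict_mono (r :: nat \<Rightarrow> nat)" "AE x in M. (\<lambda>n. u (r n) x) \<longlonglongrightarrow> v x"
proof -
  have d: "(\<lambda>x. u n x - v x) \<in> Lp 2 M" for n using assms by (auto intro: Lp_diff)
  have "(\<lambda>n. LINT x|M. norm (u n x - v x)) \<longlonglongrightarrow> 0"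
  proof (rule tendsto_sandwich[OF _ _ tendsto_const])
    show "\<forall>\<^sub>F n in sequentially. (LINT x|M. norm (u n x - v x)) \<le> sqrt (measure M (space M)) * nrm 2 M (\<lambda>x. u n x - v x)"
      using L2_imp_integrable(2)[OF d] by simp
    show "(\<lambda>n. sqrt (measure M (space M)) * nrm 2 M (\<lambda>x. u n x - v x)) \<longlonglongrightarrow> 0"
      using tendsto_mult_left[OF assms(3), of "sqrt (measure M (space M))"] by simp
  qed simp
  from tendsto_L1_AE_subseq[OF L2_imp_integrable(1)[OF d] this] obtain r where
    "strict_mono r" "AE x in M. (\<lambda>n. u (r n) x - v x) \<longlonglongrightarrow> 0" by blast
  then show thesis by (intro that[of r]) (auto simp: LIM_zero_iff)
qed

text \<open>The Riesz-Fischer argument: along a subsequence whose increments have L2 norm at most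
  2^-k, the L1 norms of the increments are summable on a finite measure space, so the telescoping
  series converges absolutely almost everywhere.\<close>

lemma (in finite_measure) L2_Cauchy_AE_subseq:
  assumes u: "\<And>n. u n \<in> Lp 2 M"
    and C: "\<And>e. 0 < e \<Longrightarrow> \<exists>N. \<forall>m\<ge>N. \<forall>n\<ge>N. nrm 2 M (\<lambda>x. u m x - u n x) < e"
  obtains r where "strict_mono (r :: nat \<Rightarrow> nat)" "AE x in M. convergent (\<lambda>n. u (r n) x)"
proof -
  obtain N where N: "\<And>k m n. m \<ge> N k \<Longrightarrow> n \<ge> N k \<Longrightarrow> nrm 2 M (\<lambda>x. u m x - u n x) < (1/2) ^ k"
  proof -
    have "\<forall>k. \<exists>N. \<forall>m\<ge>N. \<forall>n\<ge>N. nrm 2 M (\<lambda>x. u m x - u n x) < (1/2) ^ k"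
      by (intro allI C) simp
    then show thesis using that by metis
  qed
  obtain r where r: "strict_mono r" "\<And>k. r k \<ge> N k"
  proof -
    have "\<exists>r. \<forall>k. r k \<ge> N k \<and> r k < r (Suc k)"
    proof (rule dependent_nat_choice)
      show "\<exists>x. x \<ge> N 0" by blast
      show "\<exists>y. y \<ge> N (Suc n) \<and> x < y" for x n
        by (rule exI[of _ "max (N (Suc n)) (Suc x)"]) auto
    qed
    then show thesis using that by (auto simp: strict_mono_Suc_iff)
  qed
  define d where "d k x = u (r (Suc k)) x - u (r k) x" for k x
  have dL: "d k \<in> Lp 2 M" for k using Lp_diff[OF u[of "r (Suc k)"] u[of "r k"]] by (simp add: d_def[abs_def])
  have [measurable]: "d k \<in> borel_measurable M" for k using dL by (auto dest: Lp_measurable)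
  have db: "nrm 2 M (d k) \<le> (1/2) ^ k" for k
  proof -
    have "N k \<le> r (Suc k)" using r(2)[of k] strict_monoD[OF r(1), of k "Suc k"] by simp
    then show ?thesis unfolding d_def using N[of k "r (Suc k)" "r k"] r(2)[of k] by simp
  qed
  let ?s = "sqrt (measure M (space M))"
  have "(\<integral>\<^sup>+x. (\<Sum>k. ennreal \<bar>d k x\<bar>) \<partial>M) = (\<Sum>k. \<integral>\<^sup>+x. ennreal \<bar>d k x\<bar> \<partial>M)"
    by (intro nn_integral_suminf) auto
  also have "\<dots> \<le> (\<Sum>k. ennreal (?s * (1/2) ^ k))"
  proof (intro suminf_le)
    fix k
    have "(LINT x|M. \<bar>d k x\<bar>) \<le> ?s * (1/2) ^ k"
      using L2_imp_integrable(2)[OF dL, of k] mult_left_mono[OF db, of ?s k] by simp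
    then show "(\<integral>\<^sup>+x. ennreal \<bar>d k x\<bar> \<partial>M) \<le> ennreal (?s * (1/2) ^ k)"
      using L2_imp_integrable(1)[OF dL, of k] by (subst nn_integral_eq_integral) (auto intro!: ennreal_leI)
  qed auto
  also have "\<dots> = ennreal (\<Sum>k. ?s * (1/2) ^ k)"
    by (intro suminf_ennreal2) (auto intro!: summable_mult summable_geometric)
  also have "\<dots> < \<infinity>" by simp
  finally have "AE x in M. (\<Sum>k. ennreal \<bar>d k x\<bar>) \<noteq> \<infinity>"
    by (intro nn_integral_noteq_infinite) auto
  then have "AE x in M. convergent (\<lambda>n. u (r n) x)"
  proof eventually_elim
    case (elim x)
    then have "summable (\<lambda>k. \<bar>d k x\<bar>)" by (intro summable_suminf_not_top) auto
    then have "summable (\<lambda>k. d k x)" by (rule summable_rabs_cancel)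
    then have "convergent (\<lambda>n. \<Sum>k<n. d k x)" by (simp add: summable_iff_convergent)
    moreover have "(\<Sum>k<n. d k x) = u (r n) x - u (r 0) x" for n
      unfolding d_def by (rule sum_lessThan_telescope)
    ultimately have "convergent (\<lambda>n. (u (r n) x - u (r 0) x) + u (r 0) x)"
      by (intro convergent_add convergent_const) simp
    then show ?case by simp
  qed
  with r(1) show thesis by (rule that)
qed

text \<open>For fixed \<open>m\<close>, Fatou is applied to u m - u (r n) as \<open>n\<close> grows.
  The candidate \<open>v\<close> is an input and need only be an almost everywhere limit along a
  subsequence, so a limit found in L2 can be recognized as a limit in L4.\<close>

lemma Lp_Cauchy_limit:
  assumes p: "0 < p" and u: "\<And>n. u n \<in> Lp p M"
    and C: "\<And>e. 0 < e \<Longrightarrow> \<exists>N. \<forall>m\<ge>N. \<forall>n\<ge>N. nrm p M (\<lambda>x. u m x - u n x) < e"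
    and r: "strict_mono (r :: nat \<Rightarrow> nat)" and v: "v \<in> borel_measurable M"
    and lim: "AE x in M. (\<lambda>n. u (r n) x) \<longlonglongrightarrow> v x"
  shows "v \<in> Lp p M" "(\<lambda>n. nrm p M (\<lambda>x. u n x - v x)) \<longlonglongrightarrow> 0"
proof -
  have *: "\<exists>N. \<forall>m\<ge>N. (\<lambda>x. u m x - v x) \<in> Lp p M \<and> nrm p M (\<lambda>x. u m x - v x) \<le> e" if e: "0 < e" for e
  proof -
    obtain N where N: "\<And>m n. m \<ge> N \<Longrightarrow> n \<ge> N \<Longrightarrow> nrm p M (\<lambda>x. u m x - u n x) < e"
      using C[OF e] by blast
    have "(\<lambda>x. u m x - v x) \<in> Lp p M \<and> nrm p M (\<lambda>x. u m x - v x) \<le> e" if m: "m \<ge> N" for m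
    proof -
      have 1: "AE x in M. (\<lambda>n. u m x - u (r n) x) \<longlonglongrightarrow> u m x - v x"
        using lim by eventually_elim (intro tendsto_intros)
      have 2: "\<forall>\<^sub>F n in sequentially. nrm p M (\<lambda>x. u m x - u (r n) x) \<le> e"
        using eventually_ge_at_top[of N]
      proof eventually_elim
        case (elim n)
        then show ?case using N[OF m, of "r n"] seq_suble[OF r, of n] by simp
      qed
      show ?thesis
        using Lp_Fatou[OF p _ _ 1 2] u v Lp_measurable[OF u] by (auto intro: Lp_diff)
    qed
    then show ?thesis by blast
  qed
  obtain N where "(\<lambda>x. u N x - v x) \<in> Lp p M" using *[of 1] by auto
  from Lp_diff[OF u[of N] this] show "v \<in> Lp p M" by simp
  show "(\<lambda>n. nrm p M (\<lambda>x. u n x - v x)) \<longlonglongrightarrow> 0"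
  proof (rule LIMSEQ_I)
    fix e :: real assume e: "0 < e"
    then obtain N where N: "\<And>m. m \<ge> N \<Longrightarrow> nrm p M (\<lambda>x. u m x - v x) \<le> e / 2"
      using *[of "e/2"] by auto
    have "norm (nrm p M (\<lambda>x. u n x - v x) - 0) < e" if "n \<ge> N" for n
      using N[OF that] e nrm_nonneg[of p M "\<lambda>x. u n x - v x"] by simp
    then show "\<exists>no. \<forall>n\<ge>no. norm (nrm p M (\<lambda>x. u n x - v x) - 0) < e" by blast
  qed
qed

section \<open>The unit cell\<close>

text \<open>Lebesgue measure on the cell, kept on the space \<open>UNIV\<close> so that periodic
  functions are integrated without restricting their domain. The qualified constant is the measure
  with a given density; the short name belongs to the electron density.\<close>

definition cm :: "real^3^3 \<Rightarrow> (real^3) measure" where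
  "cm A = Nonnegative_Lebesgue_Integration.density lborel (\<lambda>x. ennreal (indicator (cell A) x))"

lemma space_cm [simp]: "space (cm A) = UNIV" and sets_cm [simp, measurable_cong]: "sets (cm A) = sets borel"
  by (simp_all add: cm_def)

lemma nn_integral_lborel_shift:
  fixes f :: "real^3 \<Rightarrow> ennreal"
  assumes "f \<in> borel_measurable borel"
  shows "(\<integral>\<^sup>+x. f (x + z) \<partial>lborel) = (\<integral>\<^sup>+x. f x \<partial>lborel)"
proof -
  have "(\<integral>\<^sup>+x. f x \<partial>distr lborel borel ((+) z)) = (\<integral>\<^sup>+x. f (z + x) \<partial>lborel)"
    using assms by (intro nn_integral_distr) auto
  then show ?thesis by (simp add: lborel_distr_plus add.commute)
qed

lemma lborel_integral_shift:
  fixes f :: "real^3 \<Rightarrow> 'b::{banach, second_countable_topology}"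
  assumes "f \<in> borel_measurable borel"
  shows "(LINT x|lborel. f (x + z)) = (LINT x|lborel. f x)"
proof -
  have "(LINT x|distr lborel borel ((+) z). f x) = (LINT x|lborel. f (z + x))"
    using assms by (intro integral_distr) auto
  then show ?thesis by (simp add: lborel_distr_plus add.commute)
qed

lemma lborel_integrable_shift:
  fixes f :: "real^3 \<Rightarrow> 'b::{banach, second_countable_topology}"
  assumes "f \<in> borel_measurable borel"
  shows "integrable lborel (\<lambda>x. f (x + z)) \<longleftrightarrow> integrable lborel f"
proof -
  have "integrable (distr lborel borel ((+) z)) f = integrable lborel (\<lambda>x. f (z + x))"
    using assms by (intro integrable_distr_eq) auto
  then show ?thesis by (simp add: lborel_distr_plus add.commute)
qed

locale bravais =
  fixes A :: "real^3^3"
  assumes inv: "invertible A"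
begin

section \<open>Lattice coordinates and the volume of boxes\<close>

definition tc :: "real^3 \<Rightarrow> real^3" where "tc x = matrix_inv A *v x"

lemma matrix_inv_A: "A ** matrix_inv A = mat 1" "matrix_inv A ** A = mat 1"
  using inv unfolding invertible_def matrix_inv_def by (metis (mono_tags, lifting) someI_ex)+

lemma A_tc [simp]: "A *v tc x = x" and tc_A [simp]: "tc (A *v x) = x"
  by (simp_all add: tc_def matrix_vector_mul_assoc matrix_inv_A)

lemma tc_add: "tc (x + y) = tc x + tc y" and tc_diff: "tc (x - y) = tc x - tc y"
  and tc_scaleR: "tc (c *\<^sub>R x) = c *\<^sub>R tc x"
  by (simp_all add: tc_def matrix_vector_right_distrib matrix_vector_mult_diff_distrib matrix_vector_mult_scaleR)

lemma continuous_tc: "continuous_on S tc"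
  unfolding tc_def[abs_def] by (intro linear_continuous_on matrix_vector_mul_bounded_linear)

lemma tc_measurable [measurable]: "tc \<in> borel_measurable borel"
  by (intro borel_measurable_continuous_onI continuous_tc)

lemma mem_cell: "x \<in> cell A \<longleftrightarrow> (\<forall>i. 0 \<le> tc x $ i \<and> tc x $ i < 1)"
  unfolding cell_def by (auto intro: exI[of _ "tc x"])

text \<open>Half-open boxes in lattice coordinates \<open>tc x\<close>; the unit cell is \<open>box_at 0 1\<close>.\<close>

definition box_at :: "real^3 \<Rightarrow> real \<Rightarrow> (real^3) set" where
  "box_at a s = {x. \<forall>i. a $ i \<le> tc x $ i \<and> tc x $ i < a $ i + s}"

lemma cell_box_at: "cell A = box_at 0 1"
  by (auto simp: box_at_def mem_cell)

lemma sets_box_at [measurable]: "box_at a s \<in> sets borel"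
  unfolding box_at_def by measurable

lemma sets_cell [measurable]: "cell A \<in> sets borel"
  unfolding cell_box_at by (rule sets_box_at)

lemma box_at_image:
  assumes "0 < s"
  shows "box_at a s = (\<lambda>x. s *\<^sub>R x + A *v a) ` cell A"
proof (intro set_eqI iffI)
  fix x assume x: "x \<in> box_at a s"
  show "x \<in> (\<lambda>x. s *\<^sub>R x + A *v a) ` cell A"
    using x assms
    by (intro image_eqI[of _ _ "(1/s) *\<^sub>R (x - A *v a)"])
      (auto simp: box_at_def mem_cell tc_diff tc_scaleR divide_simps diff_less_eq add.commute)
next
  fix x assume "x \<in> (\<lambda>x. s *\<^sub>R x + A *v a) ` cell A"
  then show "x \<in> box_at a s"
    using assms by (auto simp: box_at_def mem_cell tc_add tc_scaleR)
qed

lemma bounded_cell: "bounded (cell A)"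
proof -
  have "cell A \<subseteq> (*v) A ` cbox 0 1"
  proof
    fix x assume "x \<in> cell A"
    then have "tc x \<in> cbox 0 1" by (simp add: mem_cell mem_box_cart less_imp_le)
    then show "x \<in> (*v) A ` cbox 0 1" by (metis A_tc imageI)
  qed
  moreover have "bounded ((*v) A ` cbox 0 1)"
    by (intro compact_imp_bounded compact_continuous_image linear_continuous_on matrix_vector_mul_bounded_linear) simp
  ultimately show ?thesis by (rule bounded_subset[rotated])
qed

lemma emeasure_cell_finite: "emeasure lborel (cell A) < \<infinity>"
  using bounded_cell by (rule emeasure_bounded_finite)

definition vol :: real where "vol = measure lborel (cell A)"

lemma emeasure_cell: "emeasure lborel (cell A) = ennreal vol"
  using emeasure_cell_finite unfolding vol_def by (intro emeasure_eq_ennreal_measure) auto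

text \<open>An open part of the cell. Openness yields positive volume, finite covers of bounded sets
  by translates, and pointwise consequences of almost everywhere identities for continuous
  functions.\<close>

definition icell :: "(real^3) set" where "icell = {x. \<forall>i. 0 < tc x $ i \<and> tc x $ i < 1}"

lemma open_icell: "open icell"
proof -
  have "icell = (\<Inter>i\<in>UNIV. {x. 0 < tc x $ i} \<inter> {x. tc x $ i < 1})" by (auto simp: icell_def)
  also have "open \<dots>"
    by (intro open_INT open_Int open_Collect_less continuous_intros continuous_tc ballI) auto
  finally show ?thesis .
qed

lemma icell_subset: "icell \<subseteq> cell A"
  by (auto simp: icell_def mem_cell less_imp_le)

definition mid :: "real^3" where "mid = A *v (\<chi> i. 1/2)"

lemma mid_icell: "mid \<in> icell"
  by (simp add: mid_def icell_def)

lemma vol_pos: "0 < vol"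
proof -
  have "0 < emeasure lborel icell"
  proof (rule ccontr)
    assume "\<not> ?thesis"
    then have "emeasure lebesgue icell = 0" using open_icell by auto
    then have "negligible icell"
      using open_icell by (auto simp: negligible_iff_null_sets null_sets_def)
    then show False using open_not_negligible[OF open_icell] mid_icell by blast
  qed
  also have "\<dots> \<le> emeasure lborel (cell A)" by (intro emeasure_mono icell_subset) auto
  finally show ?thesis by (simp add: emeasure_cell)
qed

lemma measure_box_at:
  assumes "0 < s"
  shows "emeasure lborel (box_at a s) = ennreal (s ^ 3 * vol)"
proof -
  have "emeasure lborel (box_at a s) = emeasure lebesgue (box_at a s)" by simp
  also have "\<dots> = \<bar>s\<bar> ^ 3 * emeasure lebesgue (cell A)"
    using emeasure_lebesgue_affine[of s "A *v a" "cell A"] assms by (simp add: box_at_image)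
  also have "\<dots> = ennreal (s ^ 3 * vol)"
    using assms vol_pos by (simp add: emeasure_cell ennreal_mult ennreal_power[symmetric])
  finally show ?thesis .
qed

section \<open>Lattice vectors and integrals of periodic functions\<close>

definition lv :: "int^3 \<Rightarrow> real^3" where "lv j = A *v (\<chi> i. real_of_int (j $ i))"

lemma lv_minus: "lv (- j) = - lv j"
proof -
  have "(\<chi> i. real_of_int ((- j) $ i)) = (-1) *\<^sub>R (\<chi> i. real_of_int (j $ i))" by (simp add: vec_eq_iff)
  then show ?thesis unfolding lv_def by (simp only: matrix_vector_mult_scaleR) simp
qed

lemma tc_lv [simp]: "tc (lv j) $ i = of_int (j $ i)"
  by (simp add: lv_def)

lemma periodic_int_multiple:
  assumes "periodic A u"
  shows "u (x + of_int k *\<^sub>R column i A) = u x"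
proof -
  have nat: "u (x + of_nat n *\<^sub>R column i A) = u x" for n x
  proof (induction n)
    case (Suc n)
    have "u (x + of_nat (Suc n) *\<^sub>R column i A) = u ((x + of_nat n *\<^sub>R column i A) + column i A)"
      by (simp add: algebra_simps)
    with Suc assms show ?case by (simp add: periodic_def)
  qed simp
  show ?thesis
  proof (cases "0 \<le> k")
    case True
    then show ?thesis using nat[of x "nat k"] by simp
  next
    case False
    \<comment> \<open>For negative \<open>k\<close> the statement for natural multiples is applied
      at the shifted point.\<close>
    then show ?thesis using nat[of "x + of_int k *\<^sub>R column i A" "nat (- k)"] by simp
  qed
qed

lemma periodic_lv:
  assumes "periodic A u"
  shows "u (x + lv j) = u x"
proof -
  have "u (x + (\<Sum>i\<in>I. of_int (j $ i) *\<^sub>R column i A)) = u x" for I :: "3 set"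
  proof (induction I arbitrary: x rule: infinite_finite_induct)
    case (insert i F)
    then show ?case using periodic_int_multiple[OF assms, of "x + (\<Sum>i\<in>F. of_int (j $ i) *\<^sub>R column i A)" "j $ i" i]
      by (simp add: algebra_simps)
  qed auto
  from this[of UNIV] show ?thesis
    by (simp add: lv_def matrix_mult_sum scalar_mult_eq_scaleR)
qed

lemma periodic_lv_minus: "periodic A u \<Longrightarrow> u (x - lv j) = u x"
  using periodic_lv[of u x "- j"] by (simp add: lv_minus)

text \<open>Half-openness makes the translates tile space: the only possible reduction subtracts the
  floors of the lattice coordinates.\<close>

lemma ex1_cell_minus: "\<exists>!j. x - lv j \<in> cell A"
proof (rule ex1I[of _ "\<chi> i. \<lfloor>tc x $ i\<rfloor>"])
  show "x - lv (\<chi> i. \<lfloor>tc x $ i\<rfloor>) \<in> cell A"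
    by (auto simp: mem_cell tc_diff) linarith
  show "j = (\<chi> i. \<lfloor>tc x $ i\<rfloor>)" if "x - lv j \<in> cell A" for j
    using that by (auto simp: mem_cell tc_diff vec_eq_iff intro!: floor_unique[symmetric]) (smt (verit))
qed

lemma ex1_cell_plus: "\<exists>!j. x + lv j \<in> cell A"
proof -
  obtain j where j: "x - lv j \<in> cell A" "\<And>k. x - lv k \<in> cell A \<Longrightarrow> k = j"
    using ex1_cell_minus[of x] by auto
  show ?thesis
  proof (rule ex1I[of _ "- j"])
    show "x + lv (- j) \<in> cell A" using j(1) by (simp add: lv_minus)
    show "k = - j" if "x + lv k \<in> cell A" for k
      using j(2)[of "- k"] that by (auto simp: lv_minus)
  qed
qed

text \<open>Gives the partition of unity by translates of the cell. The sum over the lattice is an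
  integral over a counting measure, so that it can be exchanged with the integral over
  space.\<close>

lemma count_space_ex1:
  assumes "\<exists>!j. P j"
  shows "(\<integral>\<^sup>+j. indicator {j. P j} j \<partial>count_space UNIV) = 1"
proof -
  obtain k where "{j. P j} = {k}" using assms by auto
  then show ?thesis by simp
qed

lemma nn_integral_cm: "h \<in> borel_measurable borel \<Longrightarrow> (\<integral>\<^sup>+x. h x \<partial>cm A) = (\<integral>\<^sup>+x. indicator (cell A) x * h x \<partial>lborel)"
  unfolding cm_def by (subst nn_integral_density) (auto intro!: nn_integral_cong simp: indicator_def)

text \<open>Both the cell and its translate by \<open>- z\<close> are fundamental domains: insert the partition of unity
  by lattice translates of the cell and exchange sum and integral.\<close>

lemma nn_integral_cm_shift:
  fixes h :: "real^3 \<Rightarrow> ennreal"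
  assumes [measurable]: "h \<in> borel_measurable borel" and per: "periodic A h"
  shows "(\<integral>\<^sup>+x. h (x + z) \<partial>cm A) = (\<integral>\<^sup>+x. h x \<partial>cm A)"
proof -
  let ?c = "indicator (cell A) :: real^3 \<Rightarrow> ennreal"
  have "(\<integral>\<^sup>+x. h (x + z) \<partial>cm A) = (\<integral>\<^sup>+x. ?c x * h (x + z) \<partial>lborel)"
    by (rule nn_integral_cm) measurable
  also have "\<dots> = (\<integral>\<^sup>+x. ?c (x - z) * h x \<partial>lborel)"
    using nn_integral_lborel_shift[of "\<lambda>x. ?c (x - z) * h x" z] by simp
  also have "\<dots> = (\<integral>\<^sup>+x. (\<integral>\<^sup>+j. ?c (x - z) * h x * ?c (x + lv j) \<partial>count_space UNIV) \<partial>lborel)"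
  proof (rule nn_integral_cong)
    fix x
    have "(\<integral>\<^sup>+j. ?c (x - z) * h x * ?c (x + lv j) \<partial>count_space UNIV)
        = ?c (x - z) * h x * (\<integral>\<^sup>+j. indicator {j. x + lv j \<in> cell A} j \<partial>count_space UNIV)"
      by (subst nn_integral_cmult[symmetric]) (auto intro!: nn_integral_cong simp: indicator_def)
    then show "?c (x - z) * h x = (\<integral>\<^sup>+j. ?c (x - z) * h x * ?c (x + lv j) \<partial>count_space UNIV)"
      by (simp add: count_space_ex1[OF ex1_cell_plus])
  qed
  also have "\<dots> = (\<integral>\<^sup>+j. (\<integral>\<^sup>+x. ?c (x - z) * h x * ?c (x + lv j) \<partial>lborel) \<partial>count_space UNIV)"
    by (intro nn_integral_count_space_nn_integral) auto
  also have "\<dots> = (\<integral>\<^sup>+j. (\<integral>\<^sup>+x. ?c ((x - z) - lv j) * (h x * ?c x) \<partial>lborel) \<partial>count_space UNIV)"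
  proof (rule nn_integral_cong)
    fix j
    have "(\<integral>\<^sup>+x. ?c (x - z) * h x * ?c (x + lv j) \<partial>lborel)
        = (\<integral>\<^sup>+x. ?c (x + (- lv j) - z) * h (x + (- lv j)) * ?c (x + (- lv j) + lv j) \<partial>lborel)"
      by (rule nn_integral_lborel_shift[symmetric]) measurable
    also have "\<dots> = (\<integral>\<^sup>+x. ?c ((x - z) - lv j) * (h x * ?c x) \<partial>lborel)"
      using periodic_lv_minus[OF per] by (intro nn_integral_cong) (simp add: algebra_simps)
    finally show "(\<integral>\<^sup>+x. ?c (x - z) * h x * ?c (x + lv j) \<partial>lborel) = (\<integral>\<^sup>+x. ?c ((x - z) - lv j) * (h x * ?c x) \<partial>lborel)" .
  qed
  also have "\<dots> = (\<integral>\<^sup>+x. (\<integral>\<^sup>+j. ?c ((x - z) - lv j) * (h x * ?c x) \<partial>count_space UNIV) \<partial>lborel)"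
    by (intro nn_integral_count_space_nn_integral[symmetric]) auto
  also have "\<dots> = (\<integral>\<^sup>+x. ?c x * h x \<partial>lborel)"
  proof (rule nn_integral_cong)
    fix x
    have "(\<integral>\<^sup>+j. ?c ((x - z) - lv j) * (h x * ?c x) \<partial>count_space UNIV)
        = (h x * ?c x) * (\<integral>\<^sup>+j. indicator {j. (x - z) - lv j \<in> cell A} j \<partial>count_space UNIV)"
      by (subst nn_integral_cmult[symmetric]) (auto intro!: nn_integral_cong simp: indicator_def)
    then show "(\<integral>\<^sup>+j. ?c ((x - z) - lv j) * (h x * ?c x) \<partial>count_space UNIV) = ?c x * h x"
      by (simp add: count_space_ex1[OF ex1_cell_minus] mult.commute)
  qed
  also have "\<dots> = (\<integral>\<^sup>+x. h x \<partial>cm A)"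
    by (rule nn_integral_cm[symmetric]) measurable
  finally show ?thesis .
qed

text \<open>The closure of \<open>S\<close> is compact, hence covered by finitely many translates of
  \<open>icell\<close>, and every translated cell carries the same integral of \<open>h\<close>. The
  number \<open>N\<close> depends on \<open>S\<close> alone; this later makes integration against a
  test function continuous in the L2 norm of one cell.\<close>

lemma periodic_locally_bounded:
  assumes S: "bounded S"
  shows "\<exists>N::nat. \<forall>h::real^3 \<Rightarrow> ennreal. h \<in> borel_measurable borel \<longrightarrow> periodic A h \<longrightarrow>
    (\<integral>\<^sup>+x. indicator S x * h x \<partial>lborel) \<le> of_nat N * (\<integral>\<^sup>+x. h x \<partial>cm A)"
proof -
  \<comment> \<open>The translate of \<open>icell\<close> that moves \<open>mid\<close> to
    \<open>y\<close>, hence an open neighbourhood of \<open>y\<close>.\<close>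
  let ?U = "\<lambda>y. (\<lambda>x. x + (mid - y)) -` icell"
  have "open (?U y)" for y
    by (intro open_vimage open_icell continuous_intros)
  moreover have "closure S \<subseteq> (\<Union>y\<in>closure S. ?U y)" using mid_icell by auto
  ultimately obtain F where F: "F \<subseteq> closure S" "finite F" "closure S \<subseteq> (\<Union>y\<in>F. ?U y)"
    using compactE_image[of "closure S" "closure S" ?U] S compact_closure by metis
  have "(\<integral>\<^sup>+x. indicator S x * h x \<partial>lborel) \<le> of_nat (card F) * (\<integral>\<^sup>+x. h x \<partial>cm A)"
    if [measurable]: "h \<in> borel_measurable borel" and per: "periodic A h" for h :: "real^3 \<Rightarrow> ennreal"
  proof -
    have "(\<integral>\<^sup>+x. indicator S x * h x \<partial>lborel) \<le> (\<integral>\<^sup>+x. (\<Sum>y\<in>F. indicator (cell A) (x + (mid - y)) * h x) \<partial>lborel)"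
    proof (intro nn_integral_mono)
      fix x :: "real^3"
      show "indicator S x * h x \<le> (\<Sum>y\<in>F. indicator (cell A) (x + (mid - y)) * h x)"
      proof (cases "x \<in> S")
        case True
        then obtain y where y: "y \<in> F" "x + (mid - y) \<in> cell A"
          using F(3) closure_subset icell_subset by blast
        then have "h x \<le> indicator (cell A) (x + (mid - y)) * h x" by simp
        also have "\<dots> \<le> (\<Sum>y\<in>F. indicator (cell A) (x + (mid - y)) * h x)"
          by (rule member_le_sum) (use y F(2) in auto)
        finally show ?thesis using True by simp
      qed simp
    qed
    also have "\<dots> = (\<Sum>y\<in>F. \<integral>\<^sup>+x. indicator (cell A) (x + (mid - y)) * h x \<partial>lborel)"
      by (intro nn_integral_sum) auto
    also have "\<dots> = (\<Sum>y\<in>F. \<integral>\<^sup>+x. h x \<partial>cm A)"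
    proof (intro sum.cong refl)
      fix y
      have "(\<integral>\<^sup>+x. indicator (cell A) (x + (mid - y)) * h x \<partial>lborel) = (\<integral>\<^sup>+x. indicator (cell A) x * h (x + (y - mid)) \<partial>lborel)"
        using nn_integral_lborel_shift[of "\<lambda>x. indicator (cell A) x * h (x + (y - mid))" "mid - y"] by (simp add: algebra_simps)
      also have "\<dots> = (\<integral>\<^sup>+x. h (x + (y - mid)) \<partial>cm A)"
        by (rule nn_integral_cm[symmetric]) measurable
      also have "\<dots> = (\<integral>\<^sup>+x. h x \<partial>cm A)" by (intro nn_integral_cm_shift per) measurable
      finally show "(\<integral>\<^sup>+x. indicator (cell A) (x + (mid - y)) * h x \<partial>lborel) = (\<integral>\<^sup>+x. h x \<partial>cm A)" .
    qed
    finally show ?thesis by simp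
  qed
  then show ?thesis by blast
qed

lemma periodic_locally_integrable:
  fixes h :: "real^3 \<Rightarrow> ennreal"
  assumes "h \<in> borel_measurable borel" "periodic A h" "(\<integral>\<^sup>+x. h x \<partial>cm A) < \<infinity>" "bounded S"
  shows "(\<integral>\<^sup>+x. indicator S x * h x \<partial>lborel) < \<infinity>"
proof -
  obtain N :: nat where "(\<integral>\<^sup>+x. indicator S x * h x \<partial>lborel) \<le> of_nat N * (\<integral>\<^sup>+x. h x \<partial>cm A)"
    using periodic_locally_bounded[OF assms(4)] assms(1,2) by blast
  also have "\<dots> < \<infinity>" using assms(3) by (simp add: ennreal_mult_less_top of_nat_less_top)
  finally show ?thesis .
qed

section \<open>The cell as a finite measure space, and square integrable periodic functions\<close>

lemma finite_measure_cm: "finite_measure (cm A)"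
proof
  have "emeasure (cm A) UNIV = emeasure lborel (cell A)"
    unfolding cm_def by (subst emeasure_density) (auto simp: ennreal_indicator)
  then show "emeasure (cm A) (space (cm A)) \<noteq> \<infinity>" using emeasure_cell_finite by simp
qed

sublocale cm: finite_measure "cm A" by (rule finite_measure_cm)

lemma measure_cm: "measure (cm A) UNIV = vol"
proof -
  have "emeasure (cm A) UNIV = emeasure lborel (cell A)"
    unfolding cm_def by (subst emeasure_density) (auto simp: ennreal_indicator)
  then show ?thesis by (simp add: measure_def vol_def)
qed

lemma integral_cm:
  fixes f :: "real^3 \<Rightarrow> 'b::{banach, second_countable_topology}"
  assumes "f \<in> borel_measurable borel"
  shows "(LINT x:cell A|lborel. f x) = (LINT x|cm A. f x)"
  unfolding cm_def set_lebesgue_integral_def using assms by (subst integral_density) auto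

lemma integrable_cm:
  fixes f :: "real^3 \<Rightarrow> 'b::{banach, second_countable_topology}"
  assumes "f \<in> borel_measurable borel"
  shows "set_integrable lborel (cell A) f \<longleftrightarrow> integrable (cm A) f"
  unfolding cm_def set_integrable_def using assms by (subst integrable_density) auto

lemma AE_cm: "(AE x in cm A. P x) \<longleftrightarrow> (AE x in lborel. x \<in> cell A \<longrightarrow> P x)"
proof -
  have "(\<lambda>x. ennreal (indicator (cell A) x)) \<in> borel_measurable lborel" by simp
  then show ?thesis unfolding cm_def by (subst AE_density) (auto simp: indicator_def zero_less_iff_neq_zero)
qed

lemma AE_cm_cell: "AE x in cm A. x \<in> cell A"
  by (simp add: AE_cm)

lemma AE_lborel_imp_cm: "AE x in lborel. P x \<Longrightarrow> AE x in cm A. P x"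
  unfolding AE_cm by auto

lemma L2per_iff: "u \<in> L2per A \<longleftrightarrow> u \<in> Lp 2 (cm A) \<and> periodic A u"
proof -
  have "u \<in> borel_measurable borel \<Longrightarrow> set_integrable lborel (cell A) (\<lambda>x. (u x)\<^sup>2) = integrable (cm A) (\<lambda>x. (u x)\<^sup>2)"
    by (rule integrable_cm) measurable
  then show ?thesis by (auto simp: L2per_def Lp_def)
qed

lemma L2per_Lp: "u \<in> L2per A \<Longrightarrow> u \<in> Lp 2 (cm A)"
  by (simp add: L2per_iff)

lemma L2per_measurable: "u \<in> L2per A \<Longrightarrow> u \<in> borel_measurable borel"
  by (simp add: L2per_def)

lemma L2per_periodic: "u \<in> L2per A \<Longrightarrow> periodic A u"
  by (simp add: L2per_def)

lemma ip_cm: "u \<in> borel_measurable borel \<Longrightarrow> v \<in> borel_measurable borel \<Longrightarrow> ip A u v = (LINT x|cm A. u x * v x)"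
  unfolding ip_def by (rule integral_cm) measurable

lemma L2per_add: "u \<in> L2per A \<Longrightarrow> v \<in> L2per A \<Longrightarrow> (\<lambda>x. u x + v x) \<in> L2per A"
  by (auto simp: L2per_iff periodic_def intro: Lp_add)

lemma L2per_mult: "u \<in> L2per A \<Longrightarrow> (\<lambda>x. c * u x) \<in> L2per A"
  by (auto simp: L2per_iff periodic_def intro: Lp_mult)

lemma L2per_sum: "(\<And>i. i \<in> I \<Longrightarrow> u i \<in> L2per A) \<Longrightarrow> (\<lambda>x. \<Sum>i\<in>I. u i x) \<in> L2per A"
  by (auto simp: L2per_iff periodic_def intro: Lp_sum)

text \<open>Membership in \<open>L2per\<close> speaks about one cell; periodicity extends it to
  bounded sets, so that pairings with test functions on the whole space exist.\<close>

lemma L2per_locally_integrable: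
  assumes "u \<in> L2per A" "bounded S" and [measurable]: "S \<in> sets borel"
  shows "set_integrable lborel S u"
proof -
  have [measurable]: "u \<in> borel_measurable borel" using assms by (simp add: L2per_measurable)
  have "periodic A (\<lambda>x. ennreal \<bar>u x\<bar>)"
    using assms(1) by (simp add: L2per_iff periodic_def)
  moreover have "(\<integral>\<^sup>+x. ennreal \<bar>u x\<bar> \<partial>cm A) < \<infinity>"
    using cm.L2_imp_integrable(1)[OF L2per_Lp[OF assms(1)]] by (simp add: integrable_iff_bounded)
  ultimately have "(\<integral>\<^sup>+x. indicator S x * ennreal \<bar>u x\<bar> \<partial>lborel) < \<infinity>"
    using assms(2) by (intro periodic_locally_integrable) auto
  moreover have "indicator S x * ennreal \<bar>u x\<bar> = ennreal (norm (indicator S x *\<^sub>R u x))" for x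
    by (simp add: indicator_def)
  ultimately show ?thesis
    unfolding set_integrable_def by (intro integrableI_bounded) auto
qed

end

section \<open>Test functions\<close>

lemma vec_measurableI:
  fixes g :: "'a \<Rightarrow> real^'k"
  assumes "\<And>i. (\<lambda>x. g x $ i) \<in> borel_measurable M"
  shows "g \<in> borel_measurable M"
proof (subst borel_measurable_euclidean_space, intro ballI)
  fix b :: "real^'k" assume "b \<in> Basis"
  then obtain i where "b = axis i 1" by (auto simp: Basis_vec_def)
  then show "(\<lambda>x. g x \<bullet> b) \<in> borel_measurable M"
    using assms[of i] by (simp add: inner_axis)
qed

text \<open>The smoothness part of \<open>test_fun\<close> with the gradient hidden, which makes
  closure under products and compositions easy to use.\<close>

definition C1 :: "(real^3 \<Rightarrow> real) \<Rightarrow> bool" where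
  "C1 \<eta> \<longleftrightarrow> (\<exists>G. (\<forall>x. GDERIV \<eta> x :> G x) \<and> continuous_on UNIV G)"

lemma GDERIV_imp_continuous: "GDERIV f x :> D \<Longrightarrow> isCont f x"
  unfolding gderiv_def by (rule has_derivative_continuous)

lemma C1_continuous: "C1 \<eta> \<Longrightarrow> continuous_on S \<eta>"
  unfolding C1_def by (meson GDERIV_imp_continuous continuous_at_imp_continuous_on)

lemma C1_mult:
  assumes "C1 f" "C1 g"
  shows "C1 (\<lambda>x. f x * g x)"
proof -
  obtain F G where F: "\<forall>x. GDERIV f x :> F x" "continuous_on UNIV F" and G: "\<forall>x. GDERIV g x :> G x" "continuous_on UNIV G"
    using assms unfolding C1_def by blast
  have "\<forall>x. GDERIV (\<lambda>x. f x * g x) x :> f x *\<^sub>R G x + g x *\<^sub>R F x"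
    using F G by (blast intro: GDERIV_mult)
  moreover have "continuous_on UNIV (\<lambda>x. f x *\<^sub>R G x + g x *\<^sub>R F x)"
    using F G C1_continuous[OF assms(1)] C1_continuous[OF assms(2)] by (intro continuous_intros) auto
  ultimately show ?thesis unfolding C1_def by (intro exI[of _ "\<lambda>x. f x *\<^sub>R G x + g x *\<^sub>R F x"] conjI)
qed

lemma C1_const: "C1 (\<lambda>x. c)"
  unfolding C1_def by (rule exI[of _ "\<lambda>x. 0"]) (auto intro: GDERIV_const)

lemma C1_compose:
  assumes "C1 f" "\<And>x. (h has_real_derivative h' (f x)) (at (f x))" "continuous_on UNIV (\<lambda>x. h' (f x))"
  shows "C1 (\<lambda>x. h (f x))"
proof -
  obtain F where F: "\<forall>x. GDERIV f x :> F x" "continuous_on UNIV F"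
    using assms unfolding C1_def by blast
  have "\<forall>x. GDERIV (\<lambda>x. h (f x)) x :> h' (f x) *\<^sub>R F x"
    using F assms(2) by (blast intro: GDERIV_DERIV_compose)
  moreover have "continuous_on UNIV (\<lambda>x. h' (f x) *\<^sub>R F x)"
    using F assms(3) by (intro continuous_intros) auto
  ultimately show ?thesis unfolding C1_def by (intro exI[of _ "\<lambda>x. h' (f x) *\<^sub>R F x"] conjI)
qed

lemma C1_prod: "(\<And>i. i \<in> I \<Longrightarrow> C1 (f i)) \<Longrightarrow> C1 (\<lambda>x. \<Prod>i\<in>I. f i x)"
  by (induction I rule: infinite_finite_induct) (auto intro: C1_mult C1_const)

lemma C1_affine: "C1 (\<lambda>x. c * (x \<bullet> v) + d)"
proof -
  have "GDERIV (\<lambda>x. c * (x \<bullet> v) + d) x :> c *\<^sub>R v" for x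
    unfolding gderiv_def by (auto intro!: derivative_eq_intros)
  then show ?thesis unfolding C1_def by (intro exI[of _ "\<lambda>x. c *\<^sub>R v"]) auto
qed

text \<open>Squaring removes the corner of the positive part at 0, so products of such squares are
  C1 functions that are positive exactly on a box.\<close>

lemma DERIV_pos_part_square: "((\<lambda>t. (max 0 t)\<^sup>2) has_real_derivative 2 * max 0 t) (at t)" for t :: real
proof -
  consider "t > 0" | "t < 0" | "t = 0" by linarith
  then show ?thesis
  proof cases
    case 1
    have "((\<lambda>t. t\<^sup>2) has_real_derivative 2 * max 0 t) (at t)"
      using 1 by (auto intro!: derivative_eq_intros)
    then show ?thesis
      by (rule has_field_derivative_transform_within_open[where S="{0<..}"]) (use 1 in auto)
  next
    case 2
    have "((\<lambda>t. 0) has_real_derivative 2 * max 0 t) (at t)"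
      using 2 by (auto intro!: derivative_eq_intros)
    then show ?thesis
      by (rule has_field_derivative_transform_within_open[where S="{..<0}"]) (use 2 in auto)
  next
    case 3
    have "(\<lambda>h::real. ((max 0 (0 + h))\<^sup>2 - (max 0 0)\<^sup>2) / h) \<midarrow>0\<rightarrow> 0"
    proof (rule Lim_null_comparison)
      show "\<forall>\<^sub>F h::real in at 0. norm (((max 0 (0 + h))\<^sup>2 - (max 0 0)\<^sup>2) / h) \<le> \<bar>h\<bar>"
        by (intro always_eventually allI) (auto simp: max_def power2_eq_square)
      show "(\<lambda>h::real. \<bar>h\<bar>) \<midarrow>0\<rightarrow> 0" by (rule tendsto_rabs_zero) (rule tendsto_ident_at)
    qed
    then show ?thesis using 3 by (simp add: DERIV_def)
  qed
qed

lemma C1_pos_part_square: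
  assumes "C1 f"
  shows "C1 (\<lambda>x. (max 0 (f x))\<^sup>2)"
  using C1_continuous[OF assms]
  by (intro C1_compose[where h="\<lambda>t. (max 0 t)\<^sup>2" and h'="\<lambda>t. 2 * max 0 t", OF assms] DERIV_pos_part_square continuous_intros)

definition bump :: "real^3 \<Rightarrow> real^3 \<Rightarrow> real^3 \<Rightarrow> real" where
  "bump a b x = (\<Prod>i\<in>UNIV. (max 0 (x $ i - a $ i))\<^sup>2 * (max 0 (b $ i - x $ i))\<^sup>2)"

lemma bump_nonneg: "0 \<le> bump a b x"
  unfolding bump_def by (intro prod_nonneg) auto

lemma bump_pos_iff: "0 < bump a b x \<longleftrightarrow> x \<in> box a b"
proof -
  have "0 < bump a b x \<longleftrightarrow> bump a b x \<noteq> 0" using bump_nonneg[of a b x] by auto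
  also have "\<dots> \<longleftrightarrow> x \<in> box a b"
  proof -
    have "(max 0 s)\<^sup>2 * (max 0 t)\<^sup>2 \<noteq> 0 \<longleftrightarrow> 0 < s \<and> 0 < t" for s t :: real
      by (auto simp: max_def)
    then show ?thesis by (simp add: bump_def mem_box_cart)
  qed
  finally show ?thesis .
qed

lemma C1_bump: "C1 (bump a b)"
proof -
  have a: "C1 (\<lambda>x. x $ i - a $ i)" and b: "C1 (\<lambda>x. b $ i - x $ i)" for i
    using C1_affine[of 1 "axis i 1" "- a $ i"] C1_affine[of "-1" "axis i 1" "b $ i"] by (simp_all add: inner_axis)
  show ?thesis
    unfolding bump_def[abs_def] by (intro C1_prod C1_mult C1_pos_part_square a b)
qed

text \<open>The map t \<mapsto> k t / (1 + k t) fixes 0 and tends to 1 at every t > 0 as k grows.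
  Since \<open>bump\<close> is positive exactly on the open box, this yields test functions that lie
  below the indicator of the box and converge to it.\<close>

definition bumpk :: "real^3 \<Rightarrow> real^3 \<Rightarrow> nat \<Rightarrow> real^3 \<Rightarrow> real" where
  "bumpk a b k x = real k * bump a b x / (1 + real k * bump a b x)"

lemma bumpk_bounds: "0 \<le> bumpk a b k x" "bumpk a b k x \<le> indicator (box a b) x"
proof -
  have k: "0 \<le> real k * bump a b x" using bump_nonneg[of a b x] by simp
  then show "0 \<le> bumpk a b k x" by (simp add: bumpk_def)
  show "bumpk a b k x \<le> indicator (box a b) x"
  proof (cases "x \<in> box a b")
    case True
    then show ?thesis using k by (simp add: bumpk_def)
  next
    case False
    then have "bump a b x = 0" using bump_pos_iff[of a b x] bump_nonneg[of a b x] by auto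
    then show ?thesis using False by (simp add: bumpk_def)
  qed
qed

lemma bumpk_tendsto: "(\<lambda>k. bumpk a b k x) \<longlonglongrightarrow> indicator (box a b) x"
proof (cases "x \<in> box a b")
  case True
  then have pos: "0 < bump a b x" by (simp add: bump_pos_iff)
  have "(\<lambda>k. 1 - 1 / (1 + real k * bump a b x)) \<longlonglongrightarrow> 1 - 0"
  proof (intro tendsto_intros tendsto_divide_0[OF tendsto_const] filterlim_at_top_imp_at_infinity)
    show "filterlim (\<lambda>k. 1 + real k * bump a b x) at_top sequentially"
      by (intro filterlim_tendsto_add_at_top[OF tendsto_const] filterlim_at_top_mult_tendsto_pos[OF tendsto_const pos] filterlim_real_sequentially)
  qed
  moreover have "1 - 1 / (1 + real k * bump a b x) = bumpk a b k x" for k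
  proof -
    have "1 + real k * bump a b x > 0" using pos by (simp add: add_pos_nonneg)
    then show ?thesis by (simp add: bumpk_def field_simps)
  qed
  ultimately show ?thesis using True by simp
next
  case False
  then have "bump a b x = 0" using bump_pos_iff[of a b x] bump_nonneg[of a b x] by auto
  then show ?thesis using False by (simp add: bumpk_def)
qed

lemma test_fun_bumpk: "\<exists>G. test_fun (bumpk a b k) G"
proof -
  have pos: "1 + real k * bump a b x \<noteq> 0" for x
    using bump_nonneg[of a b x] by (metis add_nonneg_eq_0_iff mult_nonneg_nonneg of_nat_0_le_iff zero_le_one zero_neq_one)
  have "C1 (bumpk a b k)"
    unfolding bumpk_def[abs_def]
  proof (rule C1_compose[OF C1_bump, where h="\<lambda>t. real k * t / (1 + real k * t)" and h'="\<lambda>t. real k / (1 + real k * t)\<^sup>2"])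
    show "((\<lambda>t. real k * t / (1 + real k * t)) has_real_derivative real k / (1 + real k * bump a b x)\<^sup>2) (at (bump a b x))" for x
      by (rule derivative_eq_intros refl pos | simp add: power2_eq_square algebra_simps)+
    show "continuous_on UNIV (\<lambda>x. real k / (1 + real k * bump a b x)\<^sup>2)"
      using pos by (intro continuous_intros C1_continuous[OF C1_bump]) auto
  qed
  moreover have "compact (closure {x. bumpk a b k x \<noteq> 0})"
  proof -
    have "{x. bumpk a b k x \<noteq> 0} \<subseteq> box a b"
    proof (rule subsetI, rule ccontr)
      fix x assume x: "x \<in> {x. bumpk a b k x \<noteq> 0}" "x \<notin> box a b"
      then show False using bumpk_bounds[of a b k x] by simp
    qed
    then have "bounded {x. bumpk a b k x \<noteq> 0}" using bounded_box bounded_subset by blast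
    then show ?thesis by (simp add: compact_closure)
  qed
  ultimately show ?thesis unfolding test_fun_def C1_def by blast
qed

lemma test_fun_facts:
  assumes "test_fun \<eta> G"
  shows "continuous_on UNIV \<eta>" "continuous_on UNIV G"
    "\<exists>R. \<forall>x. norm x > R \<longrightarrow> \<eta> x = 0 \<and> G x = 0" "\<exists>B. \<forall>x. \<bar>\<eta> x\<bar> \<le> B \<and> norm (G x) \<le> B"
proof -
  have G: "\<And>x. GDERIV \<eta> x :> G x" and cG: "continuous_on UNIV G" and K: "compact (closure {x. \<eta> x \<noteq> 0})"
    using assms by (auto simp: test_fun_def)
  have c\<eta>: "continuous_on UNIV \<eta>" using G C1_continuous cG unfolding C1_def by blast
  then show "continuous_on UNIV \<eta>" "continuous_on UNIV G" using cG by auto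
  have z: "\<eta> x = 0 \<and> G x = 0" if "x \<notin> closure {x. \<eta> x \<noteq> 0}" for x
  proof
    have zz: "\<eta> y = 0" if "y \<notin> closure {x. \<eta> x \<noteq> 0}" for y
      using that closure_subset[of "{x. \<eta> x \<noteq> 0}"] by blast
    then show "\<eta> x = 0" using that by blast
    \<comment> \<open>Off the closed support, \<open>\<eta>\<close> vanishes on an open set, so its
      gradient vanishes there as well.\<close>
    have o: "open (- closure {x. \<eta> x \<noteq> 0})" by auto
    have "(\<eta> has_derivative (\<lambda>h. h \<bullet> G x)) (at x)" using G by (simp add: gderiv_def)
    then have "((\<lambda>x. 0) has_derivative (\<lambda>h. h \<bullet> G x)) (at x)"
      by (rule has_derivative_transform_within_open[OF _ o]) (use that zz in blast)+
    then have "(\<lambda>h. h \<bullet> G x) = (\<lambda>h. 0)"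
      by (rule has_derivative_unique) (rule has_derivative_const)
    then show "G x = 0" by (metis inner_eq_zero_iff)
  qed
  obtain R where R: "\<And>x. x \<in> closure {x. \<eta> x \<noteq> 0} \<Longrightarrow> norm x \<le> R"
    using compact_imp_bounded[OF K] unfolding bounded_iff by blast
  show "\<exists>R. \<forall>x. norm x > R \<longrightarrow> \<eta> x = 0 \<and> G x = 0"
    using z R by (meson not_le)
  have "bounded (\<eta> ` closure {x. \<eta> x \<noteq> 0})" "bounded (G ` closure {x. \<eta> x \<noteq> 0})"
    using K c\<eta> cG by (meson compact_continuous_image compact_imp_bounded continuous_on_subset subset_UNIV)+
  then obtain B1 B2 where B: "\<And>x. x \<in> closure {x. \<eta> x \<noteq> 0} \<Longrightarrow> \<bar>\<eta> x\<bar> \<le> B1"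
      "\<And>x. x \<in> closure {x. \<eta> x \<noteq> 0} \<Longrightarrow> norm (G x) \<le> B2"
    unfolding bounded_iff by (metis imageI real_norm_def)
  have "\<bar>\<eta> x\<bar> \<le> max 0 (max B1 B2) \<and> norm (G x) \<le> max 0 (max B1 B2)" for x
  proof (cases "x \<in> closure {x. \<eta> x \<noteq> 0}")
    case True
    then show ?thesis using B[OF True] by linarith
  next
    case False
    then show ?thesis using z[OF False] by simp
  qed
  then show "\<exists>B. \<forall>x. \<bar>\<eta> x\<bar> \<le> B \<and> norm (G x) \<le> B" by blast
qed

lemma test_fun_shift: "test_fun \<eta> G \<Longrightarrow> test_fun (\<lambda>x. \<eta> (x + z)) (\<lambda>x. G (x + z))"
proof -
  assume t: "test_fun \<eta> G"
  have "GDERIV (\<lambda>x. \<eta> (x + z)) x :> G (x + z)" for x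
  proof -
    have "(\<eta> has_derivative (\<lambda>h. h \<bullet> G (x + z))) (at (x + z))" using t by (auto simp: test_fun_def gderiv_def)
    then have "((\<lambda>x. \<eta> (x + z)) has_derivative (\<lambda>h. h \<bullet> G (x + z))) (at x)"
      by (rule has_derivative_compose[rotated, where f="\<lambda>x. x + z" and f'="\<lambda>h. h" and g=\<eta>, simplified]) (auto intro!: derivative_eq_intros)
    then show ?thesis by (simp add: gderiv_def)
  qed
  moreover have "continuous_on UNIV (\<lambda>x. G (x + z))"
    by (rule continuous_on_compose2[OF test_fun_facts(2)[OF t]]) (auto intro!: continuous_intros)
  moreover have "compact (closure {x. \<eta> (x + z) \<noteq> 0})"
  proof -
    obtain R where R: "\<And>x. norm x > R \<Longrightarrow> \<eta> x = 0" using test_fun_facts(3)[OF t] by auto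
    have "{x. \<eta> (x + z) \<noteq> 0} \<subseteq> cball 0 (R + norm z)"
    proof
      fix x assume "x \<in> {x. \<eta> (x + z) \<noteq> 0}"
      then have "norm (x + z) \<le> R" using R[of "x + z"] by fastforce
      then show "x \<in> cball 0 (R + norm z)" using norm_triangle_ineq4[of "x + z" z] by simp
    qed
    then have "bounded {x. \<eta> (x + z) \<noteq> 0}" using bounded_cball bounded_subset by blast
    then show ?thesis by (simp add: compact_closure)
  qed
  ultimately show ?thesis by (simp add: test_fun_def)
qed

text \<open>Boxes form a \<open>\<inter>\<close>-stable generator, so the integral of \<open>w\<close> vanishes over all bounded Borel sets.\<close>

lemma AE_zero_from_boxes:
  fixes w :: "real^3 \<Rightarrow> real"
  assumes [measurable]: "w \<in> borel_measurable borel"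
    and loc: "\<And>a b. integrable lborel (\<lambda>x. indicator (box a b) x * w x)"
    and zero: "\<And>a b. (LINT x|lborel. indicator (box a b) x * w x) = 0"
  shows "AE x in lborel. w x = 0"
proof -
  \<comment> \<open>Truncation to a bounded box makes the function integrable on the whole space, as
    the complement step of the induction over Borel sets requires.\<close>
  define wR where "wR n x = indicator (box (\<chi> i. - real n) (\<chi> i. real n)) x * w x" for n x
  have [measurable]: "wR n \<in> borel_measurable borel" for n
    unfolding wR_def by measurable
  have i: "integrable lborel (wR n)" for n unfolding wR_def by (rule loc)
  have iB: "integrable lborel (\<lambda>x. indicator B x * wR n x)" if "B \<in> sets borel" for B n
    using integrable_mult_indicator[OF _ i, of B n] that by simp
  have z: "(LINT x|lborel. indicator B x * wR n x) = 0" if "B \<in> sets borel" for B n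
  proof -
    let ?G = "range (\<lambda>(a, b). box a b :: (real^3) set)"
    have B: "B \<in> sigma_sets UNIV ?G" using that by (simp add: borel_eq_box)
    have "Int_stable ?G"
      by (auto simp: Int_stable_def box_Int_box)
    moreover have "?G \<subseteq> Pow UNIV" by auto
    ultimately show ?thesis using B
    proof (induction rule: sigma_sets_induct_disjoint)
      case (basic X)
      then obtain a b where X: "X = box a b" by auto
      obtain c d where cd: "box a b \<inter> box (\<chi> i. - real n) (\<chi> i. real n) = box c d" by (rule that[OF box_Int_box])
      have "indicator X x * wR n x = indicator (box c d) x * w x" for x
        unfolding X wR_def cd[symmetric] by (simp add: indicator_inter_arith)
      then show ?case using zero by simp
    next
      case (compl X)
      have X: "X \<in> sets borel" using compl(1) by (simp add: borel_eq_box)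
      have "(LINT x|lborel. indicator (UNIV - X) x * wR n x) = (LINT x|lborel. wR n x - indicator X x * wR n x)"
        by (intro Bochner_Integration.integral_cong) (auto simp: indicator_def)
      also have "\<dots> = (LINT x|lborel. wR n x) - 0" using i iB[OF X] compl(2) by simp
      also have "\<dots> = 0" unfolding wR_def using zero by simp
      finally show ?case .
    next
      case (union F)
      have F: "F m \<in> sets borel" for m using union(2) by (auto simp: borel_eq_box)
      have "(LINT x:(\<Union>i. F i)|lborel. wR n x) = (\<Sum>m. LINT x:F m|lborel. wR n x)"
      proof (rule lebesgue_integral_countable_add)
        show "set_integrable lborel (\<Union>i. F i) (wR n)"
          using iB[of "\<Union>i. F i" n] F by (simp add: set_integrable_def)
        show "F i \<inter> F j = {}" if "i \<noteq> j" for i j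
          using union(1) that by (auto simp: disjoint_family_on_def)
      qed (use F in auto)
      then show ?case using union(3) by (simp add: set_lebesgue_integral_def)
    qed auto
  qed
  have "AE x in lborel. wR n x = 0" for n
  proof -
    have s: "{x. wR n x > 0} \<in> sets borel" "{x. wR n x < 0} \<in> sets borel" by measurable
    have "AE x in lborel. indicator {x. wR n x > 0} x * wR n x = 0"
      using iB[OF s(1)] z[OF s(1), of n] by (subst (asm) integral_nonneg_eq_0_iff_AE) (auto simp: indicator_def)
    moreover have "AE x in lborel. - (indicator {x. wR n x < 0} x * wR n x) = 0"
    proof (subst integral_nonneg_eq_0_iff_AE[symmetric])
      show "integrable lborel (\<lambda>x. - (indicator {x. wR n x < 0} x * wR n x))"
        using iB[OF s(2)] by (rule integrable_minus)
    qed (use z[OF s(2), of n] in \<open>auto simp: indicator_def\<close>)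
    ultimately show ?thesis
      by eventually_elim (auto simp: indicator_def not_less split: if_splits)
  qed
  then have "AE x in lborel. \<forall>n. wR n x = 0" by (simp add: AE_all_countable)
  then show ?thesis
  proof eventually_elim
    case (elim x)
    obtain n where n: "norm x < real n" using reals_Archimedean2 by blast
    have "\<bar>x $ i\<bar> < real n" for i using component_le_norm_cart[of x i] n by linarith
    then have "x \<in> box (\<chi> i. - real n) (\<chi> i. real n)"
      by (auto simp: mem_box_cart abs_less_iff minus_less_iff)
    then show ?case using elim[rule_format, of n] by (simp add: wR_def)
  qed
qed

text \<open>The functions \<open>bumpk\<close> turn the hypothesis on test functions into one on
  boxes: they are dominated by the indicator of the box, on which \<open>w\<close> is
  integrable.\<close>

lemma fundamental_lemma:
  fixes w :: "real^3 \<Rightarrow> real"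
  assumes [measurable]: "w \<in> borel_measurable borel"
    and loc: "\<And>a b. integrable lborel (\<lambda>x. indicator (box a b) x * w x)"
    and zero: "\<And>\<eta> G. test_fun \<eta> G \<Longrightarrow> (LINT x|lborel. \<eta> x * w x) = 0"
  shows "AE x in lborel. w x = 0"
proof (rule AE_zero_from_boxes[OF assms(1) loc])
  fix a b :: "real^3"
  have [measurable]: "bumpk a b k \<in> borel_measurable borel" for k
    using test_fun_bumpk test_fun_facts(1) borel_measurable_continuous_onI by blast
  have "(\<lambda>k. LINT x|lborel. bumpk a b k x * w x) \<longlonglongrightarrow> (LINT x|lborel. indicator (box a b) x * w x)"
  proof (rule integral_dominated_convergence[where w="\<lambda>x. \<bar>indicator (box a b) x * w x\<bar>"])
    show "AE x in lborel. (\<lambda>k. bumpk a b k x * w x) \<longlonglongrightarrow> indicator (box a b) x * w x"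
      by (intro AE_I2 tendsto_intros bumpk_tendsto)
    show "AE x in lborel. norm (bumpk a b k x * w x) \<le> \<bar>indicator (box a b) x * w x\<bar>" for k
      using bumpk_bounds[of a b k] by (intro AE_I2) (auto simp: abs_mult intro!: mult_right_mono)
  qed (use loc in auto)
  moreover have "(LINT x|lborel. bumpk a b k x * w x) = 0" for k
    using test_fun_bumpk zero by blast
  ultimately show "(LINT x|lborel. indicator (box a b) x * w x) = 0"
    by (simp add: LIMSEQ_const_iff)
qed

section \<open>Weak gradients and translations\<close>

text \<open>The integrability needed for Fubini when averaging over the points of a segment with
  parameter \<open>s\<close> in [0, 1]: a bound on the L1 norms that is uniform in
  \<open>s\<close>.\<close>

lemma pair_integrable_segment:
  fixes f :: "real \<Rightarrow> real^3 \<Rightarrow> real"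
  assumes [measurable]: "case_prod f \<in> borel_measurable (lborel \<Otimes>\<^sub>M lborel)"
    and b: "\<And>s. (\<integral>\<^sup>+x. ennreal \<bar>f s x\<bar> \<partial>lborel) \<le> ennreal C * indicator {0..1} s"
  shows "integrable (lborel \<Otimes>\<^sub>M lborel) (case_prod f)"
proof (rule integrableI_bounded)
  have "(\<integral>\<^sup>+z. ennreal (norm (case_prod f z)) \<partial>(lborel \<Otimes>\<^sub>M lborel)) = (\<integral>\<^sup>+s. (\<integral>\<^sup>+x. ennreal \<bar>f s x\<bar> \<partial>lborel) \<partial>lborel)"
    by (subst lborel.nn_integral_fst[symmetric]) auto
  also have "\<dots> \<le> (\<integral>\<^sup>+s. ennreal C * indicator {0..1::real} s \<partial>lborel)"
    by (intro nn_integral_mono b)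
  also have "\<dots> = ennreal C" by (subst nn_integral_cmult_indicator) auto
  also have "\<dots> < \<infinity>" by simp
  finally show "(\<integral>\<^sup>+z. ennreal (norm (case_prod f z)) \<partial>(lborel \<Otimes>\<^sub>M lborel)) < \<infinity>" .
qed measurable

text \<open>The derivative of \<open>\<eta>\<close> along the segment from x to x - z is the
  negative of the inner product of \<open>G\<close> with \<open>z\<close>, whence the sign.\<close>

lemma C1_segment_FTC:
  assumes "test_fun \<eta> G"
  shows "\<eta> (x - z) - \<eta> x = - (LINT s|lborel. indicator {0..1} s * (G (x - s *\<^sub>R z) \<bullet> z))"
proof -
  have cG: "continuous_on UNIV (\<lambda>s::real. G (x - s *\<^sub>R z) \<bullet> z)"
    by (intro continuous_intros continuous_on_compose2[OF test_fun_facts(2)[OF assms]]) auto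
  have d: "((\<lambda>s. \<eta> (x - s *\<^sub>R z)) has_real_derivative - (G (x - s *\<^sub>R z) \<bullet> z)) (at s)" for s
  proof -
    have g: "(\<eta> has_derivative (\<lambda>h. h \<bullet> G (x - s *\<^sub>R z))) (at (x - s *\<^sub>R z))"
      using assms by (auto simp: test_fun_def gderiv_def)
    have "((\<lambda>s. x - s *\<^sub>R z) has_derivative (\<lambda>t. - (t *\<^sub>R z))) (at s)"
      by (auto intro!: derivative_eq_intros)
    from has_derivative_compose[OF this g] have "((\<lambda>s. \<eta> (x - s *\<^sub>R z)) has_derivative (\<lambda>t. (- (t *\<^sub>R z)) \<bullet> G (x - s *\<^sub>R z))) (at s)" .
    moreover have "(\<lambda>t. (- (t *\<^sub>R z)) \<bullet> G (x - s *\<^sub>R z)) = (*) (- (G (x - s *\<^sub>R z) \<bullet> z))"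
      by (auto simp: inner_commute fun_eq_iff)
    ultimately show ?thesis unfolding has_field_derivative_def by (simp only:)
  qed
  have "(LINT s|lborel. - (G (x - s *\<^sub>R z) \<bullet> z) * indicator {0..1} s) = \<eta> (x - 1 *\<^sub>R z) - \<eta> (x - 0 *\<^sub>R z)"
  proof (rule integral_FTC_Icc_real)
    show "isCont (\<lambda>s. - (G (x - s *\<^sub>R z) \<bullet> z)) s" for s
      using cG by (intro isCont_minus) (simp add: continuous_on_eq_continuous_at)
  qed (use d in auto)
  moreover have "(LINT s|lborel. - (G (x - s *\<^sub>R z) \<bullet> z) * indicator {0..1} s) = - (LINT s|lborel. indicator {0..1} s * (G (x - s *\<^sub>R z) \<bullet> z))"
    by (subst Bochner_Integration.integral_minus[symmetric]) (simp add: mult.commute)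
  ultimately show ?thesis by simp
qed

context bravais begin

lemma L2per_inner:
  assumes "\<And>i. (\<lambda>x. g x $ i) \<in> L2per A"
  shows "(\<lambda>x. g x \<bullet> z) \<in> L2per A"
proof -
  have "(\<lambda>x. \<Sum>i\<in>UNIV. z $ i * g x $ i) \<in> L2per A"
    using assms by (intro L2per_sum L2per_mult)
  then show ?thesis by (simp add: inner_vec_def mult.commute)
qed

lemma L2per_vec_measurable: "(\<And>i. (\<lambda>x. g x $ i) \<in> L2per A) \<Longrightarrow> g \<in> borel_measurable borel"
  by (intro vec_measurableI L2per_measurable)

lemma L2per_shift:
  assumes "u \<in> L2per A"
  shows "(\<lambda>x. u (x + z)) \<in> L2per A"
proof -
  have [measurable]: "u \<in> borel_measurable borel" using assms by (rule L2per_measurable)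
  have per: "periodic A u" using assms by (rule L2per_periodic)
  have "(\<integral>\<^sup>+x. ennreal ((u (x + z))\<^sup>2) \<partial>cm A) = (\<integral>\<^sup>+x. ennreal ((u x)\<^sup>2) \<partial>cm A)"
    using per by (intro nn_integral_cm_shift[where h="\<lambda>x. ennreal ((u x)\<^sup>2)"]) (auto simp: periodic_def)
  also have "\<dots> < \<infinity>"
    using Lp_integrable[OF L2per_Lp[OF assms]] by (simp add: integrable_iff_bounded)
  finally have "integrable (cm A) (\<lambda>x. (u (x + z))\<^sup>2)"
    by (intro integrableI_bounded) auto
  moreover have "periodic A (\<lambda>x. u (x + z))"
    using per unfolding periodic_def by (metis add.assoc add.commute)
  ultimately show ?thesis by (simp add: L2per_iff Lp_def)
qed

lemma L2per_integrable_test: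
  assumes u: "u \<in> L2per A" and \<phi>: "\<phi> \<in> borel_measurable borel"
    and R: "\<And>x. norm x > R \<Longrightarrow> \<phi> x = 0" and B: "\<And>x. \<bar>\<phi> x\<bar> \<le> B"
  shows "integrable lborel (\<lambda>x. \<phi> x * u x)"
proof (rule Bochner_Integration.integrable_bound)
  show "integrable lborel (\<lambda>x. B * (indicator (cball 0 R) x *\<^sub>R u x))"
    using L2per_locally_integrable[OF u, of "cball 0 R"] by (simp add: set_integrable_def)
  show "(\<lambda>x. \<phi> x * u x) \<in> borel_measurable lborel" using \<phi> L2per_measurable[OF u] by measurable
  show "AE x in lborel. norm (\<phi> x * u x) \<le> norm (B * (indicator (cball 0 R) x *\<^sub>R u x))"
  proof (rule AE_I2)
    fix x
    have "\<bar>\<phi> x\<bar> \<le> \<bar>B\<bar> * indicator (cball 0 R) x"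
      using R[of x] B[of x] by (auto simp: indicator_def not_le)
    then have "\<bar>\<phi> x\<bar> * \<bar>u x\<bar> \<le> (\<bar>B\<bar> * indicator (cball 0 R) x) * \<bar>u x\<bar>" by (rule mult_right_mono) simp
    then show "norm (\<phi> x * u x) \<le> norm (B * (indicator (cball 0 R) x *\<^sub>R u x))"
      by (simp add: abs_mult mult.assoc)
  qed
qed

lemma L2per_box_integrable:
  assumes u: "u \<in> L2per A"
  shows "integrable lborel (\<lambda>x. indicator (box a b) x * u x)"
  using L2per_locally_integrable[OF u bounded_box, of a b] by (simp add: set_integrable_def)

lemma L2per_integrable_test_vec:
  fixes \<phi> :: "real^3 \<Rightarrow> real^3"
  assumes u: "u \<in> L2per A" and \<phi>[measurable]: "\<phi> \<in> borel_measurable borel"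
    and R: "\<And>x. norm x > R \<Longrightarrow> \<phi> x = 0" and B: "\<And>x. norm (\<phi> x) \<le> B"
  shows "integrable lborel (\<lambda>x. u x *\<^sub>R \<phi> x)"
proof (rule Bochner_Integration.integrable_bound)
  show "integrable lborel (\<lambda>x. norm (\<phi> x) * u x)"
    using R B by (intro L2per_integrable_test[OF u, of _ R B]) auto
  show "(\<lambda>x. u x *\<^sub>R \<phi> x) \<in> borel_measurable lborel" using L2per_measurable[OF u] by measurable
qed (simp add: abs_mult mult.commute)

lemma L2per_vec_integrable_test:
  fixes g :: "real^3 \<Rightarrow> real^3"
  assumes g: "\<And>i. (\<lambda>x. g x $ i) \<in> L2per A" and \<phi>[measurable]: "\<phi> \<in> borel_measurable borel"
    and R: "\<And>x. norm x > R \<Longrightarrow> \<phi> x = 0" and B: "\<And>x. \<bar>\<phi> x\<bar> \<le> B"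
  shows "integrable lborel (\<lambda>x. \<phi> x *\<^sub>R g x)"
proof (rule Bochner_Integration.integrable_bound[OF Bochner_Integration.integrable_sum[OF integrable_abs]])
  show "integrable lborel (\<lambda>x. \<phi> x * (g x \<bullet> b))" if "b \<in> Basis" for b
    by (rule L2per_integrable_test[OF L2per_inner[OF g] \<phi> R B])
  show "(\<lambda>x. \<phi> x *\<^sub>R g x) \<in> borel_measurable lborel" using L2per_vec_measurable[OF g] by measurable
  show "AE x in lborel. norm (\<phi> x *\<^sub>R g x) \<le> norm (\<Sum>b\<in>Basis. \<bar>\<phi> x * (g x \<bullet> b)\<bar>)"
    using norm_le_l1[of "\<phi> _ *\<^sub>R g _"] by (intro AE_I2) (simp add: sum_nonneg)
qed

lemma test_fun_measurable:
  assumes "test_fun \<eta> G"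
  shows "\<eta> \<in> borel_measurable borel" "G \<in> borel_measurable borel"
  using test_fun_facts(1,2)[OF assms] by (auto intro: borel_measurable_continuous_onI)

lemma test_fun_integrable:
  fixes g :: "real^3 \<Rightarrow> real^3"
  assumes t: "test_fun \<eta> G"
  shows "u \<in> L2per A \<Longrightarrow> integrable lborel (\<lambda>x. u x *\<^sub>R G x)"
    "(\<And>i. (\<lambda>x. g x $ i) \<in> L2per A) \<Longrightarrow> integrable lborel (\<lambda>x. \<eta> x *\<^sub>R g x)"
    "u \<in> L2per A \<Longrightarrow> integrable lborel (\<lambda>x. \<eta> x * u x)"
    "u \<in> L2per A \<Longrightarrow> integrable lborel (\<lambda>x. u x * (G x \<bullet> z))"
proof -
  obtain R where R: "\<And>x. norm x > R \<Longrightarrow> \<eta> x = 0 \<and> G x = 0" using test_fun_facts(3)[OF t] by blast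
  obtain B where B: "\<And>x. \<bar>\<eta> x\<bar> \<le> B \<and> norm (G x) \<le> B" using test_fun_facts(4)[OF t] by blast
  note m = test_fun_measurable[OF t]
  show 1: "integrable lborel (\<lambda>x. u x *\<^sub>R G x)" if "u \<in> L2per A"
    using R B by (intro L2per_integrable_test_vec[OF that m(2), of R B]) auto
  show "integrable lborel (\<lambda>x. \<eta> x *\<^sub>R g x)" if "\<And>i. (\<lambda>x. g x $ i) \<in> L2per A"
    using R B by (intro L2per_vec_integrable_test[OF that m(1), of R B]) auto
  show "integrable lborel (\<lambda>x. \<eta> x * u x)" if "u \<in> L2per A"
    using R B by (intro L2per_integrable_test[OF that m(1), of R B]) auto
  show "integrable lborel (\<lambda>x. u x * (G x \<bullet> z))" if "u \<in> L2per A"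
    using integrable_inner_left[of z lborel "\<lambda>x. u x *\<^sub>R G x"] 1[OF that] by simp
qed

text \<open>Two vectors agree if and only if all their inner products agree. This replaces
  vector-valued integrals by scalar ones, with \<open>z\<close> later playing the role of a
  translation.\<close>

lemma weak_grad_iff_inner:
  assumes u: "u \<in> L2per A" and g: "\<And>i. (\<lambda>x. g x $ i) \<in> L2per A"
  shows "has_grad A u g \<longleftrightarrow> (\<forall>\<eta> G z. test_fun \<eta> G \<longrightarrow>
    (LINT x|lborel. u x * (G x \<bullet> z)) = - (LINT x|lborel. \<eta> x * (g x \<bullet> z)))"
proof -
  have "(LINT x|lborel. u x *\<^sub>R G x) = - (LINT x|lborel. \<eta> x *\<^sub>R g x) \<longleftrightarrow>
    (\<forall>z. (LINT x|lborel. u x * (G x \<bullet> z)) = - (LINT x|lborel. \<eta> x * (g x \<bullet> z)))"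
    if t: "test_fun \<eta> G" for \<eta> G
  proof -
    have e: "(LINT x|lborel. u x *\<^sub>R G x) \<bullet> z = (LINT x|lborel. u x * (G x \<bullet> z))"
      "(- (LINT x|lborel. \<eta> x *\<^sub>R g x)) \<bullet> z = - (LINT x|lborel. \<eta> x * (g x \<bullet> z))" for z
      using integral_inner_left[of z lborel "\<lambda>x. u x *\<^sub>R G x"] integral_inner_left[of z lborel "\<lambda>x. \<eta> x *\<^sub>R g x"]
        test_fun_integrable(1)[OF t u] test_fun_integrable(2)[OF t g] by simp_all
    show ?thesis unfolding e[symmetric] by (rule vector_eq_rdot[symmetric])
  qed
  then show ?thesis using g unfolding has_grad_def weak_grad_def by blast
qed

lemma weak_grad_inner:
  assumes u: "u \<in> L2per A" and g: "has_grad A u g" and t: "test_fun \<eta> G"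
  shows "(LINT x|lborel. u x * (G x \<bullet> z)) = - (LINT x|lborel. \<eta> x * (g x \<bullet> z))"
  using weak_grad_iff_inner[OF u, of g] g t by (auto simp: has_grad_def)

lemma has_grad_unique:
  assumes u: "u \<in> L2per A" and g: "has_grad A u g" and g': "has_grad A u g'"
  shows "AE x in lborel. g x = g' x"
proof -
  have gi: "(\<lambda>x. g x $ i) \<in> L2per A" "(\<lambda>x. g' x $ i) \<in> L2per A" for i using g g' by (auto simp: has_grad_def)
  have "AE x in lborel. g x $ i - g' x $ i = 0" for i
  proof (rule fundamental_lemma)
    have "(\<lambda>x. g x $ i + (-1) * g' x $ i) \<in> L2per A" using gi by (intro L2per_add L2per_mult)
    then have d: "(\<lambda>x. g x $ i - g' x $ i) \<in> L2per A" by simp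
    show "(\<lambda>x. g x $ i - g' x $ i) \<in> borel_measurable borel" using d by (rule L2per_measurable)
    show "integrable lborel (\<lambda>x. indicator (box a b) x * (g x $ i - g' x $ i))" for a b
      by (rule L2per_box_integrable[OF d])
    show "(LINT x|lborel. \<eta> x * (g x $ i - g' x $ i)) = 0" if t: "test_fun \<eta> G" for \<eta> G
    proof -
      have "integrable lborel (\<lambda>x. \<eta> x * g x $ i)" "integrable lborel (\<lambda>x. \<eta> x * g' x $ i)"
        using gi by (auto intro: test_fun_integrable(3)[OF t])
      moreover have "(LINT x|lborel. \<eta> x * g x $ i) = (LINT x|lborel. \<eta> x * g' x $ i)"
        using weak_grad_inner[OF u g t, of "axis i 1"] weak_grad_inner[OF u g' t, of "axis i 1"] by (simp add: inner_axis)
      ultimately show ?thesis by (simp add: right_diff_distrib)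
    qed
  qed
  then have "AE x in lborel. \<forall>i. g x $ i - g' x $ i = 0" by (simp add: AE_all_countable)
  then show ?thesis by eventually_elim (simp add: vec_eq_iff)
qed

text \<open>The fundamental theorem of calculus along segments for weak gradients. After testing
  against \<open>\<eta>\<close>, the translation moves to \<open>\<eta>\<close>, where the classical
  theorem applies; the weak gradient is then used with every shifted test function, and Fubini
  exchanges the segment and space integrals before and after.\<close>

lemma translation_identity:
  assumes u: "u \<in> L2per A" and g: "has_grad A u g"
  shows "AE x in lborel. u (x + z) - u x = (LINT s|lborel. indicator {0..1} s * (g (x + s *\<^sub>R z) \<bullet> z))"
proof -
  define \<gamma> where "\<gamma> x = g x \<bullet> z" for x
  have gi: "(\<lambda>x. g x $ i) \<in> L2per A" for i using g by (simp add: has_grad_def)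
  have \<gamma>: "\<gamma> \<in> L2per A" unfolding \<gamma>_def[abs_def] by (rule L2per_inner[OF gi])
  have [measurable]: "\<gamma> \<in> borel_measurable borel" "u \<in> borel_measurable borel"
    using \<gamma> u by (auto dest: L2per_measurable)
  define D where "D x = (LINT s|lborel. indicator {0..1::real} s * \<gamma> (x + s *\<^sub>R z))" for x
  have Dm [measurable]: "D \<in> borel_measurable borel"
    unfolding D_def[abs_def] by (rule lborel.borel_measurable_lebesgue_integral) measurable
  \<comment> \<open>For \<open>s\<close> in [0, 1] the shifts of points of norm at most
    \<open>R\<close> stay in the ball of radius \<open>R + norm z\<close>, which gives a bound
    uniform in \<open>s\<close>. The weight \<open>\<phi>\<close> is general because it serves for
    indicators of boxes as well as for test functions.\<close>
  have seg: "integrable (lborel \<Otimes>\<^sub>M lborel) (\<lambda>(s, x). indicator {0..1} s * (\<phi> x * \<gamma> (x + s *\<^sub>R z)))"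
    if \<phi>[measurable]: "\<phi> \<in> borel_measurable borel" and R: "\<And>x. norm x > R \<Longrightarrow> \<phi> x = 0" and B: "\<And>x. \<bar>\<phi> x\<bar> \<le> B" for \<phi> R B
  proof -
    have B0: "0 \<le> B" using B[of 0] by linarith
    let ?K = "cball 0 (R + norm z) :: (real^3) set"
    have ik: "integrable lborel (\<lambda>x. \<bar>indicator ?K x *\<^sub>R \<gamma> x\<bar>)"
      using L2per_locally_integrable[OF \<gamma>, of ?K] by (simp add: set_integrable_def)
    define C where "C = B * (LINT x|lborel. \<bar>indicator ?K x *\<^sub>R \<gamma> x\<bar>)"
    have [measurable]: "?K \<in> sets borel" by simp
    have "(\<integral>\<^sup>+x. ennreal \<bar>indicator {0..1} s * (\<phi> x * \<gamma> (x + s *\<^sub>R z))\<bar> \<partial>lborel) \<le> ennreal C * indicator {0..1} s" for s :: real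
    proof (cases "s \<in> {0..1}")
      case True
      have "(\<integral>\<^sup>+x. ennreal \<bar>indicator {0..1} s * (\<phi> x * \<gamma> (x + s *\<^sub>R z))\<bar> \<partial>lborel)
          \<le> (\<integral>\<^sup>+x. ennreal (B * \<bar>indicator ?K (x + s *\<^sub>R z) *\<^sub>R \<gamma> (x + s *\<^sub>R z)\<bar>) \<partial>lborel)"
      proof (rule nn_integral_mono, rule ennreal_leI)
        fix x :: "real^3"
        show "\<bar>indicator {0..1} s * (\<phi> x * \<gamma> (x + s *\<^sub>R z))\<bar> \<le> B * \<bar>indicator ?K (x + s *\<^sub>R z) *\<^sub>R \<gamma> (x + s *\<^sub>R z)\<bar>"
        proof (cases "norm x > R")
          case True
          then show ?thesis using R[OF True] B0 by simp
        next
          case False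
          have "norm (x + s *\<^sub>R z) \<le> norm x + \<bar>s\<bar> * norm z" using norm_triangle_ineq[of x "s *\<^sub>R z"] by simp
          also have "\<dots> \<le> R + norm z"
            using False True mult_right_mono[of "\<bar>s\<bar>" 1 "norm z"] by simp
          finally have "x + s *\<^sub>R z \<in> ?K" by simp
          then show ?thesis using True B[of x] by (simp add: abs_mult mult_right_mono)
        qed
      qed
      also have "\<dots> = (\<integral>\<^sup>+x. ennreal (B * \<bar>indicator ?K x *\<^sub>R \<gamma> x\<bar>) \<partial>lborel)"
        by (rule nn_integral_lborel_shift[where f="\<lambda>x. ennreal (B * \<bar>indicator ?K x *\<^sub>R \<gamma> x\<bar>)"]) measurable
      also have "\<dots> = ennreal C"
        using ik B0 unfolding C_def by (subst nn_integral_eq_integral) (auto intro!: mult_nonneg_nonneg)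
      finally show ?thesis using True by simp
    qed simp
    then show ?thesis by (intro pair_integrable_segment[where C=C]) measurable
  qed
  have D_int: "integrable lborel (\<lambda>x. \<phi> x * D x)" and D_fub: "(LINT x|lborel. \<phi> x * D x) = (LINT s|lborel. indicator {0..1} s * (LINT x|lborel. \<phi> x * \<gamma> (x + s *\<^sub>R z)))"
    if \<phi>: "\<phi> \<in> borel_measurable borel" and R: "\<And>x. norm x > R \<Longrightarrow> \<phi> x = 0" and B: "\<And>x. \<bar>\<phi> x\<bar> \<le> B" for \<phi> R B
  proof -
    note i = seg[OF \<phi> R B]
    have e: "(LINT s|lborel. indicator {0..1} s * (\<phi> x * \<gamma> (x + s *\<^sub>R z))) = \<phi> x * D x" for x
      unfolding D_def by (subst integral_mult_right_zero[symmetric]) (simp add: mult_ac)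
    show "integrable lborel (\<lambda>x. \<phi> x * D x)"
      using lborel_pair.integrable_snd[OF i] unfolding e .
    have "(LINT x|lborel. \<phi> x * D x) = (LINT x|lborel. LINT s|lborel. indicator {0..1} s * (\<phi> x * \<gamma> (x + s *\<^sub>R z)))"
      unfolding e ..
    also have "\<dots> = (LINT s|lborel. LINT x|lborel. indicator {0..1} s * (\<phi> x * \<gamma> (x + s *\<^sub>R z)))"
      by (rule lborel_pair.Fubini_integral[OF i])
    finally show "(LINT x|lborel. \<phi> x * D x) = (LINT s|lborel. indicator {0..1} s * (LINT x|lborel. \<phi> x * \<gamma> (x + s *\<^sub>R z)))"
      by simp
  qed
  have uz: "(\<lambda>x. u (x + z)) \<in> L2per A" by (rule L2per_shift[OF u])
  have "AE x in lborel. u (x + z) - u x - D x = 0"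
  proof (rule fundamental_lemma)
    show "(\<lambda>x. u (x + z) - u x - D x) \<in> borel_measurable borel" by measurable
    show "integrable lborel (\<lambda>x. indicator (box a b) x * (u (x + z) - u x - D x))" for a b
    proof -
      obtain R where R: "\<And>x. x \<in> box a b \<Longrightarrow> norm x \<le> R" using bounded_box[of a b] unfolding bounded_iff by blast
      have "integrable lborel (\<lambda>x. indicator (box a b) x * D x)"
        by (rule D_int[of _ R 1]) (use R in \<open>auto simp: indicator_def not_le[symmetric]\<close>)
      then show ?thesis
        using L2per_box_integrable[OF uz, of a b] L2per_box_integrable[OF u, of a b]
        by (simp add: right_diff_distrib)
    qed
    fix \<eta> G assume t: "test_fun \<eta> G"
    obtain R where R: "\<And>x. norm x > R \<Longrightarrow> \<eta> x = 0 \<and> G x = 0" using test_fun_facts(3)[OF t] by blast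
    obtain B where B: "\<And>x. \<bar>\<eta> x\<bar> \<le> B \<and> norm (G x) \<le> B" using test_fun_facts(4)[OF t] by blast
    have [measurable]: "\<eta> \<in> borel_measurable borel" "G \<in> borel_measurable borel"
      using test_fun_facts(1,2)[OF t] by (auto intro: borel_measurable_continuous_onI)
    have tm: "test_fun (\<lambda>x. \<eta> (x - s *\<^sub>R z)) (\<lambda>x. G (x - s *\<^sub>R z))" for s
      using test_fun_shift[OF t, of "- (s *\<^sub>R z)"] by simp
    have B0: "0 \<le> B" using B[of 0] by linarith
    have i1: "integrable lborel (\<lambda>x. \<eta> x * u (x + z))" and i2: "integrable lborel (\<lambda>x. \<eta> x * u x)"
      and i3: "integrable lborel (\<lambda>x. \<eta> x * D x)"
      using R B by (auto intro!: L2per_integrable_test[OF uz, of _ R B] L2per_integrable_test[OF u, of _ R B] D_int[of _ R B])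
    have i1': "integrable lborel (\<lambda>x. \<eta> (x - z) * u x)"
      using i1 lborel_integrable_shift[of "\<lambda>x. \<eta> (x - z) * u x" z] by simp
    \<comment> \<open>The second exchange of integrals, now with the segment in the argument of
      \<open>G\<close> and \<open>u\<close> fixed.\<close>
    have fub: "integrable (lborel \<Otimes>\<^sub>M lborel) (\<lambda>(s, x). indicator {0..1} s * (u x * (G (x - s *\<^sub>R z) \<bullet> z)))"
    proof -
      let ?K = "cball 0 (R + norm z) :: (real^3) set"
      have ik: "integrable lborel (\<lambda>x. \<bar>indicator ?K x *\<^sub>R u x\<bar>)"
        using L2per_locally_integrable[OF u, of ?K] by (simp add: set_integrable_def)
      define C where "C = B * norm z * (LINT x|lborel. \<bar>indicator ?K x *\<^sub>R u x\<bar>)"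
      have "(\<integral>\<^sup>+x. ennreal \<bar>indicator {0..1} s * (u x * (G (x - s *\<^sub>R z) \<bullet> z))\<bar> \<partial>lborel) \<le> ennreal C * indicator {0..1} s" for s :: real
      proof (cases "s \<in> {0..1}")
        case True
        have "(\<integral>\<^sup>+x. ennreal \<bar>indicator {0..1} s * (u x * (G (x - s *\<^sub>R z) \<bullet> z))\<bar> \<partial>lborel)
            \<le> (\<integral>\<^sup>+x. ennreal (B * norm z * \<bar>indicator ?K x *\<^sub>R u x\<bar>) \<partial>lborel)"
        proof (rule nn_integral_mono, rule ennreal_leI)
          fix x :: "real^3"
          show "\<bar>indicator {0..1} s * (u x * (G (x - s *\<^sub>R z) \<bullet> z))\<bar> \<le> B * norm z * \<bar>indicator ?K x *\<^sub>R u x\<bar>"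
          proof (cases "x \<in> ?K")
            case True
            have "\<bar>G (x - s *\<^sub>R z) \<bullet> z\<bar> \<le> norm (G (x - s *\<^sub>R z)) * norm z" by (rule Cauchy_Schwarz_ineq2)
            also have "\<dots> \<le> B * norm z" using B by (intro mult_right_mono) auto
            finally have "\<bar>u x\<bar> * \<bar>G (x - s *\<^sub>R z) \<bullet> z\<bar> \<le> \<bar>u x\<bar> * (B * norm z)" by (rule mult_left_mono) simp
            then show ?thesis using True \<open>s \<in> {0..1}\<close> by (simp add: abs_mult mult_ac)
          next
            case False
            have "norm (s *\<^sub>R z) \<le> norm z" using \<open>s \<in> {0..1}\<close> mult_right_mono[of "\<bar>s\<bar>" 1 "norm z"] by simp
            moreover have "norm x \<le> norm (x - s *\<^sub>R z) + norm (s *\<^sub>R z)" using norm_triangle_ineq[of "x - s *\<^sub>R z" "s *\<^sub>R z"] by simp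
            ultimately have "norm (x - s *\<^sub>R z) > R" using False by simp
            then show ?thesis using R False by simp
          qed
        qed
        also have "\<dots> = ennreal C"
          using ik B0 unfolding C_def by (subst nn_integral_eq_integral) (auto intro!: mult_nonneg_nonneg)
        finally show ?thesis using True by simp
      qed simp
      then show ?thesis by (intro pair_integrable_segment[where C=C]) measurable
    qed
    have "(LINT x|lborel. \<eta> x * u (x + z)) - (LINT x|lborel. \<eta> x * u x) = (LINT x|lborel. \<eta> (x - z) * u x) - (LINT x|lborel. \<eta> x * u x)"
      using lborel_integral_shift[of "\<lambda>x. \<eta> (x - z) * u x" z] by simp
    also have "\<dots> = (LINT x|lborel. u x * (\<eta> (x - z) - \<eta> x))"
      using i1' i2 by (simp add: right_diff_distrib mult.commute)
    also have "\<dots> = - (LINT x|lborel. LINT s|lborel. indicator {0..1} s * (u x * (G (x - s *\<^sub>R z) \<bullet> z)))"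
    proof -
      have "u x * (\<eta> (x - z) - \<eta> x) = - (LINT s|lborel. indicator {0..1} s * (u x * (G (x - s *\<^sub>R z) \<bullet> z)))" for x
      proof -
        have "(LINT s|lborel. indicator {0..1} s * (u x * (G (x - s *\<^sub>R z) \<bullet> z))) = u x * (LINT s|lborel. indicator {0..1} s * (G (x - s *\<^sub>R z) \<bullet> z))"
          by (subst integral_mult_right_zero[symmetric]) (simp add: mult_ac)
        then show ?thesis unfolding C1_segment_FTC[OF t] by simp
      qed
      then show ?thesis by simp
    qed
    also have "\<dots> = - (LINT s|lborel. LINT x|lborel. indicator {0..1} s * (u x * (G (x - s *\<^sub>R z) \<bullet> z)))"
      using lborel_pair.Fubini_integral[OF fub] by simp
    also have "\<dots> = (LINT s|lborel. indicator {0..1} s * (LINT x|lborel. \<eta> (x - s *\<^sub>R z) * \<gamma> x))"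
      using weak_grad_inner[OF u g tm, where z=z] unfolding \<gamma>_def by simp
    also have "\<dots> = (LINT s|lborel. indicator {0..1} s * (LINT x|lborel. \<eta> x * \<gamma> (x + s *\<^sub>R z)))"
    proof -
      have "(LINT x|lborel. \<eta> (x - s *\<^sub>R z) * \<gamma> x) = (LINT x|lborel. \<eta> x * \<gamma> (x + s *\<^sub>R z))" for s
        using lborel_integral_shift[of "\<lambda>x. \<eta> (x - s *\<^sub>R z) * \<gamma> x" "s *\<^sub>R z"] by simp
      then show ?thesis by simp
    qed
    also have "\<dots> = (LINT x|lborel. \<eta> x * D x)"
      using R B by (intro D_fub[symmetric, of _ R B]) auto
    finally show "(LINT x|lborel. \<eta> x * (u (x + z) - u x - D x)) = 0"
      using i1 i2 i3 by (simp add: right_diff_distrib)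
  qed
  then show ?thesis by eventually_elim (simp add: D_def \<gamma>_def)
qed

section \<open>The translation estimate in L2\<close>

definition gn2 :: "(real^3 \<Rightarrow> real^3) \<Rightarrow> real" where
  "gn2 g = (LINT x|cm A. g x \<bullet> g x)"

lemma gn2_nonneg: "0 \<le> gn2 g"
  unfolding gn2_def by (intro Bochner_Integration.integral_nonneg) auto

lemma L2per_vec_integrable:
  assumes "\<And>i. (\<lambda>x. g x $ i) \<in> L2per A" "\<And>i. (\<lambda>x. h x $ i) \<in> L2per A"
  shows "integrable (cm A) (\<lambda>x. g x \<bullet> h x)"
  unfolding inner_vec_def using assms by (auto intro!: L2_mult_integrable L2per_Lp)

text \<open>Cauchy-Schwarz in the segment parameter is applied to
  \<open>translation_identity\<close>, followed by Tonelli and the invariance of cell integrals of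
  periodic functions under shifts.\<close>

lemma translation_estimate:
  assumes u: "u \<in> L2per A" and g: "has_grad A u g"
  shows "(\<integral>\<^sup>+x. ennreal ((u (x + z) - u x)\<^sup>2) \<partial>cm A) \<le> ennreal ((norm z)\<^sup>2 * gn2 g)"
proof -
  define \<gamma> where "\<gamma> x = g x \<bullet> z" for x
  have gi: "(\<lambda>x. g x $ i) \<in> L2per A" for i using g by (simp add: has_grad_def)
  have \<gamma>: "\<gamma> \<in> L2per A" unfolding \<gamma>_def[abs_def] by (rule L2per_inner[OF gi])
  have [measurable]: "\<gamma> \<in> borel_measurable borel" "g \<in> borel_measurable borel"
    using L2per_measurable[OF \<gamma>] L2per_vec_measurable[OF gi] by auto
  have pw: "ennreal ((LINT s|lborel. indicator {0..1} s * \<gamma> (x + s *\<^sub>R z))\<^sup>2) \<le> (\<integral>\<^sup>+s. indicator {0..1::real} s * ennreal ((\<gamma> (x + s *\<^sub>R z))\<^sup>2) \<partial>lborel)" for x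
  proof -
    let ?f = "\<lambda>s::real. indicator {0..1} s * \<gamma> (x + s *\<^sub>R z)"
    have "ennreal \<bar>LINT s|lborel. ?f s\<bar> \<le> (\<integral>\<^sup>+s. ennreal \<bar>?f s\<bar> \<partial>lborel)"
    proof (cases "integrable lborel ?f")
      case True
      from integral_norm_bound_ennreal[OF True] show ?thesis by simp
    next
      \<comment> \<open>An integral that does not exist is 0 by convention, so the bound is
        trivial.\<close>
      case False
      then show ?thesis by (simp add: not_integrable_integral_eq)
    qed
    also have "\<dots> = (\<integral>\<^sup>+s. indicator {0..1} s * ennreal \<bar>?f s\<bar> \<partial>lborel)"
      by (intro nn_integral_cong) (simp add: indicator_def)
    finally have "(ennreal \<bar>LINT s|lborel. ?f s\<bar>)\<^sup>2 \<le> (\<integral>\<^sup>+s. indicator {0..1} s * ennreal \<bar>?f s\<bar> \<partial>lborel)\<^sup>2"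
      by (intro power_mono) auto
    also have "\<dots> \<le> (\<integral>\<^sup>+s. (indicator {0..1::real} s)\<^sup>2 \<partial>lborel) * (\<integral>\<^sup>+s. (ennreal \<bar>?f s\<bar>)\<^sup>2 \<partial>lborel)"
      by (intro Cauchy_Schwarz_nn_integral) auto
    also have "(\<integral>\<^sup>+s. (indicator {0..1::real} s)\<^sup>2 \<partial>lborel) = (\<integral>\<^sup>+s. indicator {0..1::real} s \<partial>lborel)"
      by (intro nn_integral_cong) (simp add: indicator_def)
    also have "\<dots> = 1" by simp
    also have "(\<integral>\<^sup>+s. (ennreal \<bar>?f s\<bar>)\<^sup>2 \<partial>lborel) = (\<integral>\<^sup>+s. indicator {0..1::real} s * ennreal ((\<gamma> (x + s *\<^sub>R z))\<^sup>2) \<partial>lborel)"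
      by (intro nn_integral_cong) (simp add: indicator_def ennreal_power)
    finally show ?thesis by (simp add: ennreal_power)
  qed
  have ti: "AE x in cm A. u (x + z) - u x = (LINT s|lborel. indicator {0..1} s * \<gamma> (x + s *\<^sub>R z))"
    using AE_lborel_imp_cm[OF translation_identity[OF u g]] unfolding \<gamma>_def .
  have "(\<integral>\<^sup>+x. ennreal ((u (x + z) - u x)\<^sup>2) \<partial>cm A) \<le> (\<integral>\<^sup>+x. (\<integral>\<^sup>+s. indicator {0..1::real} s * ennreal ((\<gamma> (x + s *\<^sub>R z))\<^sup>2) \<partial>lborel) \<partial>cm A)"
  proof (rule nn_integral_mono_AE)
    show "AE x in cm A. ennreal ((u (x + z) - u x)\<^sup>2) \<le> (\<integral>\<^sup>+s. indicator {0..1::real} s * ennreal ((\<gamma> (x + s *\<^sub>R z))\<^sup>2) \<partial>lborel)"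
      using ti
    proof eventually_elim
      case (elim x)
      show ?case unfolding elim by (rule pw)
    qed
  qed
  also have "\<dots> = (\<integral>\<^sup>+s. (\<integral>\<^sup>+x. indicator {0..1::real} s * ennreal ((\<gamma> (x + s *\<^sub>R z))\<^sup>2) \<partial>cm A) \<partial>lborel)"
  proof -
    interpret pair_sigma_finite "cm A" lborel
      by (intro pair_sigma_finite.intro cm.sigma_finite_measure_axioms sigma_finite_lborel)
    show ?thesis
      by (rule Fubini'[symmetric]) measurable
  qed
  also have "\<dots> = (\<integral>\<^sup>+s. indicator {0..1::real} s * (\<integral>\<^sup>+x. ennreal ((\<gamma> x)\<^sup>2) \<partial>cm A) \<partial>lborel)"
  proof (rule nn_integral_cong)
    fix s :: real
    have "(\<integral>\<^sup>+x. indicator {0..1::real} s * ennreal ((\<gamma> (x + s *\<^sub>R z))\<^sup>2) \<partial>cm A) = indicator {0..1::real} s * (\<integral>\<^sup>+x. ennreal ((\<gamma> (x + s *\<^sub>R z))\<^sup>2) \<partial>cm A)"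
      by (intro nn_integral_cmult) measurable
    also have "(\<integral>\<^sup>+x. ennreal ((\<gamma> (x + s *\<^sub>R z))\<^sup>2) \<partial>cm A) = (\<integral>\<^sup>+x. ennreal ((\<gamma> x)\<^sup>2) \<partial>cm A)"
      using L2per_periodic[OF \<gamma>] by (intro nn_integral_cm_shift[where h="\<lambda>x. ennreal ((\<gamma> x)\<^sup>2)"]) (auto simp: periodic_def)
    finally show "(\<integral>\<^sup>+x. indicator {0..1::real} s * ennreal ((\<gamma> (x + s *\<^sub>R z))\<^sup>2) \<partial>cm A) = indicator {0..1::real} s * (\<integral>\<^sup>+x. ennreal ((\<gamma> x)\<^sup>2) \<partial>cm A)" .
  qed
  also have "\<dots> = (\<integral>\<^sup>+x. ennreal ((\<gamma> x)\<^sup>2) \<partial>cm A)"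
    by (simp add: nn_integral_multc)
  also have "\<dots> \<le> (\<integral>\<^sup>+x. ennreal ((norm z)\<^sup>2 * (g x \<bullet> g x)) \<partial>cm A)"
  proof (intro nn_integral_mono ennreal_leI)
    show "(\<gamma> x)\<^sup>2 \<le> (norm z)\<^sup>2 * (g x \<bullet> g x)" for x
      using Cauchy_Schwarz_ineq[of "g x" z] by (simp add: \<gamma>_def power2_norm_eq_inner mult.commute)
  qed
  also have "\<dots> = ennreal ((norm z)\<^sup>2 * gn2 g)"
    using L2per_vec_integrable[OF gi gi] unfolding gn2_def by (subst nn_integral_eq_integral) auto
  finally show ?thesis .
qed

end

section \<open>Dyadic averages\<close>

lemma vec_nth_measurable:
  fixes g :: "'a \<Rightarrow> real^'k"
  assumes [measurable]: "g \<in> borel_measurable M"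
  shows "(\<lambda>x. g x $ i) \<in> borel_measurable M"
proof -
  have "(\<lambda>x. g x $ i) = (\<lambda>x. g x \<bullet> axis i 1)" by (simp add: inner_axis)
  then show ?thesis by simp
qed

context bravais begin

text \<open>\<open>K n x\<close> is the dyadic subcell of side \<open>2\<^sup>-\<^sup>n\<close> (in lattice coordinates) containing \<open>x\<close>, \<open>mK n\<close> its volume.\<close>

definition q :: "nat \<Rightarrow> real^3 \<Rightarrow> int^3" where
  "q n x = (\<chi> i. \<lfloor>2 ^ n * tc x $ i\<rfloor>)"

definition K :: "nat \<Rightarrow> real^3 \<Rightarrow> (real^3) set" where
  "K n x = {y. q n y = q n x}"

definition mK :: "nat \<Rightarrow> real" where "mK n = vol / 8 ^ n"

definition avg :: "nat \<Rightarrow> (real^3 \<Rightarrow> real) \<Rightarrow> real^3 \<Rightarrow> real" where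
  "avg n u x = (LINT y|lborel. indicator (K n x) y * u y) / mK n"

lemma mK_pos: "0 < mK n"
  using vol_pos by (simp add: mK_def)

lemma K_eq: "y \<in> K n x \<Longrightarrow> K n y = K n x"
  by (simp add: K_def)

lemma avg_const_on_K: "y \<in> K n x \<Longrightarrow> avg n u y = avg n u x"
  by (simp add: avg_def K_eq)

lemma ennreal_mult3: "0 \<le> a \<Longrightarrow> 0 \<le> b \<Longrightarrow> 0 \<le> c \<Longrightarrow> ennreal a * (ennreal b * ennreal c) = ennreal (a * (b * c))"
  by (simp add: ennreal_mult)

lemma K_box_at: "K n x = box_at (\<chi> i. of_int (q n x $ i) / 2 ^ n) (1 / 2 ^ n)"
proof (rule set_eqI)
  fix y
  have "y \<in> K n x \<longleftrightarrow> (\<forall>i. \<lfloor>2 ^ n * tc y $ i\<rfloor> = q n x $ i)"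
    by (auto simp: K_def q_def vec_eq_iff)
  also have "\<dots> \<longleftrightarrow> (\<forall>i. of_int (q n x $ i) \<le> 2 ^ n * tc y $ i \<and> 2 ^ n * tc y $ i < of_int (q n x $ i) + 1)"
    by (simp add: floor_eq_iff)
  also have "\<dots> \<longleftrightarrow> y \<in> box_at (\<chi> i. of_int (q n x $ i) / 2 ^ n) (1 / 2 ^ n)"
    by (simp add: box_at_def add_divide_distrib[symmetric] pos_divide_le_eq pos_less_divide_eq mult.commute)
  finally show "y \<in> K n x \<longleftrightarrow> y \<in> box_at (\<chi> i. of_int (q n x $ i) / 2 ^ n) (1 / 2 ^ n)" .
qed

lemma sets_K [measurable]: "K n x \<in> sets borel"
  unfolding K_box_at by (rule sets_box_at)

lemma emeasure_K: "emeasure lborel (K n x) = ennreal (mK n)"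
  unfolding K_box_at mK_def by (subst measure_box_at) (auto simp: power_divide power_mult[symmetric] mult.commute[of n] power_mult)

lemma measure_K: "measure lborel (K n x) = mK n"
  using mK_pos[of n] by (simp add: measure_def emeasure_K)

text \<open>Multiplied by 2^n, the coordinates of the cell range over [0, 2^n), whose end points are
  integers; so the cell is a union of subcells.\<close>

lemma K_subset_cell:
  assumes "x \<in> cell A"
  shows "K n x \<subseteq> cell A"
proof
  fix y assume y: "y \<in> K n x"
  show "y \<in> cell A"
    unfolding mem_cell
  proof
    fix i
    have x: "0 \<le> 2 ^ n * tc x $ i" "2 ^ n * tc x $ i < 2 ^ n" using assms by (auto simp: mem_cell)
    have e: "\<lfloor>2 ^ n * tc y $ i\<rfloor> = \<lfloor>2 ^ n * tc x $ i\<rfloor>" using y by (auto simp: K_def q_def vec_eq_iff)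
    have "0 \<le> \<lfloor>2 ^ n * tc y $ i\<rfloor>" unfolding e using x(1) by simp
    moreover have "\<lfloor>2 ^ n * tc y $ i\<rfloor> < 2 ^ n" unfolding e using x(2) by (simp add: floor_less_iff)
    ultimately have "0 \<le> 2 ^ n * tc y $ i" "2 ^ n * tc y $ i < 2 ^ n" by (simp_all add: floor_less_iff)
    moreover have "(0::real) < 2 ^ n" by simp
    ultimately show "0 \<le> tc y $ i \<and> tc y $ i < 1"
      using mult_pos_neg[of "2 ^ n" "tc y $ i"] by (auto simp: not_le[symmetric])
  qed
qed

text \<open>The floor of r is the floor of 2 r divided by 2 as an integer, so the index of a subcell
  determines the index of the subcell one level coarser.\<close>

lemma floor_double_eq:
  fixes s t :: real
  assumes "\<lfloor>2 * s\<rfloor> = \<lfloor>2 * t\<rfloor>"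
  shows "\<lfloor>s\<rfloor> = \<lfloor>t\<rfloor>"
proof -
  have "\<lfloor>r\<rfloor> = \<lfloor>2 * r\<rfloor> div 2" for r :: real
    using floor_divide_real_eq_div[of 2 "2 * r"] by simp
  then show ?thesis using assms by metis
qed

lemma K_Suc_subset: "K (Suc n) x \<subseteq> K n x"
proof
  fix y assume "y \<in> K (Suc n) x"
  then have "\<lfloor>2 * (2 ^ n * tc y $ i)\<rfloor> = \<lfloor>2 * (2 ^ n * tc x $ i)\<rfloor>" for i
    by (simp add: K_def q_def vec_eq_iff mult.assoc)
  then show "y \<in> K n x"
    by (auto simp: K_def q_def vec_eq_iff intro: floor_double_eq)
qed

text \<open>Joint measurability makes averages measurable as integrals depending on a
  parameter.\<close>

lemma indicator_K_measurable [measurable]: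
  "(\<lambda>(x, y). indicator (K n x) y :: real) \<in> borel_measurable (borel \<Otimes>\<^sub>M borel)"
proof -
  have "(\<lambda>(x, y). indicator (K n x) y :: real) = (\<lambda>(x, y). if \<forall>i. \<lfloor>2 ^ n * tc y $ i\<rfloor> = \<lfloor>2 ^ n * tc x $ i\<rfloor> then 1 else 0)"
    by (auto simp: K_def q_def vec_eq_iff indicator_def fun_eq_iff)
  also have "\<dots> \<in> borel_measurable (borel \<Otimes>\<^sub>M borel)"
  proof -
    have t: "(\<lambda>x. tc x $ i) \<in> borel_measurable borel" for i
      by (rule vec_nth_measurable) measurable
    have [measurable]: "(\<lambda>z. tc (fst z) $ i) \<in> borel_measurable (borel \<Otimes>\<^sub>M borel)" "(\<lambda>z. tc (snd z) $ i) \<in> borel_measurable (borel \<Otimes>\<^sub>M borel)" for i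
      by (rule measurable_compose[OF measurable_fst t], rule measurable_compose[OF measurable_snd t])
    show ?thesis by measurable
  qed
  finally show ?thesis .
qed

lemma avg_measurable [measurable]:
  assumes [measurable]: "u \<in> borel_measurable borel"
  shows "avg n u \<in> borel_measurable borel"
proof -
  have "(\<lambda>(x, y). indicator (K n x) y * u y) \<in> borel_measurable (borel \<Otimes>\<^sub>M lborel)" by measurable
  then have "(\<lambda>x. LINT y|lborel. indicator (K n x) y * u y) \<in> borel_measurable borel"
    by (rule lborel.borel_measurable_lebesgue_integral)
  then show ?thesis unfolding avg_def[abs_def] by measurable
qed

lemma bounded_K: "bounded (K n x)"
proof -
  have "bounded (cell A)" by (rule bounded_cell)
  then have "bounded ((\<lambda>y. A *v (\<chi> i. of_int (q n x $ i) / 2 ^ n) + (1 / 2 ^ n) *\<^sub>R y) ` cell A)"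
    using bounded_translation[OF bounded_scaling[of "cell A" "1 / 2 ^ n"]] by (simp add: image_image)
  then show ?thesis by (simp add: K_box_at box_at_image add.commute)
qed

lemma K_integrable:
  assumes "u \<in> L2per A"
  shows "integrable lborel (\<lambda>y. indicator (K n x) y * u y)"
  using L2per_locally_integrable[OF assms bounded_K sets_K, of n x] by (simp add: set_integrable_def)

lemma L2per_const: "(\<lambda>x. c) \<in> L2per A"
  by (auto simp: L2per_iff periodic_def intro: Lp_const finite_measure_cm)

lemma avg_const_diff:
  assumes "u \<in> L2per A"
  shows "avg n (\<lambda>y. c - u y) x = c - avg n u x"
proof -
  have "(LINT y|lborel. indicator (K n x) y * (c - u y)) = (LINT y|lborel. indicator (K n x) y * c) - (LINT y|lborel. indicator (K n x) y * u y)"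
    using K_integrable[OF assms] K_integrable[OF L2per_const] by (simp add: right_diff_distrib)
  also have "(LINT y|lborel. indicator (K n x) y * c) = mK n * c"
    by (simp add: measure_K)
  finally show ?thesis using mK_pos[of n] by (simp add: avg_def diff_divide_distrib)
qed

text \<open>Jensen's inequality for the square, by Cauchy-Schwarz against the indicator of the
  subcell.\<close>

lemma avg_square_le:
  assumes u: "u \<in> L2per A"
  shows "ennreal ((avg n u x)\<^sup>2) \<le> ennreal (1 / mK n) * (\<integral>\<^sup>+y. indicator (K n x) y * ennreal ((u y)\<^sup>2) \<partial>lborel)"
proof -
  have [measurable]: "u \<in> borel_measurable borel" using u by (rule L2per_measurable)
  let ?I = "indicator (K n x) :: real^3 \<Rightarrow> real"
  have "ennreal \<bar>LINT y|lborel. ?I y * u y\<bar> \<le> (\<integral>\<^sup>+y. ennreal \<bar>?I y * u y\<bar> \<partial>lborel)"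
    using integral_norm_bound_ennreal[OF K_integrable[OF u], of n x] by simp
  also have "\<dots> = (\<integral>\<^sup>+y. indicator (K n x) y * ennreal \<bar>?I y * u y\<bar> \<partial>lborel)"
    by (intro nn_integral_cong) (simp add: indicator_def)
  finally have "(ennreal \<bar>LINT y|lborel. ?I y * u y\<bar>)\<^sup>2 \<le> (\<integral>\<^sup>+y. indicator (K n x) y * ennreal \<bar>?I y * u y\<bar> \<partial>lborel)\<^sup>2"
    by (intro power_mono) auto
  also have "\<dots> \<le> (\<integral>\<^sup>+y. (indicator (K n x) y)\<^sup>2 \<partial>lborel) * (\<integral>\<^sup>+y. (ennreal \<bar>?I y * u y\<bar>)\<^sup>2 \<partial>lborel)"
    by (intro Cauchy_Schwarz_nn_integral) auto
  also have "(\<integral>\<^sup>+y. (indicator (K n x) y)\<^sup>2 \<partial>lborel) = (\<integral>\<^sup>+y. indicator (K n x) y \<partial>lborel)"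
    by (intro nn_integral_cong) (simp add: indicator_def)
  also have "\<dots> = ennreal (mK n)" by (simp add: emeasure_K)
  also have "(\<integral>\<^sup>+y. (ennreal \<bar>?I y * u y\<bar>)\<^sup>2 \<partial>lborel) = (\<integral>\<^sup>+y. indicator (K n x) y * ennreal ((u y)\<^sup>2) \<partial>lborel)"
    by (intro nn_integral_cong) (simp add: indicator_def ennreal_power)
  finally have *: "ennreal ((LINT y|lborel. ?I y * u y)\<^sup>2) \<le> ennreal (mK n) * (\<integral>\<^sup>+y. indicator (K n x) y * ennreal ((u y)\<^sup>2) \<partial>lborel)"
    by (simp add: ennreal_power)
  have "ennreal ((avg n u x)\<^sup>2) = ennreal (1 / (mK n)\<^sup>2) * ennreal ((LINT y|lborel. ?I y * u y)\<^sup>2)"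
    by (simp add: avg_def power_divide ennreal_mult[symmetric])
  also have "\<dots> \<le> ennreal (1 / (mK n)\<^sup>2) * (ennreal (mK n) * (\<integral>\<^sup>+y. indicator (K n x) y * ennreal ((u y)\<^sup>2) \<partial>lborel))"
    by (intro mult_left_mono *) simp
  also have "\<dots> = ennreal (1 / mK n) * (\<integral>\<^sup>+y. indicator (K n x) y * ennreal ((u y)\<^sup>2) \<partial>lborel)"
    using mK_pos[of n] by (simp add: mult.assoc[symmetric] ennreal_mult[symmetric] power2_eq_square)
  finally show ?thesis .
qed

lemma nn_integral_L2_square:
  assumes "u \<in> Lp 2 (cm A)"
  shows "(\<integral>\<^sup>+x. ennreal ((u x)\<^sup>2) \<partial>cm A) = ennreal ((nrm 2 (cm A) u)\<^sup>2)"
  using Lp_integrable[OF assms] by (subst nn_integral_eq_integral) (auto simp: nrm_power2)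

lemma nn_integral_K_le:
  assumes x: "x \<in> cell A" and u[measurable]: "u \<in> borel_measurable borel"
  shows "(\<integral>\<^sup>+y. indicator (K n x) y * ennreal ((u y)\<^sup>2) \<partial>lborel) \<le> (\<integral>\<^sup>+y. ennreal ((u y)\<^sup>2) \<partial>cm A)"
proof -
  have "(\<integral>\<^sup>+y. indicator (K n x) y * ennreal ((u y)\<^sup>2) \<partial>lborel) \<le> (\<integral>\<^sup>+y. indicator (cell A) y * ennreal ((u y)\<^sup>2) \<partial>lborel)"
    using K_subset_cell[OF x] by (intro nn_integral_mono) (auto simp: indicator_def)
  also have "\<dots> = (\<integral>\<^sup>+y. ennreal ((u y)\<^sup>2) \<partial>cm A)" by (rule nn_integral_cm[symmetric]) measurable
  finally show ?thesis .
qed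

text \<open>The subcell of a point of the cell stays inside the cell, so
  \<open>avg_square_le\<close> sees at most the full L2 norm. The volume factor stands on the left
  so that the bound is the same for all \<open>n\<close>.\<close>

lemma avg_bound:
  assumes u: "u \<in> L2per A" and x: "x \<in> cell A"
  shows "sqrt (mK n) * \<bar>avg n u x\<bar> \<le> nrm 2 (cm A) u"
proof -
  have "ennreal ((avg n u x)\<^sup>2) \<le> ennreal (1 / mK n) * ennreal ((nrm 2 (cm A) u)\<^sup>2)"
    using order_trans[OF avg_square_le[OF u] mult_left_mono[OF nn_integral_K_le[OF x L2per_measurable[OF u]] zero_le]]
    unfolding nn_integral_L2_square[OF L2per_Lp[OF u]] .
  then have "(avg n u x)\<^sup>2 \<le> (nrm 2 (cm A) u)\<^sup>2 / mK n"
    using mK_pos[of n] by (simp add: ennreal_mult[symmetric])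
  then have "(sqrt (mK n) * \<bar>avg n u x\<bar>)\<^sup>2 \<le> (nrm 2 (cm A) u)\<^sup>2"
    using mK_pos[of n] by (simp add: power_mult_distrib field_simps)
  then show ?thesis by (rule power2_le_imp_le) simp
qed

text \<open>The 3 comes from bounding the Euclidean norm of the lattice coordinates by the sum of
  their three absolute values.\<close>

definition CA :: real where "CA = 3 * onorm ((*v) A)"

lemma CA_nonneg: "0 \<le> CA"
  unfolding CA_def by (simp add: onorm_pos_le)

lemma norm_box_at_le:
  assumes "z \<in> box_at (\<chi> i. - s) (2 * s)"
  shows "norm z \<le> CA * s"
proof -
  have "norm z = norm (A *v tc z)" by simp
  also have "\<dots> \<le> onorm ((*v) A) * norm (tc z)" by (intro onorm matrix_vector_mul_bounded_linear)
  also have "\<dots> \<le> onorm ((*v) A) * (3 * s)"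
  proof (rule mult_left_mono)
    have "norm (tc z) \<le> (\<Sum>i\<in>UNIV. \<bar>tc z $ i\<bar>)" by (rule norm_le_l1_cart)
    also have "\<dots> \<le> (\<Sum>i\<in>(UNIV::3 set). s)"
    proof (rule sum_mono)
      fix i :: 3
      have "- s \<le> tc z $ i \<and> tc z $ i < - s + 2 * s" using assms unfolding box_at_def by auto
      then show "\<bar>tc z $ i\<bar> \<le> s" by linarith
    qed
    finally show "norm (tc z) \<le> 3 * s" by simp
  qed (simp add: onorm_pos_le)
  finally show ?thesis by (simp add: CA_def mult_ac)
qed

text \<open>The 8 is the ratio of the volume of the box of shifts, of side 2 s, to that of a subcell
  of side s; the root comes from passing from the squared norm to the norm.\<close>

definition Cp :: real where "Cp = sqrt 8 * CA"

lemma Cp_nonneg: "0 \<le> Cp"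
  using CA_nonneg by (simp add: Cp_def)

text \<open>Jensen bounds the deviation from the average by the mean of \<open>(u (x + z) - u x)\<^sup>2\<close> over a box of shifts \<open>z\<close>
  of eight times the volume of \<open>K n x\<close>; the translation estimate does the rest.\<close>

lemma poincare_avg:
  assumes u: "u \<in> L2per A" and g: "has_grad A u g"
  shows "(\<lambda>x. u x - avg n u x) \<in> Lp 2 (cm A)"
    "nrm 2 (cm A) (\<lambda>x. u x - avg n u x) \<le> Cp * (1/2) ^ n * sqrt (gn2 g)"
proof -
  have [measurable]: "u \<in> borel_measurable borel" using u by (rule L2per_measurable)
  define s :: real where "s = (1/2) ^ n"
  have s: "0 < s" by (simp add: s_def)
  \<comment> \<open>A box containing all differences of two points of one subcell.\<close>
  define Z where "Z = box_at (\<chi> i. - s) (2 * s)"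
  have [measurable]: "Z \<in> sets borel" by (simp add: Z_def)
  have KZ: "z \<in> Z" if "x + z \<in> K n x" for x z
  proof -
    have "- s \<le> tc z $ i \<and> tc z $ i < s" for i
    proof -
      have "\<lfloor>2 ^ n * (tc x $ i + tc z $ i)\<rfloor> = \<lfloor>2 ^ n * tc x $ i\<rfloor>"
        using that by (simp add: K_def q_def vec_eq_iff tc_add)
      then have "-1 \<le> 2 ^ n * tc z $ i" "2 ^ n * tc z $ i < 1" by (simp_all add: distrib_left) linarith+
      then show ?thesis by (simp add: s_def power_one_over field_simps)
    qed
    then show ?thesis by (auto simp: Z_def box_at_def)
  qed
  have pw: "ennreal ((u x - avg n u x)\<^sup>2) \<le> ennreal (1 / mK n) * (\<integral>\<^sup>+z. indicator Z z * ennreal ((u (x + z) - u x)\<^sup>2) \<partial>lborel)" for x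
  proof -
    have "(\<lambda>y. u x + (-1) * u y) \<in> L2per A" by (intro L2per_add L2per_mult L2per_const u)
    then have "(\<lambda>y. u x - u y) \<in> L2per A" by simp
    from avg_square_le[OF this, of n x]
    have "ennreal ((u x - avg n u x)\<^sup>2) \<le> ennreal (1 / mK n) * (\<integral>\<^sup>+y. indicator (K n x) y * ennreal ((u x - u y)\<^sup>2) \<partial>lborel)"
      by (simp add: avg_const_diff[OF u])
    also have "(\<integral>\<^sup>+y. indicator (K n x) y * ennreal ((u x - u y)\<^sup>2) \<partial>lborel) = (\<integral>\<^sup>+z. indicator (K n x) (z + x) * ennreal ((u x - u (z + x))\<^sup>2) \<partial>lborel)"
      by (rule nn_integral_lborel_shift[symmetric]) measurable
    also have "\<dots> \<le> (\<integral>\<^sup>+z. indicator Z z * ennreal ((u (x + z) - u x)\<^sup>2) \<partial>lborel)"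
      using KZ by (intro nn_integral_mono) (auto simp: indicator_def add.commute power2_commute)
    finally show ?thesis by (auto simp: mult_left_mono)
  qed
  have "(\<integral>\<^sup>+x. ennreal ((u x - avg n u x)\<^sup>2) \<partial>cm A) \<le> (\<integral>\<^sup>+x. ennreal (1 / mK n) * (\<integral>\<^sup>+z. indicator Z z * ennreal ((u (x + z) - u x)\<^sup>2) \<partial>lborel) \<partial>cm A)"
    by (intro nn_integral_mono pw)
  also have "\<dots> = ennreal (1 / mK n) * (\<integral>\<^sup>+x. (\<integral>\<^sup>+z. indicator Z z * ennreal ((u (x + z) - u x)\<^sup>2) \<partial>lborel) \<partial>cm A)"
    by (intro nn_integral_cmult) measurable
  also have "(\<integral>\<^sup>+x. (\<integral>\<^sup>+z. indicator Z z * ennreal ((u (x + z) - u x)\<^sup>2) \<partial>lborel) \<partial>cm A)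
      = (\<integral>\<^sup>+z. (\<integral>\<^sup>+x. indicator Z z * ennreal ((u (x + z) - u x)\<^sup>2) \<partial>cm A) \<partial>lborel)"
  proof -
    interpret pair_sigma_finite "cm A" lborel
      by (intro pair_sigma_finite.intro cm.sigma_finite_measure_axioms sigma_finite_lborel)
    show ?thesis
      by (rule Fubini'[symmetric]) measurable
  qed
  also have "\<dots> \<le> (\<integral>\<^sup>+z. ennreal ((CA * s)\<^sup>2 * gn2 g) * indicator Z z \<partial>lborel)"
  proof (rule nn_integral_mono)
    fix z
    have "(\<integral>\<^sup>+x. indicator Z z * ennreal ((u (x + z) - u x)\<^sup>2) \<partial>cm A) = indicator Z z * (\<integral>\<^sup>+x. ennreal ((u (x + z) - u x)\<^sup>2) \<partial>cm A)"
      by (intro nn_integral_cmult) measurable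
    also have "\<dots> \<le> indicator Z z * ennreal ((norm z)\<^sup>2 * gn2 g)"
      by (intro mult_left_mono translation_estimate[OF u g]) simp
    also have "\<dots> \<le> ennreal ((CA * s)\<^sup>2 * gn2 g) * indicator Z z"
    proof (cases "z \<in> Z")
      case True
      then have "(norm z)\<^sup>2 * gn2 g \<le> (CA * s)\<^sup>2 * gn2 g"
        using norm_box_at_le[of z s] by (intro mult_right_mono power_mono gn2_nonneg) (auto simp: Z_def)
      then show ?thesis using True by (simp add: ennreal_leI)
    qed simp
    finally show "(\<integral>\<^sup>+x. indicator Z z * ennreal ((u (x + z) - u x)\<^sup>2) \<partial>cm A) \<le> ennreal ((CA * s)\<^sup>2 * gn2 g) * indicator Z z" .
  qed
  also have "\<dots> = ennreal ((CA * s)\<^sup>2 * gn2 g) * ennreal ((2 * s) ^ 3 * vol)"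
    using s by (simp add: nn_integral_cmult_indicator Z_def measure_box_at)
  also have "ennreal (1 / mK n) * (ennreal ((CA * s)\<^sup>2 * gn2 g) * ennreal ((2 * s) ^ 3 * vol)) = ennreal ((1 / mK n) * (((CA * s)\<^sup>2 * gn2 g) * ((2 * s) ^ 3 * vol)))"
    using mK_pos[of n] vol_pos s gn2_nonneg[of g] by (intro ennreal_mult3) auto
  also have "(1 / mK n) * (((CA * s)\<^sup>2 * gn2 g) * ((2 * s) ^ 3 * vol)) = (Cp * s * sqrt (gn2 g))\<^sup>2"
  proof -
    \<comment> \<open>Makes \<open>mK n\<close> cancel against the volume of the box of shifts,
      leaving the constant 8 for every \<open>n\<close>.\<close>
    have "s ^ 3 * 8 ^ n = 1"
    proof -
      have "s ^ 3 = (1 / 8) ^ n" unfolding s_def by (subst power_mult[symmetric], subst mult.commute, subst power_mult) (simp add: power_divide)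
      then show ?thesis by (simp add: power_one_over)
    qed
    then have "(2 * s) ^ 3 * vol / mK n = 8" using vol_pos by (simp add: mK_def power_mult_distrib mult.assoc)
    moreover have "(1 / mK n) * (((CA * s)\<^sup>2 * gn2 g) * ((2 * s) ^ 3 * vol)) = ((CA * s)\<^sup>2 * gn2 g) * ((2 * s) ^ 3 * vol / mK n)" by simp
    ultimately show ?thesis using gn2_nonneg[of g] by (simp add: Cp_def power_mult_distrib mult_ac)
  qed
  finally have *: "(\<integral>\<^sup>+x. ennreal ((u x - avg n u x)\<^sup>2) \<partial>cm A) \<le> ennreal ((Cp * s * sqrt (gn2 g))\<^sup>2)"
    by (auto simp: mult_left_mono)
  have i: "integrable (cm A) (\<lambda>x. (u x - avg n u x)\<^sup>2)"
    by (intro integrableI_bounded) (use * in \<open>auto intro: le_less_trans[OF _ ennreal_less_top]\<close>)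
  then show L: "(\<lambda>x. u x - avg n u x) \<in> Lp 2 (cm A)" by (simp add: Lp_def)
  have "(LINT x|cm A. \<bar>u x - avg n u x\<bar>\<^sup>2) \<le> (Cp * s * sqrt (gn2 g))\<^sup>2"
    using * i by (subst (asm) nn_integral_eq_integral) auto
  then show "nrm 2 (cm A) (\<lambda>x. u x - avg n u x) \<le> Cp * (1/2) ^ n * sqrt (gn2 g)"
    unfolding s_def[symmetric] using Cp_nonneg s gn2_nonneg[of g] by (intro nrm_le) auto
qed

text \<open>An inverse estimate: integrating v^2 over the subcell of x bounds its value there by the
  squared L2 norm divided by \<open>mK n\<close>, and v^4 is at most this bound times v^2.\<close>

lemma L4_of_piecewise_constant:
  assumes v: "v \<in> Lp 2 (cm A)" and c: "\<And>x y. y \<in> K n x \<Longrightarrow> v y = v x"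
  shows "v \<in> Lp 4 (cm A)" "nrm 4 (cm A) v \<le> root 4 (1 / mK n) * nrm 2 (cm A) v"
proof -
  have [measurable]: "v \<in> borel_measurable borel" using Lp_measurable[OF v] by simp
  let ?N = "nrm 2 (cm A) v"
  have b: "(v x)\<^sup>2 \<le> ?N\<^sup>2 / mK n" if x: "x \<in> cell A" for x
  proof -
    have "ennreal (mK n * (v x)\<^sup>2) = (\<integral>\<^sup>+y. ennreal ((v x)\<^sup>2) * indicator (K n x) y \<partial>lborel)"
      using mK_pos[of n] by (subst nn_integral_cmult_indicator) (simp_all add: emeasure_K ennreal_mult mult.commute)
    also have "\<dots> = (\<integral>\<^sup>+y. indicator (K n x) y * ennreal ((v y)\<^sup>2) \<partial>lborel)"
      using c[of _ x] by (intro nn_integral_cong) (auto simp: indicator_def)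
    also have "\<dots> \<le> ennreal (?N\<^sup>2)"
      using nn_integral_K_le[OF x, of v n] nn_integral_L2_square[OF v] by simp
    finally show ?thesis using mK_pos[of n] by (simp add: field_simps)
  qed
  have p: "\<bar>v x\<bar> ^ 4 = (v x)\<^sup>2 * (v x)\<^sup>2" for x by (simp add: power2_eq_square power4_eq_xxxx)
  have i2: "integrable (cm A) (\<lambda>x. (v x)\<^sup>2)" using Lp_integrable[OF v] by simp
  have ae: "AE x in cm A. \<bar>v x\<bar> ^ 4 \<le> ?N\<^sup>2 / mK n * (v x)\<^sup>2"
    using AE_cm_cell by eventually_elim (unfold p, intro mult_right_mono b, auto)
  have i4: "integrable (cm A) (\<lambda>x. \<bar>v x\<bar> ^ 4)"
    by (rule Bochner_Integration.integrable_bound[OF integrable_mult_right[OF i2, of "?N\<^sup>2 / mK n"]])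
      (use ae mK_pos[of n] in \<open>auto simp: abs_mult\<close>)
  then show "v \<in> Lp 4 (cm A)" by (simp add: Lp_def)
  have "(LINT x|cm A. \<bar>v x\<bar> ^ 4) \<le> (LINT x|cm A. ?N\<^sup>2 / mK n * (v x)\<^sup>2)"
    using ae i2 i4 by (intro integral_mono_AE) auto
  also have "\<dots> = ?N\<^sup>2 / mK n * ?N\<^sup>2" by (simp add: nrm_power2)
  also have "\<dots> = (root 4 (1 / mK n) * ?N) ^ 4"
  proof -
    have "root 4 (1 / mK n) ^ 4 = 1 / mK n" using mK_pos[of n] by simp
    moreover have "?N\<^sup>2 * ?N\<^sup>2 = ?N ^ 4" by (simp flip: power_add)
    ultimately show ?thesis by (simp add: power_mult_distrib)
  qed
  finally show "nrm 4 (cm A) v \<le> root 4 (1 / mK n) * ?N"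
    using mK_pos[of n] by (intro nrm_le) auto
qed

text \<open>Successive averages differ by \<open>O (2\<^sup>-\<^sup>n)\<close> in \<open>L\<^sup>2\<close>, and on functions constant on subcells of volume \<open>8\<^sup>-\<^sup>n\<close> the \<open>L\<^sup>4\<close>
  norm costs a factor \<open>8\<^bsup>n/4\<^esup>\<close>. The product decays like \<open>\<theta>\<^sup>n\<close>, which is what makes dimension three subcritical.\<close>

definition \<theta> :: real where "\<theta> = root 4 8 / 2"

lemma theta_bounds: "0 < \<theta>" "\<theta> < 1"
proof -
  show "0 < \<theta>" by (simp add: \<theta>_def)
  have "root 4 8 < root 4 (2 ^ 4)" by (subst real_root_less_iff) auto
  then show "\<theta> < 1" by (simp add: \<theta>_def real_root_power_cancel)
qed

text \<open>Here \<open>2 * Cp\<close> bounds the sum of two consecutive L2 errors,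
  \<open>root 4 (8 / vol)\<close> is what \<open>mK (Suc j)\<close> contributes beyond the power of
  \<theta>, and 1 / (1 - \<theta>) sums the geometric series.\<close>

definition C4 :: real where "C4 = root 4 (8 / vol) * 2 * Cp / (1 - \<theta>)"

lemma C4_nonneg: "0 \<le> C4"
  using theta_bounds vol_pos Cp_nonneg by (simp add: C4_def)

lemma Lp2_avg:
  assumes u: "u \<in> L2per A" and g: "has_grad A u g"
  shows "avg n u \<in> Lp 2 (cm A)"
  using Lp_diff[OF L2per_Lp[OF u] poincare_avg(1)[OF u g, of n]] by simp

text \<open>The bound is a difference of powers so that the induction telescopes exactly: step j
  costs the gradient norm times C4 * (1 - \<theta>) * \<theta> ^ j, and (1 - \<theta>) * \<theta> ^
  j is the difference of two consecutive powers.\<close>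

lemma avg_telescope:
  assumes u: "u \<in> L2per A" and g: "has_grad A u g"
  shows "(\<lambda>x. avg (n + k) u x - avg n u x) \<in> Lp 4 (cm A) \<and>
    nrm 4 (cm A) (\<lambda>x. avg (n + k) u x - avg n u x) \<le> C4 * sqrt (gn2 g) * (\<theta> ^ n - \<theta> ^ (n + k))"
proof (induction k)
  case (Suc k)
  let ?s = "sqrt (gn2 g)"
  define j where "j = n + k"
  define v where "v x = avg (Suc j) u x - avg j u x" for x
  have v2: "v \<in> Lp 2 (cm A)" unfolding v_def[abs_def] by (intro Lp_diff Lp2_avg[OF u g])
  have "nrm 2 (cm A) v \<le> nrm 2 (cm A) (\<lambda>x. u x - avg (Suc j) u x) + nrm 2 (cm A) (\<lambda>x. u x - avg j u x)"
    unfolding v_def[abs_def]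
    using nrm_triangle_mid[OF _ Lp2_avg[OF u g] L2per_Lp[OF u] Lp2_avg[OF u g], of "Suc j" j]
    by (simp add: nrm_minus_commute[of 2 _ u])
  also have "\<dots> \<le> Cp * (1/2) ^ Suc j * ?s + Cp * (1/2) ^ j * ?s"
    by (intro add_mono poincare_avg(2)[OF u g])
  also have "\<dots> \<le> 2 * Cp * (1/2) ^ j * ?s" using Cp_nonneg gn2_nonneg[of g] by simp
  finally have n2: "nrm 2 (cm A) v \<le> 2 * Cp * (1/2) ^ j * ?s" .
  \<comment> \<open>A subcell of level \<open>Suc j\<close> lies in one of level \<open>j\<close>,
    so both averages are constant on it.\<close>
  have cst: "v y = v x" if "y \<in> K (Suc j) x" for x y
    using that K_Suc_subset[of j x] by (auto simp: v_def avg_const_on_K)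
  note L = L4_of_piecewise_constant[OF v2, of "Suc j", OF cst]
  have r: "root 4 (1 / mK (Suc j)) = root 4 (8 / vol) * (root 4 8) ^ j"
    by (simp add: mK_def real_root_mult[symmetric] real_root_power[symmetric])
  have "nrm 4 (cm A) v \<le> root 4 (1 / mK (Suc j)) * (2 * Cp * (1/2) ^ j * ?s)"
    using mK_pos[of "Suc j"] by (intro order_trans[OF L(2) mult_left_mono[OF n2]] real_root_ge_zero) auto
  also have "\<dots> = (root 4 (8 / vol) * 2 * Cp) * ?s * \<theta> ^ j"
    unfolding r by (simp add: \<theta>_def power_divide)
  also have "root 4 (8 / vol) * 2 * Cp = C4 * (1 - \<theta>)"
    using theta_bounds by (simp add: C4_def)
  finally have n4: "nrm 4 (cm A) v \<le> C4 * ?s * (\<theta> ^ j - \<theta> ^ Suc j)" by (simp add: algebra_simps)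
  have e: "avg (n + Suc k) u x - avg n u x = (avg (n + k) u x - avg n u x) + v x" for x
    by (simp add: v_def j_def)
  have "nrm 4 (cm A) (\<lambda>x. (avg (n + k) u x - avg n u x) + v x) \<le> C4 * ?s * (\<theta> ^ n - \<theta> ^ (n + k)) + C4 * ?s * (\<theta> ^ j - \<theta> ^ Suc j)"
    using nrm_triangle[of 4 "\<lambda>x. avg (n + k) u x - avg n u x" "cm A" v] Suc L(1) n4 by simp
  also have "\<dots> = C4 * ?s * (\<theta> ^ n - \<theta> ^ (n + Suc k))" by (simp add: j_def algebra_simps)
  finally show ?case unfolding e using Suc L(1) by (auto intro: Lp_add)
qed simp

text \<open>The bound of \<open>avg_telescope\<close> is uniform in \<open>k\<close>. The averages
  tend to \<open>u\<close> in L2, hence almost everywhere along a subsequence, and Fatou carries the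
  bound to the limit.\<close>

lemma L4_approx:
  assumes u: "u \<in> L2per A" and g: "has_grad A u g"
  shows "(\<lambda>x. u x - avg n u x) \<in> Lp 4 (cm A)"
    "nrm 4 (cm A) (\<lambda>x. u x - avg n u x) \<le> C4 * \<theta> ^ n * sqrt (gn2 g)"
proof -
  have [measurable]: "u \<in> borel_measurable borel" using u by (rule L2per_measurable)
  have "(\<lambda>k. nrm 2 (cm A) (\<lambda>x. avg (n + k) u x - u x)) \<longlonglongrightarrow> 0"
  proof (rule tendsto_sandwich[OF _ _ tendsto_const])
    show "\<forall>\<^sub>F k in sequentially. nrm 2 (cm A) (\<lambda>x. avg (n + k) u x - u x) \<le> (Cp * (1/2) ^ n * sqrt (gn2 g)) * (1/2) ^ k"
      using poincare_avg(2)[OF u g, of "n + _"]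
      by (intro always_eventually allI) (simp add: nrm_minus_commute[of 2 _ _ u] power_add mult_ac)
    show "(\<lambda>k. (Cp * (1/2) ^ n * sqrt (gn2 g)) * (1/2) ^ k) \<longlonglongrightarrow> 0"
      by (intro tendsto_mult_right_zero LIMSEQ_power_zero) simp
  qed simp
  from cm.L2_tendsto_AE_subseq[OF Lp2_avg[OF u g] L2per_Lp[OF u] this]
  obtain r where r: "strict_mono r" "AE x in cm A. (\<lambda>k. avg (n + r k) u x) \<longlonglongrightarrow> u x" by blast
  have l: "AE x in cm A. (\<lambda>k. avg (n + r k) u x - avg n u x) \<longlonglongrightarrow> u x - avg n u x"
    using r(2) by eventually_elim (intro tendsto_intros)
  have b: "nrm 4 (cm A) (\<lambda>x. avg (n + r k) u x - avg n u x) \<le> C4 * \<theta> ^ n * sqrt (gn2 g)" for k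
  proof -
    have "C4 * sqrt (gn2 g) * (\<theta> ^ n - \<theta> ^ (n + r k)) \<le> C4 * sqrt (gn2 g) * \<theta> ^ n"
      using theta_bounds C4_nonneg gn2_nonneg[of g] by (intro mult_left_mono) auto
    then show ?thesis using avg_telescope[OF u g, of n "r k"] by (simp add: mult_ac)
  qed
  have "(\<lambda>x. u x - avg n u x) \<in> borel_measurable (cm A)" by measurable
  from Lp_Fatou[OF _ _ this l, of 4 "C4 * \<theta> ^ n * sqrt (gn2 g)"] avg_telescope[OF u g, of n] b
  show "(\<lambda>x. u x - avg n u x) \<in> Lp 4 (cm A)"
    "nrm 4 (cm A) (\<lambda>x. u x - avg n u x) \<le> C4 * \<theta> ^ n * sqrt (gn2 g)"
    by auto
qed

text \<open>The pointwise bound of \<open>avg_bound\<close>, measured in L4 over a set of volume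
  \<open>vol\<close>; it grows with \<open>n\<close>.\<close>

definition D4 :: "nat \<Rightarrow> real" where "D4 n = root 4 vol / sqrt (mK n)"

lemma D4_nonneg: "0 \<le> D4 n"
  using vol_pos mK_pos[of n] by (simp add: D4_def)

lemma avg_L4:
  assumes u: "u \<in> L2per A"
  shows "avg n u \<in> Lp 4 (cm A)" "nrm 4 (cm A) (avg n u) \<le> D4 n * nrm 2 (cm A) u"
proof -
  have [measurable]: "u \<in> borel_measurable borel" using u by (rule L2per_measurable)
  let ?c = "nrm 2 (cm A) u / sqrt (mK n)"
  have ae: "AE x in cm A. \<bar>avg n u x\<bar> ^ 4 \<le> ?c ^ 4"
    using AE_cm_cell
  proof eventually_elim
    case (elim x)
    have "\<bar>avg n u x\<bar> \<le> ?c" using avg_bound[OF u elim, of n] mK_pos[of n] by (simp add: field_simps)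
    then show ?case by (rule power_mono) simp
  qed
  have i: "integrable (cm A) (\<lambda>x. \<bar>avg n u x\<bar> ^ 4)"
    by (rule Bochner_Integration.integrable_bound[OF cm.integrable_const[of "?c ^ 4"]]) (use ae in auto)
  then show "avg n u \<in> Lp 4 (cm A)" by (simp add: Lp_def)
  have "(LINT x|cm A. \<bar>avg n u x\<bar> ^ 4) \<le> (LINT x|cm A. ?c ^ 4)"
    using ae i by (intro integral_mono_AE) auto
  also have "\<dots> = vol * ?c ^ 4" by (simp add: measure_cm)
  also have "\<dots> = (D4 n * nrm 2 (cm A) u) ^ 4"
    using vol_pos by (simp add: D4_def power_mult_distrib power_divide)
  finally show "nrm 4 (cm A) (avg n u) \<le> D4 n * nrm 2 (cm A) u"
    using D4_nonneg by (intro nrm_le) auto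
qed

text \<open>The free \<open>n\<close> balances the two terms: the coefficient of the gradient norm
  can be made as small as desired at the price of a large \<open>D4 n\<close>.\<close>

lemma H1_L4:
  assumes u: "u \<in> L2per A" and g: "has_grad A u g"
  shows "u \<in> Lp 4 (cm A)" "nrm 4 (cm A) u \<le> C4 * \<theta> ^ n * sqrt (gn2 g) + D4 n * nrm 2 (cm A) u"
  using Lp_add[OF L4_approx(1)[OF u g] avg_L4(1)[OF u], of n n]
    nrm_triangle[OF _ L4_approx(1)[OF u g] avg_L4(1)[OF u], of n n] L4_approx(2)[OF u g, of n] avg_L4(2)[OF u, of n]
  by auto

end

section \<open>Compactness and lower semicontinuity\<close>

context bravais begin

lemma L2per_diff: "u \<in> L2per A \<Longrightarrow> v \<in> L2per A \<Longrightarrow> (\<lambda>x. u x - v x) \<in> L2per A"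
  using L2per_add[OF _ L2per_mult, of u v "-1"] by simp

lemma L2per_Cauchy_limit:
  assumes u: "\<And>n. u n \<in> L2per A"
    and C: "\<And>e. 0 < e \<Longrightarrow> \<exists>N. \<forall>m\<ge>N. \<forall>n\<ge>N. nrm 2 (cm A) (\<lambda>x. u m x - u n x) < e"
  obtains r v where "strict_mono (r :: nat \<Rightarrow> nat)" "AE x in cm A. (\<lambda>n. u (r n) x) \<longlonglongrightarrow> v x"
    "v \<in> L2per A" "(\<lambda>n. nrm 2 (cm A) (\<lambda>x. u n x - v x)) \<longlonglongrightarrow> 0"
proof -
  obtain r where r: "strict_mono (r :: nat \<Rightarrow> nat)" "AE x in cm A. convergent (\<lambda>n. u (r n) x)"
    using cm.L2_Cauchy_AE_subseq[of u] L2per_Lp[OF u] C by blast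
  define v where "v x = lim (\<lambda>n. u (r n) x)" for x
  have [measurable]: "u n \<in> borel_measurable borel" for n using u by (rule L2per_measurable)
  have vm: "v \<in> borel_measurable (cm A)" unfolding v_def[abs_def] by measurable
  have l: "AE x in cm A. (\<lambda>n. u (r n) x) \<longlonglongrightarrow> v x"
    using r(2) by eventually_elim (simp add: v_def convergent_LIMSEQ_iff)
  note c = Lp_Cauchy_limit[OF _ L2per_Lp[OF u] C r(1) vm l]
  have "periodic A v"
    using L2per_periodic[OF u] by (simp add: periodic_def v_def)
  then have "v \<in> L2per A" using c(1) by (simp add: L2per_iff)
  with r(1) l c(2) show thesis by (intro that) auto
qed

text \<open>The averages of level \<open>n\<close> on the cell are determined by their values at
  corner points, of which there are countably many over all levels, so a diagonal subsequence makes
  them converge for all \<open>n\<close> and \<open>i\<close> at once. \<open>L4_approx\<close>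
  bounds the distance to the averages uniformly along the sequence, hence the subsequence is Cauchy
  in L4.\<close>

lemma L4_compactness:
  fixes u :: "nat \<Rightarrow> 'i::finite \<Rightarrow> real^3 \<Rightarrow> real"
  assumes u: "\<And>k i. u k i \<in> L2per A" and g: "\<And>k i. has_grad A (u k i) (g k i)"
    and R: "\<And>k i. nrm 2 (cm A) (u k i) \<le> R" and L: "\<And>k i. gn2 (g k i) \<le> L"
  obtains r v where "strict_mono (r :: nat \<Rightarrow> nat)" "\<And>i. v i \<in> L2per A" "\<And>i. v i \<in> Lp 4 (cm A)"
    "\<And>i. (\<lambda>k. nrm 4 (cm A) (\<lambda>x. u (r k) i x - v i x)) \<longlonglongrightarrow> 0"
proof -
  have [measurable]: "u k i \<in> borel_measurable borel" for k i using u by (rule L2per_measurable)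
  \<comment> \<open>The lower corner of the subcell with index \<open>j\<close>, used as its
    representative point.\<close>
  define P where "P n j = A *v (\<chi> l. of_int (j $ l) / 2 ^ n)" for n :: nat and j :: "int^3"
  have KP: "P n (q n x) \<in> K n x" for n x
    by (simp add: P_def K_def q_def vec_eq_iff)
  \<comment> \<open>With the factor \<open>sqrt (mK n)\<close> these sequences obey one common bound
    \<open>R\<close> at all levels, as the diagonal extraction requires.\<close>
  define c where "c k = (\<lambda>(i, n, j). sqrt (mK n) * avg n (u k i) (P n j))" for k
  define T where "T = {(i :: 'i, n, j). P n j \<in> cell A}"
  have cR: "norm (c k z) \<le> R" if z: "z \<in> T" for k z
  proof -
    obtain i n j where ij: "z = (i, n, j)" "P n j \<in> cell A" using z by (auto simp: T_def)
    have "norm (c k z) = sqrt (mK n) * \<bar>avg n (u k i) (P n j)\<bar>"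
      using mK_pos[of n] by (simp add: ij(1) c_def abs_mult)
    also have "\<dots> \<le> R" using avg_bound[OF u ij(2)] R by (rule order_trans)
    finally show ?thesis .
  qed
  obtain r where r: "strict_mono (r :: nat \<Rightarrow> nat)" "\<And>z. z \<in> T \<Longrightarrow> \<exists>l. (\<lambda>k. c (r k) z) \<longlonglongrightarrow> l"
    by (rule function_convergent_subsequence[OF countableI_type[of T] cR], assumption) (rule that)
  have conv: "convergent (\<lambda>k. avg n (u (r k) i) x)" if x: "x \<in> cell A" for n i x
  proof -
    have "(i, n, q n x) \<in> T" using KP[of n x] K_subset_cell[OF x, of n] by (auto simp: T_def)
    from r(2)[OF this] obtain l where "(\<lambda>k. sqrt (mK n) * avg n (u (r k) i) (P n (q n x))) \<longlonglongrightarrow> l"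
      by (auto simp: c_def)
    then have "(\<lambda>k. sqrt (mK n) * avg n (u (r k) i) x) \<longlonglongrightarrow> l"
      by (simp add: avg_const_on_K[OF KP])
    from tendsto_mult_left[OF this, of "1 / sqrt (mK n)"] show ?thesis
      using mK_pos[of n] by (auto simp: convergent_def)
  qed
  define a where "a n i x = lim (\<lambda>k. avg n (u (r k) i) x)" for n i x
  have [measurable]: "a n i \<in> borel_measurable borel" for n i
    unfolding a_def[abs_def] by measurable
  have lim: "(\<lambda>k. avg n (u (r k) i) x) \<longlonglongrightarrow> a n i x" if "x \<in> cell A" for n i x
    using conv[OF that] by (simp add: a_def convergent_LIMSEQ_iff)
  have R0: "0 \<le> R" using order_trans[OF nrm_nonneg R] .
  have ab: "\<bar>avg n (u k i) x\<bar> \<le> R / sqrt (mK n)" if "x \<in> cell A" for n k i x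
    using avg_bound[OF u that, of n k i] R[of k i] mK_pos[of n] by (simp add: field_simps)
  have an: "a n i \<in> Lp 4 (cm A) \<and> (\<lambda>k. nrm 4 (cm A) (\<lambda>x. avg n (u (r k) i) x - a n i x)) \<longlonglongrightarrow> 0" for n i
  proof -
    let ?B = "R / sqrt (mK n)"
    have al: "\<bar>a n i x\<bar> \<le> ?B" if "x \<in> cell A" for x
      by (rule LIMSEQ_le_const2[OF tendsto_rabs[OF lim[OF that]]]) (use ab[OF that] in blast)
    have "a n i \<in> Lp 4 (cm A)"
      unfolding Lp_def
    proof (intro CollectI conjI)
      have "AE x in cm A. \<bar>a n i x\<bar> ^ 4 \<le> ?B ^ 4"
        using AE_cm_cell by eventually_elim (intro power_mono al, auto)
      then show "integrable (cm A) (\<lambda>x. \<bar>a n i x\<bar> ^ 4)"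
        by (intro Bochner_Integration.integrable_bound[OF cm.integrable_const[of "?B ^ 4"]]) (auto elim!: eventually_mono)
    qed measurable
    moreover have "(\<lambda>k. LINT x|cm A. \<bar>avg n (u (r k) i) x - a n i x\<bar> ^ 4) \<longlonglongrightarrow> (LINT x|cm A. 0)"
    proof (rule integral_dominated_convergence[where w="\<lambda>x. (2 * ?B) ^ 4"])
      show "AE x in cm A. (\<lambda>k. \<bar>avg n (u (r k) i) x - a n i x\<bar> ^ 4) \<longlonglongrightarrow> 0"
        using AE_cm_cell
      proof eventually_elim
        case (elim x)
        have "(\<lambda>k. \<bar>avg n (u (r k) i) x - a n i x\<bar> ^ 4) \<longlonglongrightarrow> \<bar>a n i x - a n i x\<bar> ^ 4"
          by (intro tendsto_intros lim elim)
        then show ?case by simp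
      qed
      show "AE x in cm A. norm (\<bar>avg n (u (r k) i) x - a n i x\<bar> ^ 4) \<le> (2 * ?B) ^ 4" for k
        using AE_cm_cell
      proof eventually_elim
        case (elim x)
        have "\<bar>avg n (u (r k) i) x - a n i x\<bar> \<le> 2 * ?B" using ab[OF elim, of n "r k" i] al[OF elim] by linarith
        then have "\<bar>avg n (u (r k) i) x - a n i x\<bar> ^ 4 \<le> (2 * ?B) ^ 4" by (rule power_mono) simp
        then show ?case by simp
      qed
    qed auto
    then have "(\<lambda>k. root 4 (LINT x|cm A. \<bar>avg n (u (r k) i) x - a n i x\<bar> ^ 4)) \<longlonglongrightarrow> root 4 0"
      by (intro tendsto_real_root) simp
    ultimately show ?thesis by (simp add: nrm_def)
  qed
  have L0: "0 \<le> L" using order_trans[OF gn2_nonneg L] .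
  have C4: "\<exists>N. \<forall>k\<ge>N. \<forall>l\<ge>N. nrm 4 (cm A) (\<lambda>x. u (r k) i x - u (r l) i x) < e" if e: "0 < e" for e i
  proof -
    \<comment> \<open>First a level \<open>n\<close> is fixed whose error is small uniformly in the
      sequence, then the convergence of the averages of that level is used. Two members differ by
      four errors of size below e / 4.\<close>
    have "(\<lambda>n. C4 * sqrt L * \<theta> ^ n) \<longlonglongrightarrow> C4 * sqrt L * 0"
      using theta_bounds by (intro tendsto_intros LIMSEQ_power_zero) simp
    then have "\<forall>\<^sub>F n in sequentially. C4 * sqrt L * \<theta> ^ n < e / 4"
      using e by (intro order_tendstoD) auto
    then obtain n where n: "C4 * sqrt L * \<theta> ^ n < e / 4" by (meson eventually_happens trivial_limit_sequentially)
    have A: "nrm 4 (cm A) (\<lambda>x. u k i x - avg n (u k i) x) < e / 4" for k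
    proof -
      have "C4 * \<theta> ^ n * sqrt (gn2 (g k i)) \<le> C4 * \<theta> ^ n * sqrt L"
        using C4_nonneg theta_bounds L[of k i] by (intro mult_left_mono) auto
      then show ?thesis using L4_approx(2)[OF u g, of k i n] n by (simp add: mult_ac)
    qed
    have "\<forall>\<^sub>F k in sequentially. nrm 4 (cm A) (\<lambda>x. avg n (u (r k) i) x - a n i x) < e / 4"
      using an[of n i] e by (intro order_tendstoD) auto
    then obtain N where N: "\<And>k. k \<ge> N \<Longrightarrow> nrm 4 (cm A) (\<lambda>x. avg n (u (r k) i) x - a n i x) < e / 4"
      by (auto simp: eventually_sequentially)
    have "nrm 4 (cm A) (\<lambda>x. u (r k) i x - u (r l) i x) < e" if "k \<ge> N" "l \<ge> N" for k l
    proof -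
      have M: "u (r k) i \<in> Lp 4 (cm A)" "avg n (u (r k) i) \<in> Lp 4 (cm A)" "a n i \<in> Lp 4 (cm A)" for k
        using H1_L4(1)[OF u g] avg_L4(1)[OF u] an by auto
      have h: "nrm 4 (cm A) (\<lambda>x. u (r k) i x - a n i x) < e / 2" if "k \<ge> N" for k
        using nrm_triangle_mid[of 4, OF _ M(1) M(2) M(3), of k k] A[of "r k"] N[OF that] by simp
      show ?thesis
        using nrm_triangle_mid[of 4, OF _ M(1) M(3) M(1), of k l] h[OF \<open>k \<ge> N\<close>] h[OF \<open>l \<ge> N\<close>]
          nrm_minus_commute[of 4 "cm A" "u (r l) i" "a n i"] by simp
    qed
    then show ?thesis by blast
  qed
  have ev: "\<exists>v. v \<in> L2per A \<and> v \<in> Lp 4 (cm A) \<and> (\<lambda>k. nrm 4 (cm A) (\<lambda>x. u (r k) i x - v x)) \<longlonglongrightarrow> 0" for i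
  proof -
    let ?c = "root 4 vol"
    have c: "0 < ?c" using vol_pos by simp
    have m4: "u (r k) i \<in> Lp 4 (cm A)" for k using H1_L4(1)[OF u g] .
    \<comment> \<open>An almost everywhere limit that is also periodic is obtained in L2;
      \<open>Lp_Cauchy_limit\<close> then shows that the same function is the limit in L4.\<close>
    have C2: "\<exists>N. \<forall>k\<ge>N. \<forall>l\<ge>N. nrm 2 (cm A) (\<lambda>x. u (r k) i x - u (r l) i x) < e" if e: "0 < e" for e
    proof -
      obtain N where N: "\<forall>k\<ge>N. \<forall>l\<ge>N. nrm 4 (cm A) (\<lambda>x. u (r k) i x - u (r l) i x) < e / ?c"
        using C4[of "e / ?c" i] e c by auto
      have "nrm 2 (cm A) (\<lambda>x. u (r k) i x - u (r l) i x) < e" if "k \<ge> N" "l \<ge> N" for k l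
      proof -
        have "nrm 2 (cm A) (\<lambda>x. u (r k) i x - u (r l) i x) \<le> ?c * nrm 4 (cm A) (\<lambda>x. u (r k) i x - u (r l) i x)"
          using cm.L4_imp_L2(2)[OF Lp_diff[OF m4 m4], of k l] by (simp add: measure_cm)
        also have "\<dots> < ?c * (e / ?c)" using N that c by (intro mult_strict_left_mono) auto
        also have "\<dots> = e" using c by simp
        finally show ?thesis .
      qed
      then show ?thesis by blast
    qed
    obtain s v where s: "strict_mono (s :: nat \<Rightarrow> nat)" "AE x in cm A. (\<lambda>n. u (r (s n)) i x) \<longlonglongrightarrow> v x" "v \<in> L2per A"
      and "(\<lambda>n. nrm 2 (cm A) (\<lambda>x. u (r n) i x - v x)) \<longlonglongrightarrow> 0"
      by (rule L2per_Cauchy_limit[of "\<lambda>k. u (r k) i", OF u C2], assumption) (rule that)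
    have "v \<in> borel_measurable (cm A)" using L2per_measurable[OF s(3)] by simp
    from Lp_Cauchy_limit[of 4 "\<lambda>k. u (r k) i", OF _ m4 C4 s(1) this s(2)] s(3) show ?thesis by auto
  qed
  obtain v where v: "\<forall>i. v i \<in> L2per A \<and> v i \<in> Lp 4 (cm A) \<and> (\<lambda>k. nrm 4 (cm A) (\<lambda>x. u (r k) i x - v i x)) \<longlonglongrightarrow> 0"
    by (rule exE[OF choice[OF allI[OF ev]]]) (rule that)
  show thesis by (rule that[of r v]) (use r(1) v in auto)
qed

text \<open>The integral runs over the whole space while the norm sees a single cell: the support is
  covered by finitely many translated cells, whence the factor \<open>N\<close> from
  \<open>periodic_locally_bounded\<close>.\<close>

lemma L2per_test_bounded:
  assumes \<phi>: "\<phi> \<in> borel_measurable borel" and R: "\<And>x. norm x > R \<Longrightarrow> \<phi> x = 0" and B: "\<And>x. \<bar>\<phi> x\<bar> \<le> B"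
  shows "\<exists>C. \<forall>v\<in>L2per A. \<bar>LINT x|lborel. \<phi> x * v x\<bar> \<le> C * nrm 2 (cm A) v"
proof -
  have B0: "0 \<le> B" using B[of 0] by linarith
  let ?S = "cball 0 R :: (real^3) set"
  have [measurable]: "?S \<in> sets borel" by simp
  obtain N :: nat where N: "\<And>h::real^3 \<Rightarrow> ennreal. h \<in> borel_measurable borel \<Longrightarrow> periodic A h \<Longrightarrow>
    (\<integral>\<^sup>+x. indicator ?S x * h x \<partial>lborel) \<le> of_nat N * (\<integral>\<^sup>+x. h x \<partial>cm A)"
    using periodic_locally_bounded[of ?S] bounded_cball by blast
  have "\<bar>LINT x|lborel. \<phi> x * v x\<bar> \<le> (B * N * sqrt vol) * nrm 2 (cm A) v" if v: "v \<in> L2per A" for v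
  proof -
    have [measurable]: "v \<in> borel_measurable borel" using v by (rule L2per_measurable)
    have "ennreal \<bar>LINT x|lborel. \<phi> x * v x\<bar> \<le> (\<integral>\<^sup>+x. ennreal \<bar>\<phi> x * v x\<bar> \<partial>lborel)"
      using integral_norm_bound_ennreal[OF L2per_integrable_test[OF v \<phi> R B]] by simp
    also have "\<dots> \<le> (\<integral>\<^sup>+x. ennreal B * (indicator ?S x * ennreal \<bar>v x\<bar>) \<partial>lborel)"
    proof (rule nn_integral_mono)
      fix x
      have "\<bar>\<phi> x\<bar> * \<bar>v x\<bar> \<le> B * \<bar>v x\<bar>" using B by (intro mult_right_mono) auto
      then show "ennreal \<bar>\<phi> x * v x\<bar> \<le> ennreal B * (indicator ?S x * ennreal \<bar>v x\<bar>)"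
        using R[of x] B0 by (cases "x \<in> ?S") (auto simp: abs_mult ennreal_mult[symmetric] ennreal_leI)
    qed
    also have "\<dots> = ennreal B * (\<integral>\<^sup>+x. indicator ?S x * ennreal \<bar>v x\<bar> \<partial>lborel)"
      by (rule nn_integral_cmult) measurable
    also have "\<dots> \<le> ennreal B * (of_nat N * (\<integral>\<^sup>+x. ennreal \<bar>v x\<bar> \<partial>cm A))"
      using L2per_periodic[OF v] by (intro mult_left_mono N) (auto simp: periodic_def)
    also have "(\<integral>\<^sup>+x. ennreal \<bar>v x\<bar> \<partial>cm A) = ennreal (LINT x|cm A. \<bar>v x\<bar>)"
      using cm.L2_imp_integrable(1)[OF L2per_Lp[OF v]] by (subst nn_integral_eq_integral) auto
    also have "ennreal B * (of_nat N * \<dots>) = ennreal (B * (real N * (LINT x|cm A. \<bar>v x\<bar>)))"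
      using B0 by (simp add: ennreal_mult Bochner_Integration.integral_nonneg ennreal_of_nat_eq_real_of_nat)
    finally have "\<bar>LINT x|lborel. \<phi> x * v x\<bar> \<le> B * (real N * (LINT x|cm A. \<bar>v x\<bar>))"
      using B0 by (subst (asm) ennreal_le_iff) (auto intro!: mult_nonneg_nonneg Bochner_Integration.integral_nonneg)
    also have "\<dots> \<le> B * (real N * (sqrt vol * nrm 2 (cm A) v))"
      using cm.L2_imp_integrable(2)[OF L2per_Lp[OF v]] B0 by (intro mult_left_mono) (auto simp: measure_cm)
    finally show ?thesis by (simp add: mult_ac)
  qed
  then show ?thesis by blast
qed

lemma L2per_test_tendsto:
  assumes \<phi>: "\<phi> \<in> borel_measurable borel" and R: "\<And>x. norm x > R \<Longrightarrow> \<phi> x = 0" and B: "\<And>x. \<bar>\<phi> x\<bar> \<le> B"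
    and u: "\<And>n. u n \<in> L2per A" and v: "v \<in> L2per A" and lim: "(\<lambda>n. nrm 2 (cm A) (\<lambda>x. u n x - v x)) \<longlonglongrightarrow> 0"
  shows "(\<lambda>n. LINT x|lborel. \<phi> x * u n x) \<longlonglongrightarrow> (LINT x|lborel. \<phi> x * v x)"
proof -
  obtain C where C: "\<And>v. v \<in> L2per A \<Longrightarrow> \<bar>LINT x|lborel. \<phi> x * v x\<bar> \<le> C * nrm 2 (cm A) v"
    using L2per_test_bounded[OF \<phi> R B] by blast
  have b: "norm ((LINT x|lborel. \<phi> x * u n x) - (LINT x|lborel. \<phi> x * v x)) \<le> C * nrm 2 (cm A) (\<lambda>x. u n x - v x)" for n
    using C[OF L2per_diff[OF u v], of n] L2per_integrable_test[OF u \<phi> R B] L2per_integrable_test[OF v \<phi> R B]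
    by (simp add: right_diff_distrib)
  have l: "(\<lambda>n. C * nrm 2 (cm A) (\<lambda>x. u n x - v x)) \<longlonglongrightarrow> 0"
    using tendsto_mult_left[OF lim, of C] by simp
  have "(\<lambda>n. (LINT x|lborel. \<phi> x * u n x) - (LINT x|lborel. \<phi> x * v x)) \<longlonglongrightarrow> 0"
    by (rule Lim_null_comparison[OF always_eventually l]) (rule allI, rule b)
  then show ?thesis by (simp add: LIM_zero_iff)
qed

text \<open>Closedness of the weak gradient: both sides of the tested identity pass to the limit by
  \<open>L2per_test_tendsto\<close>.\<close>

lemma has_grad_limit:
  assumes u: "\<And>n. u n \<in> L2per A" and v: "v \<in> L2per A" and lim: "(\<lambda>n. nrm 2 (cm A) (\<lambda>x. u n x - v x)) \<longlonglongrightarrow> 0"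
    and g: "\<And>n. has_grad A (u n) (g n)" and h: "\<And>i. (\<lambda>x. h x $ i) \<in> L2per A"
    and glim: "\<And>i. (\<lambda>n. nrm 2 (cm A) (\<lambda>x. g n x $ i - h x $ i)) \<longlonglongrightarrow> 0"
  shows "has_grad A v h"
  unfolding weak_grad_iff_inner[OF v h]
proof (intro allI impI)
  fix \<eta> G z assume t: "test_fun \<eta> G"
  obtain R where R: "\<And>x. norm x > R \<Longrightarrow> \<eta> x = 0 \<and> G x = 0" using test_fun_facts(3)[OF t] by blast
  obtain B where B: "\<And>x. \<bar>\<eta> x\<bar> \<le> B \<and> norm (G x) \<le> B" using test_fun_facts(4)[OF t] by blast
  note [measurable] = test_fun_measurable[OF t]
  have gi: "(\<lambda>x. g n x $ i) \<in> L2per A" for n i using g by (simp add: has_grad_def)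
  have Bz: "\<bar>G x \<bullet> z\<bar> \<le> B * norm z" for x
    using Cauchy_Schwarz_ineq2[of "G x" z] B[of x] mult_right_mono[of "norm (G x)" B "norm z"] by simp
  have 1: "(\<lambda>n. LINT x|lborel. (G x \<bullet> z) * u n x) \<longlonglongrightarrow> (LINT x|lborel. (G x \<bullet> z) * v x)"
    using R Bz by (intro L2per_test_tendsto[OF _ _ _ u v lim, of _ R "B * norm z"]) auto
  have "(\<lambda>n. \<Sum>i\<in>UNIV. z $ i * (LINT x|lborel. \<eta> x * g n x $ i)) \<longlonglongrightarrow> (\<Sum>i\<in>UNIV. z $ i * (LINT x|lborel. \<eta> x * h x $ i))"
    using R B by (intro tendsto_intros L2per_test_tendsto[OF _ _ _ gi h glim, of _ R B]) auto
  moreover have "(\<Sum>i\<in>UNIV. z $ i * (LINT x|lborel. \<eta> x * k x $ i)) = (LINT x|lborel. \<eta> x * (k x \<bullet> z))"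
    if k: "\<And>i. (\<lambda>x. k x $ i) \<in> L2per A" for k
  proof -
    have "(LINT x|lborel. \<eta> x * (k x \<bullet> z)) = (LINT x|lborel. (\<Sum>i\<in>UNIV. z $ i * (\<eta> x * k x $ i)))"
      by (simp add: inner_vec_def sum_distrib_left mult_ac)
    also have "\<dots> = (\<Sum>i\<in>UNIV. LINT x|lborel. z $ i * (\<eta> x * k x $ i))"
      using test_fun_integrable(3)[OF t k] by (intro Bochner_Integration.integral_sum integrable_mult_right)
    finally show ?thesis by simp
  qed
  ultimately have 2: "(\<lambda>n. LINT x|lborel. \<eta> x * (g n x \<bullet> z)) \<longlonglongrightarrow> (LINT x|lborel. \<eta> x * (h x \<bullet> z))"
    using gi h by simp
  have "(LINT x|lborel. (G x \<bullet> z) * u n x) = - (LINT x|lborel. \<eta> x * (g n x \<bullet> z))" for n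
    using weak_grad_inner[OF u g t, of n z] by (simp add: mult.commute)
  with 1 tendsto_minus[OF 2] show "(LINT x|lborel. v x * (G x \<bullet> z)) = - (LINT x|lborel. \<eta> x * (h x \<bullet> z))"
    by (metis (no_types, lifting) LIMSEQ_unique ext mult.commute)
qed

lemma has_grad_lincomb:
  assumes u: "u \<in> L2per A" "has_grad A u g" and v: "v \<in> L2per A" "has_grad A v h"
  shows "has_grad A (\<lambda>x. a * u x + b * v x) (\<lambda>x. a *\<^sub>R g x + b *\<^sub>R h x)"
proof -
  have gi: "(\<lambda>x. g x $ i) \<in> L2per A" "(\<lambda>x. h x $ i) \<in> L2per A" for i using u v by (auto simp: has_grad_def)
  have w: "(\<lambda>x. a * u x + b * v x) \<in> L2per A" by (intro L2per_add L2per_mult u v)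
  have k: "(\<lambda>x. (a *\<^sub>R g x + b *\<^sub>R h x) $ i) \<in> L2per A" for i
    using L2per_add[OF L2per_mult[OF gi(1)] L2per_mult[OF gi(2)], of a i b i] by simp
  show ?thesis
    unfolding weak_grad_iff_inner[OF w k]
  proof (intro allI impI)
    fix \<eta> G z assume t: "test_fun \<eta> G"
    have "(LINT x|lborel. (a * u x + b * v x) * (G x \<bullet> z)) = a * (LINT x|lborel. u x * (G x \<bullet> z)) + b * (LINT x|lborel. v x * (G x \<bullet> z))"
      using test_fun_integrable(4)[OF t u(1), of z] test_fun_integrable(4)[OF t v(1), of z]
      by (simp add: distrib_right mult.assoc)
    also have "\<dots> = - (a * (LINT x|lborel. \<eta> x * (g x \<bullet> z)) + b * (LINT x|lborel. \<eta> x * (h x \<bullet> z)))"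
      using weak_grad_inner[OF u t, of z] weak_grad_inner[OF v t, of z] by simp
    also have "a * (LINT x|lborel. \<eta> x * (g x \<bullet> z)) + b * (LINT x|lborel. \<eta> x * (h x \<bullet> z)) = (LINT x|lborel. a * (\<eta> x * (g x \<bullet> z)) + b * (\<eta> x * (h x \<bullet> z)))"
      using test_fun_integrable(3)[OF t L2per_inner[OF gi(1)], of z] test_fun_integrable(3)[OF t L2per_inner[OF gi(2)], of z] by simp
    finally show "(LINT x|lborel. (a * u x + b * v x) * (G x \<bullet> z)) = - (LINT x|lborel. \<eta> x * ((a *\<^sub>R g x + b *\<^sub>R h x) \<bullet> z))"
      by (simp add: inner_add_left distrib_left mult_ac)
  qed
qed

lemma gn2_sum:
  assumes "\<And>i. (\<lambda>x. g x $ i) \<in> L2per A"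
  shows "gn2 g = (\<Sum>i\<in>UNIV. (nrm 2 (cm A) (\<lambda>x. g x $ i))\<^sup>2)"
proof -
  have "gn2 g = (\<Sum>i\<in>UNIV. LINT x|cm A. g x $ i * g x $ i)"
    unfolding gn2_def inner_vec_def using L2_mult_integrable[OF L2per_Lp L2per_Lp, OF assms assms]
    by (subst Bochner_Integration.integral_sum) auto
  then show ?thesis by (simp add: nrm_power2 power2_eq_square[symmetric])
qed

lemma gn2_parallelogram:
  assumes g: "\<And>i. (\<lambda>x. g x $ i) \<in> L2per A" and h: "\<And>i. (\<lambda>x. h x $ i) \<in> L2per A"
  shows "gn2 (\<lambda>x. g x - h x) = 2 * gn2 g + 2 * gn2 h - 4 * gn2 (\<lambda>x. (1/2) *\<^sub>R g x + (1/2) *\<^sub>R h x)"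
proof -
  have e: "(a - b) \<bullet> (a - b) = 2 * (a \<bullet> a) + 2 * (b \<bullet> b) - 4 * (((1/2) *\<^sub>R a + (1/2) *\<^sub>R b) \<bullet> ((1/2) *\<^sub>R a + (1/2) *\<^sub>R b))" for a b :: "real^3"
    by (simp add: inner_add_left inner_add_right inner_diff_left inner_diff_right inner_commute)
  have m: "(\<lambda>x. ((1/2) *\<^sub>R g x + (1/2) *\<^sub>R h x) $ i) \<in> L2per A" for i
    using L2per_add[OF L2per_mult[OF g] L2per_mult[OF h], of "1/2" i "1/2" i] by simp
  show ?thesis
    unfolding gn2_def e using L2per_vec_integrable[OF g g] L2per_vec_integrable[OF h h] L2per_vec_integrable[OF m m]
    by simp
qed

text \<open>Instead of weak compactness: among all pairs \<open>(w, grad w)\<close> with \<open>w\<close> close to \<open>v\<close>, gradients of almost minimal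
  norm form a Cauchy sequence by the parallelogram identity.\<close>

lemma dirichlet_lsc:
  assumes u: "\<And>n. u n \<in> L2per A" and v: "v \<in> L2per A" and lim: "(\<lambda>n. nrm 2 (cm A) (\<lambda>x. u n x - v x)) \<longlonglongrightarrow> 0"
    and g: "\<And>n. has_grad A (u n) (g n)" and L: "\<And>n. gn2 (g n) \<le> L"
  shows "\<exists>h. has_grad A v h \<and> gn2 h \<le> L"
proof -
  \<comment> \<open>Convex sets of pairs that shrink with \<open>e\<close>. The infimum
    \<open>d e\<close> of the squared gradient norms grows as \<open>e\<close> decreases, and stays
    below \<open>L\<close> because members of the given sequence enter every set.\<close>
  define C where "C e = {(w, h). w \<in> L2per A \<and> has_grad A w h \<and> nrm 2 (cm A) (\<lambda>x. w x - v x) \<le> e}" for e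
  define S where "S e = (\<lambda>(w, h). gn2 h) ` C e" for e
  define d where "d e = Inf (S e)" for e
  have bb: "bdd_below (S e)" for e
    by (rule bdd_belowI[of _ 0]) (auto simp: S_def gn2_nonneg)
  have ex: "\<exists>y\<in>S e. y \<le> L" if "0 < e" for e
  proof -
    from order_tendstoD(2)[OF lim that] obtain n where "nrm 2 (cm A) (\<lambda>x. u n x - v x) < e"
      by (meson eventually_happens trivial_limit_sequentially)
    then have "(u n, g n) \<in> C e" using u g by (auto simp: C_def)
    then show ?thesis using L[of n] unfolding S_def by force
  qed
  define \<epsilon> where "\<epsilon> n = inverse (real (Suc n))" for n
  have eps: "0 < \<epsilon> n" for n by (simp add: \<epsilon>_def)
  have epslim: "\<epsilon> \<longlonglongrightarrow> 0" unfolding \<epsilon>_def[abs_def] by (rule LIMSEQ_inverse_real_of_nat)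
  have dL: "d (\<epsilon> n) \<le> L" for n
    using ex[OF eps] cInf_lower[OF _ bb] unfolding d_def by (meson order_trans)
  have anti: "\<epsilon> m \<le> \<epsilon> n" if "n \<le> m" for m n using that by (simp add: \<epsilon>_def)
  have mono: "d (\<epsilon> n) \<le> d (\<epsilon> m)" if "n \<le> m" for m n
  proof -
    have "S (\<epsilon> m) \<subseteq> S (\<epsilon> n)" using anti[OF that] unfolding S_def C_def by (intro image_mono) auto
    then show ?thesis unfolding d_def using ex[OF eps, of m] by (intro cInf_superset_mono bb) auto
  qed
  have "\<exists>w h. (w, h) \<in> C (\<epsilon> n) \<and> gn2 h < d (\<epsilon> n) + \<epsilon> n" for n
  proof -
    have "S (\<epsilon> n) \<noteq> {}" using ex[OF eps] by auto
    then obtain y where "y \<in> S (\<epsilon> n)" "y < d (\<epsilon> n) + \<epsilon> n"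
      using cInf_lessD[of "S (\<epsilon> n)" "d (\<epsilon> n) + \<epsilon> n"] eps[of n] unfolding d_def by auto
    then show ?thesis unfolding S_def by auto
  qed
  then obtain w h where wh: "\<And>n. (w n, h n) \<in> C (\<epsilon> n)" "\<And>n. gn2 (h n) < d (\<epsilon> n) + \<epsilon> n" by metis
  have w: "\<And>n. w n \<in> L2per A" and hg: "\<And>n. has_grad A (w n) (h n)" and wl: "\<And>n. nrm 2 (cm A) (\<lambda>x. w n x - v x) \<le> \<epsilon> n"
    using wh(1) by (auto simp: C_def)
  have hi: "(\<lambda>x. h n x $ i) \<in> L2per A" for n i using hg by (simp add: has_grad_def)
  have wlim: "(\<lambda>n. nrm 2 (cm A) (\<lambda>x. w n x - v x)) \<longlonglongrightarrow> 0"
    by (rule tendsto_sandwich[OF _ _ tendsto_const epslim]) (auto simp: wl)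
  have close: "gn2 (\<lambda>x. h n x - h m x) \<le> 2 * (d (\<epsilon> m) - d (\<epsilon> n)) + 4 * \<epsilon> n" if nm: "n \<le> m" for n m
  proof -
    \<comment> \<open>The midpoint of the two pairs lies again in the convex set for
      \<open>\<epsilon> n\<close>, so its squared gradient norm is at least
      \<open>d (\<epsilon> n)\<close>; the parallelogram identity turns this into closeness of the
      gradients.\<close>
    define wm where "wm x = (1/2) * w n x + (1/2) * w m x" for x
    define hm where "hm x = (1/2) *\<^sub>R h n x + (1/2) *\<^sub>R h m x" for x
    have wm: "wm \<in> L2per A" unfolding wm_def[abs_def] by (intro L2per_add L2per_mult w)
    have "has_grad A wm hm" unfolding wm_def[abs_def] hm_def[abs_def] by (intro has_grad_lincomb w hg)
    moreover have "nrm 2 (cm A) (\<lambda>x. wm x - v x) \<le> \<epsilon> n"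
    proof -
      have e: "(\<lambda>x. wm x - v x) = (\<lambda>x. (1/2) * (w n x - v x) + (1/2) * (w m x - v x))"
        by (auto simp: wm_def algebra_simps)
      have "nrm 2 (cm A) (\<lambda>x. wm x - v x) \<le> nrm 2 (cm A) (\<lambda>x. (1/2) * (w n x - v x)) + nrm 2 (cm A) (\<lambda>x. (1/2) * (w m x - v x))"
        unfolding e by (intro nrm_triangle Lp_mult Lp_diff L2per_Lp w v) simp
      also have "\<dots> = (1/2) * nrm 2 (cm A) (\<lambda>x. w n x - v x) + (1/2) * nrm 2 (cm A) (\<lambda>x. w m x - v x)"
        by (subst (1 2) nrm_mult) auto
      also have "\<dots> \<le> \<epsilon> n" using wl[of n] wl[of m] anti[OF nm] by linarith
      finally show ?thesis .
    qed
    ultimately have "gn2 hm \<in> S (\<epsilon> n)" using wm unfolding S_def C_def by force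
    then have "d (\<epsilon> n) \<le> gn2 hm" unfolding d_def by (rule cInf_lower[OF _ bb])
    moreover have "gn2 (\<lambda>x. h n x - h m x) = 2 * gn2 (h n) + 2 * gn2 (h m) - 4 * gn2 hm"
      unfolding hm_def[abs_def] by (rule gn2_parallelogram[OF hi hi])
    moreover have "X \<le> 2 * (dm - dn) + 4 * en"
      if "dn \<le> c" "X = 2 * a + 2 * b - 4 * c" "a < dn + en" "b < dm + em" "em \<le> en"
      for X a b c dn dm en em :: real using that by (simp add: algebra_simps)
    ultimately show ?thesis
      using wh(2)[of n] wh(2)[of m] anti[OF nm] by blast
  qed
  \<comment> \<open>A monotone bounded sequence, so the difference of infima in \<open>close\<close>
    becomes small.\<close>
  have "convergent (\<lambda>n. d (\<epsilon> n))"
    by (rule incseq_convergent[of "\<lambda>n. d (\<epsilon> n)" L]) (use dL mono in \<open>auto simp: incseq_def convergent_def\<close>)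
  then have dC: "Cauchy (\<lambda>n. d (\<epsilon> n))" by (rule convergent_Cauchy)
  have Cau: "\<exists>N. \<forall>m\<ge>N. \<forall>n\<ge>N. nrm 2 (cm A) (\<lambda>x. h m x $ i - h n x $ i) < e" if e: "0 < e" for e i
  proof -
    obtain N1 where N1: "\<And>m n. m \<ge> N1 \<Longrightarrow> n \<ge> N1 \<Longrightarrow> \<bar>d (\<epsilon> m) - d (\<epsilon> n)\<bar> < e\<^sup>2 / 8"
      using CauchyD[OF dC, of "e\<^sup>2 / 8"] e by auto
    obtain N2 where N2: "\<And>n. n \<ge> N2 \<Longrightarrow> \<epsilon> n < e\<^sup>2 / 8"
      using order_tendstoD(2)[OF epslim, of "e\<^sup>2 / 8"] e by (auto simp: eventually_sequentially)
    have le: "nrm 2 (cm A) (\<lambda>x. h n x $ i - h m x $ i) < e" if nm: "n \<le> m" "n \<ge> max N1 N2" for m n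
    proof -
      have "(nrm 2 (cm A) (\<lambda>x. (h n x - h m x) $ i))\<^sup>2 \<le> gn2 (\<lambda>x. h n x - h m x)"
      proof (subst gn2_sum)
        show "(\<lambda>x. (h n x - h m x) $ i) \<in> L2per A" for i using L2per_diff[OF hi hi] by simp
        show "(nrm 2 (cm A) (\<lambda>x. (h n x - h m x) $ i))\<^sup>2 \<le> (\<Sum>i\<in>UNIV. (nrm 2 (cm A) (\<lambda>x. (h n x - h m x) $ i))\<^sup>2)"
          by (rule member_le_sum) auto
      qed
      also have "\<dots> < e\<^sup>2"
      proof -
        have "d (\<epsilon> m) - d (\<epsilon> n) < e\<^sup>2 / 8"
          using nm by (intro le_less_trans[OF abs_ge_self N1]) auto
        moreover have "\<epsilon> n < e\<^sup>2 / 8" "0 < e\<^sup>2" using N2[of n] nm e by auto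
        moreover have "X < E" if "b - a < E / 8" "c < E / 8" "0 < E" "X \<le> 2 * (b - a) + 4 * c" for X E a b c :: real
          using that unfolding right_diff_distrib by linarith
        ultimately show ?thesis using close[OF nm(1)] by blast
      qed
      finally show ?thesis using e by (simp add: power2_less_imp_less)
    qed
    have "nrm 2 (cm A) (\<lambda>x. h m x $ i - h n x $ i) < e" if "m \<ge> max N1 N2" "n \<ge> max N1 N2" for m n
      using le[of n m] le[of m n] that nrm_minus_commute[of 2 "cm A" "\<lambda>x. h m x $ i" "\<lambda>x. h n x $ i"]
      by (cases "n \<le> m") auto
    then show ?thesis by blast
  qed
  have ek: "\<exists>k. k \<in> L2per A \<and> (\<lambda>n. nrm 2 (cm A) (\<lambda>x. h n x $ i - k x)) \<longlonglongrightarrow> 0" for i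
    by (rule L2per_Cauchy_limit[of "\<lambda>n x. h n x $ i", OF hi Cau], assumption) blast
  obtain k where k: "\<forall>i. k i \<in> L2per A \<and> (\<lambda>n. nrm 2 (cm A) (\<lambda>x. h n x $ i - k i x)) \<longlonglongrightarrow> 0"
    by (rule exE[OF choice[OF allI[OF ek]]]) (rule that)
  define H where "H x = (\<chi> i. k i x)" for x
  have H: "(\<lambda>x. H x $ i) \<in> L2per A" for i using k by (simp add: H_def)
  have Hl: "(\<lambda>n. nrm 2 (cm A) (\<lambda>x. h n x $ i - H x $ i)) \<longlonglongrightarrow> 0" for i using k by (simp add: H_def)
  have "has_grad A v H" by (rule has_grad_limit[OF w v wlim hg H Hl])
  moreover have "gn2 H \<le> L"
  proof -
    have nl: "(\<lambda>n. nrm 2 (cm A) (\<lambda>x. h n x $ i)) \<longlonglongrightarrow> nrm 2 (cm A) (\<lambda>x. H x $ i)" for i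
    proof (rule LIM_zero_cancel, rule Lim_null_comparison[OF always_eventually Hl[of i]], rule allI)
      show "norm (nrm 2 (cm A) (\<lambda>x. h n x $ i) - nrm 2 (cm A) (\<lambda>x. H x $ i)) \<le> nrm 2 (cm A) (\<lambda>x. h n x $ i - H x $ i)" for n
        using nrm_reverse_triangle[OF _ L2per_Lp[OF hi] L2per_Lp[OF H], of n i i] by simp
    qed
    have "(\<lambda>n. gn2 (h n)) \<longlonglongrightarrow> gn2 H"
      unfolding gn2_sum[OF hi] gn2_sum[OF H] by (intro tendsto_intros nl)
    moreover have "(\<lambda>n. L + \<epsilon> n) \<longlonglongrightarrow> L + 0" by (intro tendsto_intros epslim)
    moreover have "gn2 (h n) \<le> L + \<epsilon> n" for n using wh(2)[of n] dL[of n] by linarith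
    ultimately show ?thesis by (intro LIMSEQ_le[of "\<lambda>n. gn2 (h n)" "gn2 H" "\<lambda>n. L + \<epsilon> n" L]) auto
  qed
  ultimately show ?thesis by blast
qed

section \<open>The Dirichlet integral on \<open>H1per\<close>\<close>

lemma H1per_L2per: "u \<in> H1per A \<Longrightarrow> u \<in> L2per A"
  by (simp add: H1per_def)

lemma H1per_grad:
  assumes "u \<in> H1per A"
  shows "has_grad A u (grad A u)"
proof -
  from assms have "\<exists>g. has_grad A u g" by (simp add: H1per_def)
  then show ?thesis unfolding grad_def by (rule someI_ex)
qed

lemma H1perI: "u \<in> L2per A \<Longrightarrow> has_grad A u g \<Longrightarrow> u \<in> H1per A"
  by (auto simp: H1per_def)

text \<open>By \<open>dir_eq\<close> the representative chosen by \<open>grad\<close> does not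
  matter. There is no factor 1/2, since that of the kinetic energy cancels against the factor 2 for
  spin.\<close>

definition dir :: "(real^3 \<Rightarrow> real) \<Rightarrow> real" where "dir u = gn2 (grad A u)"

lemma dir_nonneg: "0 \<le> dir u"
  by (simp add: dir_def gn2_nonneg)

lemma has_grad_measurable: "has_grad A u g \<Longrightarrow> g \<in> borel_measurable borel"
  by (rule L2per_vec_measurable) (simp add: has_grad_def)

lemma dir_eq:
  assumes u: "u \<in> L2per A" and g: "has_grad A u g"
  shows "dir u = gn2 g"
proof -
  have g': "has_grad A u (grad A u)" by (rule H1per_grad[OF H1perI[OF u g]])
  have [measurable]: "g \<in> borel_measurable borel" "grad A u \<in> borel_measurable borel"
    using has_grad_measurable[OF g] has_grad_measurable[OF g'] by auto
  show ?thesis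
    unfolding dir_def gn2_def
  proof (rule integral_cong_AE)
    show "AE x in cm A. grad A u x \<bullet> grad A u x = g x \<bullet> g x"
      using AE_lborel_imp_cm[OF has_grad_unique[OF u g' g]] by eventually_elim simp
  qed measurable
qed

lemma H1per_lincomb: "u \<in> H1per A \<Longrightarrow> v \<in> H1per A \<Longrightarrow> (\<lambda>x. a * u x + b * v x) \<in> H1per A"
  by (rule H1perI[OF L2per_add[OF L2per_mult L2per_mult] has_grad_lincomb]) (auto intro: H1per_L2per H1per_grad)

lemma zero_H1per: "(\<lambda>x. 0) \<in> H1per A"
proof (rule H1perI[OF L2per_const])
  show "has_grad A (\<lambda>x. 0) (\<lambda>x. 0)"
    using L2per_const[of 0] by (simp add: has_grad_def weak_grad_def)
qed

lemma H1per_mult: "u \<in> H1per A \<Longrightarrow> (\<lambda>x. a * u x) \<in> H1per A"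
  using H1per_lincomb[of u u a 0] by simp

lemma H1per_sum: "(\<And>i. i \<in> I \<Longrightarrow> u i \<in> H1per A) \<Longrightarrow> (\<lambda>x. \<Sum>i\<in>I. u i x) \<in> H1per A"
proof (induction I rule: infinite_finite_induct)
  case (insert i I)
  then show ?case using H1per_lincomb[of "u i" "\<lambda>x. \<Sum>i\<in>I. u i x" 1 1] by simp
qed (auto simp: zero_H1per)

lemma dir_mult:
  assumes u: "u \<in> H1per A"
  shows "dir (\<lambda>x. a * u x) = a\<^sup>2 * dir u"
proof -
  have "has_grad A (\<lambda>x. a * u x) (\<lambda>x. a *\<^sub>R grad A u x)"
    using has_grad_lincomb[OF H1per_L2per[OF u] H1per_grad[OF u] H1per_L2per[OF u] H1per_grad[OF u], of a 0] by simp
  from dir_eq[OF L2per_mult[OF H1per_L2per[OF u]] this] show ?thesis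
    by (simp add: dir_def gn2_def power2_eq_square mult.assoc)
qed

end

section \<open>The form of \<open>B\<close>\<close>

text \<open>By translation invariance \<eta> and its translate have the same integral; by
  \<open>C1_segment_FTC\<close> their difference is an average of integrals of shifted derivatives
  along \<open>z\<close>, all of which are equal.\<close>

lemma integral_test_grad_zero:
  assumes t: "test_fun \<eta> G"
  shows "(LINT x|lborel. G x \<bullet> z) = 0"
proof -
  obtain R where R: "\<And>x. norm x > R \<Longrightarrow> \<eta> x = 0 \<and> G x = 0" using test_fun_facts(3)[OF t] by blast
  obtain B where B: "\<And>x. \<bar>\<eta> x\<bar> \<le> B \<and> norm (G x) \<le> B" using test_fun_facts(4)[OF t] by blast
  have [measurable]: "\<eta> \<in> borel_measurable borel" "G \<in> borel_measurable borel"
    using test_fun_facts(1,2)[OF t] by (auto intro: borel_measurable_continuous_onI)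
  have fin: "emeasure lborel (cball 0 R :: (real^3) set) < \<infinity>" by (rule emeasure_bounded_finite) simp
  have ib: "integrable lborel (\<lambda>x. indicator (cball 0 R :: (real^3) set) x *\<^sub>R C)" for C :: real
    using fin by (intro integrable_scaleR_left integrable_real_indicator) auto
  have i\<eta>: "integrable lborel \<eta>"
    by (rule Bochner_Integration.integrable_bound[OF ib[of B]]) (use R B in \<open>auto simp: indicator_def not_le intro: order_trans[OF _ abs_ge_self]\<close>)
  have iG: "integrable lborel (\<lambda>x. G x \<bullet> z)"
  proof (rule Bochner_Integration.integrable_bound[OF ib[of "B * norm z"]])
    show "AE x in lborel. norm (G x \<bullet> z) \<le> norm (indicator (cball 0 R :: (real^3) set) x *\<^sub>R (B * norm z))"
    proof (rule AE_I2)
      fix x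
      have "\<bar>G x \<bullet> z\<bar> \<le> norm (G x) * norm z" by (rule Cauchy_Schwarz_ineq2)
      also have "\<dots> \<le> B * norm z" using B by (intro mult_right_mono) auto
      finally show "norm (G x \<bullet> z) \<le> norm (indicator (cball 0 R :: (real^3) set) x *\<^sub>R (B * norm z))"
        using R[of x] by (cases "x \<in> cball 0 R") auto
    qed
  qed measurable
  have "integrable (lborel \<Otimes>\<^sub>M lborel) (\<lambda>(s, x). indicator {0..1} s * (G (x - s *\<^sub>R z) \<bullet> z))"
  proof (rule pair_integrable_segment[where C="LINT x|lborel. \<bar>G x \<bullet> z\<bar>"])
    fix s :: real
    have "(\<integral>\<^sup>+x. ennreal \<bar>indicator {0..1} s * (G (x - s *\<^sub>R z) \<bullet> z)\<bar> \<partial>lborel) = (\<integral>\<^sup>+x. ennreal \<bar>G (x - s *\<^sub>R z) \<bullet> z\<bar> * indicator {0..1} s \<partial>lborel)"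
      by (intro nn_integral_cong) (simp add: indicator_def)
    also have "\<dots> = (\<integral>\<^sup>+x. ennreal \<bar>G (x + - (s *\<^sub>R z)) \<bullet> z\<bar> \<partial>lborel) * indicator {0..1} s"
      by (subst nn_integral_multc) auto
    also have "(\<integral>\<^sup>+x. ennreal \<bar>G (x + - (s *\<^sub>R z)) \<bullet> z\<bar> \<partial>lborel) = (\<integral>\<^sup>+x. ennreal \<bar>G x \<bullet> z\<bar> \<partial>lborel)"
      by (rule nn_integral_lborel_shift) measurable
    also have "\<dots> = ennreal (LINT x|lborel. \<bar>G x \<bullet> z\<bar>)"
      using iG by (subst nn_integral_eq_integral) auto
    finally show "(\<integral>\<^sup>+x. ennreal \<bar>indicator {0..1} s * (G (x - s *\<^sub>R z) \<bullet> z)\<bar> \<partial>lborel) \<le> ennreal (LINT x|lborel. \<bar>G x \<bullet> z\<bar>) * indicator {0..1} s"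
      by simp
  qed measurable
  note fub = lborel_pair.Fubini_integral[OF this]
  have "0 = (LINT x|lborel. \<eta> (x + - z)) - (LINT x|lborel. \<eta> x)"
    using lborel_integral_shift[of \<eta> "- z"] by simp
  also have "\<dots> = (LINT x|lborel. \<eta> (x - z) - \<eta> x)"
    using i\<eta> lborel_integrable_shift[of \<eta> "- z"] by simp
  also have "\<dots> = - (LINT x|lborel. LINT s|lborel. indicator {0..1} s * (G (x - s *\<^sub>R z) \<bullet> z))"
    unfolding C1_segment_FTC[OF t] by simp
  also have "\<dots> = - (LINT s|lborel. indicator {0..1} s * (LINT x|lborel. G (x + - (s *\<^sub>R z)) \<bullet> z))"
    unfolding fub by simp
  also have "\<dots> = - (LINT s|lborel. indicator {0..1::real} s * (LINT x|lborel. G x \<bullet> z))"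
  proof -
    have "(LINT x|lborel. G (x + - (s *\<^sub>R z)) \<bullet> z) = (LINT x|lborel. G x \<bullet> z)" for s
      by (rule lborel_integral_shift[where f="\<lambda>x. G x \<bullet> z"]) measurable
    then show ?thesis by (simp only:)
  qed
  also have "\<dots> = - (LINT x|lborel. G x \<bullet> z)" by simp
  finally show ?thesis by simp
qed

lemma linear_kernel_nontrivial:
  fixes T :: "'a::euclidean_space \<Rightarrow> 'b::euclidean_space"
  assumes "linear T" "DIM('b) < DIM('a)"
  shows "\<exists>c. c \<noteq> 0 \<and> T c = 0"
proof (rule ccontr)
  assume "\<not> ?thesis"
  then have "inj T" using linear_injective_0[OF assms(1)] by blast
  then have "dim (T ` UNIV) = dim (UNIV :: 'a set)"
    by (intro dim_image_eq assms(1)) (auto intro: inj_on_subset)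
  moreover have "dim (T ` UNIV) \<le> DIM('b)" by (rule dim_subset_UNIV)
  ultimately show False using assms(2) by simp
qed

context bravais begin

section \<open>Smooth periodic functions: an infinite supply of independent elements of
  \<open>H1per\<close>\<close>

lemma bounded_L2per:
  assumes [measurable]: "u \<in> borel_measurable borel" and "periodic A u" and B: "\<And>x. \<bar>u x\<bar> \<le> B"
  shows "u \<in> L2per A"
proof -
  have "\<bar>u x\<bar>\<^sup>2 \<le> B\<^sup>2" for x using B[of x] by (intro power_mono) auto
  then have "integrable (cm A) (\<lambda>x. \<bar>u x\<bar>\<^sup>2)"
    by (intro cm.integrable_const_bound[of _ "B\<^sup>2"]) auto
  then show ?thesis using assms by (simp add: L2per_iff Lp_def)
qed

text \<open>Integration by parts: \<open>integral_test_grad_zero\<close> is applied to the product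
  of \<open>e\<close> with a test function, which has compact support although a periodic
  \<open>e\<close> generally has not.\<close>

lemma C1_periodic_H1per:
  assumes e: "\<And>x. GDERIV e x :> E x" and E: "continuous_on UNIV E"
    and per: "periodic A e" "periodic A E" and B: "\<And>x. \<bar>e x\<bar> \<le> B" "\<And>x. norm (E x) \<le> B'"
  shows "e \<in> H1per A"
proof -
  have ce: "continuous_on UNIV e" using e GDERIV_imp_continuous continuous_at_imp_continuous_on by blast
  have [measurable]: "e \<in> borel_measurable borel" "E \<in> borel_measurable borel"
    using ce E by (auto intro: borel_measurable_continuous_onI)
  have e2: "e \<in> L2per A" by (rule bounded_L2per[OF _ per(1) B(1)]) measurable
  have E2: "(\<lambda>x. E x $ i) \<in> L2per A" for i
  proof (rule bounded_L2per)
    show "(\<lambda>x. E x $ i) \<in> borel_measurable borel" by (rule vec_nth_measurable) measurable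
    show "periodic A (\<lambda>x. E x $ i)" using per(2) by (simp add: periodic_def)
    show "\<bar>E x $ i\<bar> \<le> B'" for x using component_le_norm_cart[of "E x" i] B(2)[of x] by linarith
  qed
  have "has_grad A e E"
    unfolding weak_grad_iff_inner[OF e2 E2]
  proof (intro allI impI)
    fix \<eta> G z assume t: "test_fun \<eta> G"
    have "test_fun (\<lambda>x. e x * \<eta> x) (\<lambda>x. e x *\<^sub>R G x + \<eta> x *\<^sub>R E x)"
      unfolding test_fun_def
    proof (intro conjI allI)
      show "GDERIV (\<lambda>x. e x * \<eta> x) x :> e x *\<^sub>R G x + \<eta> x *\<^sub>R E x" for x
        using t e by (intro GDERIV_mult) (auto simp: test_fun_def)
      show "continuous_on UNIV (\<lambda>x. e x *\<^sub>R G x + \<eta> x *\<^sub>R E x)"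
        using test_fun_facts(1,2)[OF t] ce E by (intro continuous_intros)
      have "bounded {x. \<eta> x \<noteq> 0}"
        using t compact_imp_bounded bounded_subset[OF _ closure_subset] unfolding test_fun_def by blast
      then have "bounded {x. e x * \<eta> x \<noteq> 0}" by (rule bounded_subset) auto
      then show "compact (closure {x. e x * \<eta> x \<noteq> 0})" by (simp add: compact_closure)
    qed
    from integral_test_grad_zero[OF this, of z]
    have "(LINT x|lborel. e x * (G x \<bullet> z) + \<eta> x * (E x \<bullet> z)) = 0" by (simp add: inner_add_left)
    then show "(LINT x|lborel. e x * (G x \<bullet> z)) = - (LINT x|lborel. \<eta> x * (E x \<bullet> z))"
      using test_fun_integrable(4)[OF t e2, of z] test_fun_integrable(3)[OF t L2per_inner[OF E2], of z] by simp
  qed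
  then show ?thesis by (rule H1perI[OF e2])
qed

text \<open>A smooth periodic function that takes all values in (-1, 1), so that distinct
  polynomials in it are distinct functions.\<close>

definition wave :: "real^3 \<Rightarrow> real" where "wave x = cos (2 * pi * tc x $ 1)"

lemma tc_periodic_1: "tc (x + column i A) $ j = tc x $ j + (if i = j then 1 else 0)"
proof -
  have "column i A = A *v axis i 1" by (simp add: matrix_vector_mult_basis)
  then show ?thesis by (simp add: tc_add axis_def)
qed

lemma wave_periodic: "periodic A wave"
  by (auto simp: periodic_def wave_def tc_periodic_1 distrib_left cos_add)

lemma continuous_wave: "continuous_on S wave"
  unfolding wave_def[abs_def] by (intro continuous_intros continuous_tc)

lemma wave_power_H1per: "(\<lambda>x. wave x ^ k) \<in> H1per A"
proof -
  define w where "w = matrix_inv A $ 1"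
  have t: "tc x $ 1 = x \<bullet> w" for x
    by (simp add: tc_def w_def matrix_vector_mul_component inner_commute)
  define E where "E x = (real k * wave x ^ (k - 1) * - (sin (2 * pi * tc x $ 1) * (2 * pi))) *\<^sub>R w" for x
  show ?thesis
  proof (rule C1_periodic_H1per)
    show "GDERIV (\<lambda>x. wave x ^ k) x :> E x" for x
    proof -
      have 1: "GDERIV (\<lambda>x. tc x $ 1) x :> w"
        unfolding t gderiv_def by (auto intro!: derivative_eq_intros)
      have 2: "DERIV (\<lambda>s. cos (2 * pi * s) ^ k) (tc x $ 1) :> real k * wave x ^ (k - 1) * - (sin (2 * pi * tc x $ 1) * (2 * pi))"
        unfolding wave_def by (auto intro!: derivative_eq_intros)
      show ?thesis
        using GDERIV_DERIV_compose[OF 1 2] by (simp add: E_def wave_def)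
    qed
    show "continuous_on UNIV E"
      unfolding E_def[abs_def] by (intro continuous_intros continuous_tc continuous_wave)
    show "periodic A (\<lambda>x. wave x ^ k)" using wave_periodic by (simp add: periodic_def)
    show "periodic A E"
      using wave_periodic by (auto simp: periodic_def E_def tc_periodic_1 distrib_left sin_add)
    show "\<bar>wave x ^ k\<bar> \<le> 1" for x
      by (simp add: wave_def power_abs power_le_one)
    show "norm (E x) \<le> (real k * 1 * (1 * (2 * pi))) * norm w" for x
      unfolding E_def norm_scaleR
    proof (rule mult_right_mono)
      have "\<bar>wave x ^ (k - 1)\<bar> \<le> 1" by (simp add: wave_def power_abs power_le_one)
      then have "(real k * \<bar>wave x ^ (k - 1)\<bar>) * (\<bar>sin (2 * pi * tc x $ 1)\<bar> * (2 * pi)) \<le> (real k * 1) * (1 * (2 * pi))"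
        by (intro mult_mono) auto
      then show "\<bar>real k * wave x ^ (k - 1) * - (sin (2 * pi * tc x $ 1) * (2 * pi))\<bar> \<le> real k * 1 * (1 * (2 * pi))"
        by (simp only: abs_mult abs_minus_cancel) simp
    qed simp
  qed
qed

lemma continuous_AE_zero_icell:
  assumes f: "continuous_on UNIV f" and ae: "AE x in cm A. f x = (0::real)" and x: "x \<in> icell"
  shows "f x = 0"
proof (rule ccontr)
  assume "f x \<noteq> 0"
  define U where "U = icell \<inter> {y. f y \<noteq> 0}"
  have "open {y. f y \<noteq> 0}" using f by (intro open_Collect_neq continuous_intros)
  then have oU: "open U" unfolding U_def using open_icell by (rule open_Int[rotated])
  have xU: "x \<in> U" using x \<open>f x \<noteq> 0\<close> by (simp add: U_def)
  have "AE y in lborel. y \<notin> U"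
    using ae unfolding AE_cm by eventually_elim (use icell_subset in \<open>auto simp: U_def\<close>)
  then have "U \<in> null_sets lborel"
    using oU by (subst AE_iff_null_sets) auto
  then have "negligible U" by (simp add: negligible_iff_null_sets null_sets_completionI)
  then show False using open_not_negligible[OF oU] xU by blast
qed

text \<open>By continuity the polynomial vanishes at \<open>wave x\<close> for every x in
  \<open>icell\<close>. Along the diagonal of the cell \<open>wave\<close> covers (-1, 1), which
  gives infinitely many roots.\<close>

lemma poly_wave_AE_zero:
  assumes "AE x in cm A. poly p (wave x) = 0"
  shows "p = 0"
proof (rule ccontr)
  assume p: "p \<noteq> 0"
  have z: "poly p (cos (2 * pi * s)) = 0" if s: "0 < s" "s < 1" for s :: real
  proof -
    have "continuous_on UNIV (\<lambda>x. poly p (wave x))" by (intro continuous_intros continuous_wave)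
    moreover have "A *v (\<chi> i. s) \<in> icell" using s by (simp add: icell_def)
    ultimately have "poly p (wave (A *v (\<chi> i. s))) = 0" by (rule continuous_AE_zero_icell[OF _ assms])
    then show ?thesis by (simp add: wave_def)
  qed
  have "{-1<..<1} \<subseteq> {y. poly p y = 0}"
  proof
    fix y :: real assume y: "y \<in> {-1<..<1}"
    define s where "s = arccos y / (2 * pi)"
    have a: "0 < arccos y" "arccos y < pi" using y arccos_lt_bounded[of y] by auto
    have "s < 1" using a pi_gt_zero unfolding s_def by (subst pos_divide_less_eq) auto
    moreover have "0 < s" using a pi_gt_zero unfolding s_def by simp
    moreover have "cos (2 * pi * s) = y" using y by (simp add: s_def)
    ultimately show "y \<in> {y. poly p y = 0}" using z[of s] by simp
  qed
  then have "finite {-1<..<1::real}" using poly_roots_finite[OF p] by (rule finite_subset)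
  then show False using infinite_Ioo[of "-1" "1::real"] by simp
qed

end

locale operators = bravais A for A +
  fixes M :: "real^3 \<Rightarrow> real^'m" and Q :: "real^3 \<Rightarrow> real^'m^'m" and \<alpha> :: real
  assumes M: "(\<lambda>x. M x $ l) \<in> L2per A"
    and Q: "(\<lambda>x. Q x $ l $ p) \<in> L2per A" and Q_sym: "transpose (Q x) = Q x"
    and \<alpha>: "0 < \<alpha>" and coercive: "\<psi> \<in> L2per A \<Longrightarrow> ip A \<psi> (Bop1 A M Q \<psi>) \<ge> \<alpha> * ip A \<psi> \<psi>"
begin

section \<open>The bilinear form of \<open>Bop\<close>, a finite-rank perturbation of the inner
  product\<close>

definition mvec :: "(real^3 \<Rightarrow> real) \<Rightarrow> real^'m" where
  "mvec u = (\<chi> l. ip A u (\<lambda>x. M x $ l))"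

definition bform :: "(real^3 \<Rightarrow> real) \<Rightarrow> (real^3 \<Rightarrow> real) \<Rightarrow> real" where
  "bform u v = ip A u v + mvec u \<bullet> (int_mat A Q *v mvec v)"

lemma ip_commute: "ip A u v = ip A v u"
  by (simp add: ip_def mult.commute)

lemma ip_add_mult:
  assumes "u \<in> L2per A" "v \<in> L2per A" "w \<in> L2per A"
  shows "ip A (\<lambda>x. a * u x + b * v x) w = a * ip A u w + b * ip A v w"
proof -
  note [measurable] = assms[THEN L2per_measurable]
  have "ip A (\<lambda>x. a * u x + b * v x) w = (LINT x|cm A. a * (u x * w x) + b * (v x * w x))"
    by (subst ip_cm) (auto simp: distrib_right mult.assoc)
  also have "\<dots> = a * ip A u w + b * ip A v w"
    using L2_mult_integrable[OF L2per_Lp L2per_Lp, OF assms(1,3)] L2_mult_integrable[OF L2per_Lp L2per_Lp, OF assms(2,3)]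
    by (simp add: ip_cm)
  finally show ?thesis .
qed

lemma ip_mult: "u \<in> L2per A \<Longrightarrow> w \<in> L2per A \<Longrightarrow> ip A (\<lambda>x. a * u x) w = a * ip A u w"
  using ip_add_mult[of u u w a 0] by simp

lemma ip_sum:
  assumes "\<And>i. i \<in> I \<Longrightarrow> u i \<in> L2per A" "w \<in> L2per A"
  shows "ip A (\<lambda>x. \<Sum>i\<in>I. c i * u i x) w = (\<Sum>i\<in>I. c i * ip A (u i) w)"
  using assms(1)
proof (induction I rule: infinite_finite_induct)
  case (insert i I)
  have "(\<lambda>x. \<Sum>i\<in>I. c i * u i x) \<in> L2per A" using insert by (intro L2per_sum L2per_mult) auto
  from ip_add_mult[OF _ this assms(2), of "u i" "c i" 1] insert show ?case by simp
qed (simp_all add: ip_def)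

lemma ip_self: "u \<in> L2per A \<Longrightarrow> ip A u u = (nrm 2 (cm A) u)\<^sup>2"
  by (subst ip_cm) (auto simp: L2per_measurable nrm_power2 power2_eq_square[symmetric])

lemma mvec_add_mult:
  assumes "u \<in> L2per A" "v \<in> L2per A"
  shows "mvec (\<lambda>x. a * u x + b * v x) = a *\<^sub>R mvec u + b *\<^sub>R mvec v"
  using ip_add_mult[OF assms M] by (simp add: mvec_def vec_eq_iff)

lemma mvec_mult: "u \<in> L2per A \<Longrightarrow> mvec (\<lambda>x. a * u x) = a *\<^sub>R mvec u"
  using mvec_add_mult[of u u a 0] by simp

lemma mvec_sum:
  assumes "\<And>i. i \<in> I \<Longrightarrow> u i \<in> L2per A"
  shows "mvec (\<lambda>x. \<Sum>i\<in>I. c i * u i x) = (\<Sum>i\<in>I. c i *\<^sub>R mvec (u i))"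
  using ip_sum[of I u "\<lambda>x. M x $ _" c, OF assms M] by (simp add: mvec_def vec_eq_iff)

lemma int_mat_sym: "transpose (int_mat A Q) = int_mat A Q"
  using Q_sym by (simp add: int_mat_def transpose_def vec_eq_iff)

lemma bform_commute: "bform u v = bform v u"
proof -
  have "mvec u \<bullet> (int_mat A Q *v mvec v) = (transpose (int_mat A Q) *v mvec u) \<bullet> mvec v"
    by (metis dot_lmul_matrix transpose_matrix_vector)
  then show ?thesis by (simp add: bform_def ip_commute int_mat_sym inner_commute)
qed

lemma bform_sum:
  assumes "\<And>i. i \<in> I \<Longrightarrow> u i \<in> L2per A" "w \<in> L2per A"
  shows "bform (\<lambda>x. \<Sum>i\<in>I. c i * u i x) w = (\<Sum>i\<in>I. c i * bform (u i) w)"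
  using ip_sum[of I u w c, OF assms] mvec_sum[of I u c, OF assms(1)]
  by (simp add: bform_def inner_sum_left sum.distrib distrib_left)

lemma bform_mult: "u \<in> L2per A \<Longrightarrow> w \<in> L2per A \<Longrightarrow> bform (\<lambda>x. a * u x) w = a * bform u w"
  by (simp add: bform_def ip_mult mvec_mult distrib_left)

lemma bform_mult_right: "u \<in> L2per A \<Longrightarrow> w \<in> L2per A \<Longrightarrow> bform u (\<lambda>x. a * w x) = a * bform u w"
  using bform_mult[of w u a] by (simp add: bform_commute)

lemma Mc_L2per: "(\<lambda>x. M x \<bullet> c) \<in> L2per A"
proof -
  have "(\<lambda>x. \<Sum>l\<in>UNIV. c $ l * M x $ l) \<in> L2per A" by (intro L2per_sum L2per_mult M)
  then show ?thesis by (simp add: inner_vec_def mult.commute)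
qed

lemma ip_Mc:
  assumes "u \<in> L2per A"
  shows "ip A u (\<lambda>x. M x \<bullet> c) = mvec u \<bullet> c"
proof -
  have "ip A (\<lambda>x. \<Sum>l\<in>UNIV. c $ l * M x $ l) u = (\<Sum>l\<in>UNIV. c $ l * ip A (\<lambda>x. M x $ l) u)"
    by (rule ip_sum[OF M assms])
  then show ?thesis by (simp add: inner_vec_def mvec_def mult.commute ip_commute)
qed

text \<open>The finite-rank parts of both \<open>Bop\<close> and \<open>Vnl\<close> have this form,
  with \<open>X\<close> the integral of \<open>Q\<close> or the matrix \<open>D\<close>.\<close>

lemma matrix_product_component:
  fixes y :: "real^'m" and X :: "real^'m^'m" and \<Psi> :: "real^3 \<Rightarrow> real^'p"
  shows "(y v* (X ** gram A M \<Psi>)) $ j = y \<bullet> (X *v mvec (\<lambda>x. \<Psi> x $ j))"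
proof -
  have "(y v* (X ** gram A M \<Psi>)) $ j = (\<Sum>l\<in>UNIV. y $ l * (\<Sum>k\<in>UNIV. X $ l $ k * ip A (\<lambda>x. M x $ k) (\<lambda>x. \<Psi> x $ j)))"
    by (simp add: vector_matrix_mult_def matrix_matrix_mult_def gram_def)
  also have "\<dots> = y \<bullet> (X *v mvec (\<lambda>x. \<Psi> x $ j))"
    by (simp add: inner_vec_def matrix_vector_mult_def mvec_def ip_commute[of _ "\<lambda>x. M x $ _"])
  finally show ?thesis .
qed

lemma Bop_component: "Bop A M Q \<Psi> x $ j = \<Psi> x $ j + M x \<bullet> (int_mat A Q *v mvec (\<lambda>x. \<Psi> x $ j))"
  by (simp add: Bop_def matrix_product_component)

lemma ip_add_right: "u \<in> L2per A \<Longrightarrow> v \<in> L2per A \<Longrightarrow> w \<in> L2per A \<Longrightarrow> ip A u (\<lambda>x. v x + w x) = ip A u v + ip A u w"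
  using ip_add_mult[of v w u 1 1] by (simp add: ip_commute)

lemma gram_Bop:
  assumes "\<And>i. (\<lambda>x. \<Psi> x $ i) \<in> L2per A"
  shows "gram A \<Psi> (Bop A M Q \<Psi>) $ i $ j = bform (\<lambda>x. \<Psi> x $ i) (\<lambda>x. \<Psi> x $ j)"
  by (simp add: gram_def Bop_component bform_def ip_add_right[OF assms assms Mc_L2per] ip_Mc[OF assms])

lemma bform_coercive:
  assumes "u \<in> L2per A"
  shows "\<alpha> * (nrm 2 (cm A) u)\<^sup>2 \<le> bform u u"
proof -
  have "ip A u (Bop1 A M Q u) = bform u u"
    unfolding Bop1_def Bop_component bform_def by (simp add: ip_add_right[OF assms assms Mc_L2per] ip_Mc[OF assms])
  then show ?thesis using coercive[OF assms] by (simp add: ip_self[OF assms])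
qed

text \<open>Powers of \<open>wave\<close> are linearly independent; a nonzero combination of \<open>CARD('n) + 1\<close> of them satisfies the \<open>CARD('n)\<close>
  orthogonality conditions.\<close>

lemma exists_orthogonal:
  fixes \<phi> :: "'n::finite \<Rightarrow> real^3 \<Rightarrow> real"
  assumes \<phi>: "\<And>i. \<phi> i \<in> L2per A"
  obtains w where "w \<in> H1per A" "bform w w = 1" "\<And>i. bform w (\<phi> i) = 0"
proof -
  \<comment> \<open>\<open>'n option\<close> has one element more than \<open>'n\<close>, and
    \<open>to_nat\<close> turns its elements into distinct exponents.\<close>
  define e where "e k x = wave x ^ to_nat k" for k :: "'n option" and x
  have eH: "e k \<in> H1per A" for k unfolding e_def[abs_def] by (rule wave_power_H1per)
  note eL = H1per_L2per[OF eH]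
  define T :: "real^('n option) \<Rightarrow> real^'n" where "T c = (\<chi> i. \<Sum>k\<in>UNIV. c $ k * bform (e k) (\<phi> i))" for c
  have "linear T"
    by (rule linearI) (simp_all add: T_def vec_eq_iff distrib_right sum.distrib sum_distrib_left mult.assoc)
  then obtain c where c: "c \<noteq> 0" "T c = 0"
    using linear_kernel_nontrivial[of T] by auto
  define v where "v x = (\<Sum>k\<in>UNIV. c $ k * e k x)" for x
  have vH: "v \<in> H1per A" unfolding v_def[abs_def] by (intro H1per_sum H1per_mult eH)
  note vL = H1per_L2per[OF vH]
  have orth: "bform v (\<phi> i) = 0" for i
  proof -
    have "bform v (\<phi> i) = T c $ i"
      unfolding v_def[abs_def] using bform_sum[of UNIV e "\<phi> i" "\<lambda>k. c $ k"] eL \<phi> by (simp add: T_def)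
    then show ?thesis using c by simp
  qed
  define p where "p = (\<Sum>k\<in>UNIV. monom (c $ k) (to_nat k))"
  have pv: "poly p (wave x) = v x" for x
    by (simp add: p_def v_def e_def poly_sum poly_monom)
  obtain k0 where k0: "c $ k0 \<noteq> 0" using c(1) by (auto simp: vec_eq_iff)
  have "coeff p (to_nat k0) = (\<Sum>k\<in>UNIV. if k = k0 then c $ k else 0)"
    unfolding p_def coeff_sum by (intro sum.cong) auto
  then have "p \<noteq> 0" using k0 by auto
  then have "\<not> (AE x in cm A. v x = 0)" using poly_wave_AE_zero[of p] by (auto simp: pv)
  have n: "nrm 2 (cm A) v \<noteq> 0"
  proof
    assume "nrm 2 (cm A) v = 0"
    then have "(LINT x|cm A. (v x)\<^sup>2) = 0" by (simp add: nrm_power2[symmetric])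
    then have "AE x in cm A. (v x)\<^sup>2 = 0"
      using Lp_integrable[OF L2per_Lp[OF vL]] by (subst (asm) integral_nonneg_eq_0_iff_AE) auto
    then show False using \<open>\<not> (AE x in cm A. v x = 0)\<close> by simp
  qed
  then have "0 < \<alpha> * (nrm 2 (cm A) v)\<^sup>2" using \<alpha> by simp
  then have b: "0 < bform v v" using bform_coercive[OF vL] by linarith
  define w where "w x = (1 / sqrt (bform v v)) * v x" for x
  show thesis
  proof (rule that)
    show "w \<in> H1per A" unfolding w_def[abs_def] by (rule H1per_mult[OF vH])
    show "bform w w = 1"
      unfolding w_def[abs_def] bform_mult[OF vL L2per_mult[OF vL]] bform_mult_right[OF vL vL]
      using b by (simp add: real_sqrt_mult[symmetric] field_simps)
    show "bform w (\<phi> i) = 0" for i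
      unfolding w_def[abs_def] bform_mult[OF vL \<phi>] by (simp add: orth)
  qed
qed

text \<open>Missing indices are filled one at a time by \<open>exists_orthogonal\<close>. With
  \<open>J\<close> the indices of nonzero occupation this completes a minimizer; with
  \<open>J\<close> empty it shows that \<open>MB\<close> is inhabited.\<close>

lemma orthonormal_extension:
  fixes \<phi> :: "'n::finite \<Rightarrow> real^3 \<Rightarrow> real"
  assumes "\<And>i. i \<in> J \<Longrightarrow> \<phi> i \<in> H1per A"
    and "\<And>i j. i \<in> J \<Longrightarrow> j \<in> J \<Longrightarrow> bform (\<phi> i) (\<phi> j) = (if i = j then 1 else 0)"
  shows "\<exists>\<psi>. (\<forall>i\<in>J. \<psi> i = \<phi> i) \<and> (\<forall>i. \<psi> i \<in> H1per A) \<and> (\<forall>i j. bform (\<psi> i) (\<psi> j) = (if i = j then 1 else 0))"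
  using assms
proof (induction "card (- J)" arbitrary: J \<phi>)
  case 0
  then have J: "J = UNIV" by auto
  show ?case by (rule exI[of _ \<phi>]) (use 0 J in auto)
next
  case (Suc n)
  then obtain k where k: "k \<notin> J" by (metis Compl_iff card_eq_0_iff ex_in_conv nat.distinct(1))
  \<comment> \<open>Orthogonality is stated for a family indexed by the whole type; the zero
    functions outside \<open>J\<close> impose no condition.\<close>
  define \<phi>' where "\<phi>' i = (if i \<in> J then \<phi> i else (\<lambda>x. 0))" for i
  have \<phi>'L: "\<phi>' i \<in> L2per A" for i using Suc.prems(1) by (auto simp: \<phi>'_def L2per_const intro: H1per_L2per)
  obtain w where w: "w \<in> H1per A" "bform w w = 1" "\<And>i. bform w (\<phi>' i) = 0"
    by (rule exists_orthogonal[of \<phi>', OF \<phi>'L]) (rule that)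
  have wJ: "bform w (\<phi> i) = 0" "bform (\<phi> i) w = 0" if "i \<in> J" for i
    using w(3)[of i] that by (auto simp: \<phi>'_def bform_commute)
  have "- insert k J = - J - {k}" by auto
  then have "n = card (- insert k J)" using Suc.hyps(2) k by simp
  moreover have "(\<phi>(k := w)) i \<in> H1per A" if "i \<in> insert k J" for i
    using that Suc.prems(1) w by auto
  moreover have "bform ((\<phi>(k := w)) i) ((\<phi>(k := w)) j) = (if i = j then 1 else 0)" if "i \<in> insert k J" "j \<in> insert k J" for i j
    using that Suc.prems(2) w wJ k by auto
  ultimately obtain \<psi> where \<psi>: "\<forall>i\<in>insert k J. \<psi> i = (\<phi>(k := w)) i" "\<forall>i. \<psi> i \<in> H1per A"
      "\<forall>i j. bform (\<psi> i) (\<psi> j) = (if i = j then 1 else 0)"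
    using Suc.hyps(1)[of "insert k J" "\<phi>(k := w)"] by blast
  show ?case
  proof (rule exI[of _ \<psi>], intro conjI ballI)
    show "\<psi> i = \<phi> i" if "i \<in> J" for i using \<psi>(1) that k by auto
  qed (use \<psi> in auto)
qed

lemma MB_iff:
  "\<Psi> \<in> MB A M Q \<longleftrightarrow> (\<forall>i. (\<lambda>x. \<Psi> x $ i) \<in> H1per A) \<and>
    (\<forall>i j. bform (\<lambda>x. \<Psi> x $ i) (\<lambda>x. \<Psi> x $ j) = (if i = j then 1 else 0))"
proof -
  have "gram A \<Psi> (Bop A M Q \<Psi>) = mat 1 \<longleftrightarrow> (\<forall>i j. bform (\<lambda>x. \<Psi> x $ i) (\<lambda>x. \<Psi> x $ j) = (if i = j then 1 else 0))"
    if "\<forall>i. (\<lambda>x. \<Psi> x $ i) \<in> H1per A"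
    using that by (simp add: vec_eq_iff gram_Bop[OF H1per_L2per] mat_def)
  then show ?thesis unfolding MB_def by blast
qed

end

section \<open>Entropy, exchange-correlation and Hartree terms\<close>

lemma real_analytic_isCont:
  assumes "real_analytic f"
  shows "isCont f x"
proof -
  obtain P where "(\<lambda>h. f (x + h)) has_fps_expansion P" using assms by (auto simp: real_analytic_def)
  then have "isCont (\<lambda>h. f (x + h)) 0" by (rule has_fps_expansion_imp_continuous)
  then show ?thesis by (simp add: isCont_iff)
qed

text \<open>Inside the interval the inverse of a continuous injective function is continuous. At 0
  and 1 the preimages under \<open>f\<close> run off to plus and minus infinity, where
  \<open>S\<close> has limits.\<close>

lemma continuous_S_finv:
  assumes cf: "\<And>x. isCont f x" and cS: "\<And>x. isCont S x"
    and lf: "(f \<longlongrightarrow> 1) at_bot" "(f \<longlongrightarrow> 0) at_top"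
    and lS: "(S \<longlongrightarrow> a) at_bot" "(S \<longlongrightarrow> b) at_top"
    and dec: "\<And>x y. x < y \<Longrightarrow> f y < f x"
  shows "continuous_on {0..1} (S_finv S f)"
proof -
  have inj: "inj f"
    by (rule linorder_inj_onI') (use dec in force)
  have inv: "inv f (f x) = x" for x using inj by simp
  have le: "x \<le> y" if "f y \<le> f x" for x y using dec[of y x] that by linarith
  have range: "\<exists>x. f x = t" if t: "0 < t" "t < 1" for t
  proof -
    obtain u where u: "f u < t"
      using eventually_happens[OF order_tendstoD(2)[OF lf(2) t(1)]] by auto
    obtain l where l: "t < f l"
      using eventually_happens[OF order_tendstoD(1)[OF lf(1) t(2)]] by auto
    have "l \<le> u" using le[of u l] u l by linarith
    then show ?thesis using IVT2[of f u t l] u l cf by auto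
  qed
  \<comment> \<open>The limits give weak inequalities only; passing through f (x + 1) and f (x - 1)
    makes them strict.\<close>
  have b01: "0 < f x" "f x < 1" for x
  proof -
    have "f (x + 1) < f x" "f x < f (x - 1)" by (auto intro: dec)
    moreover have "0 \<le> f (x + 1)"
      by (rule tendsto_upperbound[OF lf(2)]) (auto intro!: eventually_mono[OF eventually_gt_at_top[of "x + 1"]] less_imp_le dec)
    moreover have "f (x - 1) \<le> 1"
      by (rule tendsto_lowerbound[OF lf(1)]) (auto intro!: eventually_mono[OF eventually_gt_at_bot[of "x - 1"]] less_imp_le dec)
    ultimately show "0 < f x" "f x < 1" by linarith+
  qed
  have La: "Lim at_bot S = a" and Lb: "Lim at_top S = b"
    using lS by (auto intro: tendsto_Lim)
  have S01: "S_finv S f (f x) = S x" for x using b01[of x] by (simp add: S_finv_def inv)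
  show ?thesis
    unfolding continuous_on_def
  proof
    fix t :: real assume "t \<in> {0..1}"
    then consider "t = 0" | "t = 1" | "0 < t" "t < 1" by force
    then show "(S_finv S f \<longlongrightarrow> S_finv S f t) (at t within {0..1})"
    proof cases
      case 1
      show ?thesis
      proof (rule tendstoI)
        fix e :: real assume "0 < e"
        then obtain k where k: "\<And>x. x \<ge> k \<Longrightarrow> dist (S x) b < e"
          using tendstoD[OF lS(2)] by (auto simp: eventually_at_top_linorder)
        have "dist (S_finv S f s) b < e" if s: "s \<in> {0..1}" "s \<noteq> 0" "dist s 0 < f k" for s
        proof -
          have "s < f k" using s by simp
          then have "0 < s" "s < 1" using s b01[of k] by auto
          then obtain x where x: "f x = s" using range by blast
          then have "k \<le> x" using le[of x k] \<open>s < f k\<close> by simp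
          then show ?thesis using k S01[of x] x by simp
        qed
        then show "\<forall>\<^sub>F s in at t within {0..1}. dist (S_finv S f s) (S_finv S f t) < e"
          using b01[of k] 1 unfolding eventually_at by (intro exI[of _ "f k"]) (auto simp: S_finv_def Lb)
      qed
    next
      case 2
      show ?thesis
      proof (rule tendstoI)
        fix e :: real assume "0 < e"
        then obtain k where k: "\<And>x. x \<le> k \<Longrightarrow> dist (S x) a < e"
          using tendstoD[OF lS(1)] by (auto simp: eventually_at_bot_linorder)
        have "dist (S_finv S f s) a < e" if s: "s \<in> {0..1}" "s \<noteq> 1" "dist s 1 < 1 - f k" for s
        proof -
          have "f k < s" using s by (simp add: dist_real_def)
          then have "0 < s" "s < 1" using s b01[of k] by auto
          then obtain x where x: "f x = s" using range by blast
          then have "x \<le> k" using le[of k x] \<open>f k < s\<close> by simp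
          then show ?thesis using k S01[of x] x by simp
        qed
        then show "\<forall>\<^sub>F s in at t within {0..1}. dist (S_finv S f s) (S_finv S f t) < e"
          using b01[of k] 2 unfolding eventually_at by (intro exI[of _ "1 - f k"]) (auto simp: S_finv_def La)
      qed
    next
      case 3
      then obtain x where x: "f x = t" using range by blast
      have "isCont (inv f) (f x)"
        by (rule isCont_inverse_function2[of "x - 1" x "x + 1"]) (auto simp: inv cf)
      then have "isCont (inv f) t" by (simp only: x)
      then have "isCont (\<lambda>s. S (inv f s)) t" by (rule isCont_o2[OF _ cS])
      then have "((\<lambda>s. S (inv f s)) \<longlongrightarrow> S (inv f t)) (at t within {0..1})"
        unfolding isCont_def by (rule tendsto_within_subset) simp
      moreover have "\<forall>\<^sub>F s in at t within {0..1}. S (inv f s) = S_finv S f s"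
        unfolding eventually_at using 3
        by (intro exI[of _ "min t (1 - t)"]) (auto simp: S_finv_def dist_real_def)
      ultimately show ?thesis using 3 by (auto simp: S_finv_def intro: Lim_transform_eventually)
    qed
  qed
qed

text \<open>The parameter \<open>s\<close> is chosen later as \<open>1 + \<parallel>\<rho>\<parallel>\<close>, which makes the integral of the bound linear in \<open>\<parallel>\<rho>\<parallel>\<close>.\<close>

lemma powr_four_thirds_le:
  fixes s t :: real
  assumes "0 \<le> t" "0 < s"
  shows "t powr (4/3) \<le> 1 + s * t + t\<^sup>2 / s"
proof (cases "t \<le> 1")
  case True
  then have "t powr (4/3) \<le> 1 powr (4/3)" using assms by (intro powr_mono2) auto
  moreover have "0 \<le> s * t + t\<^sup>2 / s" using assms by simp
  ultimately show ?thesis by simp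
next
  case False
  define y where "y = sqrt t"
  have y: "0 \<le> y" "y\<^sup>2 = t" using assms by (auto simp: y_def)
  have "t powr (4/3) \<le> t powr (3/2)" using False by (intro powr_mono) auto
  also have "\<dots> = y ^ 3"
    using False by (simp add: y_def powr_half_sqrt[symmetric] powr_realpow[symmetric] powr_powr)
  also have "\<dots> \<le> s * y\<^sup>2 + y ^ 4 / s"
  proof -
    \<comment> \<open>The inequality between the arithmetic and geometric means: y^3 is the
      geometric mean of s y^2 and y^4 / s.\<close>
    have "0 \<le> y\<^sup>2 / s * (s - y)\<^sup>2" using assms by simp
    also have "\<dots> = s * y\<^sup>2 + y ^ 4 / s - 2 * y ^ 3"
      using assms by (simp add: power2_eq_square power3_eq_cube power4_eq_xxxx field_simps)
    finally show ?thesis using y zero_le_power[of y 3] by linarith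
  qed
  also have "\<dots> = s * t + t\<^sup>2 / s" by (simp add: y(2)[symmetric])
  finally show ?thesis by simp
qed

text \<open>Both classes lead to one bound. With exponent 3 and c1 \<ge> 0 the function is bounded
  below; with exponent 4/3, where c1 may be negative, \<open>powr_four_thirds_le\<close>
  applies.\<close>

lemma growth_class_lower_bound:
  assumes "\<N> \<in> growth_class 3 c1 c2 \<and> c1 \<ge> 0 \<or> \<N> \<in> growth_class (4/3) c1 c2"
  shows "\<exists>C\<ge>0. \<forall>t\<ge>0. \<forall>s>0. - C * (1 + s * t + t\<^sup>2 / s) \<le> \<N> t"
proof -
  have nn: "1 \<le> 1 + s * t + t\<^sup>2 / s" if "0 \<le> t" "0 < s" for s t :: real using that by simp
  from assms show ?thesis
  proof
    assume "\<N> \<in> growth_class 3 c1 c2 \<and> c1 \<ge> 0"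
    then obtain a1 where a: "\<And>t. t \<ge> 0 \<Longrightarrow> c1 * t powr 3 + a1 \<le> \<N> t" and c1: "c1 \<ge> 0"
      by (auto simp: growth_class_def)
    have "- \<bar>a1\<bar> * (1 + s * t + t\<^sup>2 / s) \<le> \<N> t" if "t \<ge> 0" "s > 0" for s t
    proof -
      have "\<bar>a1\<bar> * 1 \<le> \<bar>a1\<bar> * (1 + s * t + t\<^sup>2 / s)" by (intro mult_left_mono nn that) simp
      moreover have "0 \<le> c1 * t powr 3" using c1 by simp
      ultimately show ?thesis using a[OF that(1)] by simp
    qed
    then show ?thesis by (intro exI[of _ "\<bar>a1\<bar>"]) auto
  next
    assume "\<N> \<in> growth_class (4/3) c1 c2"
    then obtain a1 where a: "\<And>t. t \<ge> 0 \<Longrightarrow> c1 * t powr (4/3) + a1 \<le> \<N> t"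
      by (auto simp: growth_class_def)
    have "- (\<bar>a1\<bar> + \<bar>c1\<bar>) * (1 + s * t + t\<^sup>2 / s) \<le> \<N> t" if "t \<ge> 0" "s > 0" for s t
    proof -
      define w where "w = 1 + s * t + t\<^sup>2 / s"
      define P where "P = t powr (4/3)"
      have 1: "\<bar>a1\<bar> * 1 \<le> \<bar>a1\<bar> * w" unfolding w_def by (intro mult_left_mono nn that) simp
      have 2: "\<bar>c1\<bar> * P \<le> \<bar>c1\<bar> * w" unfolding w_def P_def by (intro mult_left_mono powr_four_thirds_le that) simp
      have 3: "- (\<bar>c1\<bar> * P) \<le> c1 * P"
        using mult_right_mono[of "- \<bar>c1\<bar>" c1 P] by (simp add: P_def)
      have "- (\<bar>a1\<bar> + \<bar>c1\<bar>) * w = - (\<bar>a1\<bar> * w) - \<bar>c1\<bar> * w" by (simp add: algebra_simps)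
      also have "\<dots> \<le> \<N> t" using 1 2 3 a[OF that(1), folded P_def] by linarith
      finally show ?thesis unfolding w_def .
    qed
    then show ?thesis by (intro exI[of _ "\<bar>a1\<bar> + \<bar>c1\<bar>"]) auto
  qed
qed

text \<open>Sum over the dyadic shells around the origin.\<close>

lemma inverse_norm_integrable:
  assumes R: "0 < R"
  shows "(\<integral>\<^sup>+z. ennreal (1 / norm z) * indicator (ball (0 :: real^3) R) z \<partial>lborel) < \<infinity>"
proof -
  have pw: "ennreal (1 / norm z) * indicator (ball 0 R) z \<le> (\<Sum>k. ennreal (2 ^ Suc k / R) * indicator (ball 0 (R / 2 ^ k)) z)" for z :: "real^3"
  proof (cases "z \<noteq> 0 \<and> norm z < R")
    case True
    \<comment> \<open>The least such \<open>n\<close> is positive and locates the shell containing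
      \<open>z\<close>.\<close>
    have "\<exists>n. R / 2 ^ n \<le> norm z"
    proof -
      obtain n where "(1/2) ^ n < norm z / R" using real_arch_pow_inv[of "norm z / R" "1/2"] True R by auto
      then show ?thesis using R by (intro exI[of _ n]) (simp add: field_simps)
    qed
    then obtain n where n: "R / 2 ^ n \<le> norm z" "\<And>m. m < n \<Longrightarrow> norm z < R / 2 ^ m"
      using exists_least_iff[of "\<lambda>n. R / 2 ^ n \<le> norm z"] by (auto simp: not_le)
    have "n \<noteq> 0" using n(1) True by (intro notI) simp
    then obtain k where k: "n = Suc k" by (cases n) auto
    have "1 / norm z \<le> 2 ^ Suc k / R" using n(1) R True unfolding k by (simp add: field_simps)
    then have "ennreal (1 / norm z) * indicator (ball 0 R) z \<le> ennreal (2 ^ Suc k / R) * indicator (ball 0 (R / 2 ^ k)) z"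
      using n(2)[of k] True k by (simp add: ennreal_leI)
    also have "\<dots> \<le> (\<Sum>k. ennreal (2 ^ Suc k / R) * indicator (ball 0 (R / 2 ^ k)) z)"
    proof -
      have "F k \<le> suminf F" for F :: "nat \<Rightarrow> ennreal" using sum_le_suminf[of F "{k}"] by simp
      then show ?thesis .
    qed
    finally show ?thesis .
  qed auto
  have [measurable]: "ball (0 :: real^3) r \<in> sets borel" for r by simp
  define c where "c = unit_ball_vol 3"
  have c: "0 \<le> c" by (simp add: c_def)
  have "(\<integral>\<^sup>+z. ennreal (1 / norm z) * indicator (ball (0 :: real^3) R) z \<partial>lborel)
      \<le> (\<integral>\<^sup>+z. (\<Sum>k. ennreal (2 ^ Suc k / R) * indicator (ball (0 :: real^3) (R / 2 ^ k)) z) \<partial>lborel)"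
    by (intro nn_integral_mono pw)
  also have "\<dots> = (\<Sum>k. \<integral>\<^sup>+z. ennreal (2 ^ Suc k / R) * indicator (ball (0 :: real^3) (R / 2 ^ k)) z \<partial>lborel)"
    by (intro nn_integral_suminf) auto
  \<comment> \<open>The ball of radius R / 2^k has volume of order 8^-k while the kernel is of order
    2^k, so the terms decay like 4^-k.\<close>
  also have "\<dots> = (\<Sum>k. ennreal (2 * c * R\<^sup>2 * (1/4) ^ k))"
  proof (rule suminf_cong)
    fix k :: nat
    have p: "(2::real) ^ k * 4 ^ k = 2 ^ k * (2 ^ k * 2 ^ k)" by (simp flip: power_mult_distrib)
    have "(\<integral>\<^sup>+z. ennreal (2 ^ Suc k / R) * indicator (ball (0 :: real^3) (R / 2 ^ k)) z \<partial>lborel) = ennreal (2 ^ Suc k / R) * ennreal (c * (R / 2 ^ k) ^ 3)"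
      using R by (subst nn_integral_cmult_indicator) (auto simp: emeasure_ball c_def)
    also have "\<dots> = ennreal (2 ^ Suc k / R * (c * (R / 2 ^ k) ^ 3))"
      using R c by (subst ennreal_mult) auto
    also have "2 ^ Suc k / R * (c * (R / 2 ^ k) ^ 3) = 2 * c * R\<^sup>2 * (1/4) ^ k"
      using R p by (simp add: power_divide power3_eq_cube power2_eq_square field_simps)
    finally show "(\<integral>\<^sup>+z. ennreal (2 ^ Suc k / R) * indicator (ball (0 :: real^3) (R / 2 ^ k)) z \<partial>lborel) = ennreal (2 * c * R\<^sup>2 * (1/4) ^ k)" .
  qed
  also have "\<dots> = ennreal (\<Sum>k. 2 * c * R\<^sup>2 * (1/4) ^ k)"
    using c by (intro suminf_ennreal2) (auto intro!: summable_mult summable_geometric)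
  also have "\<dots> < \<infinity>" by simp
  finally show ?thesis .
qed

section \<open>The exchange-correlation functional and the Hartree energy\<close>

context bravais begin

lemma set_nn_integral_cm:
  "h \<in> borel_measurable borel \<Longrightarrow> (\<integral>\<^sup>+x\<in>cell A. h x \<partial>lborel) = (\<integral>\<^sup>+x. h x \<partial>cm A)"
  by (simp add: nn_integral_cm mult.commute)

text \<open>Through constant densities, differentiability of the functional becomes a statement
  about \<N> itself.\<close>

lemma local_xc_const:
  assumes "0 \<le> a"
  shows "local_xc A \<N> (\<lambda>x. a) = ereal (\<N> a * vol)"
proof -
  have c: "(\<integral>\<^sup>+x\<in>cell A. ennreal c \<partial>lborel) = ennreal c * ennreal vol" for c
    by (simp add: nn_integral_cmult_indicator emeasure_cell)
  show ?thesis
  proof (cases "0 \<le> \<N> a")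
    case True
    then show ?thesis using assms vol_pos unfolding local_xc_def c
      by (simp add: ennreal_mult[symmetric] ennreal_neg zero_ennreal.rep_eq)
  next
    case False
    then have "\<N> a * vol \<le> 0" using vol_pos by (simp add: mult_nonpos_nonneg)
    then show ?thesis using False assms vol_pos enn2ereal_ennreal[of "- (\<N> a * vol)"] unfolding local_xc_def c
      by (simp add: ennreal_mult[symmetric] ennreal_neg zero_ennreal.rep_eq)
  qed
qed

lemma xc_differentiable_continuous:
  assumes diff: "xc_differentiable A (local_xc A \<N>)"
  shows "continuous_on {0..} \<N>"
proof -
  \<comment> \<open>differentiability is tested along constant densities only\<close>
  have L: "(\<lambda>x. c) \<in> Linf_per A" for c by (auto simp: Linf_per_def periodic_def)
  \<comment> \<open>The difference quotient has a real limit, so the increment itself tends to 0.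
    This is one-sided, along the segment from \<open>a\<close> towards \<open>b\<close>.\<close>
  have near: "\<exists>d>0. \<forall>t. 0 < t \<longrightarrow> t < d \<longrightarrow> \<bar>\<N> (a + t * (b - a)) - \<N> a\<bar> < e"
    if a: "0 \<le> a" and b: "0 \<le> b" and e: "0 < e" for a b e :: real
  proof -
    obtain l where l: "((\<lambda>t. (local_xc A \<N> (\<lambda>x. a + t * (b - a)) - local_xc A \<N> (\<lambda>x. a)) / ereal t) \<longlongrightarrow> ereal l) (at_right 0)"
    proof -
      have "\<exists>F. \<forall>\<eta>\<in>Linf_per A. (\<forall>x. 0 \<le> \<eta> x) \<longrightarrow>
        ((\<lambda>t. (local_xc A \<N> (\<lambda>x. a + t * (\<eta> x - a)) - local_xc A \<N> (\<lambda>x. a)) / ereal t) \<longlongrightarrow> ereal (F (\<lambda>x. \<eta> x - a))) (at_right 0)"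
        using diff[unfolded xc_differentiable_def, rule_format, OF L[of a]] a by blast
      then obtain F where F: "\<And>\<eta>. \<eta> \<in> Linf_per A \<Longrightarrow> \<forall>x. 0 \<le> \<eta> x \<Longrightarrow>
        ((\<lambda>t. (local_xc A \<N> (\<lambda>x. a + t * (\<eta> x - a)) - local_xc A \<N> (\<lambda>x. a)) / ereal t) \<longlongrightarrow> ereal (F (\<lambda>x. \<eta> x - a))) (at_right 0)"
        by blast
      show thesis by (rule that[OF F[OF L]]) (use b in simp)
    qed
    have ev: "\<forall>\<^sub>F t in at_right 0. (local_xc A \<N> (\<lambda>x. a + t * (b - a)) - local_xc A \<N> (\<lambda>x. a)) / ereal t
        = ereal ((\<N> (a + t * (b - a)) * vol - \<N> a * vol) / t)"
      unfolding eventually_at_right[OF zero_less_one]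
    proof (intro exI[of _ 1] conjI allI impI)
      fix t :: real assume t: "0 < t" "t < 1"
      have "a + t * (b - a) = (1 - t) * a + t * b" by (simp add: algebra_simps)
      then have "0 \<le> a + t * (b - a)" using a b t by simp
      then show "(local_xc A \<N> (\<lambda>x. a + t * (b - a)) - local_xc A \<N> (\<lambda>x. a)) / ereal t
        = ereal ((\<N> (a + t * (b - a)) * vol - \<N> a * vol) / t)"
        using a t by (simp add: local_xc_const)
    qed simp
    have "((\<lambda>t. (\<N> (a + t * (b - a)) * vol - \<N> a * vol) / t) \<longlongrightarrow> l) (at_right 0)"
      using Lim_transform_eventually[OF l ev] by simp
    then have "((\<lambda>t. t * ((\<N> (a + t * (b - a)) * vol - \<N> a * vol) / t)) \<longlongrightarrow> 0 * l) (at_right 0)"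
      by (intro tendsto_mult tendsto_ident_at)
    moreover have "\<forall>\<^sub>F t::real in at_right 0. t * ((\<N> (a + t * (b - a)) * vol - \<N> a * vol) / t) = (\<N> (a + t * (b - a)) - \<N> a) * vol"
      unfolding eventually_at_right[OF zero_less_one] by (intro exI[of _ 1]) (auto simp: left_diff_distrib)
    ultimately have "((\<lambda>t. (\<N> (a + t * (b - a)) - \<N> a) * vol) \<longlongrightarrow> 0) (at_right 0)"
      using Lim_transform_eventually by fastforce
    from tendstoD[OF this, of "e * vol"] e vol_pos
    obtain d where d: "0 < d" "\<And>t. 0 < t \<Longrightarrow> t < d \<Longrightarrow> \<bar>(\<N> (a + t * (b - a)) - \<N> a) * vol\<bar> < e * vol"
      unfolding eventually_at_right[OF zero_less_one] by (auto simp: dist_real_def)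
    show ?thesis
    proof (intro exI[of _ d] conjI allI impI d(1))
      fix t assume "0 < t" "t < d"
      from d(2)[OF this] show "\<bar>\<N> (a + t * (b - a)) - \<N> a\<bar> < e" using vol_pos by (simp add: abs_mult)
    qed
  qed
  show ?thesis
    unfolding continuous_on_iff
  proof (intro ballI allI impI)
    fix a e :: real assume a: "a \<in> {0..}" and e: "0 < e"
    obtain d1 where d1: "0 < d1" "\<And>t. 0 < t \<Longrightarrow> t < d1 \<Longrightarrow> \<bar>\<N> (a + t * ((a + 1) - a)) - \<N> a\<bar> < e"
      using near[of a "a + 1" e] a e by auto
    obtain d2 where d2: "0 < d2" "\<And>t. 0 < t \<Longrightarrow> t < d2 \<Longrightarrow> \<bar>\<N> (a + t * (0 - a)) - \<N> a\<bar> < e"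
      using near[of a 0 e] a e by auto
    \<comment> \<open>A point x below \<open>a\<close> is reached from \<open>a\<close> in the
      direction of 0 at parameter (a - x) / a, so the radius \<open>d2\<close> is scaled by
      \<open>a\<close>. At a = 0 there are only points above.\<close>
    define d where "d = (if a = 0 then d1 else min d1 (d2 * a))"
    have d: "0 < d" using a d1 d2 by (auto simp: d_def)
    have "dist (\<N> x) (\<N> a) < e" if x: "x \<in> {0..}" "dist x a < d" for x
    proof -
      consider "x = a" | "a < x" | "x < a" by linarith
      then show ?thesis
      proof cases
        case 2
        then show ?thesis using d1(2)[of "x - a"] x by (auto simp: dist_real_def d_def split: if_splits)
      next
        case 3
        then have a0: "0 < a" using x by simp
        have "(a - x) / a < d2" using x 3 a0 by (auto simp: dist_real_def d_def field_simps)
        then show ?thesis using d2(2)[of "(a - x) / a"] 3 a0 by (simp add: dist_real_def)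
      qed (use e in simp)
    qed
    then show "\<exists>d>0. \<forall>x\<in>{0..}. dist x a < d \<longrightarrow> dist (\<N> x) (\<N> a) < e" using d by blast
  qed
qed

text \<open>Adding the weight \<open>w\<close> makes the integrand nonnegative, so that Fatou's lemma applies to it.\<close>

lemma local_xc_eq:
  assumes cN: "continuous_on {0..} \<N>" and C: "\<And>t. 0 \<le> t \<Longrightarrow> - w t \<le> \<N> t" and w0: "\<And>t. 0 \<le> t \<Longrightarrow> 0 \<le> w t"
    and w[measurable]: "w \<in> borel_measurable borel"
    and \<rho>[measurable]: "\<rho> \<in> borel_measurable borel" and pos: "AE x in cm A. 0 \<le> \<rho> x"
    and wi: "integrable (cm A) (\<lambda>x. w (\<rho> x))"
  shows "local_xc A \<N> \<rho> = enn2ereal (\<integral>\<^sup>+x. ennreal (\<N> (max 0 (\<rho> x)) + w (\<rho> x)) \<partial>cm A) - ereal (LINT x|cm A. w (\<rho> x))"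
    "- ereal (LINT x|cm A. w (\<rho> x)) \<le> local_xc A \<N> \<rho>"
proof -
  \<comment> \<open>A continuous, hence Borel measurable, extension of \<N> to the line; it agrees
    with \<N> almost everywhere along the density.\<close>
  define N' where "N' t = \<N> (max 0 t)" for t
  have "continuous_on UNIV N'"
    unfolding N'_def[abs_def] by (rule continuous_on_compose2[OF cN]) (auto intro!: continuous_intros)
  then have [measurable]: "N' \<in> borel_measurable borel" by (rule borel_measurable_continuous_onI)
  have ae: "AE x in cm A. \<N> (\<rho> x) = N' (\<rho> x)"
    using pos by eventually_elim (simp add: N'_def)
  have set: "(\<integral>\<^sup>+x\<in>cell A. ennreal (k (\<N> (\<rho> x))) \<partial>lborel) = (\<integral>\<^sup>+x. ennreal (k (N' (\<rho> x))) \<partial>cm A)"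
    if [measurable]: "k \<in> borel_measurable borel" for k
  proof -
    have "(\<integral>\<^sup>+x\<in>cell A. ennreal (k (\<N> (\<rho> x))) \<partial>lborel) = (\<integral>\<^sup>+x\<in>cell A. ennreal (k (N' (\<rho> x))) \<partial>lborel)"
    proof (rule nn_integral_cong_AE)
      show "AE x in lborel. ennreal (k (\<N> (\<rho> x))) * indicator (cell A) x = ennreal (k (N' (\<rho> x))) * indicator (cell A) x"
        using ae unfolding AE_cm by eventually_elim (auto simp: indicator_def)
    qed
    then show ?thesis by (simp add: set_nn_integral_cm)
  qed
  let ?P = "\<integral>\<^sup>+x. ennreal (N' (\<rho> x)) \<partial>cm A" and ?N = "\<integral>\<^sup>+x. ennreal (- N' (\<rho> x)) \<partial>cm A"
    and ?W = "\<integral>\<^sup>+x. ennreal (w (\<rho> x)) \<partial>cm A" and ?J = "\<integral>\<^sup>+x. ennreal (N' (\<rho> x) + w (\<rho> x)) \<partial>cm A"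
  have loc: "local_xc A \<N> \<rho> = enn2ereal ?P - enn2ereal ?N"
    using pos set[of "\<lambda>x. x"] set[of "\<lambda>x. - x"] unfolding local_xc_def AE_cm by simp
  have wpos: "AE x in cm A. 0 \<le> w (\<rho> x)" using pos by eventually_elim (rule w0)
  have W: "?W = ennreal (LINT x|cm A. w (\<rho> x))" by (rule nn_integral_eq_integral[OF wi wpos])
  have L0: "0 \<le> (LINT x|cm A. w (\<rho> x))" using wpos by (intro integral_nonneg_AE)
  have NW: "?N \<le> ?W"
  proof (rule nn_integral_mono_AE)
    show "AE x in cm A. ennreal (- N' (\<rho> x)) \<le> ennreal (w (\<rho> x))"
      using pos
    proof eventually_elim
      case (elim x)
      then show ?case using C[OF elim] by (intro ennreal_leI) (simp add: N'_def)
    qed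
  qed
  \<comment> \<open>The decomposition into positive and negative parts in additive form, since
    \<open>?P\<close> and \<open>?J\<close> may be infinite.\<close>
  have "?J + ?N = ?P + ?W"
  proof -
    have "?J + ?N = (\<integral>\<^sup>+x. ennreal (N' (\<rho> x) + w (\<rho> x)) + ennreal (- N' (\<rho> x)) \<partial>cm A)"
      by (rule nn_integral_add[symmetric]) measurable
    also have "\<dots> = (\<integral>\<^sup>+x. ennreal (N' (\<rho> x)) + ennreal (w (\<rho> x)) \<partial>cm A)"
    proof (rule nn_integral_cong_AE)
      show "AE x in cm A. ennreal (N' (\<rho> x) + w (\<rho> x)) + ennreal (- N' (\<rho> x)) = ennreal (N' (\<rho> x)) + ennreal (w (\<rho> x))"
        using pos
      proof eventually_elim
        case (elim x)
        have "- w (\<rho> x) \<le> N' (\<rho> x)" "0 \<le> w (\<rho> x)" using C[OF elim] w0[OF elim] elim by (simp_all add: N'_def)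
        then show ?case
          by (cases "0 \<le> N' (\<rho> x)") (simp_all add: ennreal_neg ennreal_plus[symmetric] del: ennreal_plus)
      qed
    qed
    also have "\<dots> = ?P + ?W" by (rule nn_integral_add) measurable
    finally show ?thesis .
  qed
  \<comment> \<open>Finiteness of the negative part, by comparison with the weight, is what allows
    the additive identity to be solved for the difference.\<close>
  moreover obtain n where n: "?N = ennreal n" "0 \<le> n" using NW W by (cases ?N) (auto simp: top_unique)
  ultimately have "?J + ennreal n = ?P + ennreal (LINT x|cm A. w (\<rho> x))" by (simp only: W)
  from arg_cong[OF this, of enn2ereal] have E: "enn2ereal ?J + ereal n = enn2ereal ?P + ereal (LINT x|cm A. w (\<rho> x))"
    by (simp only: plus_ennreal.rep_eq enn2ereal_ennreal[OF n(2)] enn2ereal_ennreal[OF L0])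
  have "enn2ereal ?P - ereal n = enn2ereal ?J - ereal (LINT x|cm A. w (\<rho> x))"
    using E by (cases "enn2ereal ?J"; cases "enn2ereal ?P") auto
  then show "local_xc A \<N> \<rho> = enn2ereal (\<integral>\<^sup>+x. ennreal (\<N> (max 0 (\<rho> x)) + w (\<rho> x)) \<partial>cm A) - ereal (LINT x|cm A. w (\<rho> x))"
    unfolding loc n(1) using n(2) by (simp add: N'_def)
  have "0 \<le> enn2ereal ?J" by simp
  then show "- ereal (LINT x|cm A. w (\<rho> x)) \<le> local_xc A \<N> \<rho>"
    unfolding loc n(1) using n(2) \<open>enn2ereal ?P - ereal n = _\<close>
    by (cases "enn2ereal ?J") auto
qed

text \<open>The bound of \<open>growth_class_lower_bound\<close> with opposite sign; its integral
  involves only the volume, the mass and the L2 norm of the density.\<close>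

definition wgt :: "real \<Rightarrow> real \<Rightarrow> real \<Rightarrow> real" where "wgt C s t = C * (1 + s * t + t\<^sup>2 / s)"

lemma wgt_nonneg: "0 \<le> C \<Longrightarrow> 0 < s \<Longrightarrow> 0 \<le> t \<Longrightarrow> 0 \<le> wgt C s t"
  by (simp add: wgt_def)

lemma wgt_integral:
  assumes "\<rho> \<in> Lp 2 (cm A)"
  shows "integrable (cm A) (\<lambda>x. wgt C s (\<rho> x))"
    "(LINT x|cm A. wgt C s (\<rho> x)) = C * (vol + s * (LINT x|cm A. \<rho> x) + (nrm 2 (cm A) \<rho>)\<^sup>2 / s)"
proof -
  have i: "integrable (cm A) \<rho>" "integrable (cm A) (\<lambda>x. (\<rho> x)\<^sup>2)"
    using cm.L2_imp_integrable(1)[OF assms] Lp_integrable[OF assms] by auto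
  then show "integrable (cm A) (\<lambda>x. wgt C s (\<rho> x))" by (simp add: wgt_def)
  have "(LINT x|cm A. wgt C s (\<rho> x)) = C * (LINT x|cm A. 1 + s * \<rho> x + (\<rho> x)\<^sup>2 / s)" by (simp add: wgt_def)
  also have "(LINT x|cm A. 1 + s * \<rho> x + (\<rho> x)\<^sup>2 / s) = vol + s * (LINT x|cm A. \<rho> x) + (nrm 2 (cm A) \<rho>)\<^sup>2 / s"
    using i by (simp add: nrm_power2 measure_cm)
  finally show "(LINT x|cm A. wgt C s (\<rho> x)) = C * (vol + s * (LINT x|cm A. \<rho> x) + (nrm 2 (cm A) \<rho>)\<^sup>2 / s)" .
qed

lemma local_xc_lower:
  assumes cN: "continuous_on {0..} \<N>" and C0: "0 \<le> C" and C: "\<And>t s. 0 \<le> t \<Longrightarrow> 0 < s \<Longrightarrow> - C * (1 + s * t + t\<^sup>2 / s) \<le> \<N> t"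
    and \<rho>: "\<rho> \<in> Lp 2 (cm A)" and pos: "AE x in cm A. 0 \<le> \<rho> x" and s: "0 < s"
  shows "- ereal (C * (vol + s * (LINT x|cm A. \<rho> x) + (nrm 2 (cm A) \<rho>)\<^sup>2 / s)) \<le> local_xc A \<N> \<rho>"
proof -
  have m: "\<rho> \<in> borel_measurable borel" using Lp_measurable[OF \<rho>] by simp
  have wm: "wgt C s \<in> borel_measurable borel" unfolding wgt_def[abs_def] by measurable
  have b: "- wgt C s t \<le> \<N> t" if "0 \<le> t" for t using C[OF that s] by (simp add: wgt_def)
  from local_xc_eq(2)[OF cN b wgt_nonneg[OF C0 s] wm m pos wgt_integral(1)[OF \<rho>]]
  show ?thesis by (simp add: wgt_integral(2)[OF \<rho>])
qed

text \<open>Fatou applies to the nonnegative sum of \<N> and the weight, while the integrals of the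
  weight converge because the densities converge in L2; subtracting a convergent sequence preserves
  lower semicontinuity.\<close>

lemma local_xc_lsc:
  assumes cN: "continuous_on {0..} \<N>" and C0: "0 \<le> C" and C: "\<And>t s. 0 \<le> t \<Longrightarrow> 0 < s \<Longrightarrow> - C * (1 + s * t + t\<^sup>2 / s) \<le> \<N> t"
    and \<rho>k: "\<And>k. \<rho>k k \<in> Lp 2 (cm A)" and posk: "\<And>k. AE x in cm A. 0 \<le> \<rho>k k x"
    and \<rho>: "\<rho> \<in> Lp 2 (cm A)" and lim: "(\<lambda>k. nrm 2 (cm A) (\<lambda>x. \<rho>k k x - \<rho> x)) \<longlonglongrightarrow> 0"
    and ae: "AE x in cm A. (\<lambda>k. \<rho>k k x) \<longlonglongrightarrow> \<rho> x"
    and x: "\<And>k. local_xc A \<N> (\<rho>k k) \<le> ereal (X k)" "X \<longlonglongrightarrow> x"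
  shows "local_xc A \<N> \<rho> \<le> ereal x"
proof -
  have m: "\<rho> \<in> borel_measurable borel" "\<rho>k k \<in> borel_measurable borel" for k
    using Lp_measurable[OF \<rho>] Lp_measurable[OF \<rho>k] by simp_all
  have wm[measurable]: "wgt C 1 \<in> borel_measurable borel" unfolding wgt_def[abs_def] by measurable
  have b: "- wgt C 1 t \<le> \<N> t" if "0 \<le> t" for t using C[OF that, of 1] by (simp add: wgt_def)
  have w0: "0 \<le> wgt C 1 t" if "0 \<le> t" for t using wgt_nonneg[OF C0 _ that, of 1] by simp
  have pos: "AE x in cm A. 0 \<le> \<rho> x"
  proof -
    have "AE x in cm A. \<forall>k. 0 \<le> \<rho>k k x" using posk by (simp add: AE_all_countable)
    with ae show ?thesis by eventually_elim (auto intro: LIMSEQ_le_const)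
  qed
  have e: "local_xc A \<N> \<rho> = enn2ereal (\<integral>\<^sup>+x. ennreal (\<N> (max 0 (\<rho> x)) + wgt C 1 (\<rho> x)) \<partial>cm A) - ereal (LINT x|cm A. wgt C 1 (\<rho> x))"
    by (rule local_xc_eq(1)[OF cN b w0 wm m(1) pos wgt_integral(1)[OF \<rho>]])
  have ek: "local_xc A \<N> (\<rho>k k) = enn2ereal (\<integral>\<^sup>+x. ennreal (\<N> (max 0 (\<rho>k k x)) + wgt C 1 (\<rho>k k x)) \<partial>cm A) - ereal (LINT x|cm A. wgt C 1 (\<rho>k k x))" for k
    by (rule local_xc_eq(1)[OF cN b w0 wm m(2) posk wgt_integral(1)[OF \<rho>k]])
  define W where "W = (LINT x|cm A. wgt C 1 (\<rho> x))"
  define Wk where "Wk k = (LINT x|cm A. wgt C 1 (\<rho>k k x))" for k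
  let ?c = "\<lambda>t. \<N> (max 0 t) + wgt C 1 t"
  have cc: "continuous_on UNIV ?c"
    unfolding wgt_def by (intro continuous_intros continuous_on_compose2[OF cN]) auto
  have [measurable]: "?c \<in> borel_measurable borel" using cc by (rule borel_measurable_continuous_onI)
  have [measurable]: "\<rho> \<in> borel_measurable borel" "\<And>k. \<rho>k k \<in> borel_measurable borel" by (rule m)+
  have Wlim: "Wk \<longlonglongrightarrow> W"
  proof -
    have c1: "(\<lambda>x. 1::real) \<in> Lp 2 (cm A)" by (rule Lp_const) (rule finite_measure_cm)
    have "(\<lambda>k. LINT x|cm A. \<rho>k k x * 1) \<longlonglongrightarrow> (LINT x|cm A. \<rho> x * 1)"
      by (rule L2_inner_tendsto[where v="\<lambda>_ _. 1", OF \<rho>k \<rho> c1 c1 lim]) simp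
    then have 1: "(\<lambda>k. LINT x|cm A. \<rho>k k x) \<longlonglongrightarrow> (LINT x|cm A. \<rho> x)" by simp
    have "(\<lambda>k. LINT x|cm A. \<rho>k k x * \<rho>k k x) \<longlonglongrightarrow> (LINT x|cm A. \<rho> x * \<rho> x)"
      by (rule L2_inner_tendsto[OF \<rho>k \<rho> \<rho>k \<rho> lim lim])
    then have 2: "(\<lambda>k. (nrm 2 (cm A) (\<rho>k k))\<^sup>2) \<longlonglongrightarrow> (nrm 2 (cm A) \<rho>)\<^sup>2"
      by (simp add: nrm_power2 power2_eq_square[symmetric])
    show ?thesis unfolding W_def Wk_def[abs_def] wgt_integral(2)[OF \<rho>k] wgt_integral(2)[OF \<rho>]
      by (intro tendsto_intros 1 2) simp
  qed
  let ?J = "\<integral>\<^sup>+x. ennreal (?c (\<rho> x)) \<partial>cm A" and ?Jk = "\<lambda>k. \<integral>\<^sup>+x. ennreal (?c (\<rho>k k x)) \<partial>cm A"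
  have Jk: "?Jk k \<le> ennreal (X k + Wk k) \<and> 0 \<le> X k + Wk k" for k
  proof -
    have "enn2ereal (?Jk k) - ereal (Wk k) \<le> ereal (X k)" using x(1)[of k] by (simp only: ek Wk_def)
    then have *: "enn2ereal (?Jk k) \<le> ereal (X k + Wk k)" by (cases "enn2ereal (?Jk k)") auto
    have "0 \<le> X k + Wk k" using order_trans[OF enn2ereal_nonneg *] by simp
    then show ?thesis using * by (simp add: less_eq_ennreal.rep_eq)
  qed
  have "AE x in cm A. ennreal (?c (\<rho> x)) = liminf (\<lambda>k. ennreal (?c (\<rho>k k x)))"
    using ae
  proof eventually_elim
    case (elim x)
    have "(\<lambda>k. ?c (\<rho>k k x)) \<longlonglongrightarrow> ?c (\<rho> x)"
      using cc elim by (rule continuous_on_tendsto_compose) auto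
    then have "(\<lambda>k. ennreal (?c (\<rho>k k x))) \<longlonglongrightarrow> ennreal (?c (\<rho> x))" by (rule tendsto_ennrealI)
    then show ?case by (rule lim_imp_Liminf[OF trivial_limit_sequentially, symmetric])
  qed
  then have "?J = (\<integral>\<^sup>+x. liminf (\<lambda>k. ennreal (?c (\<rho>k k x))) \<partial>cm A)" by (rule nn_integral_cong_AE)
  also have "\<dots> \<le> liminf ?Jk" by (rule nn_integral_liminf) measurable
  also have "\<dots> \<le> liminf (\<lambda>k. ennreal (X k + Wk k))" using Jk by (intro Liminf_mono always_eventually) auto
  also have "\<dots> = ennreal (x + W)"
    by (intro lim_imp_Liminf trivial_limit_sequentially tendsto_ennrealI tendsto_add x(2) Wlim)
  finally have J: "?J \<le> ennreal (x + W)" .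
  have "0 \<le> x + W"
    by (rule LIMSEQ_le_const[OF tendsto_add[OF x(2) Wlim]]) (use Jk in auto)
  then have "enn2ereal ?J \<le> ereal (x + W)" using J by (simp add: less_eq_ennreal.rep_eq)
  then have "enn2ereal ?J - ereal W \<le> ereal x" by (cases "enn2ereal ?J") auto
  then show ?thesis unfolding e W_def .
qed

text \<open>Twice the Hartree energy as an iterated nonnegative integral, to which Tonelli and Fatou
  apply; \<open>hartree_eq\<close> gives the link for nonnegative densities.\<close>

definition Hn :: "(real^3 \<Rightarrow> real) \<Rightarrow> ennreal" where
  "Hn \<rho> = (\<integral>\<^sup>+r. \<integral>\<^sup>+r'. ennreal (\<rho> r * \<rho> r' / norm (r - r')) \<partial>cm A \<partial>cm A)"

text \<open>Differences of points of the cell lie in a ball, over which the Coulomb kernel is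
  integrable in dimension three.\<close>

lemma coulomb_bound: "\<exists>\<kappa>. \<forall>r\<in>cell A. (\<integral>\<^sup>+r'. ennreal (1 / norm (r - r')) \<partial>cm A) \<le> ennreal \<kappa>"
proof -
  obtain R where R: "\<And>x. x \<in> cell A \<Longrightarrow> norm x \<le> R" using bounded_cell unfolding bounded_iff by blast
  define R' where "R' = 2 * \<bar>R\<bar> + 1"
  have [measurable]: "ball (0 :: real^3) R' \<in> sets borel" by simp
  define k where "k = (\<integral>\<^sup>+z. ennreal (1 / norm z) * indicator (ball (0 :: real^3) R') z \<partial>lborel)"
  have k: "k < \<infinity>" unfolding k_def by (rule inverse_norm_integrable) (simp add: R'_def)
  have "(\<integral>\<^sup>+r'. ennreal (1 / norm (r - r')) \<partial>cm A) \<le> k" if r: "r \<in> cell A" for r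
  proof -
    have "(\<integral>\<^sup>+r'. ennreal (1 / norm (r - r')) \<partial>cm A) = (\<integral>\<^sup>+r'. indicator (cell A) r' * ennreal (1 / norm (r - r')) \<partial>lborel)"
      by (rule nn_integral_cm) measurable
    also have "\<dots> \<le> (\<integral>\<^sup>+r'. ennreal (1 / norm (r' + - r)) * indicator (ball 0 R') (r' + - r) \<partial>lborel)"
    proof (rule nn_integral_mono)
      fix r' :: "real^3"
      have "r' \<in> cell A \<Longrightarrow> norm (r' - r) < R'"
        using norm_triangle_ineq4[of r' r] R[of r'] R[OF r] by (simp add: R'_def)
      then show "indicator (cell A) r' * ennreal (1 / norm (r - r')) \<le> ennreal (1 / norm (r' + - r)) * indicator (ball 0 R') (r' + - r)"
        by (auto simp: indicator_def norm_minus_commute)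
    qed
    also have "\<dots> = k" unfolding k_def by (rule nn_integral_lborel_shift) measurable
    finally show ?thesis .
  qed
  then show ?thesis using k by (intro exI[of _ "enn2real k"]) auto
qed

text \<open>Schur's test: the product of two values of the density is at most the sum of their
  squares, and each square is paired with a kernel whose integral over the other variable is
  bounded.\<close>

lemma Hn_finite:
  assumes \<rho>: "\<rho> \<in> Lp 2 (cm A)"
  shows "Hn \<rho> < \<infinity>"
proof -
  obtain \<kappa> where \<kappa>: "\<And>r. r \<in> cell A \<Longrightarrow> (\<integral>\<^sup>+r'. ennreal (1 / norm (r - r')) \<partial>cm A) \<le> ennreal \<kappa>" using coulomb_bound by blast
  have [measurable]: "\<rho> \<in> borel_measurable borel" using Lp_measurable[OF \<rho>] by simp
  let ?f = "\<lambda>r r'. ennreal ((\<rho> r)\<^sup>2) * ennreal (1 / norm (r - r'))"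
  have fin: "(\<integral>\<^sup>+r. \<integral>\<^sup>+r'. ?f r r' \<partial>cm A \<partial>cm A) \<le> ennreal ((nrm 2 (cm A) \<rho>)\<^sup>2) * ennreal \<kappa>"
  proof -
    have "(\<integral>\<^sup>+r. \<integral>\<^sup>+r'. ?f r r' \<partial>cm A \<partial>cm A) \<le> (\<integral>\<^sup>+r. ennreal ((\<rho> r)\<^sup>2) * ennreal \<kappa> \<partial>cm A)"
    proof (rule nn_integral_mono_AE)
      show "AE r in cm A. (\<integral>\<^sup>+r'. ?f r r' \<partial>cm A) \<le> ennreal ((\<rho> r)\<^sup>2) * ennreal \<kappa>"
        using AE_cm_cell
      proof eventually_elim
        case (elim r)
        have "(\<integral>\<^sup>+r'. ?f r r' \<partial>cm A) = ennreal ((\<rho> r)\<^sup>2) * (\<integral>\<^sup>+r'. ennreal (1 / norm (r - r')) \<partial>cm A)"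
          by (rule nn_integral_cmult) measurable
        then show ?case using \<kappa>[OF elim] by (simp add: mult_left_mono)
      qed
    qed
    also have "\<dots> = (\<integral>\<^sup>+r. ennreal ((\<rho> r)\<^sup>2) \<partial>cm A) * ennreal \<kappa>" by (rule nn_integral_multc) measurable
    finally show ?thesis unfolding nn_integral_L2_square[OF \<rho>] .
  qed
  interpret pair_sigma_finite "cm A" "cm A" by (intro pair_sigma_finite.intro cm.sigma_finite_measure_axioms)
  have sw: "(\<integral>\<^sup>+r. \<integral>\<^sup>+r'. ?f r' r \<partial>cm A \<partial>cm A) = (\<integral>\<^sup>+r. \<integral>\<^sup>+r'. ?f r r' \<partial>cm A \<partial>cm A)"
    by (rule Fubini') measurable
  have "Hn \<rho> \<le> (\<integral>\<^sup>+r. \<integral>\<^sup>+r'. ?f r r' + ?f r' r \<partial>cm A \<partial>cm A)"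
    unfolding Hn_def
  proof (intro nn_integral_mono)
    fix r r' :: "real^3"
    have "\<rho> r * \<rho> r' \<le> (\<rho> r)\<^sup>2 + (\<rho> r')\<^sup>2"
      using sum_squares_bound[of "\<rho> r" "\<rho> r'"] zero_le_power2[of "\<rho> r"] zero_le_power2[of "\<rho> r'"] by linarith
    then have "\<rho> r * \<rho> r' / norm (r - r') \<le> ((\<rho> r)\<^sup>2 + (\<rho> r')\<^sup>2) / norm (r - r')" by (rule divide_right_mono) simp
    also have "\<dots> = (\<rho> r)\<^sup>2 * (1 / norm (r - r')) + (\<rho> r')\<^sup>2 * (1 / norm (r' - r))"
      by (simp add: add_divide_distrib norm_minus_commute)
    finally show "ennreal (\<rho> r * \<rho> r' / norm (r - r')) \<le> ?f r r' + ?f r' r"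
      by (simp add: ennreal_mult[symmetric] ennreal_plus[symmetric] ennreal_leI del: ennreal_plus)
  qed
  also have "\<dots> = (\<integral>\<^sup>+r. \<integral>\<^sup>+r'. ?f r r' \<partial>cm A \<partial>cm A) + (\<integral>\<^sup>+r. \<integral>\<^sup>+r'. ?f r' r \<partial>cm A \<partial>cm A)"
    by (simp add: nn_integral_add)
  also have "\<dots> < \<infinity>" unfolding sw using fin by (auto intro: le_less_trans simp: ennreal_mult_less_top)
  finally show ?thesis .
qed

lemma hartree_eq:
  assumes \<rho>: "\<rho> \<in> Lp 2 (cm A)" and pos: "AE x in cm A. 0 \<le> \<rho> x"
  shows "ennreal (2 * hartree A \<rho>) = Hn \<rho>" "0 \<le> hartree A \<rho>"
proof -
  have [measurable]: "\<rho> \<in> borel_measurable borel" using Lp_measurable[OF \<rho>] by simp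
  let ?I = "\<lambda>r. \<integral>\<^sup>+r'. ennreal (\<rho> r * \<rho> r' / norm (r - r')) \<partial>cm A"
  have inner: "AE r in cm A. (LINT r':cell A|lborel. \<rho> r * \<rho> r' / norm (r - r')) = enn2real (?I r)"
    using pos
  proof eventually_elim
    case (elim r)
    have "(LINT r':cell A|lborel. \<rho> r * \<rho> r' / norm (r - r')) = (LINT r'|cm A. \<rho> r * \<rho> r' / norm (r - r'))"
      by (rule integral_cm) measurable
    also have "\<dots> = enn2real (?I r)"
    proof (rule integral_eq_nn_integral)
      show "AE r' in cm A. 0 \<le> \<rho> r * \<rho> r' / norm (r - r')"
        using pos by eventually_elim (use elim in auto)
    qed measurable
    finally show ?case .
  qed
  have m: "(\<lambda>r. LINT r':cell A|lborel. \<rho> r * \<rho> r' / norm (r - r')) \<in> borel_measurable borel"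
    unfolding set_lebesgue_integral_def by (rule lborel.borel_measurable_lebesgue_integral) measurable
  have "2 * hartree A \<rho> = (LINT r|cm A. (LINT r':cell A|lborel. \<rho> r * \<rho> r' / norm (r - r')))"
    unfolding hartree_def by (subst integral_cm[OF m]) simp
  also have "\<dots> = (LINT r|cm A. enn2real (?I r))"
    using inner m by (intro integral_cong_AE) auto
  also have "\<dots> = enn2real (\<integral>\<^sup>+r. ennreal (enn2real (?I r)) \<partial>cm A)"
    by (rule integral_eq_nn_integral) auto
  also have "(\<integral>\<^sup>+r. ennreal (enn2real (?I r)) \<partial>cm A) = Hn \<rho>"
    unfolding Hn_def
  proof (rule nn_integral_cong_AE)
    \<comment> \<open>Needed because \<open>enn2real\<close> sends infinity to 0.\<close>
    have "AE r in cm A. ?I r \<noteq> \<infinity>"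
      using Hn_finite[OF \<rho>] unfolding Hn_def by (intro nn_integral_noteq_infinite) auto
    then show "AE r in cm A. ennreal (enn2real (?I r)) = ?I r"
      by eventually_elim (simp add: less_top)
  qed
  finally have *: "2 * hartree A \<rho> = enn2real (Hn \<rho>)" .
  then show "ennreal (2 * hartree A \<rho>) = Hn \<rho>" using Hn_finite[OF \<rho>] by simp
  show "0 \<le> hartree A \<rho>" using * enn2real_nonneg[of "Hn \<rho>"] by linarith
qed

text \<open>Fatou's lemma in r' for almost every r, and then in r.\<close>

lemma hartree_lsc:
  assumes \<rho>k: "\<And>k. \<rho>k k \<in> Lp 2 (cm A)" and posk: "\<And>k. AE x in cm A. 0 \<le> \<rho>k k x"
    and \<rho>: "\<rho> \<in> Lp 2 (cm A)" and pos: "AE x in cm A. 0 \<le> \<rho> x"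
    and ae: "AE x in cm A. (\<lambda>k. \<rho>k k x) \<longlonglongrightarrow> \<rho> x"
    and lim: "(\<lambda>k. hartree A (\<rho>k k)) \<longlonglongrightarrow> h"
  shows "hartree A \<rho> \<le> h"
proof -
  have [measurable]: "\<rho> \<in> borel_measurable borel" "\<rho>k k \<in> borel_measurable borel" for k
    using Lp_measurable[OF \<rho>] Lp_measurable[OF \<rho>k] by simp_all
  let ?F = "\<lambda>k r r'. ennreal (\<rho>k k r * \<rho>k k r' / norm (r - r'))"
  have "Hn \<rho> \<le> (\<integral>\<^sup>+r. liminf (\<lambda>k. \<integral>\<^sup>+r'. ?F k r r' \<partial>cm A) \<partial>cm A)"
    unfolding Hn_def
  proof (rule nn_integral_mono_AE)
    show "AE r in cm A. (\<integral>\<^sup>+r'. ennreal (\<rho> r * \<rho> r' / norm (r - r')) \<partial>cm A) \<le> liminf (\<lambda>k. \<integral>\<^sup>+r'. ?F k r r' \<partial>cm A)"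
      using ae
    proof eventually_elim
      case (elim r)
      have "AE r' in cm A. ennreal (\<rho> r * \<rho> r' / norm (r - r')) = liminf (\<lambda>k. ?F k r r')"
        using ae
      proof eventually_elim
        case e: (elim r')
        have "(\<lambda>k. \<rho>k k r * \<rho>k k r' * (1 / norm (r - r'))) \<longlonglongrightarrow> \<rho> r * \<rho> r' * (1 / norm (r - r'))"
          by (intro tendsto_mult elim e tendsto_const)
        then have "(\<lambda>k. ?F k r r') \<longlonglongrightarrow> ennreal (\<rho> r * \<rho> r' / norm (r - r'))" by (intro tendsto_ennrealI) simp
        then show ?case by (rule lim_imp_Liminf[OF trivial_limit_sequentially, symmetric])
      qed
      then have "(\<integral>\<^sup>+r'. ennreal (\<rho> r * \<rho> r' / norm (r - r')) \<partial>cm A) = (\<integral>\<^sup>+r'. liminf (\<lambda>k. ?F k r r') \<partial>cm A)"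
        by (rule nn_integral_cong_AE)
      also have "\<dots> \<le> liminf (\<lambda>k. \<integral>\<^sup>+r'. ?F k r r' \<partial>cm A)" by (rule nn_integral_liminf) measurable
      finally show ?case .
    qed
  qed
  also have "\<dots> \<le> liminf (\<lambda>k. Hn (\<rho>k k))"
    unfolding Hn_def by (rule nn_integral_liminf) measurable
  also have "\<dots> = liminf (\<lambda>k. ennreal (2 * hartree A (\<rho>k k)))"
    using hartree_eq(1)[OF \<rho>k posk] by simp
  also have "\<dots> = ennreal (2 * h)"
    by (intro lim_imp_Liminf trivial_limit_sequentially tendsto_ennrealI tendsto_mult tendsto_const lim)
  finally have "ennreal (2 * hartree A \<rho>) \<le> ennreal (2 * h)" unfolding hartree_eq(1)[OF \<rho> pos] .
  moreover have "0 \<le> h"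
    by (rule LIMSEQ_le_const[OF lim]) (use hartree_eq(2)[OF \<rho>k posk] in auto)
  ultimately show ?thesis by simp
qed

end

section \<open>Weighted orbitals\<close>

lemma nrm_sum_le:
  assumes "0 < p" "\<And>i. i \<in> I \<Longrightarrow> u i \<in> Lp p M"
  shows "nrm p M (\<lambda>x. \<Sum>i\<in>I. u i x) \<le> (\<Sum>i\<in>I. nrm p M (u i))"
  using assms(2)
proof (induction I rule: infinite_finite_induct)
  case (insert i I)
  have "(\<lambda>x. \<Sum>i\<in>I. u i x) \<in> Lp p M" using insert assms(1) by (intro Lp_sum) auto
  from nrm_triangle[OF assms(1) _ this, of "u i"] insert show ?case by simp
qed (use assms(1) in auto)

lemma trace_Diag: "trace (X ** Diag v) = (\<Sum>i\<in>UNIV. X $ i $ i * v $ i)"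
proof -
  have "(\<Sum>k\<in>UNIV. X $ i $ k * (if k = i then v $ k else 0)) = X $ i $ i * v $ i" for i
    using sum.delta[of UNIV i "\<lambda>k. X $ i $ k * v $ k"] by (simp add: if_distrib cong: if_cong)
  then show ?thesis by (simp add: trace_def matrix_matrix_mult_def Diag_def)
qed

lemma Diag_nth [simp]: "Diag v $ i $ i = v $ i"
  by (simp add: Diag_def)

lemma trace_apply_diag: "trace (apply_diag g (Diag v)) = (\<Sum>i\<in>UNIV. g (v $ i))"
  by (simp add: apply_diag_def trace_def)

lemma Focc_iff: "F \<in> Focc Ne \<longleftrightarrow> (\<exists>v. F = Diag v \<and> 2 * (\<Sum>i\<in>UNIV. v $ i) = real Ne \<and> (\<forall>i. v $ i \<in> {0..1}))"
  by (auto simp: Focc_def)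

context operators begin

definition qf :: "(real^3 \<Rightarrow> real) \<Rightarrow> real^3 \<Rightarrow> real" where
  "qf u x = mvec u \<bullet> (Q x *v mvec u)"

text \<open>\<open>rhoT\<close> is the density in terms of the weighted orbitals \<open>tup\<close>, that is \<open>u\<^sub>i = \<surd>v\<^sub>i \<psi>\<^sub>i\<close>.\<close>

definition rhoT :: "('n::finite \<Rightarrow> real^3 \<Rightarrow> real) \<Rightarrow> real^3 \<Rightarrow> real" where
  "rhoT u x = (\<Sum>i\<in>UNIV. 2 * ((u i x)\<^sup>2 + qf (u i) x))"

definition tup :: "(real^3 \<Rightarrow> real^'n::finite) \<Rightarrow> real^'n \<Rightarrow> 'n \<Rightarrow> real^3 \<Rightarrow> real" where
  "tup \<Psi> v i x = sqrt (v $ i) * \<Psi> x $ i"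

lemma qf_mult: "u \<in> L2per A \<Longrightarrow> qf (\<lambda>x. a * u x) x = a\<^sup>2 * qf u x"
  by (simp add: qf_def mvec_mult matrix_vector_mult_scaleR power2_eq_square mult.assoc)

text \<open>Every contribution is quadratic in the orbital, so an occupation enters as the square of
  its root.\<close>

lemma density_eq:
  assumes \<Psi>: "\<And>i. (\<lambda>x. \<Psi> x $ i) \<in> L2per A" and v: "\<And>i. 0 \<le> v $ i"
  shows "density A M Q \<Psi> (Diag v) = rhoT (tup \<Psi> v)"
proof
  fix x
  have 1: "(gram A \<Psi> M ** Q x ** gram A M \<Psi>) $ i $ i = qf (\<lambda>y. \<Psi> y $ i) x" for i
  proof -
    have "(gram A \<Psi> M ** (Q x ** gram A M \<Psi>)) $ i $ i = (\<Sum>l\<in>UNIV. mvec (\<lambda>y. \<Psi> y $ i) $ l * (\<Sum>p\<in>UNIV. Q x $ l $ p * mvec (\<lambda>y. \<Psi> y $ i) $ p))"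
      by (simp add: matrix_matrix_mult_def gram_def mvec_def ip_commute[of "\<lambda>y. M y $ _"])
    then show ?thesis by (simp add: matrix_mul_assoc qf_def inner_vec_def matrix_vector_mult_def)
  qed
  have 2: "qf (tup \<Psi> v i) x = v $ i * qf (\<lambda>y. \<Psi> y $ i) x" for i
    using qf_mult[OF \<Psi>, of "sqrt (v $ i)" i x] v[of i] by (simp add: tup_def[abs_def])
  have 3: "(tup \<Psi> v i x)\<^sup>2 = v $ i * (\<Psi> x $ i)\<^sup>2" for i
    using v[of i] by (simp add: tup_def power_mult_distrib)
  show "density A M Q \<Psi> (Diag v) x = rhoT (tup \<Psi> v) x"
    unfolding density_def trace_Diag rhoT_def 2 3
    by (simp add: 1 outer_def sum_distrib_left power2_eq_square algebra_simps)
qed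

lemma energy_kin_eq:
  assumes \<Psi>: "\<And>i. (\<lambda>x. \<Psi> x $ i) \<in> H1per A" and v: "\<And>i. 0 \<le> v $ i"
  shows "2 * trace ((kin A \<Psi> + gram A \<Psi> (Vnl A M D \<Psi>)) ** Diag v)
    = (\<Sum>i\<in>UNIV. dir (tup \<Psi> v i)) + (\<Sum>i\<in>UNIV. 2 * (mvec (tup \<Psi> v i) \<bullet> (D *v mvec (tup \<Psi> v i))))"
proof -
  note \<Psi>L = H1per_L2per[OF \<Psi>]
  have 1: "kin A \<Psi> $ i $ i = dir (\<lambda>x. \<Psi> x $ i) / 2" for i
  proof -
    have [measurable]: "grad A (\<lambda>x. \<Psi> x $ i) \<in> borel_measurable borel"
      by (rule has_grad_measurable[OF H1per_grad[OF \<Psi>]])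
    show ?thesis unfolding kin_def dir_def gn2_def by (simp add: integral_cm)
  qed
  have 2: "gram A \<Psi> (Vnl A M D \<Psi>) $ i $ i = mvec (\<lambda>x. \<Psi> x $ i) \<bullet> (D *v mvec (\<lambda>x. \<Psi> x $ i))" for i
  proof -
    have "Vnl A M D \<Psi> x $ i = M x \<bullet> (D *v mvec (\<lambda>x. \<Psi> x $ i))" for x
      by (simp only: Vnl_def matrix_product_component)
    then show ?thesis by (simp add: gram_def ip_Mc[OF \<Psi>L])
  qed
  have 3: "dir (tup \<Psi> v i) = v $ i * dir (\<lambda>x. \<Psi> x $ i)" for i
    using dir_mult[OF \<Psi>, of "sqrt (v $ i)" i] v[of i] by (simp add: tup_def[abs_def])
  have 4: "mvec (tup \<Psi> v i) = sqrt (v $ i) *\<^sub>R mvec (\<lambda>x. \<Psi> x $ i)" for i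
    using mvec_mult[OF \<Psi>L, of "sqrt (v $ i)" i] by (simp add: tup_def[abs_def])
  have 5: "mvec (tup \<Psi> v i) \<bullet> (D *v mvec (tup \<Psi> v i)) = v $ i * (mvec (\<lambda>x. \<Psi> x $ i) \<bullet> (D *v mvec (\<lambda>x. \<Psi> x $ i)))" for i
    unfolding 4 using v[of i] by (simp add: matrix_vector_mult_scaleR mult.assoc[symmetric])
  show ?thesis
    unfolding trace_Diag 3 5 by (simp add: 1 2 sum_distrib_left sum.distrib[symmetric] algebra_simps)
qed

section \<open>Bounds in terms of L2 norms and Dirichlet integrals\<close>

lemma mvec_bound:
  assumes "u \<in> L2per A"
  shows "\<bar>mvec u $ l\<bar> \<le> nrm 2 (cm A) u * nrm 2 (cm A) (\<lambda>x. M x $ l)"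
  using L2_inner_le[OF L2per_Lp[OF assms] L2per_Lp[OF M]]
  by (simp add: mvec_def ip_cm L2per_measurable[OF assms] L2per_measurable[OF M])

lemma qf_expand: "qf u x = (\<Sum>l\<in>UNIV. \<Sum>p\<in>UNIV. (mvec u $ l * mvec u $ p) * Q x $ l $ p)"
  by (simp add: qf_def inner_vec_def matrix_vector_mult_def sum_distrib_left mult_ac)

lemma qf_L2per: "qf u \<in> L2per A"
  unfolding qf_expand[abs_def] by (intro L2per_sum L2per_mult Q)

text \<open>\<open>qf\<close> contains two factors \<open>mvec\<close>, each estimated by
  Cauchy-Schwarz against a component of \<open>M\<close>, and one entry of \<open>Q\<close>.\<close>

definition CQ :: real where
  "CQ = (\<Sum>l\<in>UNIV. \<Sum>p\<in>UNIV. nrm 2 (cm A) (\<lambda>x. M x $ l) * nrm 2 (cm A) (\<lambda>x. M x $ p) * nrm 2 (cm A) (\<lambda>x. Q x $ l $ p))"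

lemma CQ_nonneg: "0 \<le> CQ"
  unfolding CQ_def by (intro sum_nonneg mult_nonneg_nonneg) auto

lemma qf_norm:
  assumes u: "u \<in> L2per A" and R: "nrm 2 (cm A) u \<le> R"
  shows "nrm 2 (cm A) (qf u) \<le> CQ * R\<^sup>2"
proof -
  let ?q = "\<lambda>l p. nrm 2 (cm A) (\<lambda>x. Q x $ l $ p)" and ?m = "\<lambda>l. nrm 2 (cm A) (\<lambda>x. M x $ l)"
  note QL = L2per_Lp[OF Q]
  have m: "\<bar>mvec u $ l\<bar> \<le> R * ?m l" for l
    using mvec_bound[OF u, of l] mult_right_mono[OF R, of "?m l"] by simp
  have R0: "0 \<le> R" using R nrm_nonneg[of 2 "cm A" u] by linarith
  have "nrm 2 (cm A) (qf u) \<le> (\<Sum>l\<in>UNIV. \<Sum>p\<in>UNIV. nrm 2 (cm A) (\<lambda>x. (mvec u $ l * mvec u $ p) * Q x $ l $ p))"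
    unfolding qf_expand[abs_def]
    by (intro order_trans[OF nrm_sum_le] sum_mono nrm_sum_le Lp_sum Lp_mult QL) auto
  also have "\<dots> = (\<Sum>l\<in>UNIV. \<Sum>p\<in>UNIV. (\<bar>mvec u $ l\<bar> * \<bar>mvec u $ p\<bar>) * ?q l p)"
    by (simp add: nrm_mult abs_mult)
  also have "\<dots> \<le> (\<Sum>l\<in>UNIV. \<Sum>p\<in>UNIV. ((R * ?m l) * (R * ?m p)) * ?q l p)"
    using R0 by (intro sum_mono mult_right_mono mult_mono m) auto
  also have "\<dots> = CQ * R\<^sup>2"
    by (simp add: CQ_def sum_distrib_left power2_eq_square mult_ac)
  finally show ?thesis .
qed

lemma rhoT_Lp:
  assumes u: "\<And>i. u i \<in> Lp 4 (cm A)"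
  shows "rhoT u \<in> Lp 2 (cm A)"
    "nrm 2 (cm A) (rhoT u) \<le> (\<Sum>i\<in>UNIV. 2 * ((nrm 4 (cm A) (u i))\<^sup>2 + nrm 2 (cm A) (qf (u i))))"
proof -
  have s: "(\<lambda>x. (u i x)\<^sup>2) \<in> Lp 2 (cm A)" for i
    using L4_iff_square[OF Lp_measurable[OF u]] u by blast
  note qL = L2per_Lp[OF qf_L2per]
  have t: "(\<lambda>x. 2 * ((u i x)\<^sup>2 + qf (u i) x)) \<in> Lp 2 (cm A)" for i
    by (intro Lp_mult Lp_add s qL)
  show "rhoT u \<in> Lp 2 (cm A)" unfolding rhoT_def[abs_def] by (intro Lp_sum t) simp
  have "nrm 2 (cm A) (rhoT u) \<le> (\<Sum>i\<in>UNIV. nrm 2 (cm A) (\<lambda>x. 2 * ((u i x)\<^sup>2 + qf (u i) x)))"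
    unfolding rhoT_def[abs_def] by (intro nrm_sum_le t) simp
  also have "\<dots> \<le> (\<Sum>i\<in>UNIV. 2 * ((nrm 4 (cm A) (u i))\<^sup>2 + nrm 2 (cm A) (qf (u i))))"
  proof (rule sum_mono)
    fix i
    show "nrm 2 (cm A) (\<lambda>x. 2 * ((u i x)\<^sup>2 + qf (u i) x)) \<le> 2 * ((nrm 4 (cm A) (u i))\<^sup>2 + nrm 2 (cm A) (qf (u i)))"
      using nrm_triangle[OF _ s qL, of i "u i"] by (subst nrm_mult) (auto simp: nrm_square)
  qed
  finally show "nrm 2 (cm A) (rhoT u) \<le> (\<Sum>i\<in>UNIV. 2 * ((nrm 4 (cm A) (u i))\<^sup>2 + nrm 2 (cm A) (qf (u i))))" .
qed

lemma H1per_L4: "u \<in> H1per A \<Longrightarrow> u \<in> Lp 4 (cm A)"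
  by (rule H1_L4(1)[OF H1per_L2per H1per_grad])

lemma H1per_nrm4: "u \<in> H1per A \<Longrightarrow> nrm 4 (cm A) u \<le> C4 * \<theta> ^ n * sqrt (dir u) + D4 n * nrm 2 (cm A) u"
  unfolding dir_def by (rule H1_L4(2)[OF H1per_L2per H1per_grad])

text \<open>The L2 norm of a squared orbital is the square of its L4 norm. So \<open>H1_L4\<close>
  enters squared, and its gradient term becomes a small multiple of the Dirichlet integral;
  everything else is bounded through \<open>R\<close>.\<close>

lemma rhoT_eps:
  assumes e: "0 < e"
  shows "\<exists>C\<ge>0. \<forall>u::'n::finite \<Rightarrow> real^3 \<Rightarrow> real. (\<forall>i. u i \<in> H1per A \<and> nrm 2 (cm A) (u i) \<le> R) \<longrightarrow>
    nrm 2 (cm A) (rhoT u) \<le> e * (\<Sum>i\<in>UNIV. dir (u i)) + C"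
proof -
  have "(\<lambda>n. 4 * C4\<^sup>2 * (\<theta>\<^sup>2) ^ n) \<longlonglongrightarrow> 4 * C4\<^sup>2 * 0"
    using theta_bounds by (intro tendsto_intros LIMSEQ_power_zero) (simp add: power_less_one_iff)
  from order_tendstoD(2)[OF this, of e] e obtain n where "4 * C4\<^sup>2 * (\<theta>\<^sup>2) ^ n < e"
    by (auto simp: eventually_sequentially)
  \<comment> \<open>The 4 is the factor 2 in the density times the 2 in (a + b)^2 \<le> 2 a^2 + 2
    b^2.\<close>
  then have n: "4 * (C4 * \<theta> ^ n)\<^sup>2 \<le> e" by (simp add: power_mult_distrib power_mult[symmetric] mult_ac less_imp_le)
  define c where "c = 4 * (D4 n * R)\<^sup>2 + 2 * (CQ * R\<^sup>2)"
  have c0: "0 \<le> c" using CQ_nonneg by (simp add: c_def)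
  have "nrm 2 (cm A) (rhoT u) \<le> e * (\<Sum>i\<in>UNIV. dir (u i)) + real CARD('n) * c"
    if u: "\<forall>i. u i \<in> H1per A \<and> nrm 2 (cm A) (u i) \<le> R" for u :: "'n \<Rightarrow> real^3 \<Rightarrow> real"
  proof -
    have "nrm 2 (cm A) (rhoT u) \<le> (\<Sum>i\<in>UNIV. 2 * ((nrm 4 (cm A) (u i))\<^sup>2 + nrm 2 (cm A) (qf (u i))))"
      using u by (intro rhoT_Lp(2) H1per_L4) auto
    also have "\<dots> \<le> (\<Sum>i\<in>UNIV. e * dir (u i) + c)"
    proof (rule sum_mono)
      fix i
      define a where "a = C4 * \<theta> ^ n * sqrt (dir (u i))"
      define b where "b = D4 n * R"
      have uH: "u i \<in> H1per A" and uR: "nrm 2 (cm A) (u i) \<le> R" using u by auto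
      have "nrm 4 (cm A) (u i) \<le> a + b"
        using H1per_nrm4[OF uH, of n] mult_left_mono[OF uR D4_nonneg, of n] unfolding a_def b_def by linarith
      then have "(nrm 4 (cm A) (u i))\<^sup>2 \<le> (a + b)\<^sup>2" by (intro power_mono) auto
      also have "\<dots> \<le> 2 * a\<^sup>2 + 2 * b\<^sup>2" using sum_squares_bound[of a b] by (simp add: power2_sum)
      finally have 1: "(nrm 4 (cm A) (u i))\<^sup>2 \<le> 2 * a\<^sup>2 + 2 * b\<^sup>2" .
      have "4 * a\<^sup>2 = 4 * (C4 * \<theta> ^ n)\<^sup>2 * dir (u i)"
        using dir_nonneg[of "u i"] by (simp add: a_def power_mult_distrib)
      also have "\<dots> \<le> e * dir (u i)" by (rule mult_right_mono[OF n dir_nonneg])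
      finally have 2: "4 * a\<^sup>2 \<le> e * dir (u i)" .
      have 3: "nrm 2 (cm A) (qf (u i)) \<le> CQ * R\<^sup>2" by (rule qf_norm[OF H1per_L2per[OF uH] uR])
      show "2 * ((nrm 4 (cm A) (u i))\<^sup>2 + nrm 2 (cm A) (qf (u i))) \<le> e * dir (u i) + c"
        using 1 2 3 unfolding c_def b_def[symmetric] distrib_left by linarith
    qed
    also have "\<dots> = e * (\<Sum>i\<in>UNIV. dir (u i)) + real CARD('n) * c"
      by (simp add: sum.distrib sum_distrib_left)
    finally show ?thesis .
  qed
  then show ?thesis using c0 by (intro exI[of _ "real CARD('n) * c"]) auto
qed

text \<open>The mass is controlled by the L2 norms without the gradient. This matters in
  \<open>xc_bound\<close>, where it is multiplied by a factor as large as the norm of the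
  density.\<close>

lemma rhoT_integral_bound:
  "\<exists>I\<ge>0. \<forall>u::'n::finite \<Rightarrow> real^3 \<Rightarrow> real. (\<forall>i. u i \<in> H1per A \<and> nrm 2 (cm A) (u i) \<le> R) \<longrightarrow>
    (LINT x|cm A. rhoT u x) \<le> I"
proof -
  define c where "c = 2 * (R\<^sup>2 + sqrt vol * (CQ * R\<^sup>2))"
  have c0: "0 \<le> c" using CQ_nonneg vol_pos by (simp add: c_def)
  have "(LINT x|cm A. rhoT u x) \<le> real CARD('n) * c"
    if u: "\<forall>i. u i \<in> H1per A \<and> nrm 2 (cm A) (u i) \<le> R" for u :: "'n \<Rightarrow> real^3 \<Rightarrow> real"
  proof -
    have uH: "u i \<in> H1per A" and uR: "nrm 2 (cm A) (u i) \<le> R" for i using u by auto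
    have i1: "integrable (cm A) (\<lambda>x. (u i x)\<^sup>2)" for i
      using Lp_integrable[OF L2per_Lp[OF H1per_L2per[OF uH]], of i] by simp
    note q = cm.L2_imp_integrable[OF L2per_Lp[OF qf_L2per]]
    have "(LINT x|cm A. rhoT u x) = (\<Sum>i\<in>UNIV. 2 * ((LINT x|cm A. (u i x)\<^sup>2) + (LINT x|cm A. qf (u i) x)))"
      unfolding rhoT_def using i1 q(1) by (simp add: Bochner_Integration.integral_sum)
    also have "\<dots> \<le> (\<Sum>i\<in>(UNIV::'n set). c)"
    proof (rule sum_mono)
      fix i
      have "(LINT x|cm A. (u i x)\<^sup>2) \<le> R\<^sup>2"
        unfolding nrm_power2[symmetric] by (rule power_mono[OF uR]) simp
      moreover have "(LINT x|cm A. qf (u i) x) \<le> sqrt vol * (CQ * R\<^sup>2)"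
      proof -
        have "(LINT x|cm A. qf (u i) x) \<le> (LINT x|cm A. \<bar>qf (u i) x\<bar>)"
          using integral_abs_bound[of "cm A" "qf (u i)"] by linarith
        also have "\<dots> \<le> sqrt vol * nrm 2 (cm A) (qf (u i))" using q(2)[of "u i"] by (simp add: measure_cm)
        also have "\<dots> \<le> sqrt vol * (CQ * R\<^sup>2)"
          using vol_pos by (intro mult_left_mono qf_norm[OF H1per_L2per[OF uH] uR]) auto
        finally show ?thesis .
      qed
      ultimately show "2 * ((LINT x|cm A. (u i x)\<^sup>2) + (LINT x|cm A. qf (u i) x)) \<le> c" by (simp add: c_def)
    qed
    finally show ?thesis by simp
  qed
  then show ?thesis using c0 by (intro exI[of _ "real CARD('n) * c"]) auto
qed

text \<open>The nonlocal and local potential energies: of indefinite sign, but continuous under L4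
  convergence of the orbitals.\<close>

definition Zpart :: "real^'m^'m \<Rightarrow> (real^3 \<Rightarrow> real) \<Rightarrow> ('n::finite \<Rightarrow> real^3 \<Rightarrow> real) \<Rightarrow> real" where
  "Zpart D V u = (\<Sum>i\<in>UNIV. 2 * (mvec (u i) \<bullet> (D *v mvec (u i)))) + ip A V (rhoT u)"

text \<open>The nonlocal part is bounded through \<open>R\<close>; Cauchy-Schwarz with
  \<open>V\<close> makes the local part linear in the norm of the density.\<close>

lemma Zpart_bound:
  assumes V: "V \<in> L2per A"
  shows "\<exists>B\<ge>0. \<forall>u::'n::finite \<Rightarrow> real^3 \<Rightarrow> real. (\<forall>i. u i \<in> H1per A \<and> nrm 2 (cm A) (u i) \<le> R) \<longrightarrow>
    - (B * (1 + nrm 2 (cm A) (rhoT u))) \<le> Zpart D V u"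
proof -
  let ?m = "\<lambda>l. nrm 2 (cm A) (\<lambda>x. M x $ l)"
  define c where "c = (\<Sum>l\<in>UNIV. \<Sum>p\<in>UNIV. (R * ?m l) * (\<bar>D $ l $ p\<bar> * (R * ?m p)))"
  define B where "B = \<bar>real CARD('n) * (2 * c)\<bar> + nrm 2 (cm A) V"
  have "- (B * (1 + nrm 2 (cm A) (rhoT u))) \<le> Zpart D V u"
    if u: "\<forall>i. u i \<in> H1per A \<and> nrm 2 (cm A) (u i) \<le> R" for u :: "'n \<Rightarrow> real^3 \<Rightarrow> real"
  proof -
    have uH: "u i \<in> H1per A" and uR: "nrm 2 (cm A) (u i) \<le> R" for i using u by auto
    have R0: "0 \<le> R" using uR nrm_nonneg order_trans by blast
    have m: "\<bar>mvec (u i) $ l\<bar> \<le> R * ?m l" for i l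
      using mvec_bound[OF H1per_L2per[OF uH], of i l] mult_right_mono[OF uR, of "?m l" i] by simp
    have 1: "- c \<le> mvec (u i) \<bullet> (D *v mvec (u i))" for i
    proof -
      have "\<bar>mvec (u i) \<bullet> (D *v mvec (u i))\<bar> = \<bar>\<Sum>l\<in>UNIV. \<Sum>p\<in>UNIV. mvec (u i) $ l * (D $ l $ p * mvec (u i) $ p)\<bar>"
        by (simp add: inner_vec_def matrix_vector_mult_def sum_distrib_left)
      also have "\<dots> \<le> (\<Sum>l\<in>UNIV. \<Sum>p\<in>UNIV. \<bar>mvec (u i) $ l * (D $ l $ p * mvec (u i) $ p)\<bar>)"
        by (intro order_trans[OF sum_abs] sum_mono sum_abs)
      also have "\<dots> \<le> c"
        unfolding c_def abs_mult using R0 by (intro sum_mono mult_mono m) auto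
      finally show ?thesis by linarith
    qed
    have "(\<Sum>i\<in>(UNIV::'n set). 2 * - c) \<le> (\<Sum>i\<in>UNIV. 2 * (mvec (u i) \<bullet> (D *v mvec (u i))))"
      by (intro sum_mono mult_left_mono 1) simp
    then have 2: "- \<bar>real CARD('n) * (2 * c)\<bar> \<le> (\<Sum>i\<in>UNIV. 2 * (mvec (u i) \<bullet> (D *v mvec (u i))))" by simp
    have \<rho>: "rhoT u \<in> Lp 2 (cm A)" by (rule rhoT_Lp(1)[OF H1per_L4[OF uH]])
    define r where "r = nrm 2 (cm A) (rhoT u)"
    have "ip A V (rhoT u) = (LINT x|cm A. V x * rhoT u x)"
      using L2per_measurable[OF V] Lp_measurable[OF \<rho>] by (intro ip_cm) auto
    then have 3: "- (nrm 2 (cm A) V * r) \<le> ip A V (rhoT u)"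
      using L2_inner_le[OF L2per_Lp[OF V] \<rho>] unfolding r_def by linarith
    have r0: "0 \<le> r" by (simp add: r_def)
    have "B * (1 + r) = \<bar>real CARD('n) * (2 * c)\<bar> + \<bar>real CARD('n) * (2 * c)\<bar> * r + nrm 2 (cm A) V + nrm 2 (cm A) V * r"
      by (simp add: B_def algebra_simps)
    moreover have "0 \<le> \<bar>real CARD('n) * (2 * c)\<bar> * r" using r0 by (intro mult_nonneg_nonneg) auto
    moreover have "0 \<le> nrm 2 (cm A) V" by simp
    ultimately show ?thesis using 2 3 unfolding Zpart_def r_def[symmetric] by linarith
  qed
  moreover have "0 \<le> B" by (simp add: B_def)
  ultimately show ?thesis by blast
qed

lemma xc_bound:
  assumes cN: "continuous_on {0..} \<N>" and C0: "0 \<le> C" and C: "\<And>t s. 0 \<le> t \<Longrightarrow> 0 < s \<Longrightarrow> - C * (1 + s * t + t\<^sup>2 / s) \<le> \<N> t"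
  shows "\<exists>B\<ge>0. \<forall>u::'n::finite \<Rightarrow> real^3 \<Rightarrow> real. (\<forall>i. u i \<in> H1per A \<and> nrm 2 (cm A) (u i) \<le> R) \<longrightarrow>
    (AE x in cm A. 0 \<le> rhoT u x) \<longrightarrow> - ereal (B * (1 + nrm 2 (cm A) (rhoT u))) \<le> local_xc A \<N> (rhoT u)"
proof -
  obtain I where I: "0 \<le> I" "\<And>u::'n \<Rightarrow> real^3 \<Rightarrow> real. \<forall>i. u i \<in> H1per A \<and> nrm 2 (cm A) (u i) \<le> R \<Longrightarrow> (LINT x|cm A. rhoT u x) \<le> I"
    using rhoT_integral_bound[of R, where 'n='n] by blast
  define B where "B = C * (vol + I + 1)"
  have "- ereal (B * (1 + nrm 2 (cm A) (rhoT u))) \<le> local_xc A \<N> (rhoT u)"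
    if u: "\<forall>i. u i \<in> H1per A \<and> nrm 2 (cm A) (u i) \<le> R" and pos: "AE x in cm A. 0 \<le> rhoT u x" for u :: "'n \<Rightarrow> real^3 \<Rightarrow> real"
  proof -
    have \<rho>: "rhoT u \<in> Lp 2 (cm A)" using u by (intro rhoT_Lp(1) H1per_L4) auto
    define r where "r = nrm 2 (cm A) (rhoT u)"
    have r: "0 \<le> r" by (simp add: r_def)
    \<comment> \<open>With s = 1 + r, each of the three terms of the weight grows at most linearly
      in \<open>r\<close>, as the mass is bounded by \<open>I\<close>.\<close>
    have "r\<^sup>2 / (1 + r) \<le> r" using r by (simp add: divide_le_eq power2_eq_square algebra_simps)
    moreover have "(1 + r) * (LINT x|cm A. rhoT u x) \<le> (1 + r) * I" using r by (intro mult_left_mono I(2) u) simp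
    moreover have "vol \<le> vol * (1 + r)" using vol_pos r by (simp add: distrib_left)
    moreover have "(vol + I + 1) * (1 + r) = vol * (1 + r) + (1 + r) * I + 1 + r" by (simp add: algebra_simps)
    ultimately have "vol + (1 + r) * (LINT x|cm A. rhoT u x) + r\<^sup>2 / (1 + r) \<le> (vol + I + 1) * (1 + r)" by linarith
    from mult_left_mono[OF this C0] have "C * (vol + (1 + r) * (LINT x|cm A. rhoT u x) + r\<^sup>2 / (1 + r)) \<le> B * (1 + r)"
      by (simp add: B_def mult.assoc)
    then have "- ereal (B * (1 + r)) \<le> - ereal (C * (vol + (1 + r) * (LINT x|cm A. rhoT u x) + r\<^sup>2 / (1 + r)))" by simp
    also have "\<dots> \<le> local_xc A \<N> (rhoT u)"
      unfolding r_def by (rule local_xc_lower[OF cN C0 C \<rho> pos]) (simp_all add: add_pos_nonneg)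
    finally show ?thesis unfolding r_def .
  qed
  moreover have "0 \<le> B" using C0 vol_pos I(1) by (simp add: B_def)
  ultimately show ?thesis by blast
qed

section \<open>Limits along convergent orbitals\<close>

lemma mvec_tendsto:
  assumes u: "\<And>k. u k \<in> L2per A" and w: "w \<in> L2per A" and lim: "(\<lambda>k. nrm 2 (cm A) (\<lambda>x. u k x - w x)) \<longlonglongrightarrow> 0"
  shows "(\<lambda>k. mvec (u k)) \<longlonglongrightarrow> mvec w"
proof (rule vec_tendstoI)
  fix l
  have "(\<lambda>k. LINT x|cm A. u k x * M x $ l) \<longlonglongrightarrow> (LINT x|cm A. w x * M x $ l)"
    by (rule L2_inner_tendsto[OF L2per_Lp[OF u] L2per_Lp[OF w] L2per_Lp[OF M] L2per_Lp[OF M] lim]) simp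
  then show "(\<lambda>k. mvec (u k) $ l) \<longlonglongrightarrow> mvec w $ l"
    by (simp add: mvec_def ip_cm L2per_measurable[OF u] L2per_measurable[OF w] L2per_measurable[OF M])
qed

lemma matrix_vector_tendsto: "(y \<longlonglongrightarrow> l) \<Longrightarrow> (\<lambda>k. (X :: real^'m^'m) *v y k) \<longlonglongrightarrow> X *v l"
  by (rule bounded_linear.tendsto[OF matrix_vector_mul_bounded_linear])

lemma bform_tendsto:
  assumes u: "\<And>k. u k \<in> L2per A" and w: "w \<in> L2per A" and lim: "(\<lambda>k. nrm 2 (cm A) (\<lambda>x. u k x - w x)) \<longlonglongrightarrow> 0"
    and u': "\<And>k. u' k \<in> L2per A" and w': "w' \<in> L2per A" and lim': "(\<lambda>k. nrm 2 (cm A) (\<lambda>x. u' k x - w' x)) \<longlonglongrightarrow> 0"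
  shows "(\<lambda>k. bform (u k) (u' k)) \<longlonglongrightarrow> bform w w'"
proof -
  have "(\<lambda>k. LINT x|cm A. u k x * u' k x) \<longlonglongrightarrow> (LINT x|cm A. w x * w' x)"
    by (rule L2_inner_tendsto[OF L2per_Lp[OF u] L2per_Lp[OF w] L2per_Lp[OF u'] L2per_Lp[OF w'] lim lim'])
  then have "(\<lambda>k. ip A (u k) (u' k)) \<longlonglongrightarrow> ip A w w'"
    by (simp add: ip_cm L2per_measurable[OF u] L2per_measurable[OF w] L2per_measurable[OF u'] L2per_measurable[OF w'])
  then show ?thesis unfolding bform_def
    by (intro tendsto_add tendsto_inner matrix_vector_tendsto mvec_tendsto assms)
qed

text \<open>The difference u^2 - w^2 = (u - w)(u + w) is a product of L4 functions whose first
  factor tends to 0; the remaining part has fixed functions, the entries of \<open>Q\<close>, with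
  convergent coefficients.\<close>

lemma rhoT_tendsto:
  fixes u :: "nat \<Rightarrow> 'n::finite \<Rightarrow> real^3 \<Rightarrow> real"
  assumes u: "\<And>k i. u k i \<in> L2per A" "\<And>k i. u k i \<in> Lp 4 (cm A)" and w: "\<And>i. w i \<in> L2per A" "\<And>i. w i \<in> Lp 4 (cm A)"
    and lim4: "\<And>i. (\<lambda>k. nrm 4 (cm A) (\<lambda>x. u k i x - w i x)) \<longlonglongrightarrow> 0"
    and lim2: "\<And>i. (\<lambda>k. nrm 2 (cm A) (\<lambda>x. u k i x - w i x)) \<longlonglongrightarrow> 0"
  shows "(\<lambda>k. nrm 2 (cm A) (\<lambda>x. rhoT (u k) x - rhoT w x)) \<longlonglongrightarrow> 0"
proof -
  note QL = L2per_Lp[OF Q] and qL = L2per_Lp[OF qf_L2per]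
  define a where "a k i = nrm 4 (cm A) (\<lambda>x. u k i x - w i x)" for k i
  define d where "d k i l p = mvec (u k i) $ l * mvec (u k i) $ p - mvec (w i) $ l * mvec (w i) $ p" for k i l p
  define q where "q l p = nrm 2 (cm A) (\<lambda>x. Q x $ l $ p)" for l p
  define b where "b k = (\<Sum>i\<in>UNIV. 2 * (a k i * (a k i + 2 * nrm 4 (cm A) (w i)) + (\<Sum>l\<in>UNIV. \<Sum>p\<in>UNIV. \<bar>d k i l p\<bar> * q l p)))" for k
  have bound: "nrm 2 (cm A) (\<lambda>x. rhoT (u k) x - rhoT w x) \<le> b k" for k
  proof -
    define s where "s i x = (u k i x)\<^sup>2 - (w i x)\<^sup>2" for i x
    have D4: "(\<lambda>x. u k i x - w i x) \<in> Lp 4 (cm A)" "(\<lambda>x. u k i x + w i x) \<in> Lp 4 (cm A)" for i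
      by (intro Lp_diff Lp_add u w)+
    have se: "s i = (\<lambda>x. (u k i x - w i x) * (u k i x + w i x))" for i
      by (auto simp: s_def power2_eq_square algebra_simps)
    have sL: "s i \<in> Lp 2 (cm A)" for i unfolding se by (rule L4_mult(1)[OF D4])
    have sn: "nrm 2 (cm A) (s i) \<le> a k i * (a k i + 2 * nrm 4 (cm A) (w i))" for i
    proof -
      have "nrm 4 (cm A) (\<lambda>x. (u k i x - w i x) + 2 * w i x) \<le> a k i + nrm 4 (cm A) (\<lambda>x. 2 * w i x)"
        unfolding a_def by (intro nrm_triangle D4 Lp_mult w) simp
      then have "nrm 4 (cm A) (\<lambda>x. u k i x + w i x) \<le> a k i + 2 * nrm 4 (cm A) (w i)" by (simp add: nrm_mult add.commute)
      then have "a k i * nrm 4 (cm A) (\<lambda>x. u k i x + w i x) \<le> a k i * (a k i + 2 * nrm 4 (cm A) (w i))"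
        by (rule mult_left_mono) (simp add: a_def)
      then show ?thesis using L4_mult(2)[OF D4, of i i] unfolding se a_def by linarith
    qed
    have qe: "(\<lambda>x. qf (u k i) x - qf (w i) x) = (\<lambda>x. \<Sum>l\<in>UNIV. \<Sum>p\<in>UNIV. d k i l p * Q x $ l $ p)" for i
      by (auto simp: qf_expand d_def sum_subtractf[symmetric] left_diff_distrib)
    have qn: "nrm 2 (cm A) (\<lambda>x. qf (u k i) x - qf (w i) x) \<le> (\<Sum>l\<in>UNIV. \<Sum>p\<in>UNIV. \<bar>d k i l p\<bar> * q l p)" for i
    proof -
      have "nrm 2 (cm A) (\<lambda>x. \<Sum>l\<in>UNIV. \<Sum>p\<in>UNIV. d k i l p * Q x $ l $ p) \<le> (\<Sum>l\<in>UNIV. \<Sum>p\<in>UNIV. nrm 2 (cm A) (\<lambda>x. d k i l p * Q x $ l $ p))"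
        by (intro order_trans[OF nrm_sum_le] sum_mono nrm_sum_le Lp_sum Lp_mult QL) auto
      then show ?thesis unfolding qe by (simp add: nrm_mult q_def)
    qed
    have dL: "(\<lambda>x. qf (u k i) x - qf (w i) x) \<in> Lp 2 (cm A)" for i by (intro Lp_diff qL)
    have e: "rhoT (u k) x - rhoT w x = (\<Sum>i\<in>UNIV. 2 * (s i x + (qf (u k i) x - qf (w i) x)))" for x
      by (simp add: rhoT_def sum_subtractf[symmetric] s_def algebra_simps)
    have "nrm 2 (cm A) (\<lambda>x. rhoT (u k) x - rhoT w x) \<le> (\<Sum>i\<in>UNIV. nrm 2 (cm A) (\<lambda>x. 2 * (s i x + (qf (u k i) x - qf (w i) x))))"
      unfolding e by (intro nrm_sum_le Lp_mult Lp_add sL dL) simp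
    also have "\<dots> \<le> b k"
      unfolding b_def
    proof (rule sum_mono)
      fix i
      have "nrm 2 (cm A) (\<lambda>x. s i x + (qf (u k i) x - qf (w i) x)) \<le> nrm 2 (cm A) (s i) + nrm 2 (cm A) (\<lambda>x. qf (u k i) x - qf (w i) x)"
        by (intro nrm_triangle sL dL) simp
      also have "\<dots> \<le> a k i * (a k i + 2 * nrm 4 (cm A) (w i)) + (\<Sum>l\<in>UNIV. \<Sum>p\<in>UNIV. \<bar>d k i l p\<bar> * q l p)"
        by (rule add_mono[OF sn qn])
      finally show "nrm 2 (cm A) (\<lambda>x. 2 * (s i x + (qf (u k i) x - qf (w i) x))) \<le> 2 * (a k i * (a k i + 2 * nrm 4 (cm A) (w i)) + (\<Sum>l\<in>UNIV. \<Sum>p\<in>UNIV. \<bar>d k i l p\<bar> * q l p))"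
        by (subst nrm_mult) simp_all
    qed
    finally show ?thesis .
  qed
  have dl: "(\<lambda>k. d k i l p) \<longlonglongrightarrow> 0" for i l p
  proof -
    have m: "(\<lambda>k. mvec (u k i) $ j) \<longlonglongrightarrow> mvec (w i) $ j" for j
      by (intro tendsto_vec_nth mvec_tendsto u w lim2)
    then have "(\<lambda>k. d k i l p) \<longlonglongrightarrow> mvec (w i) $ l * mvec (w i) $ p - mvec (w i) $ l * mvec (w i) $ p"
      unfolding d_def by (intro tendsto_diff tendsto_mult m tendsto_const)
    then show ?thesis by simp
  qed
  have al: "(\<lambda>k. a k i) \<longlonglongrightarrow> 0" for i using lim4 by (simp add: a_def)
  have "b \<longlonglongrightarrow> (\<Sum>i\<in>(UNIV::'n set). 2 * (0 * (0 + 2 * nrm 4 (cm A) (w i)) + (\<Sum>l\<in>UNIV. \<Sum>p\<in>UNIV. \<bar>0\<bar> * q l p)))"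
    unfolding b_def[abs_def] by (intro tendsto_intros al dl)
  then have "b \<longlonglongrightarrow> 0" by simp
  from tendsto_sandwich[OF _ _ tendsto_const this] bound show ?thesis by simp
qed

text \<open>\<open>dirichlet_lsc\<close> asks for one bound along the whole sequence; it is applied
  to tails, with the bound \<delta> + e.\<close>

lemma dirichlet_lsc_lim:
  assumes u: "\<And>k. u k \<in> H1per A" and w: "w \<in> L2per A" and lim: "(\<lambda>k. nrm 2 (cm A) (\<lambda>x. u k x - w x)) \<longlonglongrightarrow> 0"
    and d: "(\<lambda>k. dir (u k)) \<longlonglongrightarrow> \<delta>"
  shows "w \<in> H1per A" "dir w \<le> \<delta>"
proof -
  have *: "w \<in> H1per A \<and> dir w \<le> \<delta> + e" if e: "0 < e" for e
  proof -
    from order_tendstoD(2)[OF d, of "\<delta> + e"] e obtain N where N: "\<And>k. k \<ge> N \<Longrightarrow> dir (u k) < \<delta> + e"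
      by (auto simp: eventually_sequentially)
    have "\<exists>h. has_grad A w h \<and> gn2 h \<le> \<delta> + e"
    proof (rule dirichlet_lsc[where u="\<lambda>k. u (k + N)" and g="\<lambda>k. grad A (u (k + N))"])
      show "(\<lambda>k. nrm 2 (cm A) (\<lambda>x. u (k + N) x - w x)) \<longlonglongrightarrow> 0" by (rule LIMSEQ_ignore_initial_segment[OF lim])
      show "gn2 (grad A (u (k + N))) \<le> \<delta> + e" for k using N[of "k + N"] by (simp add: dir_def)
    qed (use u w in \<open>auto intro: H1per_L2per H1per_grad\<close>)
    then obtain h where "has_grad A w h" "gn2 h \<le> \<delta> + e" by blast
    then show ?thesis using H1perI[OF w] dir_eq[OF w] by auto
  qed
  show "w \<in> H1per A" using *[of 1] by simp
  show "dir w \<le> \<delta>" by (rule field_le_epsilon) (use * in blast)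
qed

end

section \<open>The relaxed problem\<close>

context operators begin

definition relaxed :: "('n::finite \<Rightarrow> real^3 \<Rightarrow> real) \<Rightarrow> real^'n \<Rightarrow> bool" where
  "relaxed u v \<longleftrightarrow> (\<forall>i. u i \<in> H1per A) \<and> (\<forall>i j. bform (u i) (u j) = (if i = j then v $ i else 0))"

definition relaxed_energy ::
  "real^'m^'m \<Rightarrow> (real^3 \<Rightarrow> real) \<Rightarrow> (real \<Rightarrow> real) \<Rightarrow> real \<Rightarrow> (real \<Rightarrow> real) \<Rightarrow> ('n::finite \<Rightarrow> real^3 \<Rightarrow> real) \<Rightarrow> real^'n \<Rightarrow> ereal"
  where "relaxed_energy D V \<N> \<sigma> s u v = ereal ((\<Sum>i\<in>UNIV. dir (u i)) + Zpart D V u + hartree A (rhoT u))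
    + local_xc A \<N> (rhoT u) - ereal (2 * \<sigma> * (\<Sum>i\<in>UNIV. s (v $ i)))"

lemma energy_eq_relaxed:
  assumes \<Psi>: "\<Psi> \<in> MB A M Q" and v: "\<And>i. 0 \<le> v $ i"
  shows "energy A M Q D V (local_xc A \<N>) \<sigma> f S \<Psi> (Diag v) = relaxed_energy D V \<N> \<sigma> (S_finv S f) (tup \<Psi> v) v"
proof -
  have H: "(\<lambda>x. \<Psi> x $ i) \<in> H1per A" for i using \<Psi> by (simp add: MB_iff)
  show ?thesis
    unfolding energy_def relaxed_energy_def density_eq[OF H1per_L2per[OF H] v] energy_kin_eq[OF H v] trace_apply_diag Zpart_def
    by (simp only: add.assoc)
qed

lemma tup_relaxed:
  assumes \<Psi>: "\<Psi> \<in> MB A M Q" and v: "\<And>i. 0 \<le> v $ i"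
  shows "relaxed (tup \<Psi> v) v"
proof -
  have H: "(\<lambda>x. \<Psi> x $ i) \<in> H1per A" and b: "bform (\<lambda>x. \<Psi> x $ i) (\<lambda>x. \<Psi> x $ j) = (if i = j then 1 else 0)" for i j
    using \<Psi> by (simp_all add: MB_iff)
  note L = H1per_L2per[OF H]
  have "bform (tup \<Psi> v i) (tup \<Psi> v j) = sqrt (v $ i) * (sqrt (v $ j) * (if i = j then 1 else 0))" for i j
    unfolding tup_def[abs_def] bform_mult[OF L L2per_mult[OF L]] bform_mult_right[OF L L] b ..
  then show ?thesis
    using v H1per_mult[OF H] by (auto simp: relaxed_def tup_def[abs_def])
qed

text \<open>Orbitals with positive occupation are recovered by division, the others by
  \<open>orthonormal_extension\<close>. Where \<open>v\<close> vanishes, \<open>tup\<close> is the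
  zero function everywhere, so equality of functions asks for the same of \<open>u\<close>.\<close>

lemma relaxed_imp_tup:
  assumes r: "relaxed u v" and v: "\<And>i. 0 \<le> v $ i" and z: "\<And>i. v $ i = 0 \<Longrightarrow> u i = (\<lambda>x. 0)"
  shows "\<exists>\<Phi>\<in>MB A M Q. tup \<Phi> v = u"
proof -
  have H: "u i \<in> H1per A" and b: "bform (u i) (u j) = (if i = j then v $ i else 0)" for i j
    using r by (simp_all add: relaxed_def)
  note L = H1per_L2per[OF H]
  define J where "J = {i. v $ i \<noteq> 0}"
  define \<phi> where "\<phi> i = (\<lambda>x. (1 / sqrt (v $ i)) * u i x)" for i
  have "bform (\<phi> i) (\<phi> j) = (if i = j then 1 else 0)" if "i \<in> J" "j \<in> J" for i j
  proof -
    have "bform (\<phi> i) (\<phi> j) = (1 / sqrt (v $ i)) * ((1 / sqrt (v $ j)) * (if i = j then v $ i else 0))"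
      unfolding \<phi>_def bform_mult[OF L L2per_mult[OF L]] bform_mult_right[OF L L] b ..
    then show ?thesis using that v[of i] by (auto simp: J_def)
  qed
  then obtain \<psi> where \<psi>: "\<forall>i\<in>J. \<psi> i = \<phi> i" "\<forall>i. \<psi> i \<in> H1per A"
      "\<forall>i j. bform (\<psi> i) (\<psi> j) = (if i = j then 1 else 0)"
    using orthonormal_extension[of J \<phi>] H1per_mult[OF H] unfolding \<phi>_def by blast
  define \<Phi> where "\<Phi> x = (\<chi> i. \<psi> i x)" for x
  have "\<Phi> \<in> MB A M Q" using \<psi> by (simp add: MB_iff \<Phi>_def)
  moreover have "tup \<Phi> v i x = u i x" for i x
    using \<psi>(1) v[of i] z[of i] by (cases "i \<in> J") (auto simp: tup_def \<Phi>_def J_def \<phi>_def)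
  ultimately show ?thesis by (intro bexI[of _ \<Phi>]) auto
qed

text \<open>Coercivity on the diagonal of the constraint. It bounds the weighted orbitals uniformly
  and makes them vanish in the limit with their occupations.\<close>

lemma relaxed_norm:
  assumes "relaxed u v"
  shows "\<alpha> * (nrm 2 (cm A) (u i))\<^sup>2 \<le> v $ i"
proof -
  have "u i \<in> H1per A" "bform (u i) (u i) = v $ i" using assms by (auto simp: relaxed_def)
  then show ?thesis using bform_coercive[OF H1per_L2per] by metis
qed

lemma relaxed_norm_bound:
  assumes "relaxed u v" "v $ i \<le> 1"
  shows "nrm 2 (cm A) (u i) \<le> sqrt (1 / \<alpha>)"
proof -
  have "\<alpha> * (nrm 2 (cm A) (u i))\<^sup>2 \<le> 1" using relaxed_norm[OF assms(1), of i] assms(2) by linarith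
  then have "(nrm 2 (cm A) (u i))\<^sup>2 \<le> 1 / \<alpha>" using \<alpha> by (simp add: field_simps)
  then show ?thesis by (rule real_le_rsqrt)
qed

text \<open>Each of the two terms of indefinite sign may consume a quarter of the Dirichlet
  integral, so half of it survives in the sum.\<close>

lemma energy_bounds:
  assumes V: "V \<in> L2per A" and cN: "continuous_on {0..} \<N>" and C0: "0 \<le> C"
    and C: "\<And>t s. 0 \<le> t \<Longrightarrow> 0 < s \<Longrightarrow> - C * (1 + s * t + t\<^sup>2 / s) \<le> \<N> t"
  shows "\<exists>K\<ge>0. \<forall>u::'n::finite \<Rightarrow> real^3 \<Rightarrow> real. (\<forall>i. u i \<in> H1per A \<and> nrm 2 (cm A) (u i) \<le> R) \<longrightarrow>
    (AE x in cm A. 0 \<le> rhoT u x) \<longrightarrow>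
    - ((\<Sum>i\<in>UNIV. dir (u i)) / 4 + K) \<le> Zpart D V u \<and> - ereal ((\<Sum>i\<in>UNIV. dir (u i)) / 4 + K) \<le> local_xc A \<N> (rhoT u)"
proof -
  let ?adm = "\<lambda>u::'n \<Rightarrow> real^3 \<Rightarrow> real. \<forall>i. u i \<in> H1per A \<and> nrm 2 (cm A) (u i) \<le> R"
  obtain B1 where B1: "0 \<le> B1" "\<And>u. ?adm u \<Longrightarrow> - (B1 * (1 + nrm 2 (cm A) (rhoT u))) \<le> Zpart D V u"
    using Zpart_bound[OF V, of R D, where 'n='n] by blast
  obtain B2 where B2: "0 \<le> B2" "\<And>u. ?adm u \<Longrightarrow> AE x in cm A. 0 \<le> rhoT u x \<Longrightarrow> - ereal (B2 * (1 + nrm 2 (cm A) (rhoT u))) \<le> local_xc A \<N> (rhoT u)"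
    using xc_bound[OF cN C0 C, of R, where 'n='n] by blast
  define B where "B = B1 + B2"
  have B: "0 \<le> B" using B1 B2 by (simp add: B_def)
  \<comment> \<open>Gives \<open>B * e \<le> 1 / 4\<close>; the added 1 covers the case
    \<open>B = 0\<close>.\<close>
  define e where "e = 1 / (4 * (B + 1))"
  have e: "0 < e" "B * e \<le> 1 / 4" using B by (auto simp: e_def divide_le_eq)
  obtain c where c: "0 \<le> c" "\<And>u. ?adm u \<Longrightarrow> nrm 2 (cm A) (rhoT u) \<le> e * (\<Sum>i\<in>UNIV. dir (u i)) + c"
    using rhoT_eps[OF e(1), of R, where 'n='n] by blast
  define K where "K = B * (1 + c)"
  have "- ((\<Sum>i\<in>UNIV. dir (u i)) / 4 + K) \<le> Zpart D V u \<and> - ereal ((\<Sum>i\<in>UNIV. dir (u i)) / 4 + K) \<le> local_xc A \<N> (rhoT u)"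
    if u: "?adm u" and pos: "AE x in cm A. 0 \<le> rhoT u x" for u
  proof -
    define X where "X = (\<Sum>i\<in>UNIV. dir (u i))"
    define r where "r = nrm 2 (cm A) (rhoT u)"
    have X: "0 \<le> X" unfolding X_def by (intro sum_nonneg dir_nonneg)
    have r: "0 \<le> r" by (simp add: r_def)
    have "B * (1 + r) \<le> B * (1 + (e * X + c))"
      using c(2)[OF u] B unfolding X_def r_def by (intro mult_left_mono) auto
    also have "\<dots> = (B * e) * X + K" by (simp add: K_def algebra_simps)
    also have "\<dots> \<le> (1 / 4) * X + K" using e(2) X by (intro add_right_mono mult_right_mono)
    finally have b: "B * (1 + r) \<le> X / 4 + K" by simp
    have le: "B1 * (1 + r) \<le> B * (1 + r)" "B2 * (1 + r) \<le> B * (1 + r)"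
      using B1(1) B2(1) r by (auto simp: B_def intro!: mult_right_mono)
    have 1: "- (X / 4 + K) \<le> Zpart D V u" using B1(2)[OF u] le(1) b unfolding r_def by linarith
    have "- ereal (X / 4 + K) \<le> - ereal (B2 * (1 + r))" using le(2) b by simp
    also have "\<dots> \<le> local_xc A \<N> (rhoT u)" using B2(2)[OF u pos] unfolding r_def .
    finally show ?thesis using 1 unfolding X_def by blast
  qed
  moreover have "0 \<le> K" using B c by (simp add: K_def)
  ultimately show ?thesis by blast
qed

text \<open>The sign of the density cannot be read off its formula, as \<open>Q\<close> need not be
  positive semidefinite; finiteness of the energy supplies it.\<close>

lemma local_xc_finite_imp_nonneg:
  assumes "local_xc A \<N> \<rho> \<noteq> \<infinity>"
  shows "AE x in cm A. 0 \<le> \<rho> x"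
  using assms unfolding local_xc_def AE_cm by (auto split: if_splits)

lemma entropy_bound:
  fixes s :: "real \<Rightarrow> real"
  assumes s: "continuous_on {0..1} s"
  shows "\<exists>b. \<forall>v::real^'n::finite. (\<forall>i. v $ i \<in> {0..1}) \<longrightarrow> 2 * \<sigma> * (\<Sum>i\<in>UNIV. s (v $ i)) \<le> b"
proof -
  obtain bs where bs: "\<forall>t\<in>{0..1}. \<bar>s t\<bar> \<le> bs"
    using compact_imp_bounded[OF compact_continuous_image[OF s compact_Icc]] unfolding bounded_iff by auto
  have "2 * \<sigma> * (\<Sum>i\<in>UNIV. s (v $ i)) \<le> 2 * \<bar>\<sigma>\<bar> * (real CARD('n) * bs)" if v: "\<forall>i. v $ i \<in> {0..1}" for v :: "real^'n"
  proof -
    have "\<bar>\<Sum>i\<in>UNIV. s (v $ i)\<bar> \<le> (\<Sum>i\<in>(UNIV::'n set). bs)"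
      by (rule order_trans[OF sum_abs sum_mono]) (use bs v in auto)
    then have "2 * \<bar>\<sigma>\<bar> * \<bar>\<Sum>i\<in>UNIV. s (v $ i)\<bar> \<le> 2 * \<bar>\<sigma>\<bar> * (real CARD('n) * bs)" by (intro mult_left_mono) auto
    moreover have "2 * \<sigma> * (\<Sum>i\<in>UNIV. s (v $ i)) \<le> 2 * \<bar>\<sigma>\<bar> * \<bar>\<Sum>i\<in>UNIV. s (v $ i)\<bar>"
      by (rule order_trans[OF abs_ge_self]) (simp add: abs_mult)
    ultimately show ?thesis by linarith
  qed
  then show ?thesis by blast
qed

lemma relaxed_energy_lower:
  assumes V: "V \<in> L2per A" and cN: "continuous_on {0..} \<N>" and C0: "0 \<le> C"
    and C: "\<And>t s. 0 \<le> t \<Longrightarrow> 0 < s \<Longrightarrow> - C * (1 + s * t + t\<^sup>2 / s) \<le> \<N> t"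
    and s: "continuous_on {0..1} s"
  shows "\<exists>K. \<forall>(u::'n::finite \<Rightarrow> real^3 \<Rightarrow> real) v. relaxed u v \<longrightarrow> (\<forall>i. v $ i \<in> {0..1}) \<longrightarrow> ereal K \<le> relaxed_energy D V \<N> \<sigma> s u v"
proof -
  define R where "R = sqrt (1 / \<alpha>)"
  obtain K where K: "0 \<le> K" "\<And>u::'n \<Rightarrow> real^3 \<Rightarrow> real. \<forall>i. u i \<in> H1per A \<and> nrm 2 (cm A) (u i) \<le> R \<Longrightarrow>
    AE x in cm A. 0 \<le> rhoT u x \<Longrightarrow>
    - ((\<Sum>i\<in>UNIV. dir (u i)) / 4 + K) \<le> Zpart D V u \<and> - ereal ((\<Sum>i\<in>UNIV. dir (u i)) / 4 + K) \<le> local_xc A \<N> (rhoT u)"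
    using energy_bounds[OF V cN C0 C, of R D, where 'n='n] by blast
  obtain b where b: "\<And>v::real^'n. \<forall>i. v $ i \<in> {0..1} \<Longrightarrow> 2 * \<sigma> * (\<Sum>i\<in>UNIV. s (v $ i)) \<le> b"
    using entropy_bound[OF s, where \<sigma>=\<sigma> and 'n='n] by blast
  \<comment> \<open>The Dirichlet integral reduced by two quarters and the Hartree energy are
    nonnegative; there remain two constants \<open>K\<close> and the bound \<open>b\<close> of the
    entropy.\<close>
  have "ereal (- 2 * K - b) \<le> relaxed_energy D V \<N> \<sigma> s u v"
    if rel: "relaxed u v" and v: "\<forall>i. v $ i \<in> {0..1}" for u :: "'n \<Rightarrow> real^3 \<Rightarrow> real" and v
  proof (cases "local_xc A \<N> (rhoT u) = \<infinity>")
    case True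
    then show ?thesis by (simp add: relaxed_energy_def)
  next
    case False
    have uH: "u i \<in> H1per A" for i using rel by (simp add: relaxed_def)
    have adm: "\<forall>i. u i \<in> H1per A \<and> nrm 2 (cm A) (u i) \<le> R"
      unfolding R_def using uH relaxed_norm_bound[OF rel] v by auto
    have pos: "AE x in cm A. 0 \<le> rhoT u x" by (rule local_xc_finite_imp_nonneg[OF False])
    note KK = K(2)[OF adm pos]
    obtain y where y: "local_xc A \<N> (rhoT u) = ereal y"
      using KK False by (cases "local_xc A \<N> (rhoT u)") auto
    define X where "X = (\<Sum>i\<in>UNIV. dir (u i))"
    have X: "0 \<le> X" unfolding X_def by (intro sum_nonneg dir_nonneg)
    have H: "0 \<le> hartree A (rhoT u)" by (rule hartree_eq(2)[OF rhoT_Lp(1)[OF H1per_L4[OF uH]] pos])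
    have z: "- (X / 4 + K) \<le> Zpart D V u" "- (X / 4 + K) \<le> y" using KK by (auto simp: y X_def)
    have "- 2 * K - b \<le> X + Zpart D V u + hartree A (rhoT u) + y - 2 * \<sigma> * (\<Sum>i\<in>UNIV. s (v $ i))"
      using z X H b[OF v] by linarith
    then show ?thesis unfolding relaxed_energy_def y X_def by simp
  qed
  then show ?thesis by blast
qed

lemma MB_nonempty: "\<exists>\<Psi>::real^3 \<Rightarrow> real^'n::finite. \<Psi> \<in> MB A M Q"
proof -
  obtain \<psi> :: "'n \<Rightarrow> real^3 \<Rightarrow> real" where "\<forall>i. \<psi> i \<in> H1per A" "\<forall>i j. bform (\<psi> i) (\<psi> j) = (if i = j then 1 else 0)"
    using orthonormal_extension[of "{}" "\<lambda>i x. 0"] by auto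
  then show ?thesis by (intro exI[of _ "\<lambda>x. \<chi> i. \<psi> i x"]) (simp add: MB_iff)
qed

text \<open>Each part of the energy is first given its own limit along a subsequence, and only then
  compared with its value at the limit orbitals. Orbitals of vanishing occupation are returned as
  exact zero functions, as \<open>relaxed_imp_tup\<close> requires.\<close>

lemma relaxed_minimizing_limit:
  fixes u :: "nat \<Rightarrow> 'n::finite \<Rightarrow> real^3 \<Rightarrow> real" and v :: "nat \<Rightarrow> real^'n"
  assumes V: "V \<in> L2per A" and cN: "continuous_on {0..} \<N>" and C0: "0 \<le> C"
    and C: "\<And>t s. 0 \<le> t \<Longrightarrow> 0 < s \<Longrightarrow> - C * (1 + s * t + t\<^sup>2 / s) \<le> \<N> t"
    and s: "continuous_on {0..1} s"
    and rel: "\<And>k. relaxed (u k) (v k)" and v01: "\<And>k i. v k $ i \<in> {0..1}" and vs: "\<And>k. 2 * (\<Sum>i\<in>UNIV. v k $ i) = Ne"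
    and en: "\<And>k. relaxed_energy D V \<N> \<sigma> s (u k) (v k) \<le> ereal (e k)" and elim: "e \<longlonglongrightarrow> I"
  shows "\<exists>(w :: 'n \<Rightarrow> real^3 \<Rightarrow> real) v'. relaxed w v' \<and> (\<forall>i. v' $ i \<in> {0..1}) \<and> 2 * (\<Sum>i\<in>UNIV. v' $ i) = Ne \<and>
    (\<forall>i. v' $ i = 0 \<longrightarrow> w i = (\<lambda>x. 0)) \<and> relaxed_energy D V \<N> \<sigma> s w v' \<le> ereal I"
proof -
  have uH: "u k i \<in> H1per A" for k i using rel by (simp add: relaxed_def)
  note uL = H1per_L2per[OF uH] and u4 = H1per_L4[OF uH]
  define R where "R = sqrt (1 / \<alpha>)"
  have uR: "nrm 2 (cm A) (u k i) \<le> R" for k i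
    unfolding R_def by (rule relaxed_norm_bound[OF rel]) (use v01 in auto)
  have adm: "\<forall>i. u k i \<in> H1per A \<and> nrm 2 (cm A) (u k i) \<le> R" for k using uH uR by blast
  define X where "X k = (\<Sum>i\<in>UNIV. dir (u k i))" for k
  define H where "H k = hartree A (rhoT (u k))" for k
  define En where "En v = 2 * \<sigma> * (\<Sum>i\<in>UNIV. s (v $ i))" for v :: "real^'n"
  define xc where "xc k = local_xc A \<N> (rhoT (u k))" for k
  have enk: "ereal (X k + Zpart D V (u k) + H k) + xc k - ereal (En (v k)) \<le> ereal (e k)" for k
    using en[of k] unfolding relaxed_energy_def X_def H_def En_def xc_def .
  have xcf: "xc k \<noteq> \<infinity>" for k using enk[of k] by auto
  have pos: "AE x in cm A. 0 \<le> rhoT (u k) x" for k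
    by (rule local_xc_finite_imp_nonneg) (use xcf in \<open>simp add: xc_def\<close>)
  have \<rho>L: "rhoT (u k) \<in> Lp 2 (cm A)" for k by (rule rhoT_Lp(1)[OF u4])
  have H0: "0 \<le> H k" for k unfolding H_def by (rule hartree_eq(2)[OF \<rho>L pos])
  have X0: "0 \<le> X k" for k unfolding X_def by (intro sum_nonneg dir_nonneg)
  obtain K where K: "0 \<le> K" "\<And>k. - (X k / 4 + K) \<le> Zpart D V (u k)" "\<And>k. - ereal (X k / 4 + K) \<le> xc k"
  proof -
    obtain K where K: "0 \<le> K" "\<And>u::'n \<Rightarrow> real^3 \<Rightarrow> real. \<forall>i. u i \<in> H1per A \<and> nrm 2 (cm A) (u i) \<le> R \<Longrightarrow>
      AE x in cm A. 0 \<le> rhoT u x \<Longrightarrow>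
      - ((\<Sum>i\<in>UNIV. dir (u i)) / 4 + K) \<le> Zpart D V u \<and> - ereal ((\<Sum>i\<in>UNIV. dir (u i)) / 4 + K) \<le> local_xc A \<N> (rhoT u)"
      using energy_bounds[OF V cN C0 C, of R D, where 'n='n] by blast
    show thesis
      by (rule that[OF K(1)]) (use K(2)[OF adm pos] in \<open>auto simp: X_def xc_def\<close>)
  qed
  define y where "y k = real_of_ereal (xc k)" for k
  have xcy: "xc k = ereal (y k)" for k using K(3)[of k] xcf[of k] unfolding y_def by (cases "xc k") auto
  have y_lower: "- (X k / 4 + K) \<le> y k" for k using K(3)[of k] by (simp add: xcy)
  have enr: "X k + Zpart D V (u k) + H k + y k - En (v k) \<le> e k" for k using enk[of k] by (simp add: xcy)
  obtain eb where Enb: "\<And>k. En (v k) \<le> eb"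
    using entropy_bound[OF s, where \<sigma>=\<sigma> and 'n='n] v01 unfolding En_def by blast
  obtain e0 where e0: "\<And>k. e k \<le> e0"
  proof -
    have "Bseq e" using elim by (intro convergent_imp_Bseq convergentI)
    then obtain b where "\<And>k. norm (e k) \<le> b" unfolding Bseq_def by auto
    then show thesis by (intro that[of b]) (metis abs_le_D1 real_norm_def)
  qed
  define em where "em = e0 + eb"
  have sumb: "X k + Zpart D V (u k) + H k + y k \<le> em" for k
    using enr[of k] Enb[of k] e0[of k] unfolding em_def by linarith
  \<comment> \<open>Solves X - 2 (X / 4 + K) \<le> em for X.\<close>
  define XM where "XM = 2 * em + 4 * K"
  have XM: "X k \<le> XM" for k using sumb[of k] K(2)[of k] y_lower[of k] H0[of k] unfolding XM_def by linarith
  have HM: "\<bar>H k\<bar> \<le> em + 2 * K" for k using sumb[of k] K(2)[of k] y_lower[of k] H0[of k] X0[of k] by linarith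
  have yM: "\<bar>y k\<bar> \<le> \<bar>em\<bar> + XM + K" for k
    using sumb[of k] K(1) K(2)[of k] y_lower[of k] H0[of k] X0[of k] XM[of k] by linarith
  have dM: "dir (u k i) \<le> XM" for k i
  proof -
    have "dir (u k i) \<le> X k" unfolding X_def by (rule member_le_sum) (auto simp: dir_nonneg)
    then show ?thesis using XM[of k] by linarith
  qed
  \<comment> \<open>All scalar quantities are collected in one vector, so that a single bounded
    sequence has to be made convergent.\<close>
  define z where "z k = ((\<chi> i. dir (u k i)) :: real^'n, H k, y k, v k)" for k
  have "bounded (range z)"
  proof (rule bounded_subset)
    show "bounded (cbox 0 (\<chi> i. XM) \<times> cbox (- (em + 2 * K)) (em + 2 * K) \<times> cbox (- (\<bar>em\<bar> + XM + K)) (\<bar>em\<bar> + XM + K) \<times> cbox 0 (\<chi> i. (1::real)) :: ((real^'n) \<times> real \<times> real \<times> (real^'n)) set)"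
      by (intro bounded_Times bounded_cbox)
    show "range z \<subseteq> cbox 0 (\<chi> i. XM) \<times> cbox (- (em + 2 * K)) (em + 2 * K) \<times> cbox (- (\<bar>em\<bar> + XM + K)) (\<bar>em\<bar> + XM + K) \<times> cbox 0 (\<chi> i. 1)"
    proof
      fix a assume "a \<in> range z"
      then obtain k where a: "a = z k" by blast
      have h: "- (em + 2 * K) \<le> H k" "H k \<le> em + 2 * K" "- (\<bar>em\<bar> + XM + K) \<le> y k" "y k \<le> \<bar>em\<bar> + XM + K"
        using HM[of k] yM[of k] by linarith+
      show "a \<in> cbox 0 (\<chi> i. XM) \<times> cbox (- (em + 2 * K)) (em + 2 * K) \<times> cbox (- (\<bar>em\<bar> + XM + K)) (\<bar>em\<bar> + XM + K) \<times> cbox 0 (\<chi> i. 1)"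
        unfolding a z_def using h dM[of k] v01[of k] dir_nonneg by (simp add: mem_box_cart)
    qed
  qed
  from bounded_imp_convergent_subsequence[OF this] obtain l r1 where r1: "strict_mono r1" "(z \<circ> r1) \<longlonglongrightarrow> l" by blast
  obtain \<delta> h y' v' where l: "l = (\<delta>, h, y', v')" by (cases l)
  have z1: "(\<lambda>k. z (r1 k)) \<longlonglongrightarrow> (\<delta>, h, y', v')" using r1(2) by (simp add: l o_def)
  have "(\<lambda>k. fst (z (r1 k))) \<longlonglongrightarrow> fst (\<delta>, h, y', v')" by (rule tendsto_fst[OF z1])
  then have l1: "(\<lambda>k. \<chi> i. dir (u (r1 k) i)) \<longlonglongrightarrow> \<delta>" by (simp add: z_def)
  have "(\<lambda>k. snd (z (r1 k))) \<longlonglongrightarrow> snd (\<delta>, h, y', v')" by (rule tendsto_snd[OF z1])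
  then have z2: "(\<lambda>k. (H (r1 k), y (r1 k), v (r1 k))) \<longlonglongrightarrow> (h, y', v')" by (simp add: z_def)
  from tendsto_fst[OF this] have l2: "(\<lambda>k. H (r1 k)) \<longlonglongrightarrow> h" by simp
  from tendsto_snd[OF z2] have z3: "(\<lambda>k. (y (r1 k), v (r1 k))) \<longlonglongrightarrow> (y', v')" by simp
  from tendsto_fst[OF this] have l3: "(\<lambda>k. y (r1 k)) \<longlonglongrightarrow> y'" by simp
  from tendsto_snd[OF z3] have l4: "(\<lambda>k. v (r1 k)) \<longlonglongrightarrow> v'" by simp
  obtain r2 w0 where r2: "strict_mono (r2 :: nat \<Rightarrow> nat)" and w0L: "\<And>i. w0 i \<in> L2per A" and w04: "\<And>i. w0 i \<in> Lp 4 (cm A)"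
    and w0lim: "\<And>i. (\<lambda>k. nrm 4 (cm A) (\<lambda>x. u (r1 (r2 k)) i x - w0 i x)) \<longlonglongrightarrow> 0"
  proof (rule L4_compactness[of "\<lambda>k. u (r1 k)" "\<lambda>k i. grad A (u (r1 k) i)" R XM])
    show "gn2 (grad A (u (r1 k) i)) \<le> XM" for k i using dM[of "r1 k" i] by (simp add: dir_def)
  qed (use uL uR H1per_grad[OF uH] in auto)
  define t where "t k = r1 (r2 k)" for k
  have vt: "(\<lambda>k. v (t k)) \<longlonglongrightarrow> v'" unfolding t_def using LIMSEQ_subseq_LIMSEQ[OF l4 r2] by (simp add: o_def)
  have vti: "(\<lambda>k. v (t k) $ i) \<longlonglongrightarrow> v' $ i" for i by (rule tendsto_vec_nth[OF vt])
  have dt: "(\<lambda>k. dir (u (t k) i)) \<longlonglongrightarrow> \<delta> $ i" for i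
    using LIMSEQ_subseq_LIMSEQ[OF tendsto_vec_nth[OF l1, of i] r2] by (simp add: o_def t_def)
  have Ht: "(\<lambda>k. H (t k)) \<longlonglongrightarrow> h" unfolding t_def using LIMSEQ_subseq_LIMSEQ[OF l2 r2] by (simp add: o_def)
  have yt: "(\<lambda>k. y (t k)) \<longlonglongrightarrow> y'" unfolding t_def using LIMSEQ_subseq_LIMSEQ[OF l3 r2] by (simp add: o_def)
  have tm: "strict_mono t" unfolding t_def using strict_mono_o[OF r1(1) r2] by (simp add: o_def)
  have et: "(\<lambda>k. e (t k)) \<longlonglongrightarrow> I" using LIMSEQ_subseq_LIMSEQ[OF elim tm] by (simp add: o_def)
  have v'01: "v' $ i \<in> {0..1}" for i
    using LIMSEQ_le_const[OF vti[of i], of 0] LIMSEQ_le_const2[OF vti[of i], of 1] v01 by auto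
  have nrm24: "(\<lambda>k. nrm 2 (cm A) (\<lambda>x. f k x - g x)) \<longlonglongrightarrow> 0"
    if "\<And>k. f k \<in> Lp 4 (cm A)" "g \<in> Lp 4 (cm A)" "(\<lambda>k. nrm 4 (cm A) (\<lambda>x. f k x - g x)) \<longlonglongrightarrow> 0" for f g
  proof (rule tendsto_sandwich[OF _ _ tendsto_const])
    show "\<forall>\<^sub>F k in sequentially. nrm 2 (cm A) (\<lambda>x. f k x - g x) \<le> root 4 (measure (cm A) UNIV) * nrm 4 (cm A) (\<lambda>x. f k x - g x)"
      using cm.L4_imp_L2(2)[OF Lp_diff[OF that(1,2)]] by simp
    show "(\<lambda>k. root 4 (measure (cm A) UNIV) * nrm 4 (cm A) (\<lambda>x. f k x - g x)) \<longlonglongrightarrow> 0"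
      by (rule tendsto_mult_right_zero[OF that(3)])
  qed simp
  \<comment> \<open>By \<open>relaxed_norm\<close> the squared L2 norms are at most the occupations
    divided by \<alpha>, which tend to 0.\<close>
  have w0zero: "AE x in cm A. w0 i x = 0" if i: "v' $ i = 0" for i
  proof -
    have "(\<lambda>k. sqrt (v (t k) $ i / \<alpha>)) \<longlonglongrightarrow> sqrt (v' $ i / \<alpha>)"
      by (intro tendsto_real_sqrt tendsto_divide vti tendsto_const) (use \<alpha> in auto)
    then have *: "(\<lambda>k. nrm 2 (cm A) (\<lambda>x. u (t k) i x - w0 i x) + sqrt (v (t k) $ i / \<alpha>)) \<longlonglongrightarrow> 0 + 0"
      using i by (intro tendsto_add nrm24 u4 w04 w0lim[folded t_def]) simp
    have "nrm 2 (cm A) (w0 i) \<le> 0 + 0"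
    proof (rule LIMSEQ_le_const[OF *], intro exI allI impI)
      fix k
      have "(nrm 2 (cm A) (u (t k) i))\<^sup>2 \<le> v (t k) $ i / \<alpha>"
        using relaxed_norm[OF rel, of "t k" i] \<alpha> by (simp add: field_simps)
      then have 1: "nrm 2 (cm A) (u (t k) i) \<le> sqrt (v (t k) $ i / \<alpha>)" by (rule real_le_rsqrt)
      have "nrm 2 (cm A) (w0 i) \<le> nrm 2 (cm A) (\<lambda>x. u (t k) i x - w0 i x) + nrm 2 (cm A) (u (t k) i)"
        using nrm_reverse_triangle[OF _ L2per_Lp[OF uL] L2per_Lp[OF w0L], of "t k" i i] by simp
      then show "nrm 2 (cm A) (w0 i) \<le> nrm 2 (cm A) (\<lambda>x. u (t k) i x - w0 i x) + sqrt (v (t k) $ i / \<alpha>)"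
        using 1 by linarith
    qed
    then have "nrm 2 (cm A) (w0 i) = 0" using nrm_nonneg[of 2 "cm A" "w0 i"] by linarith
    then have "(LINT x|cm A. (w0 i x)\<^sup>2) = 0" by (simp add: nrm_power2[symmetric])
    then have "AE x in cm A. (w0 i x)\<^sup>2 = 0"
      using Lp_integrable[OF L2per_Lp[OF w0L]] by (subst (asm) integral_nonneg_eq_0_iff_AE) auto
    then show ?thesis by simp
  qed
  \<comment> \<open>By \<open>w0zero\<close> this changes \<open>w0\<close> only on a null set of
    the cell, so all limits persist.\<close>
  define w where "w i = (if v' $ i = 0 then (\<lambda>x. 0) else w0 i)" for i
  have wL: "w i \<in> L2per A" and w4: "w i \<in> Lp 4 (cm A)" for i
    using w0L w04 by (auto simp: w_def L2per_const)
  have wlim: "(\<lambda>k. nrm 4 (cm A) (\<lambda>x. u (t k) i x - w i x)) \<longlonglongrightarrow> 0" for i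
  proof (cases "v' $ i = 0")
    case True
    have "nrm 4 (cm A) (\<lambda>x. u (t k) i x - w i x) = nrm 4 (cm A) (\<lambda>x. u (t k) i x - w0 i x)" for k
    proof (rule nrm_cong_AE)
      show "AE x in cm A. u (t k) i x - w i x = u (t k) i x - w0 i x"
        using w0zero[OF True] by eventually_elim (simp add: w_def True)
    qed (use Lp_measurable[OF Lp_diff[OF u4 w4]] Lp_measurable[OF Lp_diff[OF u4 w04]] in auto)
    then show ?thesis using w0lim[folded t_def] by simp
  next
    case False
    then show ?thesis using w0lim[folded t_def] by (simp add: w_def)
  qed
  have wlim2: "(\<lambda>k. nrm 2 (cm A) (\<lambda>x. u (t k) i x - w i x)) \<longlonglongrightarrow> 0" for i
    by (rule nrm24[OF u4 w4 wlim])
  have wH: "w i \<in> H1per A" and wd: "dir (w i) \<le> \<delta> $ i" for i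
    using dirichlet_lsc_lim[of "\<lambda>k. u (t k) i", OF uH wL wlim2 dt] by auto
  have relw: "relaxed w v'"
    unfolding relaxed_def
  proof (intro conjI allI wH)
    fix i j
    have 1: "(\<lambda>k. bform (u (t k) i) (u (t k) j)) \<longlonglongrightarrow> bform (w i) (w j)"
      by (rule bform_tendsto[OF uL wL wlim2 uL wL wlim2])
    have 2: "bform (u (t k) i) (u (t k) j) = (if i = j then v (t k) $ i else 0)" for k
      using rel by (simp add: relaxed_def)
    have "(\<lambda>k. if i = j then v (t k) $ i else 0) \<longlonglongrightarrow> (if i = j then v' $ i else 0)"
      using vti by (cases "i = j") auto
    then show "bform (w i) (w j) = (if i = j then v' $ i else 0)"
      using 1 unfolding 2 by (rule LIMSEQ_unique[rotated])
  qed
  have \<rho>w: "rhoT w \<in> Lp 2 (cm A)" by (rule rhoT_Lp(1)[OF w4])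
  have \<rho>lim: "(\<lambda>k. nrm 2 (cm A) (\<lambda>x. rhoT (u (t k)) x - rhoT w x)) \<longlonglongrightarrow> 0"
    by (rule rhoT_tendsto[OF uL u4 wL w4 wlim wlim2])
  \<comment> \<open>Fatou's lemma for the Hartree and exchange-correlation terms needs pointwise
    convergence, hence one more subsequence.\<close>
  obtain r3 where r3: "strict_mono (r3 :: nat \<Rightarrow> nat)" "AE x in cm A. (\<lambda>k. rhoT (u (t (r3 k))) x) \<longlonglongrightarrow> rhoT w x"
    using cm.L2_tendsto_AE_subseq[OF \<rho>L \<rho>w \<rho>lim] by blast
  have posw: "AE x in cm A. 0 \<le> rhoT w x"
  proof -
    have "AE x in cm A. \<forall>k. 0 \<le> rhoT (u (t (r3 k))) x" using pos by (simp add: AE_all_countable)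
    with r3(2) show ?thesis by eventually_elim (auto intro: LIMSEQ_le_const)
  qed
  have hart: "hartree A (rhoT w) \<le> h"
  proof (rule hartree_lsc[OF \<rho>L pos \<rho>w posw r3(2)])
    show "(\<lambda>k. hartree A (rhoT (u (t (r3 k))))) \<longlonglongrightarrow> h"
      using LIMSEQ_subseq_LIMSEQ[OF Ht r3(1)] by (simp add: o_def H_def)
  qed
  have xcw: "local_xc A \<N> (rhoT w) \<le> ereal y'"
  proof (rule local_xc_lsc[OF cN C0 C \<rho>L pos \<rho>w _ r3(2)])
    show "(\<lambda>k. nrm 2 (cm A) (\<lambda>x. rhoT (u (t (r3 k))) x - rhoT w x)) \<longlonglongrightarrow> 0"
      using LIMSEQ_subseq_LIMSEQ[OF \<rho>lim r3(1)] by (simp add: o_def)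
    show "local_xc A \<N> (rhoT (u (t (r3 k)))) \<le> ereal (y (t (r3 k)))" for k
      using xcy[of "t (r3 k)"] by (simp add: xc_def)
    show "(\<lambda>k. y (t (r3 k))) \<longlonglongrightarrow> y'"
      using LIMSEQ_subseq_LIMSEQ[OF yt r3(1)] by (simp add: o_def)
  qed
  have Zlim: "(\<lambda>k. Zpart D V (u (t k))) \<longlonglongrightarrow> Zpart D V w"
  proof -
    have V2: "V \<in> Lp 2 (cm A)" by (rule L2per_Lp[OF V])
    have "(\<lambda>k. LINT x|cm A. V x * rhoT (u (t k)) x) \<longlonglongrightarrow> (LINT x|cm A. V x * rhoT w x)"
      by (rule L2_inner_tendsto[where u="\<lambda>_. V", OF V2 V2 \<rho>L \<rho>w _ \<rho>lim]) simp
    moreover have "ip A V \<rho> = (LINT x|cm A. V x * \<rho> x)" if "\<rho> \<in> Lp 2 (cm A)" for \<rho>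
      using L2per_measurable[OF V] Lp_measurable[OF that] by (intro ip_cm) auto
    ultimately have "(\<lambda>k. ip A V (rhoT (u (t k)))) \<longlonglongrightarrow> ip A V (rhoT w)" using \<rho>L \<rho>w by simp
    then show ?thesis unfolding Zpart_def
      by (intro tendsto_add tendsto_sum tendsto_mult tendsto_const tendsto_inner matrix_vector_tendsto mvec_tendsto uL wL wlim2)
  qed
  have Enlim: "(\<lambda>k. En (v (t k))) \<longlonglongrightarrow> En v'"
  proof -
    have "(\<lambda>k. s (v (t k) $ i)) \<longlonglongrightarrow> s (v' $ i)" for i
      by (rule continuous_on_tendsto_compose[OF s vti v'01]) (use v01 in auto)
    then show ?thesis unfolding En_def by (intro tendsto_mult tendsto_const tendsto_sum)
  qed
  have Xlim: "(\<lambda>k. X (t k)) \<longlonglongrightarrow> (\<Sum>i\<in>UNIV. \<delta> $ i)" unfolding X_def by (intro tendsto_sum dt)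
  have lhs: "(\<lambda>k. X (t k) + Zpart D V (u (t k)) + H (t k) + y (t k) - En (v (t k))) \<longlonglongrightarrow> (\<Sum>i\<in>UNIV. \<delta> $ i) + Zpart D V w + h + y' - En v'"
    by (intro tendsto_add tendsto_diff Xlim Zlim Ht yt Enlim)
  \<comment> \<open>Only \<open>Zpart\<close> and the entropy are continuous here; the limits
    \<delta>, \<open>h\<close> and \<open>y'\<close> may exceed the values at \<open>w\<close>,
    which helps the inequality.\<close>
  have le: "(\<Sum>i\<in>UNIV. \<delta> $ i) + Zpart D V w + h + y' - En v' \<le> I"
    by (rule LIMSEQ_le[OF lhs et]) (use enr in auto)
  have dsum: "(\<Sum>i\<in>UNIV. dir (w i)) \<le> (\<Sum>i\<in>UNIV. \<delta> $ i)" by (intro sum_mono wd)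
  have "relaxed_energy D V \<N> \<sigma> s w v' \<le> ereal ((\<Sum>i\<in>UNIV. \<delta> $ i) + Zpart D V w + h) + ereal y' - ereal (En v')"
    unfolding relaxed_energy_def En_def using dsum hart by (intro ereal_minus_mono add_mono xcw) auto
  also have "\<dots> \<le> ereal I" using le by simp
  finally have enw: "relaxed_energy D V \<N> \<sigma> s w v' \<le> ereal I" .
  have vs': "2 * (\<Sum>i\<in>UNIV. v' $ i) = Ne"
  proof (rule LIMSEQ_unique)
    show "(\<lambda>k. 2 * (\<Sum>i\<in>UNIV. v (t k) $ i)) \<longlonglongrightarrow> 2 * (\<Sum>i\<in>UNIV. v' $ i)" by (intro tendsto_mult tendsto_const tendsto_sum vti)
    show "(\<lambda>k. 2 * (\<Sum>i\<in>UNIV. v (t k) $ i)) \<longlonglongrightarrow> Ne" by (simp add: vs)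
  qed
  have "\<forall>i. v' $ i = 0 \<longrightarrow> w i = (\<lambda>x. 0)" by (simp add: w_def)
  with relw enw vs' v'01 show ?thesis by blast
qed

end

section \<open>Existence of minimizers\<close>

theorem theorem3p6:
  fixes A :: "real^3^3"
    and Ne :: nat
    and M :: "real^3 \<Rightarrow> real^'m"
    and Q :: "real^3 \<Rightarrow> real^'m^'m"
    and D :: "real^'m^'m"
    and Vloc :: "real^3 \<Rightarrow> real"
    and Exc :: "(real^3 \<Rightarrow> real) \<Rightarrow> ereal"
    and \<N> f S :: "real \<Rightarrow> real"
    and \<sigma> c1 c2 :: real
  assumes lattice: "invertible A"
    and sigma: "\<sigma> > 0"
    and electrons: "0 < Ne" "Ne < 2 * CARD('n::finite)"
    and M: "\<forall>i. (\<lambda>x. M x $ i) \<in> L2per A"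
    and Q: "\<forall>i j. (\<lambda>x. Q x $ i $ j) \<in> L2per A" "\<forall>x. transpose (Q x) = Q x"
    and D: "transpose D = D"
    and Vloc: "Vloc \<in> L2per A"
    and Exc_diff: "xc_differentiable A Exc"
    and Exc_local: "Exc = local_xc A \<N>"
    and c2: "c2 \<ge> 0"
    and growth: "\<N> \<in> growth_class 3 c1 c2 \<and> c1 \<ge> 0 \<or> \<N> \<in> growth_class (4/3) c1 c2"
    and coercive: "\<exists>\<alpha>>0. \<forall>\<psi>\<in>L2per A. ip A \<psi> (Bop1 A M Q \<psi>) \<ge> \<alpha> * ip A \<psi> \<psi>"
    and analytic: "real_analytic f" "real_analytic S"
    and S_deriv: "\<forall>x. deriv S x = x * deriv f x"
    and f_lim: "(f \<longlongrightarrow> 1) at_bot" "(f \<longlongrightarrow> 0) at_top"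
    and S_lim: "\<exists>l. (S \<longlongrightarrow> l) at_bot" "\<exists>l. (S \<longlongrightarrow> l) at_top"
    and f_decr: "\<forall>x y. x < y \<longrightarrow> f y < f x"
  shows "\<exists>\<Phi>\<in>MB A M Q. \<exists>F\<in>Focc Ne.
           energy A M Q D Vloc Exc \<sigma> f S \<Phi> (F :: real^'n^'n)
             = (INF (\<Psi>, G) \<in> MB A M Q \<times> (Focc Ne :: (real^'n^'n) set).
                  energy A M Q D Vloc Exc \<sigma> f S \<Psi> G)"
proof -
  obtain \<alpha> where \<alpha>: "0 < \<alpha>" "\<forall>\<psi>\<in>L2per A. ip A \<psi> (Bop1 A M Q \<psi>) \<ge> \<alpha> * ip A \<psi> \<psi>"
    using coercive by blast
  interpret operators A M Q \<alpha>
    by unfold_locales (use lattice M Q \<alpha> in auto)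
  have cN: "continuous_on {0..} \<N>"
    using Exc_diff unfolding Exc_local by (rule xc_differentiable_continuous)
  obtain C where C0: "0 \<le> C" and C: "\<And>t s. 0 \<le> t \<Longrightarrow> 0 < s \<Longrightarrow> - C * (1 + s * t + t\<^sup>2 / s) \<le> \<N> t"
    using growth_class_lower_bound[OF growth] by blast
  obtain a b where "(S \<longlongrightarrow> a) at_bot" "(S \<longlongrightarrow> b) at_top" using S_lim by blast
  then have s: "continuous_on {0..1} (S_finv S f)"
    using continuous_S_finv[OF real_analytic_isCont[OF analytic(1)] real_analytic_isCont[OF analytic(2)] f_lim] f_decr by blast
  let ?E = "energy A M Q D Vloc (local_xc A \<N>) \<sigma> f S :: (real^3 \<Rightarrow> real^'n) \<Rightarrow> real^'n^'n \<Rightarrow> ereal"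
  let ?R = "relaxed_energy D Vloc \<N> \<sigma> (S_finv S f) :: ('n \<Rightarrow> real^3 \<Rightarrow> real) \<Rightarrow> real^'n \<Rightarrow> ereal"
  let ?P = "(MB A M Q :: (real^3 \<Rightarrow> real^'n) set) \<times> (Focc Ne :: (real^'n^'n) set)"
  define m where "m = (INF (\<Psi>, G) \<in> ?P. ?E \<Psi> G)"
  have lower: "m \<le> ?E \<Psi> G" if "\<Psi> \<in> MB A M Q" "G \<in> Focc Ne" for \<Psi> G
    unfolding m_def using that by (intro INF_lower2[of "(\<Psi>, G)"]) auto
  have "\<exists>\<Phi>\<in>MB A M Q. \<exists>F\<in>Focc Ne. ?E \<Phi> F = m"
  proof (cases "m = \<infinity>")
    \<comment> \<open>If the infimum is infinite, every admissible pair attains it. Orbitals exist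
      by \<open>MB_nonempty\<close>, and equal occupations lie in [0, 1] by
      \<open>electrons\<close>.\<close>
    case True
    obtain \<Psi> :: "real^3 \<Rightarrow> real^'n" where \<Psi>: "\<Psi> \<in> MB A M Q" using MB_nonempty by blast
    have F: "Diag (\<chi> i. real Ne / (2 * CARD('n))) \<in> (Focc Ne :: (real^'n^'n) set)"
      unfolding Focc_iff using electrons by (intro exI conjI refl) (auto simp: divide_le_eq)
    show ?thesis using lower[OF \<Psi> F] True \<Psi> F by (intro bexI[OF _ \<Psi>] bexI[OF _ F]) auto
  next
    case False
    obtain K where K: "\<And>(u :: 'n \<Rightarrow> real^3 \<Rightarrow> real) v. relaxed u v \<Longrightarrow> \<forall>i. v $ i \<in> {0..1} \<Longrightarrow> ereal K \<le> ?R u v"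
      using relaxed_energy_lower[OF Vloc cN C0 C s, of D \<sigma>, where 'n='n] by blast
    \<comment> \<open>Excludes an infimum of minus infinity, so \<open>m\<close> is a real number
      and a minimizing sequence can be measured against it.\<close>
    have "ereal K \<le> m"
      unfolding m_def
    proof (rule INF_greatest)
      fix z assume "z \<in> ?P"
      then obtain \<Psi> v where z: "z = (\<Psi>, Diag v)" "\<Psi> \<in> MB A M Q" "\<forall>i. v $ i \<in> {0..1}"
        by (auto simp: Focc_iff)
      then show "ereal K \<le> (case z of (\<Psi>, G) \<Rightarrow> ?E \<Psi> G)"
        using K[OF tup_relaxed[OF z(2)] z(3)] energy_eq_relaxed[OF z(2)] by auto
    qed
    then obtain i where i: "m = ereal i" using False by (cases m) auto
    have "\<exists>\<Psi> v. \<Psi> \<in> MB A M Q \<and> 2 * (\<Sum>i\<in>UNIV. v $ i) = real Ne \<and> (\<forall>i. v $ i \<in> {0..1}) \<and>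
        ?E \<Psi> (Diag v) < ereal (i + inverse (real (Suc k)))" for k
    proof -
      have "m < ereal (i + inverse (real (Suc k)))" by (simp add: i)
      then obtain z where z: "z \<in> ?P" "(case z of (\<Psi>, G) \<Rightarrow> ?E \<Psi> G) < ereal (i + inverse (real (Suc k)))"
        unfolding m_def INF_less_iff by blast
      obtain \<Psi> v where "z = (\<Psi>, Diag v)" "\<Psi> \<in> MB A M Q" "2 * (\<Sum>i\<in>UNIV. v $ i) = real Ne" "\<forall>i. v $ i \<in> {0..1}"
        using z(1) unfolding mem_Times_iff Focc_iff by (metis prod.collapse)
      with z(2) show ?thesis by auto
    qed
    then obtain \<Psi> v where \<Psi>: "\<And>k. \<Psi> k \<in> MB A M Q" and vs: "\<And>k. 2 * (\<Sum>i\<in>UNIV. v k $ i) = real Ne"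
      and v: "\<And>k i. v k $ i \<in> {0..1}" and E: "\<And>k. ?E (\<Psi> k) (Diag (v k)) < ereal (i + inverse (real (Suc k)))"
      by metis
    have v0: "0 \<le> v k $ i" for k i using v[of k i] by simp
    have "(\<lambda>k. i + inverse (real (Suc k))) \<longlonglongrightarrow> i + 0"
      by (intro tendsto_add tendsto_const LIMSEQ_inverse_real_of_nat)
    then have lim: "(\<lambda>k. i + inverse (real (Suc k))) \<longlonglongrightarrow> i" by simp
    have "?R (tup (\<Psi> k) (v k)) (v k) \<le> ereal (i + inverse (real (Suc k)))" for k
      using E[of k] by (simp add: energy_eq_relaxed[OF \<Psi> v0])
    from relaxed_minimizing_limit[OF Vloc cN C0 C s tup_relaxed[OF \<Psi> v0] v vs this lim]
    obtain w :: "'n \<Rightarrow> real^3 \<Rightarrow> real" and v' where w: "relaxed w v'" "\<forall>i. v' $ i \<in> {0..1}" "2 * (\<Sum>i\<in>UNIV. v' $ i) = real Ne"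
        "\<forall>i. v' $ i = 0 \<longrightarrow> w i = (\<lambda>x. 0)" "?R w v' \<le> ereal i"
      by blast
    have v0': "0 \<le> v' $ i" for i using w(2) by simp
    \<comment> \<open>Back from weighted to orthonormal orbitals, with the same relaxed
      energy.\<close>
    obtain \<Phi> where \<Phi>: "\<Phi> \<in> MB A M Q" "tup \<Phi> v' = w"
      using relaxed_imp_tup[OF w(1) v0'] w(4) by blast
    have F: "Diag v' \<in> Focc Ne" unfolding Focc_iff using w(2,3) by blast
    have "?E \<Phi> (Diag v') \<le> m"
      using w(5) by (simp add: energy_eq_relaxed[OF \<Phi>(1) v0'] \<Phi>(2) i)
    with lower[OF \<Phi>(1) F] have "?E \<Phi> (Diag v') = m" by (rule antisym[rotated])
    with \<Phi>(1) F show ?thesis by blast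
  qed
  then show ?thesis unfolding m_def Exc_local .
qed

end
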